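(* Let $\Gamma$ be a commutative ordered monoid whose neutral element $\epsilon$ is its least element, acting effectively on a set $S$. Let $A$ be a $\Gamma$-graded $\mathbb{K}$-algebra which decomposes as a tensor product $A=A_1\otimes A_2\otimes\dots\otimes A_m$ of $\Gamma$-graded subalgebras, such that for all $1\le i<j\le m$ the subspace $A_{ij}=A_i\otimes A_{i+1}\otimes\dots\otimes A_j$ is a $\Gamma$-graded subalgebra of $A$. Let $J_i$ be a $\Gamma$-homogeneous basis of $A_i$ for $1\le i\le m$, and let $Y=\coprod_{i=1}^m Z_i$ be a finite $\Gamma$-convex subset of $S$. Put $Y_j=Z_1\sqcup\dots\sqcup Z_j$ and let $e_j$ be the idempotent $\chi_{\overline{Y_j}}$. Suppose there are submonoids $\Gamma_1,\dots,\Gamma_m$ of $\Gamma$ such that 1. $(A_i)_\gamma=0$ for all $\gamma\in\Gamma\setminus\Gamma_i$; 2. $\Gamma_jZ_i\cap Y\subset\coprod_{k=i}^jZ_k$ for $1\le i\le j\le m$; 3. $\Gamma_iY_j\cap Y=Y_j$ for $1\le i<j\le m$. Then: (a) For each $1\le j\le m-1$ the natural (multiplication) map $$C(Y_{j+1})e_j\otimes_{e_jC(Y_{j+1})e_j}e_jC(Y_{j+1})\to C(Y_{j+1})e_jC(Y_{j+1})$$ is an isomorphism of vector spaces. (b) For $1\le j\le m$ the set $$\bigl\{a_1a_2\cdots a_m\chi_y\;\big|\;a_k\in J_k\ (1\le k\le m),\ y\in Y_j,\ \deg(a_ka_{k+1}\cdots a_m)y\in Y_j\ (1\le k\le m)\bigr\}$$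 is a basis of $C(Y_j)$. (c) Suppose additionally that $A$ is locally finite dimensional (each $A_\gamma$ is finite dimensional), that $\operatorname{Rad}(A_\epsilon)=0$ and that on each set $Z_j$, $j\ge2$, there is an ordering $\le_j$ such that for $z,z'\in Z_j$: $z\le_{\Gamma_i}z'$ implies $z\le_jz'$ for all $i\ge j$, and $z\le_{\Gamma_i}z'$ implies $z\ge_jz'$ for all $i<j$. Then the ideals $C(Y_j)e_{j-1}C(Y_j)$ of $C(Y_j)$, $j\ge2$, are strong idempotent, and the ideal $C(Y)\chi_{\overline{Z_1}}C(Y)$ of $C(Y)$ is strong idempotent.
   Context: $\mathbb{K}$ is a field; algebras are associative and unital. An ordered monoid is a monoid with a (partial) order such that $\gamma<\gamma'$ implies $\alpha\gamma\beta<\alpha\gamma'\beta$. A $\Gamma$-graded algebra is $A=\bigoplus_{\gamma\in\Gamma}A_\gamma$ with $A_{\gamma}A_{\gamma'}\subset A_{\gamma\gamma'}$ and $1\in A_\epsilon$. "$A=A_1\otimes\dots\otimes A_m$" means that multiplication $A_1\otimes\dots\otimes A_m\to A$ is an isomorphism of graded vector spaces (the factors need not commute), and $A_{ij}$ denotes the image of $A_i\otimes\dots\otimes A_j$. $\operatorname{Rad}$ is the Jacobson radical. $\Gamma$ acts effectively on $S$ if $\gamma_1x\ne\gamma_2x$ for all $x\in S$ and $\gamma_1\ne\gamma_2$ in $\Gamma$. For a submonoid $\Gamma'\subset\Gamma$, $x\le_{\Gamma'}y$ means $y=\gamma x$ for some $\gamma\in\Gamma'$; $\Gamma'X=\{\gamma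 x:\gamma\in\Gamma',x\in X\}$. $Y\subset S$ is $\Gamma$-convex if $x\le_\Gamma z\le_\Gamma y$ with $x,y\in Y$ implies $z\in Y$. $B=\operatorname{Maps}(S,\mathbb{K})$ with right $\Gamma$-action $f^\gamma(x)=f(\gamma x)$. $C=A\ltimes_\Gamma B$ is the vector space $A\otimes B$ with product $(a\otimes b)(a'\otimes b')=aa'\otimes b^\gamma b'$ for $a'\in A_\gamma$; write $ab$ for $a\otimes b$. For $X\subset S$, $\overline X=S\setminus X$, $\chi_X\in B\subset C$ is the indicator function of $X$ (and $\chi_x=\chi_{\{x\}}$), and $C(X)=C/C\chi_{\overline X}C$. Elements of $C$ (in particular $e_j$, $a\chi_y$, $\chi_{\overline{Z_1}}$) are also used to denote their classes in $C(X)$. A two-sided ideal $I$ of an algebra $R$ is strong idempotent if for all $R/I$-modules $M,N$ and all $i\ge1$ the canonical map $\operatorname{Ext}^i_{R/I}(M,N)\to\operatorname{Ext}^i_R(M,N)$ is an isomorphism. *)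

theory Defs
  imports "HOL-Algebra.QuotRing" "HOL-Algebra.Generated_Groups" "Jordan_Normal_Form.Missing_VectorSpace"
begin

hide_const (open) Multiset.mult

section \<open>Modules and algebras\<close>

text \<open>The locale \<^locale>\<open>module\<close> asks for a commutative ring of scalars; here the ring is arbitrary.
  Homomorphisms are given by \<^const>\<open>module_hom\<close>, which does not use commutativity.\<close>

locale left_module = R?: ring R + M?: abelian_group M
  for R :: "('r, 'c) ring_scheme" (structure) and M :: "('r, 'm, 'd) module_scheme" (structure) +
  assumes smult_closed:
      "\<lbrakk>r \<in> carrier R; x \<in> carrier M\<rbrakk> \<Longrightarrow> r \<odot>\<^bsub>M\<^esub> x \<in> carrier M"
    and smult_l_distr:
      "\<lbrakk>r \<in> carrier R; s \<in> carrier R; x \<in> carrier M\<rbrakk> \<Longrightarrow>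
        (r \<oplus> s) \<odot>\<^bsub>M\<^esub> x = r \<odot>\<^bsub>M\<^esub> x \<oplus>\<^bsub>M\<^esub> s \<odot>\<^bsub>M\<^esub> x"
    and smult_r_distr:
      "\<lbrakk>r \<in> carrier R; x \<in> carrier M; y \<in> carrier M\<rbrakk> \<Longrightarrow>
        r \<odot>\<^bsub>M\<^esub> (x \<oplus>\<^bsub>M\<^esub> y) = r \<odot>\<^bsub>M\<^esub> x \<oplus>\<^bsub>M\<^esub> r \<odot>\<^bsub>M\<^esub> y"
    and smult_assoc1:
      "\<lbrakk>r \<in> carrier R; s \<in> carrier R; x \<in> carrier M\<rbrakk> \<Longrightarrow>
        (r \<otimes> s) \<odot>\<^bsub>M\<^esub> x = r \<odot>\<^bsub>M\<^esub> (s \<odot>\<^bsub>M\<^esub> x)"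
    and smult_one: "x \<in> carrier M \<Longrightarrow> \<one> \<odot>\<^bsub>M\<^esub> x = x"

text \<open>Associative unital algebras, possibly zero and possibly noncommutative (\<^locale>\<open>algebra\<close>
  is commutative).\<close>

locale kalgebra = V?: vectorspace K A + A?: ring A for K and A :: "('k, 'a, 'd) module_scheme" (structure) +
  assumes smult_mult_left:
      "\<lbrakk>k \<in> carrier K; x \<in> carrier A; y \<in> carrier A\<rbrakk> \<Longrightarrow>
        (k \<odot>\<^bsub>A\<^esub> x) \<otimes>\<^bsub>A\<^esub> y = k \<odot>\<^bsub>A\<^esub> (x \<otimes>\<^bsub>A\<^esub> y)"
    and smult_mult_right:
      "\<lbrakk>k \<in> carrier K; x \<in> carrier A; y \<in> carrier A\<rbrakk> \<Longrightarrow>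
        x \<otimes>\<^bsub>A\<^esub> (k \<odot>\<^bsub>A\<^esub> y) = k \<odot>\<^bsub>A\<^esub> (x \<otimes>\<^bsub>A\<^esub> y)"

text \<open>Free module on a set, as finitely supported functions. Like \<^const>\<open>ring.func_space\<close> it fills
  the ring fields of the record, which carry no meaning, with zeros.\<close>

definition free_module :: "('r, 'c) ring_scheme \<Rightarrow> 'x set \<Rightarrow> ('r, 'x \<Rightarrow> 'r) module" where
  "free_module R X =
    \<lparr>carrier = {f. (\<forall>x. f x \<in> carrier R) \<and> (\<forall>x. x \<notin> X \<longrightarrow> f x = \<zero>\<^bsub>R\<^esub>) \<and> finite {x. f x \<noteq> \<zero>\<^bsub>R\<^esub>}},
     mult = (\<lambda>f g x. \<zero>\<^bsub>R\<^esub>), one = (\<lambda>x. \<zero>\<^bsub>R\<^esub>),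
     zero = (\<lambda>x. \<zero>\<^bsub>R\<^esub>), add = (\<lambda>f g x. f x \<oplus>\<^bsub>R\<^esub> g x),
     smult = (\<lambda>r f x. r \<otimes>\<^bsub>R\<^esub> f x)\<rparr>"

definition free_gen :: "('r, 'c) ring_scheme \<Rightarrow> 'x \<Rightarrow> ('x \<Rightarrow> 'r)" where
  "free_gen R x = (\<lambda>y. if y = x then \<one>\<^bsub>R\<^esub> else \<zero>\<^bsub>R\<^esub>)"

text \<open>\<^const>\<open>FactRing\<close> with scalar multiplication. It serves as the quotient of a vector space by a
  subspace and of an algebra by an ideal.\<close>

definition quot_module :: "('k, 'v) module \<Rightarrow> 'v set \<Rightarrow> ('k, 'v set) module" where
  "quot_module M U =
    \<lparr>carrier = a_rcosets\<^bsub>M\<^esub> U, mult = rcoset_mult M U,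
     one = U +>\<^bsub>M\<^esub> \<one>\<^bsub>M\<^esub>, zero = U, add = set_add M,
     smult = (\<lambda>k X. \<Union>x\<in>X. U +>\<^bsub>M\<^esub> (k \<odot>\<^bsub>M\<^esub> x))\<rparr>"

abbreviation lspan :: "('k, 'c) ring_scheme \<Rightarrow> ('k, 'v) module \<Rightarrow> 'v set \<Rightarrow> 'v set" where
  "lspan K V S \<equiv> LinearCombinations.module.span K V S"

section \<open>Tensor products\<close>

definition tensor_relations ::
  "('k, 'c) ring_scheme \<Rightarrow> ('k, 'v) module \<Rightarrow> ('k, 'w) module \<Rightarrow> ('v \<times> 'w \<Rightarrow> 'k) set" where
  "tensor_relations K V W = (let F = free_module K (carrier V \<times> carrier W); g = free_gen K in
     {g (v \<oplus>\<^bsub>V\<^esub> v', w) \<ominus>\<^bsub>F\<^esub> (g (v, w) \<oplus>\<^bsub>F\<^esub> g (v', w)) | v v' w.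
        v \<in> carrier V \<and> v' \<in> carrier V \<and> w \<in> carrier W} \<union>
     {g (v, w \<oplus>\<^bsub>W\<^esub> w') \<ominus>\<^bsub>F\<^esub> (g (v, w) \<oplus>\<^bsub>F\<^esub> g (v, w')) | v w w'.
        v \<in> carrier V \<and> w \<in> carrier W \<and> w' \<in> carrier W} \<union>
     {g (k \<odot>\<^bsub>V\<^esub> v, w) \<ominus>\<^bsub>F\<^esub> k \<odot>\<^bsub>F\<^esub> g (v, w) | k v w.
        k \<in> carrier K \<and> v \<in> carrier V \<and> w \<in> carrier W} \<union>
     {g (v, k \<odot>\<^bsub>W\<^esub> w) \<ominus>\<^bsub>F\<^esub> k \<odot>\<^bsub>F\<^esub> g (v, w) | k v w.
        k \<in> carrier K \<and> v \<in> carrier V \<and> w \<in> carrier W})"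

definition tensor_null ::
  "('k, 'c) ring_scheme \<Rightarrow> ('k, 'v) module \<Rightarrow> ('k, 'w) module \<Rightarrow> ('v \<times> 'w \<Rightarrow> 'k) set" where
  "tensor_null K V W =
     lspan K (free_module K (carrier V \<times> carrier W)) (tensor_relations K V W)"

definition tensor ::
  "('k, 'c) ring_scheme \<Rightarrow> ('k, 'v) module \<Rightarrow> ('k, 'w) module \<Rightarrow> ('k, ('v \<times> 'w \<Rightarrow> 'k) set) module" where
  "tensor K V W = quot_module (free_module K (carrier V \<times> carrier W)) (tensor_null K V W)"

definition pure_tensor ::
  "('k, 'c) ring_scheme \<Rightarrow> ('k, 'v) module \<Rightarrow> ('k, 'w) module \<Rightarrow> 'v \<Rightarrow> 'w \<Rightarrow> ('v \<times> 'w \<Rightarrow> 'k) set" where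
  "pure_tensor K V W v w =
     tensor_null K V W +>\<^bsub>free_module K (carrier V \<times> carrier W)\<^esub> free_gen K (v, w)"

text \<open>The tensor product \<open>M \<otimes>\<^sub>R N\<close> over a \<open>K\<close>-algebra with carrier \<open>R\<close>, acting by
  \<open>ract\<close> from the right on \<open>M\<close> and by \<open>lact\<close> from the left on \<open>N\<close>: the quotient of
  \<open>M \<otimes>\<^sub>K N\<close> by the span of all \<open>mr \<otimes> n - m \<otimes> rn\<close>.\<close>

definition balanced_null ::
  "('k, 'c) ring_scheme \<Rightarrow> 'r set \<Rightarrow> ('k, 'v) module \<Rightarrow> ('v \<Rightarrow> 'r \<Rightarrow> 'v) \<Rightarrow> ('k, 'w) module \<Rightarrow>
    ('r \<Rightarrow> 'w \<Rightarrow> 'w) \<Rightarrow> ('v \<times> 'w \<Rightarrow> 'k) set set" where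
  "balanced_null K R M ract N lact = lspan K (tensor K M N)
     {pure_tensor K M N (ract x r) y \<ominus>\<^bsub>tensor K M N\<^esub> pure_tensor K M N x (lact r y) | x r y.
        x \<in> carrier M \<and> r \<in> R \<and> y \<in> carrier N}"

definition balanced_tensor ::
  "('k, 'c) ring_scheme \<Rightarrow> 'r set \<Rightarrow> ('k, 'v) module \<Rightarrow> ('v \<Rightarrow> 'r \<Rightarrow> 'v) \<Rightarrow> ('k, 'w) module \<Rightarrow>
    ('r \<Rightarrow> 'w \<Rightarrow> 'w) \<Rightarrow> ('k, ('v \<times> 'w \<Rightarrow> 'k) set set) module" where
  "balanced_tensor K R M ract N lact =
     quot_module (tensor K M N) (balanced_null K R M ract N lact)"

definition balanced_pure ::
  "('k, 'c) ring_scheme \<Rightarrow> 'r set \<Rightarrow> ('k, 'v) module \<Rightarrow> ('v \<Rightarrow> 'r \<Rightarrow> 'v) \<Rightarrow> ('k, 'w) module \<Rightarrow>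
    ('r \<Rightarrow> 'w \<Rightarrow> 'w) \<Rightarrow> 'v \<Rightarrow> 'w \<Rightarrow> ('v \<times> 'w \<Rightarrow> 'k) set set" where
  "balanced_pure K R M ract N lact x y =
     balanced_null K R M ract N lact +>\<^bsub>tensor K M N\<^esub> pure_tensor K M N x y"

text \<open>Tensor product of a family of vector spaces.\<close>

definition mtensor_relations ::
  "('k, 'c) ring_scheme \<Rightarrow> 'i set \<Rightarrow> ('i \<Rightarrow> ('k, 'v) module) \<Rightarrow> (('i \<Rightarrow> 'v) \<Rightarrow> 'k) set" where
  "mtensor_relations K I V =
    (let X = (\<Pi>\<^sub>E i\<in>I. carrier (V i)); F = free_module K X; g = free_gen K in
     {g (t(i := u \<oplus>\<^bsub>V i\<^esub> v)) \<ominus>\<^bsub>F\<^esub> (g (t(i := u)) \<oplus>\<^bsub>F\<^esub> g (t(i := v))) | t i u v.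
        t \<in> X \<and> i \<in> I \<and> u \<in> carrier (V i) \<and> v \<in> carrier (V i)} \<union>
     {g (t(i := k \<odot>\<^bsub>V i\<^esub> u)) \<ominus>\<^bsub>F\<^esub> k \<odot>\<^bsub>F\<^esub> g (t(i := u)) | t i k u.
        t \<in> X \<and> i \<in> I \<and> k \<in> carrier K \<and> u \<in> carrier (V i)})"

definition mtensor_null ::
  "('k, 'c) ring_scheme \<Rightarrow> 'i set \<Rightarrow> ('i \<Rightarrow> ('k, 'v) module) \<Rightarrow> (('i \<Rightarrow> 'v) \<Rightarrow> 'k) set" where
  "mtensor_null K I V =
     lspan K (free_module K (\<Pi>\<^sub>E i\<in>I. carrier (V i))) (mtensor_relations K I V)"

definition mtensor ::
  "('k, 'c) ring_scheme \<Rightarrow> 'i set \<Rightarrow> ('i \<Rightarrow> ('k, 'v) module) \<Rightarrow>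
    ('k, (('i \<Rightarrow> 'v) \<Rightarrow> 'k) set) module" where
  "mtensor K I V =
     quot_module (free_module K (\<Pi>\<^sub>E i\<in>I. carrier (V i))) (mtensor_null K I V)"

definition mpure ::
  "('k, 'c) ring_scheme \<Rightarrow> 'i set \<Rightarrow> ('i \<Rightarrow> ('k, 'v) module) \<Rightarrow> ('i \<Rightarrow> 'v) \<Rightarrow>
    (('i \<Rightarrow> 'v) \<Rightarrow> 'k) set" where
  "mpure K I V t =
     mtensor_null K I V +>\<^bsub>free_module K (\<Pi>\<^sub>E i\<in>I. carrier (V i))\<^esub> free_gen K t"

section \<open>Ordered monoids and actions\<close>

definition ordered_monoid :: "('g, 'c) monoid_scheme \<Rightarrow> 'g rel \<Rightarrow> bool" where
  "ordered_monoid G r \<longleftrightarrow> monoid G \<and> partial_order_on (carrier G) r \<and>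
     (\<forall>a\<in>carrier G. \<forall>b\<in>carrier G. \<forall>x\<in>carrier G. \<forall>y\<in>carrier G.
        (x, y) \<in> r \<and> x \<noteq> y \<longrightarrow>
          (a \<otimes>\<^bsub>G\<^esub> x \<otimes>\<^bsub>G\<^esub> b, a \<otimes>\<^bsub>G\<^esub> y \<otimes>\<^bsub>G\<^esub> b) \<in> r \<and>
          a \<otimes>\<^bsub>G\<^esub> x \<otimes>\<^bsub>G\<^esub> b \<noteq> a \<otimes>\<^bsub>G\<^esub> y \<otimes>\<^bsub>G\<^esub> b)"

definition monoid_action :: "('g, 'c) monoid_scheme \<Rightarrow> 's set \<Rightarrow> ('g \<Rightarrow> 's \<Rightarrow> 's) \<Rightarrow> bool" where
  "monoid_action G S act \<longleftrightarrow>
     (\<forall>g\<in>carrier G. \<forall>x\<in>S. act g x \<in> S) \<and> (\<forall>x\<in>S. act \<one>\<^bsub>G\<^esub> x = x) \<and>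
     (\<forall>g\<in>carrier G. \<forall>h\<in>carrier G. \<forall>x\<in>S. act (g \<otimes>\<^bsub>G\<^esub> h) x = act g (act h x))"

definition effective_action :: "('g, 'c) monoid_scheme \<Rightarrow> 's set \<Rightarrow> ('g \<Rightarrow> 's \<Rightarrow> 's) \<Rightarrow> bool" where
  "effective_action G S act \<longleftrightarrow> monoid_action G S act \<and>
     (\<forall>x\<in>S. \<forall>g\<in>carrier G. \<forall>h\<in>carrier G. g \<noteq> h \<longrightarrow> act g x \<noteq> act h x)"

text \<open>In the next three definitions \<open>H\<close> is the underlying set of a monoid or submonoid.\<close>

definition act_le :: "('g \<Rightarrow> 's \<Rightarrow> 's) \<Rightarrow> 'g set \<Rightarrow> 's \<Rightarrow> 's \<Rightarrow> bool" where
  "act_le act H x y \<longleftrightarrow> (\<exists>h\<in>H. y = act h x)"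

definition act_set :: "('g \<Rightarrow> 's \<Rightarrow> 's) \<Rightarrow> 'g set \<Rightarrow> 's set \<Rightarrow> 's set" where
  "act_set act H X = {act h x | h x. h \<in> H \<and> x \<in> X}"

definition act_convex :: "('g \<Rightarrow> 's \<Rightarrow> 's) \<Rightarrow> 'g set \<Rightarrow> 's set \<Rightarrow> 's set \<Rightarrow> bool" where
  "act_convex act H S Y \<longleftrightarrow> Y \<subseteq> S \<and>
     (\<forall>x\<in>Y. \<forall>y\<in>Y. \<forall>z\<in>S. act_le act H x z \<and> act_le act H z y \<longrightarrow> z \<in> Y)"

section \<open>Graded algebras\<close>

text \<open>The third conjunct is \<open>A = \<Oplus> A\<^sub>\<gamma>\<close>: each element has a unique finitely supported
  decomposition into homogeneous components.\<close>

definition graded_algebra ::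
  "('k, 'c) ring_scheme \<Rightarrow> ('g, 'd) monoid_scheme \<Rightarrow> ('k, 'a) module \<Rightarrow> ('g \<Rightarrow> 'a set) \<Rightarrow> bool" where
  "graded_algebra K G A gr \<longleftrightarrow> kalgebra K A \<and>
     (\<forall>g\<in>carrier G. VectorSpace.subspace K (gr g) A) \<and>
     (\<forall>a\<in>carrier A. \<exists>!f. f \<in> (\<Pi>\<^sub>E g\<in>carrier G. gr g) \<and> finite {g \<in> carrier G. f g \<noteq> \<zero>\<^bsub>A\<^esub>} \<and>
        a = finsum A f {g \<in> carrier G. f g \<noteq> \<zero>\<^bsub>A\<^esub>}) \<and>
     (\<forall>g\<in>carrier G. \<forall>h\<in>carrier G. \<forall>a\<in>gr g. \<forall>b\<in>gr h. a \<otimes>\<^bsub>A\<^esub> b \<in> gr (g \<otimes>\<^bsub>G\<^esub> h)) \<and>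
     \<one>\<^bsub>A\<^esub> \<in> gr \<one>\<^bsub>G\<^esub>"

text \<open>A graded subalgebra contains the unit of the algebra, and its components are
  \<open>U\<^sub>\<gamma> = U \<inter> A\<^sub>\<gamma>\<close>.\<close>

definition graded_subalgebra ::
  "('k, 'c) ring_scheme \<Rightarrow> ('g, 'd) monoid_scheme \<Rightarrow> ('k, 'a) module \<Rightarrow> ('g \<Rightarrow> 'a set) \<Rightarrow>
    'a set \<Rightarrow> bool" where
  "graded_subalgebra K G A gr U \<longleftrightarrow> U \<subseteq> carrier A \<and>
     graded_algebra K G (A\<lparr>carrier := U\<rparr>) (\<lambda>g. U \<inter> gr g)"

text \<open>Only meaningful for nonzero homogeneous elements.\<close>

definition gr_degree :: "('g, 'd) monoid_scheme \<Rightarrow> ('g \<Rightarrow> 'a set) \<Rightarrow> 'a \<Rightarrow> 'g" where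
  "gr_degree G gr a = (THE g. g \<in> carrier G \<and> a \<in> gr g)"

text \<open>The ordered product \<open>t\<^sub>i t\<^sub>i\<^sub>+\<^sub>1 \<dots> t\<^sub>j\<close>.\<close>

definition iprod :: "('a, 'c) monoid_scheme \<Rightarrow> (nat \<Rightarrow> 'a) \<Rightarrow> nat \<Rightarrow> nat \<Rightarrow> 'a" where
  "iprod A t i j = foldr (\<otimes>\<^bsub>A\<^esub>) (map t [i..<Suc j]) \<one>\<^bsub>A\<^esub>"

definition tensor_block ::
  "('k, 'c) ring_scheme \<Rightarrow> ('k, 'a) module \<Rightarrow> (nat \<Rightarrow> 'a set) \<Rightarrow> nat \<Rightarrow> nat \<Rightarrow> 'a set" where
  "tensor_block K A As i j = lspan K A {iprod A t i j | t. \<forall>k\<in>{i..j}. t k \<in> As k}"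

text \<open>\<open>A = A\<^sub>1 \<otimes> \<dots> \<otimes> A\<^sub>m\<close>: the multiplication map \<open>f\<close> is an isomorphism of graded vector spaces,
  where the component of degree \<open>\<gamma>\<close> of the tensor product is spanned by the pure tensors of
  homogeneous elements whose degrees multiply to \<open>\<gamma>\<close>.\<close>

definition graded_tensor_decomposition ::
  "('k, 'c) ring_scheme \<Rightarrow> ('g, 'd) monoid_scheme \<Rightarrow> ('k, 'a) module \<Rightarrow> ('g \<Rightarrow> 'a set) \<Rightarrow>
    nat \<Rightarrow> (nat \<Rightarrow> 'a set) \<Rightarrow> bool" where
  "graded_tensor_decomposition K G A gr m As \<longleftrightarrow>
    (let V = (\<lambda>i. A\<lparr>carrier := As i\<rparr>); T = mtensor K {1..m} V in
     \<exists>f\<in>module_hom K T A.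
       (\<forall>t\<in>(\<Pi>\<^sub>E i\<in>{1..m}. As i). f (mpure K {1..m} V t) = iprod A t 1 m) \<and>
       bij_betw f (carrier T) (carrier A) \<and>
       (\<forall>g\<in>carrier G.
          f ` lspan K T {mpure K {1..m} V t | t d.
            t \<in> (\<Pi>\<^sub>E i\<in>{1..m}. As i) \<and> d \<in> {1..m} \<rightarrow> carrier G \<and>
            (\<forall>i\<in>{1..m}. t i \<in> gr (d i)) \<and> finprod G d {1..m} = g}
          = gr g))"

section \<open>The algebra \<open>C = A \<ltimes>\<^sub>\<Gamma> Maps(S, K)\<close> and its quotients \<open>C(X)\<close>\<close>

definition maps_alg :: "('k, 'c) ring_scheme \<Rightarrow> 's set \<Rightarrow> ('k, 's \<Rightarrow> 'k) module" where
  "maps_alg K S =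
    \<lparr>carrier = S \<rightarrow>\<^sub>E carrier K,
     mult = (\<lambda>f g. \<lambda>x\<in>S. f x \<otimes>\<^bsub>K\<^esub> g x), one = (\<lambda>x\<in>S. \<one>\<^bsub>K\<^esub>),
     zero = (\<lambda>x\<in>S. \<zero>\<^bsub>K\<^esub>), add = (\<lambda>f g. \<lambda>x\<in>S. f x \<oplus>\<^bsub>K\<^esub> g x),
     smult = (\<lambda>k f. \<lambda>x\<in>S. k \<otimes>\<^bsub>K\<^esub> f x)\<rparr>"

definition map_shift :: "'s set \<Rightarrow> ('g \<Rightarrow> 's \<Rightarrow> 's) \<Rightarrow> ('s \<Rightarrow> 'k) \<Rightarrow> 'g \<Rightarrow> ('s \<Rightarrow> 'k)" where
  "map_shift S act f g = (\<lambda>x\<in>S. f (act g x))"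

definition indicator_map :: "('k, 'c) ring_scheme \<Rightarrow> 's set \<Rightarrow> 's set \<Rightarrow> ('s \<Rightarrow> 'k)" where
  "indicator_map K S X = (\<lambda>x\<in>S. if x \<in> X then \<one>\<^bsub>K\<^esub> else \<zero>\<^bsub>K\<^esub>)"

text \<open>The unique bilinear product with \<open>(a \<otimes> b)(a' \<otimes> b') = aa' \<otimes> b\<^sup>\<gamma>b'\<close> for \<open>a'\<close> of degree \<open>\<gamma>\<close>.
  Uniqueness on the carrier holds because homogeneous elements span \<open>A\<close>; the extensional function
  spaces fix the values elsewhere.\<close>

definition smash_mult ::
  "('k, 'c) ring_scheme \<Rightarrow> ('g, 'd) monoid_scheme \<Rightarrow> 's set \<Rightarrow> ('g \<Rightarrow> 's \<Rightarrow> 's) \<Rightarrow>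
    ('k, 'a) module \<Rightarrow> ('g \<Rightarrow> 'a set) \<Rightarrow>
    ('a \<times> ('s \<Rightarrow> 'k) \<Rightarrow> 'k) set \<Rightarrow> ('a \<times> ('s \<Rightarrow> 'k) \<Rightarrow> 'k) set \<Rightarrow> ('a \<times> ('s \<Rightarrow> 'k) \<Rightarrow> 'k) set" where
  "smash_mult K G S act A gr =
    (let B = maps_alg K S; T = tensor K A B; p = pure_tensor K A B in
     THE \<mu>. \<mu> \<in> carrier T \<rightarrow>\<^sub>E (carrier T \<rightarrow>\<^sub>E carrier T) \<and>
       (\<forall>x\<in>carrier T. (\<lambda>y. \<mu> x y) \<in> module_hom K T T) \<and>
       (\<forall>y\<in>carrier T. (\<lambda>x. \<mu> x y) \<in> module_hom K T T) \<and>
       (\<forall>g\<in>carrier G. \<forall>a\<in>carrier A. \<forall>b\<in>carrier B. \<forall>a'\<in>gr g. \<forall>b'\<in>carrier B.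
          \<mu> (p a b) (p a' b') = p (a \<otimes>\<^bsub>A\<^esub> a') (map_shift S act b g \<otimes>\<^bsub>B\<^esub> b')))"

definition smash ::
  "('k, 'c) ring_scheme \<Rightarrow> ('g, 'd) monoid_scheme \<Rightarrow> 's set \<Rightarrow> ('g \<Rightarrow> 's \<Rightarrow> 's) \<Rightarrow>
    ('k, 'a) module \<Rightarrow> ('g \<Rightarrow> 'a set) \<Rightarrow> ('k, ('a \<times> ('s \<Rightarrow> 'k) \<Rightarrow> 'k) set) module" where
  "smash K G S act A gr = (tensor K A (maps_alg K S))
     \<lparr>mult := smash_mult K G S act A gr,
      one := pure_tensor K A (maps_alg K S) \<one>\<^bsub>A\<^esub> \<one>\<^bsub>maps_alg K S\<^esub>\<rparr>"

definition smash_elem ::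
  "('k, 'c) ring_scheme \<Rightarrow> 's set \<Rightarrow> ('k, 'a) module \<Rightarrow> 'a \<Rightarrow> ('s \<Rightarrow> 'k) \<Rightarrow>
    ('a \<times> ('s \<Rightarrow> 'k) \<Rightarrow> 'k) set" where
  "smash_elem K S A a b = pure_tensor K A (maps_alg K S) a b"

text \<open>\<open>RxR\<close>, the set of finite sums of products \<open>a x b\<close>.\<close>

definition two_sided :: "('r, 'c) ring_scheme \<Rightarrow> 'r \<Rightarrow> 'r set" where
  "two_sided R x = generate (add_monoid R)
     {a \<otimes>\<^bsub>R\<^esub> x \<otimes>\<^bsub>R\<^esub> b | a b. a \<in> carrier R \<and> b \<in> carrier R}"

definition chi ::
  "('k, 'c) ring_scheme \<Rightarrow> 's set \<Rightarrow> ('k, 'a) module \<Rightarrow> 's set \<Rightarrow> ('a \<times> ('s \<Rightarrow> 'k) \<Rightarrow> 'k) set" where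
  "chi K S A X = smash_elem K S A \<one>\<^bsub>A\<^esub> (indicator_map K S X)"

definition trunc_ideal ::
  "('k, 'c) ring_scheme \<Rightarrow> ('g, 'd) monoid_scheme \<Rightarrow> 's set \<Rightarrow> ('g \<Rightarrow> 's \<Rightarrow> 's) \<Rightarrow>
    ('k, 'a) module \<Rightarrow> ('g \<Rightarrow> 'a set) \<Rightarrow> 's set \<Rightarrow> ('a \<times> ('s \<Rightarrow> 'k) \<Rightarrow> 'k) set set" where
  "trunc_ideal K G S act A gr X = two_sided (smash K G S act A gr) (chi K S A (S - X))"

definition trunc ::
  "('k, 'c) ring_scheme \<Rightarrow> ('g, 'd) monoid_scheme \<Rightarrow> 's set \<Rightarrow> ('g \<Rightarrow> 's \<Rightarrow> 's) \<Rightarrow>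
    ('k, 'a) module \<Rightarrow> ('g \<Rightarrow> 'a set) \<Rightarrow> 's set \<Rightarrow>
    ('k, ('a \<times> ('s \<Rightarrow> 'k) \<Rightarrow> 'k) set set) module" where
  "trunc K G S act A gr X = quot_module (smash K G S act A gr) (trunc_ideal K G S act A gr X)"

text \<open>The class in \<open>C(X)\<close> of an element of \<open>C\<close>.\<close>

definition trunc_class ::
  "('k, 'c) ring_scheme \<Rightarrow> ('g, 'd) monoid_scheme \<Rightarrow> 's set \<Rightarrow> ('g \<Rightarrow> 's \<Rightarrow> 's) \<Rightarrow>
    ('k, 'a) module \<Rightarrow> ('g \<Rightarrow> 'a set) \<Rightarrow> 's set \<Rightarrow>
    ('a \<times> ('s \<Rightarrow> 'k) \<Rightarrow> 'k) set \<Rightarrow> ('a \<times> ('s \<Rightarrow> 'k) \<Rightarrow> 'k) set set" where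
  "trunc_class K G S act A gr X c = trunc_ideal K G S act A gr X +>\<^bsub>smash K G S act A gr\<^esub> c"

section \<open>Multiplication \<open>De \<otimes>\<^bsub>eDe\<^esub> eD \<rightarrow> DeD\<close>\<close>

definition mult_map_iso :: "('k, 'c) ring_scheme \<Rightarrow> ('k, 'r) module \<Rightarrow> 'r \<Rightarrow> bool" where
  "mult_map_iso K D e \<longleftrightarrow>
    (let De = {x \<otimes>\<^bsub>D\<^esub> e | x. x \<in> carrier D};
         eD = {e \<otimes>\<^bsub>D\<^esub> x | x. x \<in> carrier D};
         eDe = {e \<otimes>\<^bsub>D\<^esub> x \<otimes>\<^bsub>D\<^esub> e | x. x \<in> carrier D};
         M = D\<lparr>carrier := De\<rparr>; N = D\<lparr>carrier := eD\<rparr>;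
         T = balanced_tensor K eDe M (\<otimes>\<^bsub>D\<^esub>) N (\<otimes>\<^bsub>D\<^esub>)
     in \<exists>f\<in>module_hom K T (D\<lparr>carrier := two_sided D e\<rparr>).
          (\<forall>x\<in>De. \<forall>y\<in>eD. f (balanced_pure K eDe M (\<otimes>\<^bsub>D\<^esub>) N (\<otimes>\<^bsub>D\<^esub>) x y) = x \<otimes>\<^bsub>D\<^esub> y) \<and>
          bij_betw f (carrier T) (two_sided D e))"

section \<open>Jacobson radical\<close>

definition left_ideal :: "'r set \<Rightarrow> ('r, 'c) ring_scheme \<Rightarrow> bool" where
  "left_ideal L R \<longleftrightarrow> subgroup L (add_monoid R) \<and> (\<forall>r\<in>carrier R. \<forall>x\<in>L. r \<otimes>\<^bsub>R\<^esub> x \<in> L)"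

definition maximal_left_ideal :: "'r set \<Rightarrow> ('r, 'c) ring_scheme \<Rightarrow> bool" where
  "maximal_left_ideal L R \<longleftrightarrow> left_ideal L R \<and> L \<noteq> carrier R \<and>
     (\<forall>L'. left_ideal L' R \<and> L \<subseteq> L' \<longrightarrow> L' = L \<or> L' = carrier R)"

definition jacobson_radical :: "('r, 'c) ring_scheme \<Rightarrow> 'r set" where
  "jacobson_radical R = {x \<in> carrier R. \<forall>L. maximal_left_ideal L R \<longrightarrow> x \<in> L}"

section \<open>Ext and strong idempotent ideals\<close>

text \<open>Direct summands of free modules; the free module on the underlying set of \<open>P\<close> suffices.\<close>

definition projective_module :: "('r, 'c) ring_scheme \<Rightarrow> ('r, 'p) module \<Rightarrow> bool" where
  "projective_module R P \<longleftrightarrow> left_module R P \<and>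
     (\<exists>s\<in>module_hom R P (free_module R (carrier P)).
      \<exists>p\<in>module_hom R (free_module R (carrier P)) P. \<forall>x\<in>carrier P. p (s x) = x)"

text \<open>A projective resolution \<open>\<dots> \<rightarrow> P 1 \<rightarrow> P 0 \<rightarrow> M \<rightarrow> 0\<close> with differentials \<open>d n : P (n+1) \<rightarrow> P n\<close> and
  augmentation \<open>a\<close>.\<close>

definition projective_resolution ::
  "('r, 'c) ring_scheme \<Rightarrow> ('r, 'm) module \<Rightarrow> (nat \<Rightarrow> ('r, 'p) module) \<Rightarrow> (nat \<Rightarrow> 'p \<Rightarrow> 'p) \<Rightarrow>
    ('p \<Rightarrow> 'm) \<Rightarrow> bool" where
  "projective_resolution R M P d a \<longleftrightarrow>
     (\<forall>n. projective_module R (P n)) \<and>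
     (\<forall>n. d n \<in> module_hom R (P (Suc n)) (P n)) \<and> a \<in> module_hom R (P 0) M \<and>
     a ` carrier (P 0) = carrier M \<and>
     {x \<in> carrier (P 0). a x = \<zero>\<^bsub>M\<^esub>} = d 0 ` carrier (P 1) \<and>
     (\<forall>n. {x \<in> carrier (P (Suc n)). d n x = \<zero>\<^bsub>P n\<^esub>} = d (Suc n) ` carrier (P (Suc (Suc n))))"

text \<open>The additive group of homomorphisms, written as a \<^typ>\<open>'a monoid\<close> record.\<close>

definition hom_group ::
  "('r, 'c) ring_scheme \<Rightarrow> ('r, 'm) module \<Rightarrow> ('r, 'n) module \<Rightarrow> ('m \<Rightarrow> 'n) monoid" where
  "hom_group R M N =
    \<lparr>carrier = module_hom R M N \<inter> extensional (carrier M),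
     mult = (\<lambda>f g. \<lambda>x\<in>carrier M. f x \<oplus>\<^bsub>N\<^esub> g x), one = (\<lambda>x\<in>carrier M. \<zero>\<^bsub>N\<^esub>)\<rparr>"

definition ext_cocycles ::
  "('r, 'c) ring_scheme \<Rightarrow> (nat \<Rightarrow> ('r, 'p) module) \<Rightarrow> (nat \<Rightarrow> 'p \<Rightarrow> 'p) \<Rightarrow> ('r, 'n) module \<Rightarrow>
    nat \<Rightarrow> ('p \<Rightarrow> 'n) set" where
  "ext_cocycles R P d N i = {f \<in> carrier (hom_group R (P i) N).
     compose (carrier (P (Suc i))) f (d i) = \<one>\<^bsub>hom_group R (P (Suc i)) N\<^esub>}"

definition ext_coboundaries ::
  "('r, 'c) ring_scheme \<Rightarrow> (nat \<Rightarrow> ('r, 'p) module) \<Rightarrow> (nat \<Rightarrow> 'p \<Rightarrow> 'p) \<Rightarrow> ('r, 'n) module \<Rightarrow>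
    nat \<Rightarrow> ('p \<Rightarrow> 'n) set" where
  "ext_coboundaries R P d N i = (case i of
      0 \<Rightarrow> {\<one>\<^bsub>hom_group R (P 0) N\<^esub>}
    | Suc n \<Rightarrow> (\<lambda>f. compose (carrier (P (Suc n))) f (d n)) ` carrier (hom_group R (P n) N))"

definition ext_group ::
  "('r, 'c) ring_scheme \<Rightarrow> (nat \<Rightarrow> ('r, 'p) module) \<Rightarrow> (nat \<Rightarrow> 'p \<Rightarrow> 'p) \<Rightarrow> ('r, 'n) module \<Rightarrow>
    nat \<Rightarrow> ('p \<Rightarrow> 'n) set monoid" where
  "ext_group R P d N i =
     (hom_group R (P i) N)\<lparr>carrier := ext_cocycles R P d N i\<rparr> Mod ext_coboundaries R P d N i"

definition restrict_scalars :: "('r \<Rightarrow> 'q) \<Rightarrow> ('q, 'm) module \<Rightarrow> ('r, 'm) module" where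
  "restrict_scalars h M =
    \<lparr>carrier = carrier M, mult = mult M, one = one M, zero = zero M, add = add M,
     smult = (\<lambda>r x. h r \<odot>\<^bsub>M\<^esub> x)\<rparr>"

text \<open>Chain maps \<open>Q \<rightarrow> P\<close> over the identity of the resolved module.\<close>

definition comparison_map ::
  "('r, 'c) ring_scheme \<Rightarrow> (nat \<Rightarrow> ('r, 'q) module) \<Rightarrow> (nat \<Rightarrow> 'q \<Rightarrow> 'q) \<Rightarrow> ('q \<Rightarrow> 'm) \<Rightarrow>
    (nat \<Rightarrow> ('r, 'p) module) \<Rightarrow> (nat \<Rightarrow> 'p \<Rightarrow> 'p) \<Rightarrow> ('p \<Rightarrow> 'm) \<Rightarrow> (nat \<Rightarrow> 'q \<Rightarrow> 'p) \<Rightarrow> bool" where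
  "comparison_map R Q e b P d a \<phi> \<longleftrightarrow>
     (\<forall>n. \<phi> n \<in> module_hom R (Q n) (P n)) \<and>
     (\<forall>x\<in>carrier (Q 0). a (\<phi> 0 x) = b x) \<and>
     (\<forall>n. \<forall>x\<in>carrier (Q (Suc n)). d n (\<phi> (Suc n) x) = \<phi> n (e n x))"

text \<open>The map \<open>[f] \<mapsto> [f \<circ> \<phi> i]\<close> induced on \<open>i\<close>-th cohomology by \<open>\<phi> : Q \<rightarrow> P\<close>.\<close>

definition ext_map ::
  "('r, 'c) ring_scheme \<Rightarrow> (nat \<Rightarrow> ('r, 'q) module) \<Rightarrow> (nat \<Rightarrow> 'q \<Rightarrow> 'q) \<Rightarrow> ('r, 'n) module \<Rightarrow>
    (nat \<Rightarrow> 'q \<Rightarrow> 'p) \<Rightarrow> nat \<Rightarrow> ('p \<Rightarrow> 'n) set \<Rightarrow> ('q \<Rightarrow> 'n) set" where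
  "ext_map R Q e N \<phi> i X =
     the_elem ((\<lambda>f. ext_coboundaries R Q e N i #>\<^bsub>hom_group R (Q i) N\<^esub>
                      compose (carrier (Q i)) f (\<phi> i)) ` X)"

text \<open>For \<open>R/I\<close>-modules \<open>M\<close>, \<open>N\<close> the group \<open>Ext\<^bsub>R/I\<^esub>(M, N)\<close> is computed from a projective resolution \<open>P\<close>
  of \<open>M\<close> over \<open>R/I\<close>, the group \<open>Ext\<^bsub>R\<^esub>(M, N)\<close> from a projective resolution \<open>Q\<close> of \<open>M\<close> over \<open>R\<close>, and
  the canonical map is induced by any comparison map \<open>Q \<rightarrow> P\<close>. Up to canonical isomorphism none of
  this depends on the choices, so all choices are quantified over. HOL cannot quantify over types
  inside a formula, so the types of elements of \<open>M\<close>, \<open>N\<close>, \<open>P\<close> and \<open>Q\<close> are parameters; to say that an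
  ideal is strong idempotent is to assert this with four type variables, that is, for all types.
  Modules are left modules.\<close>

definition strong_idempotent ::
  "'m itself \<Rightarrow> 'n itself \<Rightarrow> 'p itself \<Rightarrow> 'q itself \<Rightarrow> 'r set \<Rightarrow> ('r, 'c) ring_scheme \<Rightarrow> bool" where
  "strong_idempotent TM TN TP TQ I R \<longleftrightarrow> ideal I R \<and>
    (let res = (\<lambda>r. I +>\<^bsub>R\<^esub> r) in
     \<forall>(M :: ('r set, 'm) module) (N :: ('r set, 'n) module)
       (P :: nat \<Rightarrow> ('r set, 'p) module) d a (Q :: nat \<Rightarrow> ('r, 'q) module) e b \<phi>.
       left_module (R Quot I) M \<and> left_module (R Quot I) N \<and>
       projective_resolution (R Quot I) M P d a \<and>
       projective_resolution R (restrict_scalars res M) Q e b \<and>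
       comparison_map R Q e b (\<lambda>n. restrict_scalars res (P n)) d a \<phi> \<longrightarrow>
       (\<forall>i\<ge>1. ext_map R Q e (restrict_scalars res N) \<phi> i
          \<in> iso (ext_group (R Quot I) P d N i) (ext_group R Q e (restrict_scalars res N) i)))"

end

theory Submission
  imports Defs
begin

text \<open>Let \<open>T j\<close> be the ideal of \<open>C\<close> with \<open>C / T j = C(Y j)\<close>, and let \<open>w a = a 1 \<cdots> a m\<close> be the monomial basis of
  \<open>A\<close>. Read from right to left, a monomial moves a point \<open>y\<close> through \<open>S\<close>; call it good for \<open>j\<close> if the
  path stays in \<open>Y j\<close>. Conditions 2 and 3 and convexity give, by descending induction on \<open>j\<close>: if \<open>x'\<close> is
  homogeneous and moves \<open>y\<close> out of \<open>Y j\<close>, then no product \<open>x x'\<close> has a coordinate at a monomial good for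
  \<open>j\<close>. Hence \<open>T j\<close> consists of the elements all of whose components at points \<open>y\<close> of \<open>Y j\<close> have no good
  coordinates, which is (b).

  In a monomial \<open>w a\<close> that is good for \<open>j + 1\<close> but not for \<open>j\<close>, the right part \<open>a (j+1) \<cdots> a m\<close> moves \<open>y\<close> into
  \<open>Z (j+1)\<close>. These right parts yield, modulo \<open>T (j+1)\<close>, a dual basis of \<open>T j\<close>: with \<open>e = e j\<close>, elements
  \<open>q i = e q i\<close> and functionals \<open>f i\<close>, linear over \<open>D = A 1 \<cdots> A j B\<close>, such that \<open>u = \<Sum> f i (u) q i\<close>. Then \<open>u \<mapsto> \<Sum> f i (u) e \<otimes> q i\<close> inverts the
  multiplication map, which is (a). For (c), the cone of a comparison map of projective resolutions is
  exact modulo the ideal being divided out; a dual basis of each step of the chain \<open>T j \<subseteq> T (j-1) \<subseteq> \<dots>\<close>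
  provides a contracting homotopy that carries exactness to the next ideal of the chain, and exactness
  modulo the last one makes the map on \<open>Ext\<close> bijective.\<close>

section \<open>Left modules\<close>

text \<open>The obstacle is that the factors of \<open>A\<close> do not commute: a product of two
  monomials is re-expanded in the monomial basis, and the paths of the monomials that occur are a
  priori unrelated to the given paths. The induction therefore cuts every monomial after its factor
  of index \<open>j\<close>. Left parts multiply within \<open>A 1 \<cdots> A j\<close>, right parts
  within \<open>A (j+1) \<cdots> A m\<close>, and only the middle product, where the two kinds meet
  in the wrong order, is expanded anew. For the same reason the functionals \<open>f i\<close> are
  linear only over \<open>D\<close>: left multiplication by a general element of \<open>C\<close>
  mixes right parts. Linearity over \<open>D\<close>, which contains \<open>e\<close>, is enough for
  lifting, because \<open>q i = e q i\<close> allows preimages to be multiplied by \<open>e\<close>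
  and so to be taken inside the ideal. The contracting homotopy obtained in this way is not a
  homomorphism, but exactness concerns only its values. Linearity is regained at the end: there the
  ideal is all of \<open>C\<close> with dual basis \<open>1\<close>, so the homotopy is
  \<open>C\<close>-linear modulo the preceding ideal and becomes a homomorphism once composed with a
  map into a module annihilated by that ideal.\<close>

definition left_submodule :: "('r, 'c) ring_scheme \<Rightarrow> ('r, 'm, 'd) module_scheme \<Rightarrow> 'm set \<Rightarrow> bool" where
  "left_submodule R M U \<longleftrightarrow> U \<subseteq> carrier M \<and> \<zero>\<^bsub>M\<^esub> \<in> U \<and> (\<forall>x\<in>U. \<forall>y\<in>U. x \<oplus>\<^bsub>M\<^esub> y \<in> U) \<and>
     (\<forall>r\<in>carrier R. \<forall>x\<in>U. r \<odot>\<^bsub>M\<^esub> x \<in> U)"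

lemma left_submoduleI:
  assumes "U \<subseteq> carrier M" "\<zero>\<^bsub>M\<^esub> \<in> U" "\<And>x y. x \<in> U \<Longrightarrow> y \<in> U \<Longrightarrow> x \<oplus>\<^bsub>M\<^esub> y \<in> U"
    "\<And>r x. r \<in> carrier R \<Longrightarrow> x \<in> U \<Longrightarrow> r \<odot>\<^bsub>M\<^esub> x \<in> U"
  shows "left_submodule R M U"
  using assms unfolding left_submodule_def by blast

lemma left_submoduleD:
  assumes "left_submodule R M U"
  shows "U \<subseteq> carrier M" "\<And>x. x \<in> U \<Longrightarrow> x \<in> carrier M" "\<zero>\<^bsub>M\<^esub> \<in> U"
    "\<And>x y. x \<in> U \<Longrightarrow> y \<in> U \<Longrightarrow> x \<oplus>\<^bsub>M\<^esub> y \<in> U"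
    "\<And>r x. r \<in> carrier R \<Longrightarrow> x \<in> U \<Longrightarrow> r \<odot>\<^bsub>M\<^esub> x \<in> U"
  using assms unfolding left_submodule_def by blast+

context left_module begin

lemma smult_l_null [simp]: "x \<in> carrier M \<Longrightarrow> \<zero> \<odot>\<^bsub>M\<^esub> x = \<zero>\<^bsub>M\<^esub>"
proof -
  assume x: "x \<in> carrier M"
  have "\<zero> \<odot>\<^bsub>M\<^esub> x \<oplus>\<^bsub>M\<^esub> \<zero> \<odot>\<^bsub>M\<^esub> x = \<zero> \<odot>\<^bsub>M\<^esub> x"
    using smult_l_distr[of \<zero> \<zero> x] x by simp
  then show ?thesis using x smult_closed[of \<zero> x] by simp
qed

lemma smult_r_null [simp]: "r \<in> carrier R \<Longrightarrow> r \<odot>\<^bsub>M\<^esub> \<zero>\<^bsub>M\<^esub> = \<zero>\<^bsub>M\<^esub>"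
proof -
  assume r: "r \<in> carrier R"
  have "r \<odot>\<^bsub>M\<^esub> \<zero>\<^bsub>M\<^esub> \<oplus>\<^bsub>M\<^esub> r \<odot>\<^bsub>M\<^esub> \<zero>\<^bsub>M\<^esub> = r \<odot>\<^bsub>M\<^esub> \<zero>\<^bsub>M\<^esub>"
    using smult_r_distr[of r "\<zero>\<^bsub>M\<^esub>" "\<zero>\<^bsub>M\<^esub>"] r by simp
  then show ?thesis using r smult_closed[of r "\<zero>\<^bsub>M\<^esub>"] by simp
qed

lemma smult_l_minus:
  "r \<in> carrier R \<Longrightarrow> x \<in> carrier M \<Longrightarrow> (\<ominus> r) \<odot>\<^bsub>M\<^esub> x = \<ominus>\<^bsub>M\<^esub> (r \<odot>\<^bsub>M\<^esub> x)"
proof -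
  assume r: "r \<in> carrier R" and x: "x \<in> carrier M"
  have "(\<ominus> r) \<odot>\<^bsub>M\<^esub> x \<oplus>\<^bsub>M\<^esub> r \<odot>\<^bsub>M\<^esub> x = \<zero>\<^bsub>M\<^esub>"
    using smult_l_distr[of "\<ominus> r" r x] r x by (simp add: R.l_neg)
  then show ?thesis using r x smult_closed by (metis M.minus_equality R.a_inv_closed)
qed

lemma smult_r_minus:
  "r \<in> carrier R \<Longrightarrow> x \<in> carrier M \<Longrightarrow> r \<odot>\<^bsub>M\<^esub> (\<ominus>\<^bsub>M\<^esub> x) = \<ominus>\<^bsub>M\<^esub> (r \<odot>\<^bsub>M\<^esub> x)"
proof -
  assume r: "r \<in> carrier R" and x: "x \<in> carrier M"
  have "r \<odot>\<^bsub>M\<^esub> (\<ominus>\<^bsub>M\<^esub> x) \<oplus>\<^bsub>M\<^esub> r \<odot>\<^bsub>M\<^esub> x = \<zero>\<^bsub>M\<^esub>"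
    using smult_r_distr[of r "\<ominus>\<^bsub>M\<^esub> x" x] r x by (simp add: M.l_neg)
  then show ?thesis using r x smult_closed by (metis M.minus_equality M.a_inv_closed)
qed

lemma minus_one_smult: "x \<in> carrier M \<Longrightarrow> (\<ominus> \<one>) \<odot>\<^bsub>M\<^esub> x = \<ominus>\<^bsub>M\<^esub> x"
  by (simp add: smult_l_minus smult_one)

lemma smult_finsum:
  "r \<in> carrier R \<Longrightarrow> (\<And>i. i \<in> I \<Longrightarrow> f i \<in> carrier M) \<Longrightarrow>
   r \<odot>\<^bsub>M\<^esub> finsum M f I = finsum M (\<lambda>i. r \<odot>\<^bsub>M\<^esub> f i) I"
proof (induction I rule: infinite_finite_induct)
  case (insert i I)
  have "(\<lambda>i. r \<odot>\<^bsub>M\<^esub> f i) \<in> I \<rightarrow> carrier M" "f \<in> I \<rightarrow> carrier M"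
    using insert by (auto intro: smult_closed)
  then show ?case using insert by (simp add: smult_r_distr smult_closed)
qed auto

lemma finsum_smult_left:
  "x \<in> carrier M \<Longrightarrow> (\<And>i. i \<in> I \<Longrightarrow> f i \<in> carrier R) \<Longrightarrow>
   finsum R f I \<odot>\<^bsub>M\<^esub> x = finsum M (\<lambda>i. f i \<odot>\<^bsub>M\<^esub> x) I"
proof (induction I rule: infinite_finite_induct)
  case (insert i I)
  have "(\<lambda>i. f i \<odot>\<^bsub>M\<^esub> x) \<in> I \<rightarrow> carrier M" "f \<in> I \<rightarrow> carrier R"
    using insert by (auto intro: smult_closed)
  then show ?case using insert by (simp add: smult_l_distr smult_closed)
qed auto

text \<open>A negative is a multiple by \<open>\<ominus> \<one>\<close>, so stability under scalars
  in \<open>left_submodule\<close> includes negatives.\<close>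

lemma submodule_minus: "left_submodule R M U \<Longrightarrow> x \<in> U \<Longrightarrow> \<ominus>\<^bsub>M\<^esub> x \<in> U"
  using minus_one_smult left_submoduleD by (metis R.a_inv_closed R.one_closed)

lemma submodule_diff: "left_submodule R M U \<Longrightarrow> x \<in> U \<Longrightarrow> y \<in> U \<Longrightarrow> x \<ominus>\<^bsub>M\<^esub> y \<in> U"
  unfolding a_minus_def using submodule_minus left_submoduleD(4) by metis

lemma submodule_finsum:
  "left_submodule R M U \<Longrightarrow> (\<And>i. i \<in> I \<Longrightarrow> f i \<in> U) \<Longrightarrow> finsum M f I \<in> U"
proof (induction I rule: infinite_finite_induct)
  case (insert i I)
  then have "finsum M f (insert i I) = f i \<oplus>\<^bsub>M\<^esub> finsum M f I"
    by (intro M.finsum_insert) (auto dest: left_submoduleD(2))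
  then show ?case using insert by (simp add: left_submoduleD(4))
qed (auto simp: left_submoduleD)

lemma submodule_subgroup: "left_submodule R M U \<Longrightarrow> abelian_subgroup U M"
  by (intro abelian_subgroupI3 additive_subgroup.intro M.abelian_group_axioms M.add.subgroupI)
     (auto dest: left_submoduleD simp: submodule_minus[simplified a_inv_def] a_inv_def[symmetric]
       intro: submodule_minus left_submoduleD)

lemma submodule_left_module:
  assumes U: "left_submodule R M U"
  shows "left_module R (M\<lparr>carrier := U\<rparr>)"
proof -
  have "abelian_group (M\<lparr>carrier := U\<rparr>)"
  proof (rule abelian_groupI, goal_cases)
    case (6 x)
    then show ?case using left_submoduleD(2)[OF U, of x] submodule_minus[OF U, of x]
      by (auto intro!: bexI[of _ "\<ominus>\<^bsub>M\<^esub> x"] simp: M.l_neg)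
  qed (use left_submoduleD[OF U] in \<open>auto simp: M.a_ac\<close>)
  then show ?thesis
    by (intro left_module.intro left_module_axioms.intro R.ring_axioms)
       (use left_submoduleD[OF U] in \<open>auto simp: smult_l_distr smult_r_distr smult_assoc1 smult_one\<close>)
qed

end

section \<open>Homomorphisms of left modules\<close>

lemma module_homI:
  assumes "\<And>x. x \<in> carrier M \<Longrightarrow> f x \<in> carrier N"
    "\<And>x y. x \<in> carrier M \<Longrightarrow> y \<in> carrier M \<Longrightarrow> f (x \<oplus>\<^bsub>M\<^esub> y) = f x \<oplus>\<^bsub>N\<^esub> f y"
    "\<And>r x. r \<in> carrier R \<Longrightarrow> x \<in> carrier M \<Longrightarrow> f (r \<odot>\<^bsub>M\<^esub> x) = r \<odot>\<^bsub>N\<^esub> f x"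
  shows "f \<in> module_hom R M N"
  using assms unfolding module_hom_def by blast

lemma module_hom_in: "f \<in> module_hom R M N \<Longrightarrow> x \<in> carrier M \<Longrightarrow> f x \<in> carrier N"
  unfolding module_hom_def by blast

lemma module_hom_comp:
  "f \<in> module_hom R M N \<Longrightarrow> g \<in> module_hom R N P \<Longrightarrow> (\<lambda>x. g (f x)) \<in> module_hom R M P"
  unfolding module_hom_def by (auto simp: Pi_iff)

locale module_hom_pair = M: left_module R M + N: left_module R N
  for R and M :: "('r,'m,'d) module_scheme" and N :: "('r,'n,'e) module_scheme"
begin

lemma hom_zero: assumes f: "f \<in> module_hom R M N" shows "f \<zero>\<^bsub>M\<^esub> = \<zero>\<^bsub>N\<^esub>"
proof -
  have "f (\<zero>\<^bsub>R\<^esub> \<odot>\<^bsub>M\<^esub> \<zero>\<^bsub>M\<^esub>) = \<zero>\<^bsub>R\<^esub> \<odot>\<^bsub>N\<^esub> f \<zero>\<^bsub>M\<^esub>" using f by (intro module_hom_smult) auto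
  then show ?thesis using module_hom_in[OF f] by simp
qed

lemma hom_minus:
  assumes f: "f \<in> module_hom R M N" and x: "x \<in> carrier M" shows "f (\<ominus>\<^bsub>M\<^esub> x) = \<ominus>\<^bsub>N\<^esub> f x"
proof -
  have "f (\<ominus>\<^bsub>R\<^esub> \<one>\<^bsub>R\<^esub> \<odot>\<^bsub>M\<^esub> x) = \<ominus>\<^bsub>R\<^esub> \<one>\<^bsub>R\<^esub> \<odot>\<^bsub>N\<^esub> f x" using f x by (intro module_hom_smult) auto
  then show ?thesis using module_hom_in[OF f] x by (simp add: M.minus_one_smult N.minus_one_smult)
qed

lemma hom_diff:
  assumes f: "f \<in> module_hom R M N" and "x \<in> carrier M" "y \<in> carrier M"
  shows "f (x \<ominus>\<^bsub>M\<^esub> y) = f x \<ominus>\<^bsub>N\<^esub> f y"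
  using assms by (simp add: a_minus_def module_hom_add[OF f] hom_minus)

lemma hom_finsum:
  assumes f: "f \<in> module_hom R M N"
  shows "(\<And>i. i \<in> I \<Longrightarrow> g i \<in> carrier M) \<Longrightarrow> f (finsum M g I) = finsum N (\<lambda>i. f (g i)) I"
proof (induction I rule: infinite_finite_induct)
  case (insert i I)
  have "g \<in> I \<rightarrow> carrier M" "(\<lambda>i. f (g i)) \<in> I \<rightarrow> carrier N"
    using insert module_hom_in[OF f] by auto
  then show ?case using insert module_hom_in[OF f] by (simp add: module_hom_add[OF f])
qed (auto simp: hom_zero[OF f])

lemma hom_vimage:
  assumes f: "f \<in> module_hom R M N" and U: "left_submodule R N U"
  shows "left_submodule R M {x \<in> carrier M. f x \<in> U}"
  by (rule left_submoduleI)
     (auto simp: hom_zero[OF f] module_hom_add[OF f] module_hom_smult[OF f] left_submoduleD[OF U]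
        M.smult_closed)

lemma hom_equalizer:
  assumes f: "f \<in> module_hom R M N" and g: "g \<in> module_hom R M N"
  shows "left_submodule R M {x \<in> carrier M. f x = g x}"
  by (rule left_submoduleI)
     (auto simp: hom_zero[OF f] hom_zero[OF g] module_hom_add[OF f] module_hom_add[OF g]
        module_hom_smult[OF f] module_hom_smult[OF g] M.smult_closed)

lemma hom_image:
  assumes f: "f \<in> module_hom R M N"
  shows "left_submodule R N (f ` carrier M)"
  apply (rule left_submoduleI)
     apply (auto simp: module_hom_in[OF f])
    apply (metis M.zero_closed hom_zero[OF f] image_eqI)
   apply (metis M.add.m_closed module_hom_add[OF f] image_eqI)
  by (metis M.smult_closed module_hom_smult[OF f] image_eqI)

lemma hom_sum:
  assumes f: "f \<in> module_hom R M N" and g: "g \<in> module_hom R M N"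
  shows "(\<lambda>x. f x \<oplus>\<^bsub>N\<^esub> g x) \<in> module_hom R M N"
  by (rule module_homI)
     (auto simp: module_hom_in[OF f] module_hom_in[OF g] module_hom_add[OF f] module_hom_add[OF g]
        module_hom_smult[OF f] module_hom_smult[OF g] N.smult_r_distr N.a_ac)

lemma zero_hom: "(\<lambda>x. \<zero>\<^bsub>N\<^esub>) \<in> module_hom R M N"
  by (rule module_homI) auto

end

lemma (in left_module) finsum_module_hom:
  assumes N: "left_module R N" and f: "\<And>i. i \<in> I \<Longrightarrow> f i \<in> module_hom R N M"
  shows "(\<lambda>x. finsum M (\<lambda>i. f i x) I) \<in> module_hom R N M"
  using f
proof (induction I rule: infinite_finite_induct)
  case (insert i I)
  interpret N: left_module R N by fact
  interpret module_hom_pair R N M by unfold_locales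
  have 1: "f i \<in> module_hom R N M" "(\<lambda>x. finsum M (\<lambda>i. f i x) I) \<in> module_hom R N M" using insert by auto
  have 2: "finsum M (\<lambda>j. f j x) (insert i I) = f i x \<oplus>\<^bsub>M\<^esub> finsum M (\<lambda>i. f i x) I" if "x \<in> carrier N" for x
    using that insert module_hom_in by (intro M.finsum_insert) fastforce+
  show ?case using hom_sum[OF 1] unfolding module_hom_def
    by (auto simp: 2 N.smult_closed)
qed (use N left_module_axioms in \<open>auto intro!: module_hom_pair.zero_hom module_hom_pair.intro\<close>)

text \<open>\<open>finsum\<close> depends on the carrier of its record, so the sum in a submodule
  and the sum in \<open>M\<close> are different terms; the inclusion is a homomorphism and
  identifies them.\<close>

lemma (in left_module) finsum_submodule:
  assumes U: "left_submodule R M U" and g: "\<And>i. i \<in> F \<Longrightarrow> g i \<in> U"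
  shows "finsum (M\<lparr>carrier := U\<rparr>) g F = finsum M g F"
proof -
  interpret U: module_hom_pair R "M\<lparr>carrier := U\<rparr>" M
    by (intro module_hom_pair.intro submodule_left_module[OF U] left_module_axioms)
  have "(\<lambda>x. x) \<in> module_hom R (M\<lparr>carrier := U\<rparr>) M"
    by (rule module_homI) (use left_submoduleD(2)[OF U] in auto)
  from U.hom_finsum[OF this, of F g] show ?thesis using g by simp
qed

text \<open>Sums over supports are compared after extending them to one finite set that contains all
  supports in question, for instance those of \<open>u\<close>, \<open>v\<close> and
  \<open>u + v\<close>.\<close>

lemma (in abelian_monoid) finsum_support:
  assumes "finite F" "\<And>x. x \<in> F \<Longrightarrow> g x \<in> carrier G" "F' \<subseteq> F" "\<And>x. x \<in> F - F' \<Longrightarrow> g x = \<zero>"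
  shows "finsum G g F' = finsum G g F"
  using assms by (intro add.finprod_mono_neutral_cong_left) auto

subsection \<open>Quotient modules\<close>

lemma quot_module_simps:
  "carrier (quot_module M U) = a_rcosets\<^bsub>M\<^esub> U"
  "zero (quot_module M U) = U" "add (quot_module M U) = set_add M"
  "smult (quot_module M U) = (\<lambda>k X. \<Union>x\<in>X. U +>\<^bsub>M\<^esub> (k \<odot>\<^bsub>M\<^esub> x))"
  "mult (quot_module M U) = rcoset_mult M U"
  "one (quot_module M U) = U +>\<^bsub>M\<^esub> \<one>\<^bsub>M\<^esub>"
  unfolding quot_module_def by simp_all

locale quot_mod = left_module R M for R and M :: "('r, 'm) module" +
  fixes U assumes sub: "left_submodule R M U"
begin

sublocale U: abelian_subgroup U M by (rule submodule_subgroup[OF sub])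

abbreviation "Q \<equiv> quot_module M U"
abbreviation "cls x \<equiv> U +>\<^bsub>M\<^esub> x"

lemma quot_carrier: "carrier Q = cls ` carrier M"
  by (auto simp: quot_module_simps A_RCOSETS_def RCOSETS_def a_r_coset_def)

lemma cls_in: "x \<in> carrier M \<Longrightarrow> cls x \<in> carrier Q"
  unfolding quot_carrier by simp

lemma cls_add: "x \<in> carrier M \<Longrightarrow> y \<in> carrier M \<Longrightarrow> cls x \<oplus>\<^bsub>Q\<^esub> cls y = cls (x \<oplus>\<^bsub>M\<^esub> y)"
  by (simp add: quot_module_simps U.a_rcos_sum)

lemma cls_eq: "x \<in> carrier M \<Longrightarrow> y \<in> carrier M \<Longrightarrow> cls x = cls y \<longleftrightarrow> x \<ominus>\<^bsub>M\<^esub> y \<in> U"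
  using U.a_rcos_module[of y x] U.a_rcos_self[of x] U.a_repr_independence'[of x y]
  by (auto simp: a_minus_def)

lemma cls_zero: "cls \<zero>\<^bsub>M\<^esub> = \<zero>\<^bsub>Q\<^esub>"
  by (simp add: quot_module_simps U.a_subset)

lemma cls_eq_zero: "x \<in> carrier M \<Longrightarrow> cls x = \<zero>\<^bsub>Q\<^esub> \<longleftrightarrow> x \<in> U"
proof -
  assume x: "x \<in> carrier M"
  have "\<ominus>\<^bsub>M\<^esub> \<zero>\<^bsub>M\<^esub> = \<zero>\<^bsub>M\<^esub>" by (rule M.minus_equality) auto
  then have "x \<ominus>\<^bsub>M\<^esub> \<zero>\<^bsub>M\<^esub> = x" unfolding a_minus_def using x M.r_zero by metis
  then show ?thesis using cls_eq[OF x M.zero_closed] cls_zero by metis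
qed

lemma cls_smult:
  assumes k: "k \<in> carrier R" and x: "x \<in> carrier M"
  shows "k \<odot>\<^bsub>Q\<^esub> cls x = cls (k \<odot>\<^bsub>M\<^esub> x)"
proof -
  have 1: "cls (k \<odot>\<^bsub>M\<^esub> y) = cls (k \<odot>\<^bsub>M\<^esub> x)" if y: "y \<in> cls x" for y
  proof -
    have yM: "y \<in> carrier M" using y x U.a_elemrcos_carrier by blast
    have "y \<ominus>\<^bsub>M\<^esub> x \<in> U" using y x yM U.a_rcos_module by (simp add: a_minus_def)
    then have "k \<odot>\<^bsub>M\<^esub> (y \<ominus>\<^bsub>M\<^esub> x) \<in> U" using left_submoduleD(5)[OF sub k] by blast
    then have "k \<odot>\<^bsub>M\<^esub> y \<ominus>\<^bsub>M\<^esub> k \<odot>\<^bsub>M\<^esub> x \<in> U"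
      using k x yM by (simp add: a_minus_def smult_r_distr smult_r_minus)
    then show ?thesis using k x yM by (simp add: cls_eq smult_closed)
  qed
  have "x \<in> cls x" using x U.a_rcos_self by blast
  then show ?thesis unfolding quot_module_simps using 1 by blast
qed

lemma quot_abelian: "abelian_group Q"
proof -
  show ?thesis
  proof (rule abelian_groupI, goal_cases)
    case (6 X)
    then obtain x where "x \<in> carrier M" "X = cls x" by (auto simp: quot_carrier)
    then show ?case
      by (intro bexI[of _ "cls (\<ominus>\<^bsub>M\<^esub> x)"]) (auto simp: cls_add cls_in M.l_neg cls_zero)
  qed (auto simp: quot_carrier cls_add M.a_ac simp flip: cls_zero)
qed

lemma quot_left_module: "left_module R Q"
  by (intro left_module.intro left_module_axioms.intro R.ring_axioms quot_abelian)
     (auto simp: quot_carrier cls_smult cls_add smult_closed smult_l_distr smult_r_distr smult_assoc1 smult_one)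

sublocale Q: left_module R Q by (rule quot_left_module)

lemma cls_hom: "(\<lambda>x. cls x) \<in> module_hom R M Q"
  by (rule module_homI) (auto simp: cls_in cls_add cls_smult)

sublocale MQ: module_hom_pair R M Q by unfold_locales

lemma cls_finsum: "(\<And>i. i \<in> I \<Longrightarrow> f i \<in> carrier M) \<Longrightarrow> cls (finsum M f I) = finsum Q (\<lambda>i. cls (f i)) I"
  using MQ.hom_finsum[OF cls_hom] by blast

lemma quot_lift:
  assumes N: "left_module R N" and f: "f \<in> module_hom R M N" and fU: "\<And>u. u \<in> U \<Longrightarrow> f u = \<zero>\<^bsub>N\<^esub>"
  obtains g where "g \<in> module_hom R Q N" "\<And>x. x \<in> carrier M \<Longrightarrow> g (cls x) = f x"
proof -
  interpret N: left_module R N by fact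
  interpret MN: module_hom_pair R M N by unfold_locales
  \<comment> \<open>A representative is chosen in each class; the choice does not matter because
    \<open>f\<close> kills \<open>U\<close>.\<close>
  define g where "g X = f (SOME x. x \<in> carrier M \<and> cls x = X)" for X
  have g: "g (cls x) = f x" if x: "x \<in> carrier M" for x
  proof -
    define y where "y = (SOME y. y \<in> carrier M \<and> cls y = cls x)"
    have y: "y \<in> carrier M \<and> cls y = cls x" unfolding y_def using x by (intro someI) auto
    then have "f (y \<ominus>\<^bsub>M\<^esub> x) = \<zero>\<^bsub>N\<^esub>" using x fU cls_eq by blast
    then have "f y = f x" using y x MN.hom_diff[OF f] module_hom_in[OF f] by auto
    then show ?thesis unfolding g_def y_def .
  qed
  show ?thesis
  proof (rule that[of g])
    show "g \<in> module_hom R Q N"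
      by (rule module_homI)
         (auto simp: quot_carrier g module_hom_in[OF f] cls_add cls_smult module_hom_add[OF f]
            module_hom_smult[OF f] smult_closed)
  qed (rule g)
qed

end

subsection \<open>Free modules\<close>

lemma free_module_simps:
  "carrier (free_module R X) = {f. (\<forall>x. f x \<in> carrier R) \<and> (\<forall>x. x \<notin> X \<longrightarrow> f x = \<zero>\<^bsub>R\<^esub>) \<and> finite {x. f x \<noteq> \<zero>\<^bsub>R\<^esub>}}"
  "zero (free_module R X) = (\<lambda>x. \<zero>\<^bsub>R\<^esub>)" "add (free_module R X) = (\<lambda>f g x. f x \<oplus>\<^bsub>R\<^esub> g x)"
  "smult (free_module R X) = (\<lambda>r f x. r \<otimes>\<^bsub>R\<^esub> f x)"
  unfolding free_module_def by simp_all

context ring begin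

lemma free_left_module: "left_module R (free_module R X)"
proof -
  have fin: "finite {x. f x \<oplus> g x \<noteq> \<zero>}" if "finite {x. f x \<noteq> \<zero>}" "finite {x. g x \<noteq> \<zero>}"
    "\<forall>x. f x \<in> carrier R" for f g :: "'x \<Rightarrow> 'a"
    by (rule finite_subset[of _ "{x. f x \<noteq> \<zero>} \<union> {x. g x \<noteq> \<zero>}"]) (use that in auto)
  have fin2: "finite {x. r \<otimes> f x \<noteq> \<zero>}" if "finite {x. f x \<noteq> \<zero>}" "r \<in> carrier R"
    for f :: "'x \<Rightarrow> 'a" and r
    by (rule finite_subset[of _ "{x. f x \<noteq> \<zero>}"]) (use that in auto)
  have "abelian_group (free_module R X)"
  proof (rule abelian_groupI, goal_cases)
    case (6 x)
    then show ?case
      by (intro bexI[of _ "\<lambda>i. \<ominus> x i"]) (auto simp: free_module_simps l_neg elim: rev_finite_subset)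
  qed (auto simp: free_module_simps fin a_ac fun_eq_iff)
  then show ?thesis
    by (intro left_module.intro left_module_axioms.intro ring_axioms)
       (auto simp: free_module_simps fin2 l_distr r_distr m_assoc fun_eq_iff)
qed

lemma free_gen_in: "x \<in> X \<Longrightarrow> free_gen R x \<in> carrier (free_module R X)"
  by (auto simp: free_module_simps free_gen_def)

lemma free_finsum_apply:
  assumes "\<And>i. i \<in> I \<Longrightarrow> f i \<in> carrier (free_module R X)"
  shows "finsum (free_module R X) f I x = finsum R (\<lambda>i. f i x) I"
  using assms
proof (induction I rule: infinite_finite_induct)
  case (insert i I)
  interpret F: left_module R "free_module R X" by (rule free_left_module)
  have "finsum (free_module R X) f (insert i I) = f i \<oplus>\<^bsub>free_module R X\<^esub> finsum (free_module R X) f I"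
    using insert by (intro F.M.finsum_insert) auto
  moreover have "finsum R (\<lambda>i. f i x) (insert i I) = f i x \<oplus> finsum R (\<lambda>i. f i x) I"
    using insert by (intro finsum_insert) (auto simp: free_module_simps)
  ultimately show ?case using insert by (simp add: free_module_simps)
qed (auto simp: free_module_simps finsum_infinite abelian_monoid.finsum_infinite[OF
      abelian_group.axioms(1)[OF left_module.axioms(2)[OF free_left_module]]] 
      abelian_monoid.finsum_empty[OF
      abelian_group.axioms(1)[OF left_module.axioms(2)[OF free_left_module]]])

lemma free_expand:
  assumes v: "v \<in> carrier (free_module R X)" and F: "finite F" "{x. v x \<noteq> \<zero>} \<subseteq> F" "F \<subseteq> X"
  shows "v = finsum (free_module R X) (\<lambda>x. v x \<odot>\<^bsub>free_module R X\<^esub> free_gen R x) F"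
proof
  fix y
  interpret F: left_module R "free_module R X" by (rule free_left_module)
  have vR: "v x \<in> carrier R" for x using v by (simp add: free_module_simps)
  have "finsum (free_module R X) (\<lambda>x. v x \<odot>\<^bsub>free_module R X\<^esub> free_gen R x) F y
     = finsum R (\<lambda>x. (v x \<odot>\<^bsub>free_module R X\<^esub> free_gen R x) y) F"
    using F vR by (intro free_finsum_apply F.smult_closed free_gen_in) auto
  also have "\<dots> = finsum R (\<lambda>x. if x = y then v x else \<zero>) F"
    using vR by (intro finsum_cong') (auto simp: free_module_simps free_gen_def)
  also have "\<dots> = v y"
  proof (cases "y \<in> F")
    case True
    then show ?thesis using finsum_singleton[of y F v] F vR by (simp add: eq_commute)
  next
    case False
    then have "finsum R (\<lambda>x. if x = y then v x else \<zero>) F = finsum R (\<lambda>x. \<zero>) F"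
      by (intro finsum_cong') auto
    moreover have "v y = \<zero>" using False F by blast
    ultimately show ?thesis by simp
  qed
  finally show "v y = finsum (free_module R X) (\<lambda>x. v x \<odot>\<^bsub>free_module R X\<^esub> free_gen R x) F y" by simp
qed

text \<open>This is how statements about spaces given by generators and relations are proved: the
  elements for which they hold form a submodule, and it contains the generators.\<close>

lemma free_submodule_eq:
  assumes U: "left_submodule R (free_module R X) U" and gen: "\<And>x. x \<in> X \<Longrightarrow> free_gen R x \<in> U"
  shows "U = carrier (free_module R X)"
proof
  interpret F: left_module R "free_module R X" by (rule free_left_module)
  show "carrier (free_module R X) \<subseteq> U"
  proof
    fix v assume v: "v \<in> carrier (free_module R X)"
    then have F: "finite {x. v x \<noteq> \<zero>}" "{x. v x \<noteq> \<zero>} \<subseteq> X" by (auto simp: free_module_simps)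
    have "finsum (free_module R X) (\<lambda>x. v x \<odot>\<^bsub>free_module R X\<^esub> free_gen R x) {x. v x \<noteq> \<zero>} \<in> U"
      using F v gen left_submoduleD(5)[OF U]
      by (intro F.submodule_finsum[OF U]) (auto simp: free_module_simps)
    then show "v \<in> U" using free_expand[OF v F(1) _ F(2)] by simp
  qed
qed (rule left_submoduleD(1)[OF U])

end

definition free_lift :: "('r, 'c) ring_scheme \<Rightarrow> ('r, 'n, 'd) module_scheme \<Rightarrow> ('x \<Rightarrow> 'n) \<Rightarrow> ('x \<Rightarrow> 'r) \<Rightarrow> 'n" where
  "free_lift R N g v = finsum N (\<lambda>x. v x \<odot>\<^bsub>N\<^esub> g x) {x. v x \<noteq> \<zero>\<^bsub>R\<^esub>}"

context left_module begin

lemma free_lift_superset: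
  assumes v: "v \<in> carrier (free_module R X)" and g: "g \<in> X \<rightarrow> carrier M"
    and F: "finite F" "{x. v x \<noteq> \<zero>} \<subseteq> F" "F \<subseteq> X"
  shows "free_lift R M g v = finsum M (\<lambda>x. v x \<odot>\<^bsub>M\<^esub> g x) F"
  unfolding free_lift_def using assms
  by (intro M.finsum_support) (auto simp: free_module_simps Pi_iff subset_iff intro!: smult_closed)

lemma free_lift_hom:
  assumes g: "g \<in> X \<rightarrow> carrier M"
  shows "free_lift R M g \<in> module_hom R (free_module R X) M"
proof (rule module_homI)
  let ?s = "\<lambda>v. {x. v x \<noteq> \<zero>}"
  interpret F: left_module R "free_module R X" by (rule R.free_left_module)
  show cl: "free_lift R M g v \<in> carrier M" if "v \<in> carrier (free_module R X)" for v
    unfolding free_lift_def using that g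
    by (intro M.finsum_closed) (auto simp: free_module_simps intro!: smult_closed)
  show "free_lift R M g (v \<oplus>\<^bsub>free_module R X\<^esub> w) = free_lift R M g v \<oplus>\<^bsub>M\<^esub> free_lift R M g w"
    if v: "v \<in> carrier (free_module R X)" and w: "w \<in> carrier (free_module R X)" for v w
  proof -
    let ?F = "?s v \<union> ?s w"
    have F: "finite ?F" "?F \<subseteq> X" using v w by (auto simp: free_module_simps)
    have vw: "v \<oplus>\<^bsub>free_module R X\<^esub> w \<in> carrier (free_module R X)" using v w by simp
    have s: "?s (v \<oplus>\<^bsub>free_module R X\<^esub> w) \<subseteq> ?F" by (auto simp: free_module_simps)
    have c: "\<And>x. x \<in> ?F \<Longrightarrow> g x \<in> carrier M" "\<And>x. v x \<in> carrier R" "\<And>x. w x \<in> carrier R"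
      using F g v w by (auto simp: free_module_simps)
    have "finsum M (\<lambda>x. (v \<oplus>\<^bsub>free_module R X\<^esub> w) x \<odot>\<^bsub>M\<^esub> g x) ?F
       = finsum M (\<lambda>x. v x \<odot>\<^bsub>M\<^esub> g x \<oplus>\<^bsub>M\<^esub> w x \<odot>\<^bsub>M\<^esub> g x) ?F"
      using c by (intro M.finsum_cong') (auto simp: free_module_simps smult_l_distr smult_closed)
    also have "\<dots> = finsum M (\<lambda>x. v x \<odot>\<^bsub>M\<^esub> g x) ?F \<oplus>\<^bsub>M\<^esub> finsum M (\<lambda>x. w x \<odot>\<^bsub>M\<^esub> g x) ?F"
      using c by (intro M.finsum_addf) (auto simp: smult_closed)
    finally show ?thesis
      using free_lift_superset[OF vw g F(1) s F(2)] free_lift_superset[OF v g F(1) _ F(2)]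
        free_lift_superset[OF w g F(1) _ F(2)] by simp
  qed
  show "free_lift R M g (r \<odot>\<^bsub>free_module R X\<^esub> v) = r \<odot>\<^bsub>M\<^esub> free_lift R M g v"
    if r: "r \<in> carrier R" and v: "v \<in> carrier (free_module R X)" for r v
  proof -
    have F: "finite (?s v)" "?s v \<subseteq> X" using v by (auto simp: free_module_simps)
    have rv: "r \<odot>\<^bsub>free_module R X\<^esub> v \<in> carrier (free_module R X)" using F.smult_closed r v by simp
    have s: "?s (r \<odot>\<^bsub>free_module R X\<^esub> v) \<subseteq> ?s v" using r by (auto simp: free_module_simps)
    have c: "\<And>x. x \<in> ?s v \<Longrightarrow> g x \<in> carrier M" "\<And>x. v x \<in> carrier R"
      using F g v by (auto simp: free_module_simps)
    have "finsum M (\<lambda>x. (r \<odot>\<^bsub>free_module R X\<^esub> v) x \<odot>\<^bsub>M\<^esub> g x) (?s v)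
       = finsum M (\<lambda>x. r \<odot>\<^bsub>M\<^esub> (v x \<odot>\<^bsub>M\<^esub> g x)) (?s v)"
      using c r by (intro M.finsum_cong') (auto simp: free_module_simps smult_assoc1 smult_closed)
    also have "\<dots> = r \<odot>\<^bsub>M\<^esub> free_lift R M g v" unfolding free_lift_def
      using c r by (intro smult_finsum[symmetric]) (auto simp: smult_closed)
    finally show ?thesis using free_lift_superset[OF rv g F(1) s F(2)] by simp
  qed
qed

lemma free_lift_gen: "g x \<in> carrier M \<Longrightarrow> free_lift R M g (free_gen R x) = g x"
proof (cases "\<one> = \<zero>")
  \<comment> \<open>In the zero ring \<open>free_gen R x\<close> has empty support and
    \<open>free_lift\<close> returns zero, but then \<open>M\<close> is zero as well.\<close>
  case True
  assume "g x \<in> carrier M"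
  then have "g x = \<zero>\<^bsub>M\<^esub>" using True smult_one[of "g x"] by simp
  then show ?thesis using True by (simp add: free_lift_def free_gen_def)
next
  case False
  assume "g x \<in> carrier M"
  then have "{y. free_gen R x y \<noteq> \<zero>} = {x}" "free_gen R x x \<odot>\<^bsub>M\<^esub> g x = g x"
    using False by (auto simp: free_gen_def smult_one)
  then show ?thesis using \<open>g x \<in> carrier M\<close> by (simp add: free_lift_def)
qed

end

subsection \<open>Vector spaces\<close>

text \<open>Vector spaces are treated as left modules, so that quotients, free modules and
  homomorphisms are shared with the modules over noncommutative rings.\<close>

lemma vectorspace_iff: "vectorspace K V \<longleftrightarrow> field K \<and> left_module K V"
proof
  assume "vectorspace K V"
  then interpret vectorspace K V .
  show "field K \<and> left_module K V"
    by (intro conjI left_module.intro left_module_axioms.intro field_axioms R.ring_axioms M.abelian_group_axioms)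
       (auto simp: smult_l_distr smult_r_distr smult_assoc1)
next
  assume a: "field K \<and> left_module K V"
  interpret field K using a by blast
  interpret left_module K V using a by blast
  show "vectorspace K V"
    by (intro vectorspace.intro field_axioms Module.module.intro module_axioms.intro M.abelian_group_axioms is_cring)
       (auto simp: smult_l_distr smult_r_distr smult_assoc1 smult_one smult_closed)
qed

lemma vectorspaceD: assumes "vectorspace K V"
  shows "field K" "left_module K V" "Module.module K V"
  using assms vectorspace_iff vectorspace.axioms(1) by blast+

locale kspace = field K + V: left_module K V for K :: "'k ring" and V :: "('k,'v) module"
begin

sublocale vs: vectorspace K V using vectorspace_iff V.left_module_axioms field_axioms by blast

lemma lspan_submodule:
  assumes S: "S \<subseteq> carrier V" shows "left_submodule K V (lspan K V S)"
proof -
  have "submodule K (lspan K V S) V" using S by (rule vs.span_is_submodule)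
  then show ?thesis
    by (intro left_submoduleI) (auto simp: submodule_def)
qed

lemma lspan_incl: "S \<subseteq> carrier V \<Longrightarrow> x \<in> S \<Longrightarrow> x \<in> lspan K V S"
  using vs.in_own_span by blast

lemma lspan_minimal:
  assumes S: "S \<subseteq> U" and U: "left_submodule K V U" shows "lspan K V S \<subseteq> U"
proof
  fix x assume "x \<in> lspan K V S"
  then obtain a A where x: "x = vs.lincomb a A" and A: "finite A" "A \<subseteq> S" "a \<in> A \<rightarrow> carrier K"
    unfolding vs.span_def by auto
  show "x \<in> U" unfolding x vs.lincomb_def
    using A S left_submoduleD[OF U] by (intro V.submodule_finsum[OF U]) blast
qed

text \<open>Independence is proved with dual functionals: applied to a vanishing combination, the
  functional belonging to \<open>v\<close> returns the coefficient of \<open>v\<close>.\<close>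

lemma basisI:
  assumes B: "B \<subseteq> carrier V" and sp: "carrier V \<subseteq> lspan K V B"
    and f: "\<And>b. b \<in> B \<Longrightarrow> \<exists>f. (\<forall>x\<in>carrier V. f x \<in> carrier K) \<and>
       (\<forall>x\<in>carrier V. \<forall>y\<in>carrier V. f (x \<oplus>\<^bsub>V\<^esub> y) = f x \<oplus>\<^bsub>K\<^esub> f y) \<and>
       (\<forall>k\<in>carrier K. \<forall>x\<in>carrier V. f (k \<odot>\<^bsub>V\<^esub> x) = k \<otimes>\<^bsub>K\<^esub> f x) \<and>
       f b = \<one>\<^bsub>K\<^esub> \<and> (\<forall>b'\<in>B. b' \<noteq> b \<longrightarrow> f b' = \<zero>\<^bsub>K\<^esub>)"
  shows "vectorspace.basis K V B"
proof -
  have "vs.lin_indpt B"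
  proof
    assume "vs.lin_dep B"
    then obtain A a v where A: "finite A" "A \<subseteq> B" "a \<in> A \<rightarrow> carrier K" "vs.lincomb a A = \<zero>\<^bsub>V\<^esub>" "v \<in> A" "a v \<noteq> \<zero>\<^bsub>K\<^esub>"
      unfolding vs.lin_dep_def by blast
    obtain f where f1: "\<And>x. x\<in>carrier V \<Longrightarrow> f x \<in> carrier K"
      and f2: "\<And>x y. x\<in>carrier V \<Longrightarrow> y\<in>carrier V \<Longrightarrow> f (x \<oplus>\<^bsub>V\<^esub> y) = f x \<oplus>\<^bsub>K\<^esub> f y"
      and f3: "\<And>k x. k\<in>carrier K \<Longrightarrow> x\<in>carrier V \<Longrightarrow> f (k \<odot>\<^bsub>V\<^esub> x) = k \<otimes>\<^bsub>K\<^esub> f x"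
      and f4: "f v = \<one>\<^bsub>K\<^esub>" "\<And>b. b \<in> B \<Longrightarrow> b \<noteq> v \<Longrightarrow> f b = \<zero>\<^bsub>K\<^esub>"
      using f[of v] A by blast
    have f0: "f \<zero>\<^bsub>V\<^esub> = \<zero>\<^bsub>K\<^esub>"
      using f3[of "\<zero>\<^bsub>K\<^esub>" "\<zero>\<^bsub>V\<^esub>"] f1[of "\<zero>\<^bsub>V\<^esub>"] by simp
    have fs: "f (finsum V g I) = finsum K (\<lambda>i. f (g i)) I" if "finite I" "\<And>i. i \<in> I \<Longrightarrow> g i \<in> carrier V" for g and I :: "'v set"
      using that
    proof (induction I)
      case (insert i I)
      then have "finsum V g (insert i I) = g i \<oplus>\<^bsub>V\<^esub> finsum V g I"
        "finsum K (\<lambda>i. f (g i)) (insert i I) = f (g i) \<oplus>\<^bsub>K\<^esub> finsum K (\<lambda>i. f (g i)) I"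
        using f1 by (auto intro!: V.M.finsum_insert finsum_insert)
      moreover have "finsum V g I \<in> carrier V" using insert by auto
      ultimately show ?case using insert f2 by simp
    qed (simp add: f0)
    have "f (vs.lincomb a A) = finsum K (\<lambda>i. f (a i \<odot>\<^bsub>V\<^esub> i)) A"
      unfolding vs.lincomb_def using A B by (intro fs) (auto intro!: V.smult_closed)
    also have "\<dots> = finsum K (\<lambda>i. if i = v then a i else \<zero>\<^bsub>K\<^esub>) A"
    proof (intro finsum_cong')
      fix i assume i: "i \<in> A"
      then have "a i \<in> carrier K" "i \<in> carrier V" "i \<in> B" using A B by auto
      then show "f (a i \<odot>\<^bsub>V\<^esub> i) = (if i = v then a i else \<zero>\<^bsub>K\<^esub>)" using f3 f4 by auto
    qed (use A in auto)
    also have "\<dots> = a v" using finsum_singleton[of v A a] A by (simp add: eq_commute)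
    finally show False using A f0 by simp
  qed
  moreover have "vs.gen_set B"
    using sp lspan_submodule[OF B] left_submoduleD(1) by fastforce
  ultimately show ?thesis unfolding vs.basis_def using B by auto
qed

end

section \<open>Exactness along a chain of ideals\<close>

subsection \<open>Submodules generated by ideals\<close>

text \<open>The submodule \<open>I M\<close>. Stability under scalars is not a rule because it
  follows when \<open>I\<close> is an ideal. Calculating modulo \<open>I M\<close> stands for
  calculating over the quotient by \<open>I\<close>, but keeps all ideals of the chain on the same
  modules.\<close>

inductive_set ideal_span :: "('r, 'm, 'd) module_scheme \<Rightarrow> 'r set \<Rightarrow> 'm set" for M and I where
  zero: "\<zero>\<^bsub>M\<^esub> \<in> ideal_span M I"
| add: "x \<in> ideal_span M I \<Longrightarrow> y \<in> ideal_span M I \<Longrightarrow> x \<oplus>\<^bsub>M\<^esub> y \<in> ideal_span M I"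
| gen: "c \<in> I \<Longrightarrow> x \<in> carrier M \<Longrightarrow> c \<odot>\<^bsub>M\<^esub> x \<in> ideal_span M I"

lemma idealD:
  assumes "ideal I R"
  shows "I \<subseteq> carrier R" "\<And>x. x \<in> I \<Longrightarrow> x \<in> carrier R" "\<zero>\<^bsub>R\<^esub> \<in> I"
    "\<And>x y. x \<in> I \<Longrightarrow> y \<in> I \<Longrightarrow> x \<oplus>\<^bsub>R\<^esub> y \<in> I" "\<And>x y. x \<in> I \<Longrightarrow> y \<in> I \<Longrightarrow> x \<ominus>\<^bsub>R\<^esub> y \<in> I"
    "\<And>x y. x \<in> carrier R \<Longrightarrow> y \<in> I \<Longrightarrow> x \<otimes>\<^bsub>R\<^esub> y \<in> I"
    "\<And>x y. x \<in> carrier R \<Longrightarrow> y \<in> I \<Longrightarrow> y \<otimes>\<^bsub>R\<^esub> x \<in> I"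
proof -
  interpret ideal I R by fact
  show "I \<subseteq> carrier R" "\<And>x. x \<in> I \<Longrightarrow> x \<in> carrier R" "\<zero>\<^bsub>R\<^esub> \<in> I"
    "\<And>x y. x \<in> I \<Longrightarrow> y \<in> I \<Longrightarrow> x \<oplus>\<^bsub>R\<^esub> y \<in> I" "\<And>x y. x \<in> I \<Longrightarrow> y \<in> I \<Longrightarrow> x \<ominus>\<^bsub>R\<^esub> y \<in> I"
    "\<And>x y. x \<in> carrier R \<Longrightarrow> y \<in> I \<Longrightarrow> x \<otimes>\<^bsub>R\<^esub> y \<in> I"
    "\<And>x y. x \<in> carrier R \<Longrightarrow> y \<in> I \<Longrightarrow> y \<otimes>\<^bsub>R\<^esub> x \<in> I"
    by (auto simp: a_minus_def I_l_closed I_r_closed)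
qed

context left_module begin

lemma ideal_span_carrier: "I \<subseteq> carrier R \<Longrightarrow> x \<in> ideal_span M I \<Longrightarrow> x \<in> carrier M"
  by (erule ideal_span.induct[of x M I]) (auto intro: smult_closed)

lemma ideal_span_submodule:
  assumes I: "ideal I R" shows "left_submodule R M (ideal_span M I)"
proof (rule left_submoduleI)
  show "r \<odot>\<^bsub>M\<^esub> x \<in> ideal_span M I" if r: "r \<in> carrier R" and x: "x \<in> ideal_span M I" for r x
    using x
  proof induction
    case zero
    then show ?case using r by (simp add: ideal_span.zero)
  next
    case (add x y)
    then show ?case using r ideal_span_carrier[OF idealD(1)[OF I]]
      by (simp add: smult_r_distr ideal_span.add)
  next
    case (gen c x)
    then have "r \<odot>\<^bsub>M\<^esub> (c \<odot>\<^bsub>M\<^esub> x) = (r \<otimes> c) \<odot>\<^bsub>M\<^esub> x" using r idealD(2)[OF I] by (simp add: smult_assoc1)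
    then show ?case using gen r idealD(6)[OF I] by (simp add: ideal_span.gen)
  qed
qed (use ideal_span_carrier[OF idealD(1)[OF I]] in \<open>auto intro: ideal_span.intros\<close>)

lemma ideal_span_mult_congr:
  assumes I: "ideal I R" and c: "c \<in> carrier R" "c' \<in> carrier R" "c \<ominus> c' \<in> I" and x: "x \<in> carrier M"
  shows "c \<odot>\<^bsub>M\<^esub> x \<ominus>\<^bsub>M\<^esub> c' \<odot>\<^bsub>M\<^esub> x \<in> ideal_span M I"
proof -
  have "(c \<ominus> c') \<odot>\<^bsub>M\<^esub> x = c \<odot>\<^bsub>M\<^esub> x \<ominus>\<^bsub>M\<^esub> c' \<odot>\<^bsub>M\<^esub> x"
    using c x by (simp add: a_minus_def smult_l_distr smult_l_minus)
  then show ?thesis using ideal_span.gen[OF c(3) x] by simp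
qed

lemma ideal_span_annihilated:
  assumes "\<And>c x. c \<in> I \<Longrightarrow> x \<in> carrier M \<Longrightarrow> c \<odot>\<^bsub>M\<^esub> x = \<zero>\<^bsub>M\<^esub>"
  shows "ideal_span M I = {\<zero>\<^bsub>M\<^esub>}"
proof -
  have "x = \<zero>\<^bsub>M\<^esub>" if "x \<in> ideal_span M I" for x
    using that by induction (auto simp: assms)
  then show ?thesis using ideal_span.zero by blast
qed

lemma ideal_span_all: "ideal_span M (carrier R) = carrier M"
  using ideal_span_carrier[of "carrier R"] ideal_span.gen[of "\<one>" "carrier R"] smult_one by fastforce


end

lemma ideal_span_mono: "I \<subseteq> I' \<Longrightarrow> x \<in> ideal_span M I \<Longrightarrow> x \<in> ideal_span M I'"
  by (erule ideal_span.induct[of x M I]) (auto intro: ideal_span.intros)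

lemma quot_mod_ideal_span:
  "left_module R M \<Longrightarrow> ideal I R \<Longrightarrow> quot_mod R M (ideal_span M I)"
  by (simp add: quot_mod_def quot_mod_axioms_def left_module.ideal_span_submodule)

lemma (in module_hom_pair) ideal_span_hom:
  assumes f: "f \<in> module_hom R M N" and I: "I \<subseteq> carrier R" and x: "x \<in> ideal_span M I"
  shows "f x \<in> ideal_span N I"
  using x
proof induction
  case zero
  then show ?case by (simp add: hom_zero[OF f] ideal_span.zero)
next
  case (add x y)
  then show ?case using M.ideal_span_carrier[OF I] by (simp add: module_hom_add[OF f] ideal_span.add)
next
  case (gen c x)
  then have "f (c \<odot>\<^bsub>M\<^esub> x) = c \<odot>\<^bsub>N\<^esub> f x" using I by (intro module_hom_smult[OF f]) auto
  then show ?case using gen module_hom_in[OF f] by (simp add: ideal_span.gen)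
qed

subsection \<open>Lifting along relative dual bases\<close>

text \<open>The maps below are defined only on \<open>V M\<close>, additive only modulo \<open>U\<close>, and linear only over the subset \<open>D\<close>
  of \<open>C\<close>.\<close>

definition mod_lin ::
  "('r, 'c) ring_scheme \<Rightarrow> 'r set \<Rightarrow> 'r set \<Rightarrow> 'r set \<Rightarrow> ('r, 'm) module \<Rightarrow> ('r, 'n) module \<Rightarrow> ('m \<Rightarrow> 'n) \<Rightarrow> bool" where
  "mod_lin C U V D M N h \<longleftrightarrow>
     (\<forall>u\<in>ideal_span M V. h u \<in> ideal_span N V) \<and> (\<forall>u\<in>ideal_span M U. h u \<in> ideal_span N U) \<and>
     (\<forall>u\<in>ideal_span M V. \<forall>v\<in>ideal_span M V. h (u \<oplus>\<^bsub>M\<^esub> v) \<ominus>\<^bsub>N\<^esub> (h u \<oplus>\<^bsub>N\<^esub> h v) \<in> ideal_span N U) \<and>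
     (\<forall>b\<in>D. \<forall>u\<in>ideal_span M V. h (b \<odot>\<^bsub>M\<^esub> u) \<ominus>\<^bsub>N\<^esub> b \<odot>\<^bsub>N\<^esub> h u \<in> ideal_span N U)"

text \<open>The dual basis criterion for projectivity, relative to the pair \<open>U\<close>,
  \<open>V\<close>: elements of \<open>V M\<close> are recovered from their coordinates
  \<open>f i u\<close> modulo \<open>U M\<close>. The condition \<open>e \<odot> x i = x i\<close>
  later allows preimages of the \<open>x i\<close> to be moved into \<open>V N\<close>. The
  coordinates have values in \<open>D\<close> because the maps to be lifted are linear only over
  \<open>D\<close>.\<close>

definition dual_basis ::
  "('r, 'c) ring_scheme \<Rightarrow> 'r set \<Rightarrow> 'r set \<Rightarrow> 'r \<Rightarrow> 'r set \<Rightarrow> ('r, 'm) module \<Rightarrow> 'i set \<Rightarrow> ('i \<Rightarrow> 'm) \<Rightarrow>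
    ('i \<Rightarrow> 'm \<Rightarrow> 'r) \<Rightarrow> bool" where
  "dual_basis C U V e D M L x f \<longleftrightarrow>
     (\<forall>i\<in>L. x i \<in> carrier M \<and> e \<odot>\<^bsub>M\<^esub> x i = x i) \<and>
     (\<forall>i\<in>L. \<forall>u\<in>ideal_span M V. f i u \<in> D) \<and>
     (\<forall>i\<in>L. \<forall>u\<in>ideal_span M U. f i u \<in> U) \<and>
     (\<forall>i\<in>L. \<forall>u\<in>ideal_span M V. \<forall>v\<in>ideal_span M V. f i (u \<oplus>\<^bsub>M\<^esub> v) \<ominus>\<^bsub>C\<^esub> (f i u \<oplus>\<^bsub>C\<^esub> f i v) \<in> U) \<and>
     (\<forall>i\<in>L. \<forall>b\<in>D. \<forall>u\<in>ideal_span M V. f i (b \<odot>\<^bsub>M\<^esub> u) \<ominus>\<^bsub>C\<^esub> b \<otimes>\<^bsub>C\<^esub> f i u \<in> U) \<and>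
     (\<forall>u\<in>ideal_span M V. finite {i \<in> L. f i u \<noteq> \<zero>\<^bsub>C\<^esub>} \<and>
        u \<ominus>\<^bsub>M\<^esub> finsum M (\<lambda>i. f i u \<odot>\<^bsub>M\<^esub> x i) {i \<in> L. f i u \<noteq> \<zero>\<^bsub>C\<^esub>} \<in> ideal_span M U)"

text \<open>The element \<open>e\<close> has two roles: lying in \<open>V\<close> it puts every
  \<open>x i = e \<odot> x i\<close> of a dual basis into \<open>V M\<close>, and lying in
  \<open>D\<close> it commutes modulo \<open>U\<close> with the maps of
  \<open>mod_lin\<close>.\<close>

locale ideal_pair = ring C for C (structure) +
  fixes U V e D
  assumes U: "ideal U C" and V: "ideal V C" and UV: "U \<subseteq> V" and eV: "e \<in> V" and eD: "e \<in> D"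
    and D: "D \<subseteq> carrier C"
begin

lemma spanU_V: "x \<in> ideal_span M U \<Longrightarrow> x \<in> ideal_span M V"
  using ideal_span_mono[OF UV] .

lemma mod_lin_hom:
  assumes "left_module C M" "left_module C N" and h: "h \<in> module_hom C M N"
  shows "mod_lin C U V D M N h"
proof -
  interpret M: left_module C M by fact
  interpret N: left_module C N by fact
  interpret module_hom_pair C M N by unfold_locales
  note c = M.ideal_span_carrier[OF idealD(1)[OF V]]
  have z: "x \<in> carrier N \<Longrightarrow> x \<ominus>\<^bsub>N\<^esub> x \<in> ideal_span N U" for x
    by (simp add: a_minus_def N.M.r_neg ideal_span.zero)
  have hc: "h u \<in> carrier N" if "u \<in> ideal_span M V" for u using c that module_hom_in[OF h] by blast
  show ?thesis unfolding mod_lin_def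
  proof (intro conjI ballI)
    fix u v assume u: "u \<in> ideal_span M V" "v \<in> ideal_span M V"
    then have "h (u \<oplus>\<^bsub>M\<^esub> v) = h u \<oplus>\<^bsub>N\<^esub> h v" using c module_hom_add[OF h] by blast
    then show "h (u \<oplus>\<^bsub>M\<^esub> v) \<ominus>\<^bsub>N\<^esub> (h u \<oplus>\<^bsub>N\<^esub> h v) \<in> ideal_span N U"
      using z hc u by simp
  next
    fix b u assume u: "b \<in> D" "u \<in> ideal_span M V"
    then have b: "b \<in> carrier C" using D by blast
    then have "h (b \<odot>\<^bsub>M\<^esub> u) = b \<odot>\<^bsub>N\<^esub> h u" using c u module_hom_smult[OF h] by blast
    then show "h (b \<odot>\<^bsub>M\<^esub> u) \<ominus>\<^bsub>N\<^esub> b \<odot>\<^bsub>N\<^esub> h u \<in> ideal_span N U"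
      using z hc u b N.smult_closed by simp
  qed (use ideal_span_hom[OF h idealD(1)[OF V]] ideal_span_hom[OF h idealD(1)[OF U]] in blast)+
qed

text \<open>For classes in \<open>N / U N\<close> the conditions of \<open>mod_lin\<close> become
  equations, so the computations below are made with classes. The third equation says that the class
  of \<open>h u\<close> depends only on \<open>u\<close> modulo \<open>U M\<close>.\<close>

lemma mod_lin_cls:
  assumes M: "left_module C M" and N: "left_module C N" and h: "mod_lin C U V D M N h"
  defines "cl \<equiv> (\<lambda>x. ideal_span N U +>\<^bsub>N\<^esub> x)"
  shows "u \<in> ideal_span M V \<Longrightarrow> v \<in> ideal_span M V \<Longrightarrow> cl (h (u \<oplus>\<^bsub>M\<^esub> v)) = cl (h u \<oplus>\<^bsub>N\<^esub> h v)"
    "b \<in> D \<Longrightarrow> u \<in> ideal_span M V \<Longrightarrow> cl (h (b \<odot>\<^bsub>M\<^esub> u)) = cl (b \<odot>\<^bsub>N\<^esub> h u)"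
    "u \<in> ideal_span M V \<Longrightarrow> v \<in> ideal_span M V \<Longrightarrow> u \<ominus>\<^bsub>M\<^esub> v \<in> ideal_span M U \<Longrightarrow> cl (h u) = cl (h v)"
    "finite I \<Longrightarrow> (\<And>i. i \<in> I \<Longrightarrow> g i \<in> ideal_span M V) \<Longrightarrow>
       cl (h (finsum M g I)) = finsum (quot_module N (ideal_span N U)) (\<lambda>i. cl (h (g i))) I"
proof -
  interpret M: left_module C M by fact
  interpret N: quot_mod C N "ideal_span N U" by (rule quot_mod_ideal_span[OF N U])
  note cM = M.ideal_span_carrier[OF idealD(1)[OF V]] and cN = N.ideal_span_carrier[OF idealD(1)[OF V]]
  note sM = M.ideal_span_submodule[OF V]
  have hV: "\<And>u. u \<in> ideal_span M V \<Longrightarrow> h u \<in> ideal_span N V"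
    and hU: "\<And>u. u \<in> ideal_span M U \<Longrightarrow> h u \<in> ideal_span N U"
    and ha: "\<And>u v. u \<in> ideal_span M V \<Longrightarrow> v \<in> ideal_span M V \<Longrightarrow> h (u \<oplus>\<^bsub>M\<^esub> v) \<ominus>\<^bsub>N\<^esub> (h u \<oplus>\<^bsub>N\<^esub> h v) \<in> ideal_span N U"
    and hb: "\<And>b u. b \<in> D \<Longrightarrow> u \<in> ideal_span M V \<Longrightarrow> h (b \<odot>\<^bsub>M\<^esub> u) \<ominus>\<^bsub>N\<^esub> b \<odot>\<^bsub>N\<^esub> h u \<in> ideal_span N U"
    using h unfolding mod_lin_def by auto
  show A: "cl (h (u \<oplus>\<^bsub>M\<^esub> v)) = cl (h u \<oplus>\<^bsub>N\<^esub> h v)" if "u \<in> ideal_span M V" "v \<in> ideal_span M V" for u v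
    unfolding cl_def using ha[OF that] that hV cN by (subst N.cls_eq) (auto intro: ideal_span.add)
  show "cl (h (b \<odot>\<^bsub>M\<^esub> u)) = cl (b \<odot>\<^bsub>N\<^esub> h u)" if "b \<in> D" "u \<in> ideal_span M V" for b u
    unfolding cl_def using hb[OF that] that hV cN left_submoduleD[OF sM] D
    by (subst N.cls_eq) (auto intro!: N.smult_closed)
  show "cl (h u) = cl (h v)" if u: "u \<in> ideal_span M V" "v \<in> ideal_span M V" "u \<ominus>\<^bsub>M\<^esub> v \<in> ideal_span M U" for u v
  proof -
    have "u = (u \<ominus>\<^bsub>M\<^esub> v) \<oplus>\<^bsub>M\<^esub> v" using u cM by (simp add: a_minus_def M.a_assoc M.l_neg)
    then have "cl (h u) = cl (h (u \<ominus>\<^bsub>M\<^esub> v) \<oplus>\<^bsub>N\<^esub> h v)" using A[of "u \<ominus>\<^bsub>M\<^esub> v" v] u spanU_V by metis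
    also have "\<dots> = cl (h v)"
    proof -
      have "h (u \<ominus>\<^bsub>M\<^esub> v) \<in> ideal_span N U" "h (u \<ominus>\<^bsub>M\<^esub> v) \<in> carrier N" "h v \<in> carrier N"
        using hU[OF u(3)] hV[OF spanU_V[OF u(3)]] hV[OF u(2)] cN by auto
      then show ?thesis unfolding cl_def
        by (simp add: N.cls_add[symmetric] N.cls_eq_zero[THEN iffD2] N.cls_in)
    qed
    finally show ?thesis .
  qed
  show "cl (h (finsum M g I)) = finsum (quot_module N (ideal_span N U)) (\<lambda>i. cl (h (g i))) I"
    if "finite I" "\<And>i. i \<in> I \<Longrightarrow> g i \<in> ideal_span M V"
    using that
  proof (induction I)
    case empty
    then show ?case using hU[OF ideal_span.zero] cN[OF hV[OF ideal_span.zero]]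
      by (simp add: cl_def N.cls_eq_zero)
  next
    case (insert i I)
    have "finsum M g (insert i I) = g i \<oplus>\<^bsub>M\<^esub> finsum M g I"
      using insert cM by (intro M.M.finsum_insert) auto
    moreover have "finsum M g I \<in> ideal_span M V" using insert by (intro M.submodule_finsum[OF sM]) auto
    ultimately have "cl (h (finsum M g (insert i I))) = cl (h (g i) \<oplus>\<^bsub>N\<^esub> h (finsum M g I))"
      using A insert by simp
    also have "\<dots> = cl (h (g i)) \<oplus>\<^bsub>quot_module N (ideal_span N U)\<^esub> cl (h (finsum M g I))"
      unfolding cl_def using insert hV \<open>finsum M g I \<in> ideal_span M V\<close> cN by (intro N.cls_add[symmetric]) auto
    also have "\<dots> = finsum (quot_module N (ideal_span N U)) (\<lambda>i. cl (h (g i))) (insert i I)"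
      using insert hV cN by (subst N.Q.M.finsum_insert) (auto simp: cl_def intro!: N.cls_in)
    finally show ?case .
  qed
qed

lemma mod_lin_comp:
  assumes M: "left_module C M" and N: "left_module C N" and P: "left_module C P"
    and h: "mod_lin C U V D M N h" and g: "mod_lin C U V D N P g"
  shows "mod_lin C U V D M P (\<lambda>x. g (h x))"
proof -
  interpret M: left_module C M by fact
  interpret N: quot_mod C N "ideal_span N U" by (rule quot_mod_ideal_span[OF N U])
  interpret P: quot_mod C P "ideal_span P U" by (rule quot_mod_ideal_span[OF P U])
  note cP = P.ideal_span_carrier[OF idealD(1)[OF V]]
  note sM = left_submoduleD[OF M.ideal_span_submodule[OF V]]
    and sN = left_submoduleD[OF N.ideal_span_submodule[OF V]]
  note gc = mod_lin_cls[OF N P g]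
  have hV: "\<And>u. u \<in> ideal_span M V \<Longrightarrow> h u \<in> ideal_span N V"
    and gV: "\<And>u. u \<in> ideal_span N V \<Longrightarrow> g u \<in> ideal_span P V"
    and U': "\<And>u. u \<in> ideal_span M U \<Longrightarrow> g (h u) \<in> ideal_span P U"
    using h g unfolding mod_lin_def by auto
  have ha: "\<And>u v. u \<in> ideal_span M V \<Longrightarrow> v \<in> ideal_span M V \<Longrightarrow> h (u \<oplus>\<^bsub>M\<^esub> v) \<ominus>\<^bsub>N\<^esub> (h u \<oplus>\<^bsub>N\<^esub> h v) \<in> ideal_span N U"
    and hb: "\<And>b u. b \<in> D \<Longrightarrow> u \<in> ideal_span M V \<Longrightarrow> h (b \<odot>\<^bsub>M\<^esub> u) \<ominus>\<^bsub>N\<^esub> b \<odot>\<^bsub>N\<^esub> h u \<in> ideal_span N U"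
    using h unfolding mod_lin_def by auto
  have 1: "P.cls (g (h (u \<oplus>\<^bsub>M\<^esub> v))) = P.cls (g (h u) \<oplus>\<^bsub>P\<^esub> g (h v))"
    if u: "u \<in> ideal_span M V" "v \<in> ideal_span M V" for u v
    using gc(3)[OF _ _ ha[OF u]] gc(1)[of "h u" "h v"] u hV sM sN by auto
  have 2: "P.cls (g (h (b \<odot>\<^bsub>M\<^esub> u))) = P.cls (b \<odot>\<^bsub>P\<^esub> g (h u))"
    if u: "b \<in> D" "u \<in> ideal_span M V" for b u
    using gc(3)[OF _ _ hb[OF u]] gc(2)[of b "h u"] u hV sM(5) sN(5) D by auto
  have c: "g (h u) \<in> carrier P" if "u \<in> ideal_span M V" for u using that hV gV cP by blast
  show ?thesis unfolding mod_lin_def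
  proof (intro conjI ballI)
    fix u v assume u: "u \<in> ideal_span M V" "v \<in> ideal_span M V"
    show "g (h (u \<oplus>\<^bsub>M\<^esub> v)) \<ominus>\<^bsub>P\<^esub> (g (h u) \<oplus>\<^bsub>P\<^esub> g (h v)) \<in> ideal_span P U"
      by (rule P.cls_eq[THEN iffD1, OF _ _ 1[OF u]]) (use c u sM(4) in blast)+
  next
    fix b u assume u: "b \<in> D" "u \<in> ideal_span M V"
    then have b: "b \<in> carrier C" using D by blast
    show "g (h (b \<odot>\<^bsub>M\<^esub> u)) \<ominus>\<^bsub>P\<^esub> b \<odot>\<^bsub>P\<^esub> g (h u) \<in> ideal_span P U"
      by (rule P.cls_eq[THEN iffD1, OF _ _ 2[OF u]]) (use c u b sM(5) P.smult_closed in blast)+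
  qed (use hV gV U' in blast)+
qed

lemma mod_lin_diff:
  assumes M: "left_module C M" and N: "left_module C N"
    and h: "mod_lin C U V D M N h" and g: "mod_lin C U V D M N g"
  shows "mod_lin C U V D M N (\<lambda>x. h x \<ominus>\<^bsub>N\<^esub> g x)"
proof -
  interpret M: left_module C M by fact
  interpret N: quot_mod C N "ideal_span N U" by (rule quot_mod_ideal_span[OF N U])
  interpret Q: left_module C "quot_module N (ideal_span N U)" by (rule N.quot_left_module)
  note cN = N.ideal_span_carrier[OF idealD(1)[OF V]]
  note sM = left_submoduleD[OF M.ideal_span_submodule[OF V]]
  note hc = mod_lin_cls[OF M N h] and gc = mod_lin_cls[OF M N g]
  have hV: "\<And>u. u \<in> ideal_span M V \<Longrightarrow> h u \<in> ideal_span N V"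
    and hU: "\<And>u. u \<in> ideal_span M U \<Longrightarrow> h u \<in> ideal_span N U"
    using h unfolding mod_lin_def by auto
  have gV: "\<And>u. u \<in> ideal_span M V \<Longrightarrow> g u \<in> ideal_span N V"
    and gU: "\<And>u. u \<in> ideal_span M U \<Longrightarrow> g u \<in> ideal_span N U"
    using g unfolding mod_lin_def by auto
  have c: "h u \<in> carrier N" "g u \<in> carrier N" if "u \<in> ideal_span M V" for u using that hV gV cN by blast+
  have cd: "N.cls (x \<ominus>\<^bsub>N\<^esub> y) = N.cls x \<ominus>\<^bsub>quot_module N (ideal_span N U)\<^esub> N.cls y"
    if "x \<in> carrier N" "y \<in> carrier N" for x y using N.MQ.hom_diff[OF N.cls_hom that] .
  have 1: "N.cls (h (u \<oplus>\<^bsub>M\<^esub> v) \<ominus>\<^bsub>N\<^esub> g (u \<oplus>\<^bsub>M\<^esub> v)) = N.cls ((h u \<ominus>\<^bsub>N\<^esub> g u) \<oplus>\<^bsub>N\<^esub> (h v \<ominus>\<^bsub>N\<^esub> g v))"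
    if u: "u \<in> ideal_span M V" "v \<in> ideal_span M V" for u v
  proof -
    have "N.cls (h (u \<oplus>\<^bsub>M\<^esub> v) \<ominus>\<^bsub>N\<^esub> g (u \<oplus>\<^bsub>M\<^esub> v)) = N.cls ((h u \<oplus>\<^bsub>N\<^esub> h v) \<ominus>\<^bsub>N\<^esub> (g u \<oplus>\<^bsub>N\<^esub> g v))"
      using u c sM(4) hc(1)[OF u] gc(1)[OF u] by (simp add: cd)
    also have "(h u \<oplus>\<^bsub>N\<^esub> h v) \<ominus>\<^bsub>N\<^esub> (g u \<oplus>\<^bsub>N\<^esub> g v) = (h u \<ominus>\<^bsub>N\<^esub> g u) \<oplus>\<^bsub>N\<^esub> (h v \<ominus>\<^bsub>N\<^esub> g v)"
      using c[OF u(1)] c[OF u(2)] by (simp add: a_minus_def N.M.minus_add N.M.a_ac)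
    finally show ?thesis .
  qed
  have 2: "N.cls (h (b \<odot>\<^bsub>M\<^esub> u) \<ominus>\<^bsub>N\<^esub> g (b \<odot>\<^bsub>M\<^esub> u)) = N.cls (b \<odot>\<^bsub>N\<^esub> (h u \<ominus>\<^bsub>N\<^esub> g u))"
    if u: "b \<in> D" "u \<in> ideal_span M V" for b u
  proof -
    have b: "b \<in> carrier C" using u D by auto
    have "N.cls (h (b \<odot>\<^bsub>M\<^esub> u) \<ominus>\<^bsub>N\<^esub> g (b \<odot>\<^bsub>M\<^esub> u)) = N.cls (b \<odot>\<^bsub>N\<^esub> h u \<ominus>\<^bsub>N\<^esub> b \<odot>\<^bsub>N\<^esub> g u)"
      using u b c sM(5) hc(2)[OF u] gc(2)[OF u] by (simp add: cd N.smult_closed)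
    also have "b \<odot>\<^bsub>N\<^esub> h u \<ominus>\<^bsub>N\<^esub> b \<odot>\<^bsub>N\<^esub> g u = b \<odot>\<^bsub>N\<^esub> (h u \<ominus>\<^bsub>N\<^esub> g u)"
      using c[OF u(2)] b by (simp add: a_minus_def N.smult_r_distr N.smult_r_minus)
    finally show ?thesis .
  qed
  have cc: "h u \<ominus>\<^bsub>N\<^esub> g u \<in> carrier N" if "u \<in> ideal_span M V" for u using c[OF that] by simp
  show ?thesis unfolding mod_lin_def
  proof (intro conjI ballI)
    fix u v assume u: "u \<in> ideal_span M V" "v \<in> ideal_span M V"
    show "h (u \<oplus>\<^bsub>M\<^esub> v) \<ominus>\<^bsub>N\<^esub> g (u \<oplus>\<^bsub>M\<^esub> v) \<ominus>\<^bsub>N\<^esub> (h u \<ominus>\<^bsub>N\<^esub> g u \<oplus>\<^bsub>N\<^esub> (h v \<ominus>\<^bsub>N\<^esub> g v)) \<in> ideal_span N U"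
      by (rule N.cls_eq[THEN iffD1, OF _ _ 1[OF u]]) (use cc u sM(4) in blast)+
  next
    fix b u assume u: "b \<in> D" "u \<in> ideal_span M V"
    then have b: "b \<in> carrier C" using D by blast
    show "h (b \<odot>\<^bsub>M\<^esub> u) \<ominus>\<^bsub>N\<^esub> g (b \<odot>\<^bsub>M\<^esub> u) \<ominus>\<^bsub>N\<^esub> b \<odot>\<^bsub>N\<^esub> (h u \<ominus>\<^bsub>N\<^esub> g u) \<in> ideal_span N U"
      by (rule N.cls_eq[THEN iffD1, OF _ _ 2[OF u]]) (use cc u b sM(5) N.smult_closed in blast)+
  qed (use hV gV hU gU N.submodule_diff[OF N.ideal_span_submodule[OF V]]
       N.submodule_diff[OF N.ideal_span_submodule[OF U]] in blast)+
qed

text \<open>The lift is defined as on a projective module: pick \<open>y i\<close> over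
  \<open>h (x i)\<close> and send \<open>u\<close> to the sum of all
  \<open>f i u \<odot> y i\<close>. Replacing \<open>y i\<close> by \<open>e \<odot> y i\<close>
  puts it into \<open>V N\<close> and keeps its image modulo \<open>U\<close>, because
  \<open>e \<odot> x i = x i\<close> and \<open>h\<close> commutes with \<open>e\<close> modulo
  \<open>U\<close>.\<close>

lemma dual_basis_lift:
  assumes M: "left_module C M" and N: "left_module C N" and d: "d \<in> module_hom C N M"
    and db: "dual_basis C U V e D M L x f"
    and h: "mod_lin C U V D M M h"
    and ex: "\<And>u. u \<in> ideal_span M V \<Longrightarrow> \<exists>y\<in>carrier N. h u \<ominus>\<^bsub>M\<^esub> d y \<in> ideal_span M U"
  shows "\<exists>t. mod_lin C U V D M N t \<and> (\<forall>u\<in>ideal_span M V. d (t u) \<ominus>\<^bsub>M\<^esub> h u \<in> ideal_span M U)"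
proof -
  interpret M: quot_mod C M "ideal_span M U" by (rule quot_mod_ideal_span[OF M U])
  interpret N: quot_mod C N "ideal_span N U" by (rule quot_mod_ideal_span[OF N U])
  interpret NM: module_hom_pair C N M by unfold_locales
  note cM = M.ideal_span_carrier[OF idealD(1)[OF V]] and cN = N.ideal_span_carrier[OF idealD(1)[OF V]]
  note sM = left_submoduleD[OF M.ideal_span_submodule[OF V]]
    and sN = left_submoduleD[OF N.ideal_span_submodule[OF V]]
  note hc = mod_lin_cls[OF M M h]
  have hV: "\<And>u. u \<in> ideal_span M V \<Longrightarrow> h u \<in> ideal_span M V"
    using h unfolding mod_lin_def by auto
  have xL: "\<And>i. i \<in> L \<Longrightarrow> x i \<in> carrier M" "\<And>i. i \<in> L \<Longrightarrow> e \<odot>\<^bsub>M\<^esub> x i = x i"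
    and fD: "\<And>i u. i \<in> L \<Longrightarrow> u \<in> ideal_span M V \<Longrightarrow> f i u \<in> D"
    and fU: "\<And>i u. i \<in> L \<Longrightarrow> u \<in> ideal_span M U \<Longrightarrow> f i u \<in> U"
    and fa: "\<And>i u v. i \<in> L \<Longrightarrow> u \<in> ideal_span M V \<Longrightarrow> v \<in> ideal_span M V \<Longrightarrow> f i (u \<oplus>\<^bsub>M\<^esub> v) \<ominus> (f i u \<oplus> f i v) \<in> U"
    and fb: "\<And>i b u. i \<in> L \<Longrightarrow> b \<in> D \<Longrightarrow> u \<in> ideal_span M V \<Longrightarrow> f i (b \<odot>\<^bsub>M\<^esub> u) \<ominus> b \<otimes> f i u \<in> U"
    and fin: "\<And>u. u \<in> ideal_span M V \<Longrightarrow> finite {i \<in> L. f i u \<noteq> \<zero>}"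
    and fx: "\<And>u. u \<in> ideal_span M V \<Longrightarrow> u \<ominus>\<^bsub>M\<^esub> finsum M (\<lambda>i. f i u \<odot>\<^bsub>M\<^esub> x i) {i \<in> L. f i u \<noteq> \<zero>} \<in> ideal_span M U"
    using db unfolding dual_basis_def by auto
  have eC: "e \<in> carrier C" using eD D by auto
  have xV: "x i \<in> ideal_span M V" if "i \<in> L" for i
    using ideal_span.gen[OF eV, of "x i" M] xL[OF that] by simp
  have fC: "f i u \<in> carrier C" if "i \<in> L" "u \<in> ideal_span M V" for i u using fD[OF that] D by auto
  have "\<exists>y. y \<in> ideal_span N V \<and> M.cls (d y) = M.cls (h (x i))" if i: "i \<in> L" for i
  proof -
    obtain y where y: "y \<in> carrier N" "h (x i) \<ominus>\<^bsub>M\<^esub> d y \<in> ideal_span M U" using ex[OF xV[OF i]] by blast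
    have "M.cls (d (e \<odot>\<^bsub>N\<^esub> y)) = M.cls (e \<odot>\<^bsub>M\<^esub> d y)" using y eC by (simp add: module_hom_smult[OF d])
    also have "\<dots> = e \<odot>\<^bsub>M.Q\<^esub> M.cls (d y)" using eC y module_hom_in[OF d] by (simp add: M.cls_smult)
    also have "M.cls (d y) = M.cls (h (x i))"
      using y module_hom_in[OF d] hV[OF xV[OF i]] cM by (metis M.cls_eq)
    also have "e \<odot>\<^bsub>M.Q\<^esub> M.cls (h (x i)) = M.cls (e \<odot>\<^bsub>M\<^esub> h (x i))"
      using eC hV[OF xV[OF i]] cM by (simp add: M.cls_smult)
    also have "\<dots> = M.cls (h (x i))" using hc(2)[OF eD xV[OF i]] xL[OF i] by simp
    finally show ?thesis using ideal_span.gen[OF eV y(1)] by blast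
  qed
  then obtain y where yV: "\<And>i. i \<in> L \<Longrightarrow> y i \<in> ideal_span N V"
    and dy: "\<And>i. i \<in> L \<Longrightarrow> M.cls (d (y i)) = M.cls (h (x i))" by metis
  have yN: "y i \<in> carrier N" if "i \<in> L" for i using yV[OF that] cN by blast
  define s where "s u = {i \<in> L. f i u \<noteq> \<zero>}" for u
  define t where "t u = finsum N (\<lambda>i. f i u \<odot>\<^bsub>N\<^esub> y i) (s u)" for u
  have sL: "s u \<subseteq> L" "\<And>i. i \<in> s u \<Longrightarrow> i \<in> L" for u by (auto simp: s_def)
  have fs: "finite (s u)" if "u \<in> ideal_span M V" for u using fin that by (simp add: s_def)
  have tF: "t u = finsum N (\<lambda>i. f i u \<odot>\<^bsub>N\<^esub> y i) F"
    if "u \<in> ideal_span M V" "finite F" "s u \<subseteq> F" "F \<subseteq> L" for u F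
    unfolding t_def using that yN fC
    by (intro N.M.finsum_support) (auto simp: s_def subset_iff intro!: N.smult_closed)
  have tV: "t u \<in> ideal_span N V" if "u \<in> ideal_span M V" for u
    unfolding t_def using that sL fC yV by (intro N.submodule_finsum[OF N.ideal_span_submodule[OF V]] sN(5)) auto
  have tU: "t u \<in> ideal_span N U" if "u \<in> ideal_span M U" for u
    unfolding t_def using that sL fU yN by (intro N.submodule_finsum[OF N.ideal_span_submodule[OF U]] ideal_span.gen) auto
  have tcl: "N.cls (t u) = finsum N.Q (\<lambda>i. N.cls (f i u \<odot>\<^bsub>N\<^esub> y i)) F"
    if "u \<in> ideal_span M V" "finite F" "s u \<subseteq> F" "F \<subseteq> L" for u F
    using that tF[OF that] yN fC by (simp add: N.cls_finsum N.smult_closed subset_iff)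
  \<comment> \<open>The coordinates \<open>f i\<close> are additive and linear only modulo
    \<open>U\<close>; this passes their congruences on to the terms of the sum
    \<open>t\<close>.\<close>
  have ccl: "N.cls (c \<odot>\<^bsub>N\<^esub> y i) = N.cls (c' \<odot>\<^bsub>N\<^esub> y i)"
    if "c \<in> carrier C" "c' \<in> carrier C" "c \<ominus> c' \<in> U" "i \<in> L" for c c' i
    using N.ideal_span_mult_congr[OF U that(1-3) yN[OF that(4)]] that yN by (subst N.cls_eq) (auto intro: N.smult_closed)
  have ta: "t (u \<oplus>\<^bsub>M\<^esub> v) \<ominus>\<^bsub>N\<^esub> (t u \<oplus>\<^bsub>N\<^esub> t v) \<in> ideal_span N U"
    if u: "u \<in> ideal_span M V" and v: "v \<in> ideal_span M V" for u v
  proof -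
    have uv: "u \<oplus>\<^bsub>M\<^esub> v \<in> ideal_span M V" using sM(4) u v .
    let ?F = "s u \<union> s v \<union> s (u \<oplus>\<^bsub>M\<^esub> v)"
    have F: "finite ?F" "?F \<subseteq> L" using fs u v uv sL by auto
    have "N.cls (t (u \<oplus>\<^bsub>M\<^esub> v)) = finsum N.Q (\<lambda>i. N.cls (f i (u \<oplus>\<^bsub>M\<^esub> v) \<odot>\<^bsub>N\<^esub> y i)) ?F"
      using tcl[OF uv F(1) _ F(2)] by simp
    also have "\<dots> = finsum N.Q (\<lambda>i. N.cls (f i u \<odot>\<^bsub>N\<^esub> y i) \<oplus>\<^bsub>N.Q\<^esub> N.cls (f i v \<odot>\<^bsub>N\<^esub> y i)) ?F"
    proof (rule N.Q.M.finsum_cong', goal_cases)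
      case (3 i)
      then have i: "i \<in> L" using F by auto
      have "N.cls (f i (u \<oplus>\<^bsub>M\<^esub> v) \<odot>\<^bsub>N\<^esub> y i) = N.cls ((f i u \<oplus> f i v) \<odot>\<^bsub>N\<^esub> y i)"
        by (rule ccl) (use fC fa i u v uv in auto)
      then show ?case using fC i u v yN by (simp add: N.smult_l_distr N.cls_add N.smult_closed)
    qed (use F fC u v yN in \<open>auto simp: subset_iff intro!: N.cls_in N.smult_closed\<close>)
    also have "\<dots> = N.cls (t u) \<oplus>\<^bsub>N.Q\<^esub> N.cls (t v)"
      using tcl[OF u F(1) _ F(2)] tcl[OF v F(1) _ F(2)] F fC u v yN
      by (subst N.Q.M.finsum_addf) (auto simp: subset_iff intro!: N.cls_in N.smult_closed)
    also have "\<dots> = N.cls (t u \<oplus>\<^bsub>N\<^esub> t v)" using tV u v cN by (intro N.cls_add) auto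
    finally show ?thesis using tV u v uv cN by (subst (asm) N.cls_eq) auto
  qed
  have tb: "t (b \<odot>\<^bsub>M\<^esub> u) \<ominus>\<^bsub>N\<^esub> b \<odot>\<^bsub>N\<^esub> t u \<in> ideal_span N U"
    if b: "b \<in> D" and u: "u \<in> ideal_span M V" for b u
  proof -
    have bC: "b \<in> carrier C" using b D by auto
    have bu: "b \<odot>\<^bsub>M\<^esub> u \<in> ideal_span M V" using sM(5) u bC by blast
    let ?F = "s u \<union> s (b \<odot>\<^bsub>M\<^esub> u)"
    have F: "finite ?F" "?F \<subseteq> L" using fs u bu sL by auto
    have "N.cls (t (b \<odot>\<^bsub>M\<^esub> u)) = finsum N.Q (\<lambda>i. N.cls (f i (b \<odot>\<^bsub>M\<^esub> u) \<odot>\<^bsub>N\<^esub> y i)) ?F"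
      using tcl[OF bu F(1) _ F(2)] by simp
    also have "\<dots> = finsum N.Q (\<lambda>i. b \<odot>\<^bsub>N.Q\<^esub> N.cls (f i u \<odot>\<^bsub>N\<^esub> y i)) ?F"
    proof (rule N.Q.M.finsum_cong', goal_cases)
      case (3 i)
      then have i: "i \<in> L" using F by auto
      have "N.cls (f i (b \<odot>\<^bsub>M\<^esub> u) \<odot>\<^bsub>N\<^esub> y i) = N.cls ((b \<otimes> f i u) \<odot>\<^bsub>N\<^esub> y i)"
        by (rule ccl) (use fC fb i b bC u bu in auto)
      then show ?case using fC i u bC yN by (simp add: N.smult_assoc1 N.cls_smult N.smult_closed)
    qed (use F fC u bC yN in \<open>auto simp: subset_iff intro!: N.cls_in N.smult_closed N.Q.smult_closed\<close>)
    also have "\<dots> = b \<odot>\<^bsub>N.Q\<^esub> N.cls (t u)"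
    proof -
      have "N.cls (t u) = finsum N.Q (\<lambda>i. N.cls (f i u \<odot>\<^bsub>N\<^esub> y i)) ?F" using tcl[OF u F(1) _ F(2)] by simp
      moreover have "N.cls (f i u \<odot>\<^bsub>N\<^esub> y i) \<in> carrier N.Q" if "i \<in> ?F" for i
        using that F fC u yN by (intro N.cls_in N.smult_closed) auto
      ultimately show ?thesis using N.Q.smult_finsum[OF bC, of ?F] by simp
    qed
    also have "\<dots> = N.cls (b \<odot>\<^bsub>N\<^esub> t u)" using tV u bC cN by (intro N.cls_smult) auto
    finally show ?thesis using tV u bu bC cN by (subst (asm) N.cls_eq) (auto intro: N.smult_closed)
  qed
  have td: "d (t u) \<ominus>\<^bsub>M\<^esub> h u \<in> ideal_span M U" if u: "u \<in> ideal_span M V" for u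
  proof -
    have sL': "i \<in> L" if "i \<in> s u" for i using that sL by blast
    have "M.cls (d (t u)) = M.cls (finsum M (\<lambda>i. f i u \<odot>\<^bsub>M\<^esub> d (y i)) (s u))"
      unfolding t_def using sL' fC u yN
      by (subst NM.hom_finsum[OF d]) (auto simp: N.smult_closed module_hom_smult[OF d] module_hom_in[OF d] M.smult_closed
           intro!: arg_cong[of _ _ M.cls] M.M.finsum_cong')
    also have "\<dots> = finsum M.Q (\<lambda>i. M.cls (f i u \<odot>\<^bsub>M\<^esub> d (y i))) (s u)"
      using sL' fC u yN by (intro M.cls_finsum) (auto intro!: M.smult_closed module_hom_in[OF d])
    also have "\<dots> = finsum M.Q (\<lambda>i. M.cls (h (f i u \<odot>\<^bsub>M\<^esub> x i))) (s u)"
    proof (rule M.Q.M.finsum_cong', goal_cases)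
      case (3 i)
      then have i: "i \<in> L" using sL' by auto
      have "M.cls (f i u \<odot>\<^bsub>M\<^esub> d (y i)) = f i u \<odot>\<^bsub>M.Q\<^esub> M.cls (d (y i))"
        using fC i u yN by (simp add: M.cls_smult module_hom_in[OF d])
      also have "\<dots> = M.cls (f i u \<odot>\<^bsub>M\<^esub> h (x i))" using fC i u xV hV cM by (simp add: dy M.cls_smult)
      also have "\<dots> = M.cls (h (f i u \<odot>\<^bsub>M\<^esub> x i))" using hc(2)[OF fD[OF i u] xV[OF i]] by simp
      finally show ?case .
    qed (use sL' fC u xV hV cM sM(5) in \<open>auto intro!: M.cls_in\<close>)
    also have "\<dots> = M.cls (h (finsum M (\<lambda>i. f i u \<odot>\<^bsub>M\<^esub> x i) (s u)))"
      using fs[OF u] sL' fC u xV sM(5) by (intro hc(4)[symmetric]) auto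
    also have "\<dots> = M.cls (h u)"
      using sL' fC u xV sM(5) fx[OF u]
      by (intro hc(3)[symmetric] M.submodule_finsum[OF M.ideal_span_submodule[OF V]]) (auto simp: s_def)
    finally show ?thesis using tV u hV cN cM module_hom_in[OF d] by (subst (asm) M.cls_eq) auto
  qed
  show ?thesis using tV tU ta tb td unfolding mod_lin_def by blast
qed

end

lemma (in left_module) diff_zeroD:
  assumes "x \<ominus>\<^bsub>M\<^esub> y = \<zero>\<^bsub>M\<^esub>" "x \<in> carrier M" "y \<in> carrier M"
  shows "x = y"
proof -
  have "x = (x \<ominus>\<^bsub>M\<^esub> y) \<oplus>\<^bsub>M\<^esub> y" using assms(2,3) by (simp add: a_minus_def M.a_assoc M.l_neg)
  then show ?thesis using assms by simp
qed

subsection \<open>Exactness modulo an ideal\<close>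

text \<open>Exactness of the quotient complex with terms \<open>X n / U X n\<close>, including
  surjectivity onto degree 0. It is stated with elements of the \<open>X n\<close>, so that two
  ideals can be compared on the same complex.\<close>

definition exact_mod ::
  "'r set \<Rightarrow> (nat \<Rightarrow> ('r, 'm) module) \<Rightarrow> (nat \<Rightarrow> 'm \<Rightarrow> 'm) \<Rightarrow> bool" where
  "exact_mod U X d \<longleftrightarrow>
     (\<forall>x\<in>carrier (X 0). \<exists>y\<in>carrier (X 1). x \<ominus>\<^bsub>X 0\<^esub> d 0 y \<in> ideal_span (X 0) U) \<and>
     (\<forall>n. \<forall>x\<in>carrier (X (Suc n)). d n x \<in> ideal_span (X n) U \<longrightarrow>
        (\<exists>y\<in>carrier (X (Suc (Suc n))). x \<ominus>\<^bsub>X (Suc n)\<^esub> d (Suc n) y \<in> ideal_span (X (Suc n)) U))"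

locale chain_complex = ring C for C (structure) +
  fixes X :: "nat \<Rightarrow> ('a, 'm) module" and d
  assumes X: "\<And>n. left_module C (X n)" and d: "\<And>n. d n \<in> module_hom C (X (Suc n)) (X n)"
    and dd: "\<And>n x. x \<in> carrier (X (Suc (Suc n))) \<Longrightarrow> d n (d (Suc n) x) = \<zero>\<^bsub>X n\<^esub>"

text \<open>The parameter \<open>IT\<close> fixes the type of the index sets \<open>L\<close>, which
  the existential statement \<open>db\<close> would leave undetermined.\<close>

locale resolved_complex = chain_complex C X d + ideal_pair C U V e D
  for C (structure) and X :: "nat \<Rightarrow> ('a, 'm) module" and d U V e D +
  fixes IT :: "'i itself"
  assumes db: "\<And>n. \<exists>(L :: 'i set) x f. dual_basis C U V e D (X n) L x f"
    and ex: "exact_mod U X d"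
begin

text \<open>Degree 0 has no outgoing differential, so all its elements are cycles.\<close>

definition cyc where "cyc n u \<longleftrightarrow> (\<forall>k. n = Suc k \<longrightarrow> d k u = \<zero>\<^bsub>X k\<^esub>)"

text \<open>A contracting homotopy on the spans of \<open>V\<close>, built by recursion:
  \<open>t (Suc n)\<close> is a lift of \<open>u - t n (d n u)\<close> along
  \<open>d (Suc n)\<close>. The map to be lifted involves \<open>t n\<close>, which is not a
  homomorphism; this is why \<open>dual_basis_lift\<close> is stated for maps that are linear only
  in the sense of \<open>mod_lin\<close>.\<close>

lemma homotopy:
  "\<exists>t. (\<forall>n. mod_lin C U V D (X n) (X (Suc n)) (t n)) \<and>
     (\<forall>n. \<forall>u\<in>ideal_span (X n) V. cyc n u \<longrightarrow> d n (t n u) \<ominus>\<^bsub>X n\<^esub> u \<in> ideal_span (X n) U) \<and>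
     (\<forall>n. \<forall>u\<in>ideal_span (X (Suc n)) V.
        d (Suc n) (t (Suc n) u) \<ominus>\<^bsub>X (Suc n)\<^esub> (u \<ominus>\<^bsub>X (Suc n)\<^esub> t n (d n u)) \<in> ideal_span (X (Suc n)) U)"
proof -
  define P where "P n s \<longleftrightarrow> mod_lin C U V D (X n) (X (Suc n)) s \<and>
     (\<forall>u\<in>ideal_span (X n) V. cyc n u \<longrightarrow> d n (s u) \<ominus>\<^bsub>X n\<^esub> u \<in> ideal_span (X n) U)" for n s
  define Q where "Q n s s' \<longleftrightarrow> (\<forall>u\<in>ideal_span (X (Suc n)) V.
        d (Suc n) (s' u) \<ominus>\<^bsub>X (Suc n)\<^esub> (u \<ominus>\<^bsub>X (Suc n)\<^esub> s (d n u)) \<in> ideal_span (X (Suc n)) U)" for n s s'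
  have id: "mod_lin C U V D (X n) (X n) (\<lambda>x. x)" for n
    by (intro mod_lin_hom X) (auto intro: module_homI)
  have c: "x \<in> carrier (X n)" if "x \<in> ideal_span (X n) V" for n x
    using left_module.ideal_span_carrier[OF X idealD(1)[OF V] that] .
  have cU: "x \<in> carrier (X n)" if "x \<in> ideal_span (X n) U" for n x
    using left_module.ideal_span_carrier[OF X idealD(1)[OF U] that] .
  \<comment> \<open>The invariant \<open>P\<close> records that \<open>t n\<close> inverts
    \<open>d n\<close> on cycles modulo \<open>U\<close>. This makes \<open>u - t n (d n u)\<close>
    a cycle modulo \<open>U\<close>, and only then does \<open>exact_mod\<close> supply
    preimages.\<close>
  have "\<exists>f. \<forall>n. P n (f n) \<and> Q n (f n) (f (Suc n))"
  proof (rule dependent_nat_choice)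
    obtain L :: "'i set" and x f where dba: "dual_basis C U V e D (X 0) L x f" using db by blast
    have "\<exists>t. mod_lin C U V D (X 0) (X (Suc 0)) t \<and> (\<forall>u\<in>ideal_span (X 0) V. d 0 (t u) \<ominus>\<^bsub>X 0\<^esub> u \<in> ideal_span (X 0) U)"
      by (rule dual_basis_lift[OF X X d dba id]) (use ex c in \<open>auto simp: exact_mod_def\<close>)
    then show "\<exists>s. P 0 s" unfolding P_def by blast
  next
    fix s n assume P: "P n s"
    interpret Xn: quot_mod C "X n" "ideal_span (X n) U" by (rule quot_mod_ideal_span[OF X U])
    interpret Xs: quot_mod C "X (Suc n)" "ideal_span (X (Suc n)) U" by (rule quot_mod_ideal_span[OF X U])
    interpret Xsn: module_hom_pair C "X (Suc n)" "X n" by unfold_locales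
    have s: "mod_lin C U V D (X n) (X (Suc n)) s" using P by (simp add: P_def)
    let ?h = "\<lambda>u. u \<ominus>\<^bsub>X (Suc n)\<^esub> s (d n u)"
    have h: "mod_lin C U V D (X (Suc n)) (X (Suc n)) ?h"
      by (intro mod_lin_diff[OF X X] id mod_lin_comp[OF X X X mod_lin_hom[OF X X d] s])
    have dV: "d n u \<in> ideal_span (X n) V" if "u \<in> ideal_span (X (Suc n)) V" for u
      using Xsn.ideal_span_hom[OF d idealD(1)[OF V] that] .
    have sV: "s u \<in> ideal_span (X (Suc n)) V" if "u \<in> ideal_span (X n) V" for u
      using s that by (simp add: mod_lin_def)
    have sU: "s u \<in> ideal_span (X (Suc n)) U" if "u \<in> ideal_span (X n) U" for u
      using s that by (simp add: mod_lin_def)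
    have hx: "\<exists>y\<in>carrier (X (Suc (Suc n))). ?h u \<ominus>\<^bsub>X (Suc n)\<^esub> d (Suc n) y \<in> ideal_span (X (Suc n)) U"
      if u: "u \<in> ideal_span (X (Suc n)) V" for u
    proof -
      have "cyc n (d n u)" using dd c[OF u] by (auto simp: cyc_def)
      then have "d n (s (d n u)) \<ominus>\<^bsub>X n\<^esub> d n u \<in> ideal_span (X n) U"
        using P dV[OF u] by (simp add: P_def)
      then have "Xn.cls (d n (s (d n u))) = Xn.cls (d n u)"
        using c dV sV u module_hom_in[OF d] by (subst Xn.cls_eq) auto
      then have "d n u \<ominus>\<^bsub>X n\<^esub> d n (s (d n u)) \<in> ideal_span (X n) U"
        using c dV sV u module_hom_in[OF d] by (subst (asm) eq_commute, subst (asm) Xn.cls_eq) auto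
      then have "d n (?h u) \<in> ideal_span (X n) U"
        using Xsn.hom_diff[OF d] c dV sV u by auto
      moreover have "?h u \<in> carrier (X (Suc n))" using c[OF u] c[OF sV[OF dV[OF u]]] by simp
      ultimately show ?thesis using ex unfolding exact_mod_def by blast
    qed
    obtain L :: "'i set" and x f where dba: "dual_basis C U V e D (X (Suc n)) L x f" using db by blast
    obtain t where t: "mod_lin C U V D (X (Suc n)) (X (Suc (Suc n))) t"
      and td: "\<And>u. u \<in> ideal_span (X (Suc n)) V \<Longrightarrow> d (Suc n) (t u) \<ominus>\<^bsub>X (Suc n)\<^esub> ?h u \<in> ideal_span (X (Suc n)) U"
      using dual_basis_lift[OF X X d dba h hx] by blast
    have "P (Suc n) t" unfolding P_def
    proof (intro conjI t ballI impI)
      fix u assume u: "u \<in> ideal_span (X (Suc n)) V" and cy: "cyc (Suc n) u"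
      have tV: "t u \<in> ideal_span (X (Suc (Suc n))) V" using t u by (simp add: mod_lin_def)
      \<comment> \<open>On a cycle the correction term is \<open>s\<close> at zero, which
        \<open>mod_lin\<close> places in the span of \<open>U\<close>; so the invariant holds
        again.\<close>
      have s0: "s (d n u) \<in> ideal_span (X (Suc n)) U" using cy sU ideal_span.zero by (simp add: cyc_def)
      have "Xs.cls (d (Suc n) (t u)) = Xs.cls (?h u)"
        using td[OF u] c[OF u] c[OF tV] cU[OF s0] module_hom_in[OF d] by (subst Xs.cls_eq) auto
      also have "\<dots> = Xs.cls u" using Xs.cls_eq_zero[THEN iffD2, OF _ s0] c[OF u] cU[OF s0]
          Xs.MQ.hom_diff[OF Xs.cls_hom, of u "s (d n u)"] Xs.cls_in[OF c[OF u]]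
        by (simp add: a_minus_def Xs.Q.minus_one_smult[symmetric])
      finally show "d (Suc n) (t u) \<ominus>\<^bsub>X (Suc n)\<^esub> u \<in> ideal_span (X (Suc n)) U"
        using c[OF u] c[OF tV] module_hom_in[OF d] by (subst (asm) Xs.cls_eq) auto
    qed
    moreover have "Q n s t" using td by (simp add: Q_def)
    ultimately show "\<exists>y. P (Suc n) y \<and> Q n s y" by blast
  qed
  then obtain t where t: "\<And>n. P n (t n)" "\<And>n. Q n (t n) (t (Suc n))" by blast
  show ?thesis by (rule exI[of _ t]) (use t in \<open>auto simp: P_def Q_def\<close>)
qed

text \<open>If \<open>d n x\<close> lies in the span of \<open>V\<close>, then
  \<open>t (d n x)\<close> lies in the span of \<open>V\<close> too and has the same boundary as
  \<open>x\<close> modulo \<open>U\<close>. The difference is a cycle modulo \<open>U\<close>, hence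
  a boundary modulo \<open>U\<close>, so \<open>x\<close> is a boundary modulo
  \<open>V\<close>.\<close>

lemma exact_mod_step: "exact_mod V X d"
  unfolding exact_mod_def
proof (intro conjI ballI allI impI)
  fix x assume "x \<in> carrier (X 0)"
  then obtain y where "y \<in> carrier (X 1)" "x \<ominus>\<^bsub>X 0\<^esub> d 0 y \<in> ideal_span (X 0) U"
    using ex by (auto simp: exact_mod_def)
  then show "\<exists>y\<in>carrier (X 1). x \<ominus>\<^bsub>X 0\<^esub> d 0 y \<in> ideal_span (X 0) V" by (meson spanU_V)
next
  fix n x assume x: "x \<in> carrier (X (Suc n))" and dx: "d n x \<in> ideal_span (X n) V"
  interpret Xn: quot_mod C "X n" "ideal_span (X n) U" by (rule quot_mod_ideal_span[OF X U])
  interpret Xs: left_module C "X (Suc n)" by (rule X)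
  interpret Xss: left_module C "X (Suc (Suc n))" by (rule X)
  interpret Xsn: module_hom_pair C "X (Suc n)" "X n" by unfold_locales
  obtain t where t: "mod_lin C U V D (X n) (X (Suc n)) t"
    and td: "\<And>u. u \<in> ideal_span (X n) V \<Longrightarrow> cyc n u \<Longrightarrow> d n (t u) \<ominus>\<^bsub>X n\<^esub> u \<in> ideal_span (X n) U"
    using homotopy by blast
  have tV: "t (d n x) \<in> ideal_span (X (Suc n)) V" using t dx by (simp add: mod_lin_def)
  have tc: "t (d n x) \<in> carrier (X (Suc n))" using Xs.ideal_span_carrier[OF idealD(1)[OF V] tV] .
  have "d n (t (d n x)) \<ominus>\<^bsub>X n\<^esub> d n x \<in> ideal_span (X n) U"
    using td[OF dx] dd x by (auto simp: cyc_def)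
  then have "Xn.cls (d n (t (d n x))) = Xn.cls (d n x)"
    using tc x module_hom_in[OF d] by (subst Xn.cls_eq) auto
  then have "d n x \<ominus>\<^bsub>X n\<^esub> d n (t (d n x)) \<in> ideal_span (X n) U"
    using tc x module_hom_in[OF d] by (subst (asm) eq_commute, subst (asm) Xn.cls_eq) auto
  then have "d n (x \<ominus>\<^bsub>X (Suc n)\<^esub> t (d n x)) \<in> ideal_span (X n) U" using Xsn.hom_diff[OF d] tc x by simp
  then obtain y where y: "y \<in> carrier (X (Suc (Suc n)))"
    "x \<ominus>\<^bsub>X (Suc n)\<^esub> t (d n x) \<ominus>\<^bsub>X (Suc n)\<^esub> d (Suc n) y \<in> ideal_span (X (Suc n)) U"
    using ex x tc unfolding exact_mod_def by (meson Xs.M.minus_closed)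
  have "x \<ominus>\<^bsub>X (Suc n)\<^esub> d (Suc n) y =
      (x \<ominus>\<^bsub>X (Suc n)\<^esub> t (d n x) \<ominus>\<^bsub>X (Suc n)\<^esub> d (Suc n) y) \<oplus>\<^bsub>X (Suc n)\<^esub> t (d n x)"
    using x tc module_hom_in[OF d y(1)]
    by (simp add: a_minus_def) (metis Xs.M.a_assoc Xs.M.a_comm Xs.M.a_inv_closed Xs.M.add.m_closed Xs.M.l_neg Xs.M.r_zero)
  also have "\<dots> \<in> ideal_span (X (Suc n)) V" using spanU_V[OF y(2)] tV by (rule ideal_span.add)
  finally show "\<exists>y\<in>carrier (X (Suc (Suc n))). x \<ominus>\<^bsub>X (Suc n)\<^esub> d (Suc n) y \<in> ideal_span (X (Suc n)) V"
    using y by blast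
qed

text \<open>With \<open>V\<close> and \<open>D\<close> all of \<open>C\<close> the homotopy is
  defined everywhere and linear modulo \<open>U\<close>. Since \<open>U\<close> annihilates
  \<open>N\<close>, the composite of \<open>f\<close> with \<open>t n\<close> is a homomorphism; it
  solves the equation because \<open>f\<close> kills the boundary
  \<open>d (Suc n) (t (Suc n) x)\<close>.\<close>

lemma hom_exact:
  assumes all: "V = carrier C" "D = carrier C"
    and N: "left_module C N" and NU: "\<And>c y. c \<in> U \<Longrightarrow> y \<in> carrier N \<Longrightarrow> c \<odot>\<^bsub>N\<^esub> y = \<zero>\<^bsub>N\<^esub>"
    and f: "f \<in> module_hom C (X (Suc n)) N" and fd: "\<And>x. x \<in> carrier (X (Suc (Suc n))) \<Longrightarrow> f (d (Suc n) x) = \<zero>\<^bsub>N\<^esub>"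
  shows "\<exists>g\<in>module_hom C (X n) N. \<forall>x\<in>carrier (X (Suc n)). g (d n x) = f x"
proof -
  interpret N: left_module C N by fact
  interpret Xn: left_module C "X n" by (rule X)
  interpret Xs: left_module C "X (Suc n)" by (rule X)
  interpret Xss: left_module C "X (Suc (Suc n))" by (rule X)
  interpret Xsn: module_hom_pair C "X (Suc n)" N by unfold_locales
  obtain t where t: "\<And>n. mod_lin C U V D (X n) (X (Suc n)) (t n)"
    and td: "\<And>u. u \<in> ideal_span (X (Suc n)) V \<Longrightarrow>
        d (Suc n) (t (Suc n) u) \<ominus>\<^bsub>X (Suc n)\<^esub> (u \<ominus>\<^bsub>X (Suc n)\<^esub> t n (d n u)) \<in> ideal_span (X (Suc n)) U"
    using homotopy by blast
  have V_all: "ideal_span (X k) V = carrier (X k)" for k using all left_module.ideal_span_all[OF X] by simp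
  have f0: "f u = f v" if "u \<in> carrier (X (Suc n))" "v \<in> carrier (X (Suc n))" "u \<ominus>\<^bsub>X (Suc n)\<^esub> v \<in> ideal_span (X (Suc n)) U" for u v
  proof -
    have "f (u \<ominus>\<^bsub>X (Suc n)\<^esub> v) \<in> ideal_span N U" using Xsn.ideal_span_hom[OF f idealD(1)[OF U] that(3)] .
    then have "f u \<ominus>\<^bsub>N\<^esub> f v = \<zero>\<^bsub>N\<^esub>" using N.ideal_span_annihilated[OF NU] that Xsn.hom_diff[OF f] by auto
    then show ?thesis using N.diff_zeroD that module_hom_in[OF f] by metis
  qed
  have tc: "t k u \<in> carrier (X (Suc k))" if "u \<in> carrier (X k)" for k u
    using t that V_all by (auto simp: mod_lin_def)
  have ta: "f (t n (u \<oplus>\<^bsub>X n\<^esub> v)) = f (t n u) \<oplus>\<^bsub>N\<^esub> f (t n v)" if "u \<in> carrier (X n)" "v \<in> carrier (X n)" for u v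
  proof -
    have "f (t n (u \<oplus>\<^bsub>X n\<^esub> v)) = f (t n u \<oplus>\<^bsub>X (Suc n)\<^esub> t n v)"
      by (rule f0) (use t[of n] that tc V_all in \<open>auto simp: mod_lin_def\<close>)
    then show ?thesis using that tc module_hom_add[OF f] by simp
  qed
  have tb: "f (t n (b \<odot>\<^bsub>X n\<^esub> u)) = b \<odot>\<^bsub>N\<^esub> f (t n u)" if "b \<in> carrier C" "u \<in> carrier (X n)" for b u
  proof -
    have "f (t n (b \<odot>\<^bsub>X n\<^esub> u)) = f (b \<odot>\<^bsub>X (Suc n)\<^esub> t n u)"
      by (rule f0) (use t[of n] that tc V_all all in \<open>auto simp: mod_lin_def Xn.smult_closed Xs.smult_closed\<close>)
    then show ?thesis using that tc module_hom_smult[OF f] by simp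
  qed
  have "(\<lambda>x. f (t n x)) \<in> module_hom C (X n) N"
    by (rule module_homI) (use ta tb tc module_hom_in[OF f] in auto)
  moreover have "f (t n (d n x)) = f x" if x: "x \<in> carrier (X (Suc n))" for x
  proof -
    have dx: "d n x \<in> carrier (X n)" using x module_hom_in[OF d] by blast
    have "f (d (Suc n) (t (Suc n) x)) = f (x \<ominus>\<^bsub>X (Suc n)\<^esub> t n (d n x))"
      by (rule f0) (use td[of x] x dx tc V_all module_hom_in[OF d] in auto)
    then have "f x \<ominus>\<^bsub>N\<^esub> f (t n (d n x)) = \<zero>\<^bsub>N\<^esub>"
      using fd tc x dx Xsn.hom_diff[OF f] by simp
    from N.diff_zeroD[OF this module_hom_in[OF f x] module_hom_in[OF f tc[OF dx]]] show ?thesis ..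
  qed
  ultimately show ?thesis by (intro bexI[of _ "\<lambda>x. f (t n x)"] ballI)
qed

end

subsection \<open>Construction of dual bases\<close>

text \<open>The dual basis of the regular module; here additivity and \<open>D\<close>-linearity hold exactly.\<close>

definition heredity_step ::
  "('r, 'c) ring_scheme \<Rightarrow> 'r set \<Rightarrow> 'r set \<Rightarrow> 'r \<Rightarrow> 'r set \<Rightarrow> 'i set \<Rightarrow> ('i \<Rightarrow> 'r) \<Rightarrow> ('i \<Rightarrow> 'r \<Rightarrow> 'r) \<Rightarrow> bool" where
  "heredity_step C U V e D L q f \<longleftrightarrow>
     ideal_pair C U V e D \<and>
     (\<forall>i\<in>L. q i \<in> carrier C \<and> e \<otimes>\<^bsub>C\<^esub> q i = q i) \<and>
     (\<forall>i\<in>L. \<forall>u\<in>V. f i u \<in> D) \<and> (\<forall>i\<in>L. \<forall>u\<in>U. f i u \<in> U) \<and>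
     (\<forall>i\<in>L. \<forall>u\<in>V. \<forall>v\<in>V. f i (u \<oplus>\<^bsub>C\<^esub> v) = f i u \<oplus>\<^bsub>C\<^esub> f i v) \<and>
     (\<forall>i\<in>L. \<forall>b\<in>D. \<forall>u\<in>V. f i (b \<otimes>\<^bsub>C\<^esub> u) = b \<otimes>\<^bsub>C\<^esub> f i u) \<and>
     (\<forall>u\<in>V. finite {i \<in> L. f i u \<noteq> \<zero>\<^bsub>C\<^esub>} \<and>
        u \<ominus>\<^bsub>C\<^esub> finsum C (\<lambda>i. f i u \<otimes>\<^bsub>C\<^esub> q i) {i \<in> L. f i u \<noteq> \<zero>\<^bsub>C\<^esub>} \<in> U)"

lemma restrict_scalars_simps [simp]:
  "carrier (restrict_scalars h M) = carrier M" "zero (restrict_scalars h M) = zero M"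
  "add (restrict_scalars h M) = add M" "smult (restrict_scalars h M) = (\<lambda>r x. h r \<odot>\<^bsub>M\<^esub> x)"
  unfolding restrict_scalars_def by auto

lemma a_inv_restrict_scalars [simp]: "a_inv (restrict_scalars h M) = a_inv M"
  unfolding a_inv_def m_inv_def by (auto simp: fun_eq_iff)

lemma a_minus_restrict_scalars [simp]: "x \<ominus>\<^bsub>restrict_scalars h M\<^esub> y = x \<ominus>\<^bsub>M\<^esub> y"
  unfolding a_minus_def by simp

lemma restrict_scalars_left_module:
  assumes "ring_hom_ring C R h" "left_module R M"
  shows "left_module C (restrict_scalars h M)"
proof -
  interpret h: ring_hom_ring C R h by fact
  interpret M: left_module R M by fact
  have "abelian_group (restrict_scalars h M)"
  proof (rule abelian_groupI, goal_cases)
    case (6 x)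
    then show ?case by (intro bexI[of _ "\<ominus>\<^bsub>M\<^esub> x"]) (auto simp: M.M.l_neg)
  qed (auto simp: M.M.a_ac)
  then show ?thesis
    by (intro left_module.intro left_module_axioms.intro h.R.ring_axioms)
       (auto simp: M.smult_closed M.smult_l_distr M.smult_r_distr M.smult_assoc1 M.smult_one)
qed

lemma (in abelian_monoid) finsum_Sigma:
  assumes "finite A" "\<And>a. a \<in> A \<Longrightarrow> finite (B a)" "\<And>a b. a \<in> A \<Longrightarrow> b \<in> B a \<Longrightarrow> g (a, b) \<in> carrier G"
  shows "finsum G g (Sigma A B) = finsum G (\<lambda>a. finsum G (\<lambda>b. g (a, b)) (B a)) A"
  using assms
proof (induction A)
  case (insert a A)
  have 1: "finsum G g ((\<lambda>b. (a, b)) ` B a) = finsum G (\<lambda>b. g (a, b)) (B a)"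
    using insert by (intro finsum_reindex) (auto simp: inj_on_def)
  have "Sigma (insert a A) B = (\<lambda>b. (a, b)) ` B a \<union> Sigma A B" by auto
  then have "finsum G g (Sigma (insert a A) B) = finsum G g ((\<lambda>b. (a, b)) ` B a) \<oplus> finsum G g (Sigma A B)"
    using insert by (simp only:, intro finsum_Un_disjoint) auto
  also have "\<dots> = finsum G (\<lambda>a. finsum G (\<lambda>b. g (a, b)) (B a)) (insert a A)"
    using insert by (subst finsum_insert) (auto simp: 1 intro!: finsum_closed)
  finally show ?case .
qed auto

text \<open>\<open>P\<close> is a summand of a free \<open>R\<close>-module: \<open>s\<close> gives
  the coordinates of \<open>u\<close> in \<open>R\<close>, and these are lifted to \<open>C\<close>
  and resolved by the \<open>f i\<close>. So the dual basis is indexed by pairs of a generator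
  \<open>g\<close> and an index \<open>i\<close>, with elements \<open>q i\<close> times the image
  of \<open>g\<close>. Lifting to \<open>C\<close> is not additive, but its defect lies in the
  kernel of \<open>h\<close> and hence in \<open>U\<close>.\<close>

lemma dual_basis_projective:
  fixes L :: "'i set" and P :: "('r, 'p) module"
  assumes hs: "heredity_step C U V e D L q f" and h: "ring_hom_ring C R h"
    and surj: "h ` carrier C = carrier R" and ker: "\<And>c. c \<in> carrier C \<Longrightarrow> h c = \<zero>\<^bsub>R\<^esub> \<Longrightarrow> c \<in> U"
    and P: "projective_module R P"
  shows "\<exists>(L' :: ('p \<times> 'i) set) x f'. dual_basis C U V e D (restrict_scalars h P) L' x f'"
proof -
  interpret h: ring_hom_ring C R h by fact
  interpret P: left_module R P using P by (simp add: projective_module_def)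
  let ?M = "restrict_scalars h P"
  let ?F = "free_module R (carrier P)"
  interpret ideal_pair C U V e D using hs by (simp add: heredity_step_def)
  interpret F: left_module R ?F by (rule h.S.free_left_module)
  interpret M: quot_mod C ?M "ideal_span ?M U"
    by (intro quot_mod_ideal_span restrict_scalars_left_module[OF h] P.left_module_axioms U)
  interpret FP: module_hom_pair R ?F P by unfold_locales
  interpret PF: module_hom_pair R P ?F by unfold_locales
  obtain s p where s: "s \<in> module_hom R P ?F" and p: "p \<in> module_hom R ?F P" and ps: "\<And>x. x \<in> carrier P \<Longrightarrow> p (s x) = x"
    using P by (auto simp: projective_module_def)
  have qC: "\<And>i. i \<in> L \<Longrightarrow> q i \<in> carrier C" and eq: "\<And>i. i \<in> L \<Longrightarrow> e \<otimes>\<^bsub>C\<^esub> q i = q i"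
    and fD: "\<And>i u. i \<in> L \<Longrightarrow> u \<in> V \<Longrightarrow> f i u \<in> D" and fU: "\<And>i u. i \<in> L \<Longrightarrow> u \<in> U \<Longrightarrow> f i u \<in> U"
    and fa: "\<And>i u v. i \<in> L \<Longrightarrow> u \<in> V \<Longrightarrow> v \<in> V \<Longrightarrow> f i (u \<oplus>\<^bsub>C\<^esub> v) = f i u \<oplus>\<^bsub>C\<^esub> f i v"
    and fb: "\<And>i b u. i \<in> L \<Longrightarrow> b \<in> D \<Longrightarrow> u \<in> V \<Longrightarrow> f i (b \<otimes>\<^bsub>C\<^esub> u) = b \<otimes>\<^bsub>C\<^esub> f i u"
    and ff: "\<And>u. u \<in> V \<Longrightarrow> finite {i \<in> L. f i u \<noteq> \<zero>\<^bsub>C\<^esub>}"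
    and fs: "\<And>u. u \<in> V \<Longrightarrow> u \<ominus>\<^bsub>C\<^esub> finsum C (\<lambda>i. f i u \<otimes>\<^bsub>C\<^esub> q i) {i \<in> L. f i u \<noteq> \<zero>\<^bsub>C\<^esub>} \<in> U"
    using hs by (auto simp: heredity_step_def)
  have VC: "v \<in> carrier C" if "v \<in> V" for v using that idealD[OF V] by blast
  have fC: "f i u \<in> carrier C" if "i \<in> L" "u \<in> V" for i u using fD[OF that] D by blast
  have eC: "e \<in> carrier C" using eD D by blast
  \<comment> \<open>Zero is lifted to zero, so that only the finitely many generators in the support
    of \<open>s u\<close> contribute to the sum.\<close>
  define lift where "lift r = (if r = \<zero>\<^bsub>R\<^esub> then \<zero>\<^bsub>C\<^esub> else SOME c. c \<in> carrier C \<and> h c = r)" for r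
  have lift: "lift r \<in> carrier C \<and> h (lift r) = r" if r: "r \<in> carrier R" for r
  proof (cases "r = \<zero>\<^bsub>R\<^esub>")
    case False
    obtain c where "c \<in> carrier C \<and> h c = r" using r surj by (metis imageE)
    then show ?thesis unfolding lift_def using False by simp (rule someI)
  qed (simp add: lift_def)
  have congU: "c \<ominus>\<^bsub>C\<^esub> c' \<in> U" if "c \<in> carrier C" "c' \<in> carrier C" "h c = h c'" for c c'
    using that by (intro ker) (simp_all add: a_minus_def h.S.r_neg)
  define co where "co g u = lift (s u g)" for g u
  have sR: "s u g \<in> carrier R" if "u \<in> carrier P" for u g
    using module_hom_in[OF s that] by (simp add: free_module_simps)
  have co: "co g u \<in> carrier C" "h (co g u) = s u g" if "u \<in> carrier P" for u g
    using lift sR[OF that] by (auto simp: co_def)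
  \<comment> \<open>Coordinates of an element of \<open>I P\<close> lie in the image of
    \<open>I\<close>; as \<open>I\<close> contains \<open>U\<close> and with it the kernel of
    \<open>h\<close>, every lift of them lies in \<open>I\<close>. This is applied to both ideals
    \<open>V\<close> and \<open>U\<close>.\<close>
  have co_in: "co g u \<in> I" if I: "ideal I C" "U \<subseteq> I" and u: "u \<in> ideal_span ?M I" for I g u
  proof -
    have "u \<in> carrier P \<and> s u g \<in> h ` I" using u
    proof induction
      case zero
      then show ?case using idealD(3)[OF I(1)] by (auto simp: PF.hom_zero[OF s] free_module_simps image_iff intro!: bexI[of _ "\<zero>\<^bsub>C\<^esub>"])
    next
      case (add x y)
      then obtain a b where "a \<in> I" "b \<in> I" "s x g = h a" "s y g = h b" by auto
      moreover have "s (x \<oplus>\<^bsub>P\<^esub> y) g = s x g \<oplus>\<^bsub>R\<^esub> s y g" using add by (simp add: module_hom_add[OF s] free_module_simps)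
      ultimately show ?case using add idealD[OF I(1)] by (auto intro!: image_eqI[of _ _ "a \<oplus>\<^bsub>C\<^esub> b"])
    next
      case (gen c x)
      have c: "c \<in> carrier C" using gen idealD[OF I(1)] by blast
      have "s (h c \<odot>\<^bsub>P\<^esub> x) g = h c \<otimes>\<^bsub>R\<^esub> s x g" using gen c by (simp add: module_hom_smult[OF s] free_module_simps)
      also have "\<dots> = h (c \<otimes>\<^bsub>C\<^esub> co g x)" using gen c co[of x g] by simp
      finally have "s (h c \<odot>\<^bsub>P\<^esub> x) g \<in> h ` I" using gen idealD(7)[OF I(1)] co[of x g] by simp
      then show ?case using gen c by (simp add: P.smult_closed)
    qed
    then obtain v where v: "v \<in> I" "s u g = h v" and uP: "u \<in> carrier P" by auto
    have vC: "v \<in> carrier C" using v idealD[OF I(1)] by blast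
    have "co g u \<ominus>\<^bsub>C\<^esub> v \<in> I" using congU[of "co g u" v] co[OF uP] v vC I(2) by auto
    then have "(co g u \<ominus>\<^bsub>C\<^esub> v) \<oplus>\<^bsub>C\<^esub> v \<in> I" using v idealD(4)[OF I(1)] by blast
    then show ?thesis using co[OF uP] vC by (simp add: a_minus_def h.R.a_assoc h.R.l_neg)
  qed
  have coV: "co g u \<in> V" if "u \<in> ideal_span ?M V" for g u using co_in[OF V UV that] .
  have coU: "co g u \<in> U" if "u \<in> ideal_span ?M U" for g u using co_in[OF U _ that] by simp
  have f0: "f i \<zero>\<^bsub>C\<^esub> = \<zero>\<^bsub>C\<^esub>" if i: "i \<in> L" for i
    using fa[OF i idealD(3)[OF V] idealD(3)[OF V]] fC[OF i idealD(3)[OF V]] by simp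
  \<comment> \<open>Modulo \<open>U\<close> the value of \<open>f i\<close> does not depend on the
    chosen lift: two lifts differ by an element of \<open>U\<close>, which \<open>f i\<close> maps
    into \<open>U\<close>.\<close>
  have fcong: "f i a \<ominus>\<^bsub>C\<^esub> f i b \<in> U" if i: "i \<in> L" and ab: "a \<in> V" "b \<in> V" "h a = h b" for i a b
  proof -
    have ab': "a \<in> carrier C" "b \<in> carrier C" using ab VC by auto
    have dU: "a \<ominus>\<^bsub>C\<^esub> b \<in> U" using congU ab ab' by blast
    have "a = (a \<ominus>\<^bsub>C\<^esub> b) \<oplus>\<^bsub>C\<^esub> b" using ab' by (simp add: a_minus_def h.R.a_assoc h.R.l_neg)
    then have "f i a = f i (a \<ominus>\<^bsub>C\<^esub> b) \<oplus>\<^bsub>C\<^esub> f i b" using fa[OF i _ ab(2), of "a \<ominus>\<^bsub>C\<^esub> b"] dU UV by auto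
    then have "f i a \<ominus>\<^bsub>C\<^esub> f i b = f i (a \<ominus>\<^bsub>C\<^esub> b)"
      using fC[OF i] ab dU UV by (simp add: a_minus_def h.R.a_assoc h.R.r_neg subset_iff)
    then show ?thesis using fU[OF i dU] by simp
  qed
  define L' where "L' = carrier P \<times> L"
  define x where "x = (\<lambda>(g, i). h (q i) \<odot>\<^bsub>P\<^esub> p (free_gen R g))"
  define f' where "f' = (\<lambda>(g, i) u. f i (co g u))"
  have pg: "p (free_gen R g) \<in> carrier P" if "g \<in> carrier P" for g
    using module_hom_in[OF p] h.S.free_gen_in[OF that] by blast
  have MV: "u \<in> carrier P" if "u \<in> ideal_span ?M V" for u
    using M.ideal_span_carrier[OF idealD(1)[OF V] that] by simp
  have sMV: "b \<odot>\<^bsub>?M\<^esub> u \<in> ideal_span ?M V" if "b \<in> carrier C" "u \<in> ideal_span ?M V" for b u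
    using left_submoduleD(5)[OF M.ideal_span_submodule[OF V]] that by blast
  have "dual_basis C U V e D ?M L' x f'"
    unfolding dual_basis_def
  proof (intro conjI ballI, goal_cases)
    case (1 i) then show ?case using pg qC by (auto simp: x_def L'_def P.smult_closed)
  next
    case (2 i)
    then obtain g j where i: "i = (g, j)" "g \<in> carrier P" "j \<in> L" by (auto simp: L'_def)
    have "h e \<odot>\<^bsub>P\<^esub> (h (q j) \<odot>\<^bsub>P\<^esub> p (free_gen R g)) = h (e \<otimes>\<^bsub>C\<^esub> q j) \<odot>\<^bsub>P\<^esub> p (free_gen R g)"
      using i pg qC eC by (simp add: P.smult_assoc1)
    then show ?case using i eq by (simp add: x_def)
  next
    case (3 i u) then show ?case using fD coV by (auto simp: L'_def f'_def)
  next
    case (4 i u) then show ?case using fU coU by (auto simp: L'_def f'_def)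
  next
    case (5 i u v)
    then obtain g j where i: "i = (g, j)" "g \<in> carrier P" "j \<in> L" by (auto simp: L'_def)
    have c: "co g u \<in> V" "co g v \<in> V" using 5 coV by auto
    have "f j (co g (u \<oplus>\<^bsub>P\<^esub> v)) \<ominus>\<^bsub>C\<^esub> f j (co g u \<oplus>\<^bsub>C\<^esub> co g v) \<in> U"
    proof (rule fcong[OF i(3)])
      show "co g (u \<oplus>\<^bsub>P\<^esub> v) \<in> V" using 5 coV[of "u \<oplus>\<^bsub>P\<^esub> v"] ideal_span.add[of u ?M V v] by simp
      show "h (co g (u \<oplus>\<^bsub>P\<^esub> v)) = h (co g u \<oplus>\<^bsub>C\<^esub> co g v)"
        using 5 MV co by (simp add: module_hom_add[OF s] free_module_simps)
    qed (use c idealD(4)[OF V] in blast)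
    then show ?case using fa[OF i(3) c] i by (simp add: f'_def)
  next
    case (6 i b u)
    then obtain g j where i: "i = (g, j)" "g \<in> carrier P" "j \<in> L" by (auto simp: L'_def)
    have bC: "b \<in> carrier C" using 6 D by blast
    have c: "co g u \<in> V" using 6 coV by auto
    have "f j (co g (h b \<odot>\<^bsub>P\<^esub> u)) \<ominus>\<^bsub>C\<^esub> f j (b \<otimes>\<^bsub>C\<^esub> co g u) \<in> U"
    proof (rule fcong[OF i(3)])
      show "co g (h b \<odot>\<^bsub>P\<^esub> u) \<in> V" using coV[OF sMV[OF bC 6(3)]] by simp
      show "h (co g (h b \<odot>\<^bsub>P\<^esub> u)) = h (b \<otimes>\<^bsub>C\<^esub> co g u)"
        using 6 MV co bC by (simp add: module_hom_smult[OF s] free_module_simps P.smult_closed)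
    qed (use c bC idealD(6)[OF V] in blast)
    then show ?case using fb[OF i(3) 6(2) c] i by (simp add: f'_def)
  next
    case (7 u)
    define G where "G = {g. s u g \<noteq> \<zero>\<^bsub>R\<^esub>}"
    have G: "finite G" "G \<subseteq> carrier P"
      using module_hom_in[OF s MV[OF 7]] by (auto simp: G_def free_module_simps)
    have sub: "{i \<in> L'. f' i u \<noteq> \<zero>\<^bsub>C\<^esub>} = Sigma G (\<lambda>g. {i \<in> L. f i (co g u) \<noteq> \<zero>\<^bsub>C\<^esub>})"
      using G f0 by (auto simp: L'_def f'_def G_def co_def lift_def)
    then show ?case using G ff coV 7 by auto
  next
    case (8 u)
    define G where "G = {g. s u g \<noteq> \<zero>\<^bsub>R\<^esub>}"
    have uP: "u \<in> carrier P" using MV 8 .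
    have G: "finite G" "G \<subseteq> carrier P" "\<And>g. g \<in> G \<Longrightarrow> g \<in> carrier P"
      using module_hom_in[OF s uP] by (auto simp: G_def free_module_simps)
    define S where "S g = {i \<in> L. f i (co g u) \<noteq> \<zero>\<^bsub>C\<^esub>}" for g
    have S: "finite (S g)" "\<And>i. i \<in> S g \<Longrightarrow> i \<in> L" for g using ff coV 8 by (auto simp: S_def)
    have sub: "{i \<in> L'. f' i u \<noteq> \<zero>\<^bsub>C\<^esub>} = Sigma G S"
      using G f0 by (auto simp: L'_def f'_def G_def co_def lift_def S_def)
    have fc: "f i (co g u) \<in> carrier C" if "i \<in> S g" for i g using fC[OF S(2)[OF that] coV[OF 8]] .
    have cl: "h (f i (co g u)) \<odot>\<^bsub>P\<^esub> (h (q i) \<odot>\<^bsub>P\<^esub> p (free_gen R g)) = h (f i (co g u) \<otimes>\<^bsub>C\<^esub> q i) \<odot>\<^bsub>P\<^esub> p (free_gen R g)"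
      if "g \<in> G" "i \<in> S g" for g i
      using fc[OF that(2)] qC S(2)[OF that(2)] pg G that by (simp add: P.smult_assoc1)
    have "finsum ?M (\<lambda>i. f' i u \<odot>\<^bsub>?M\<^esub> x i) {i \<in> L'. f' i u \<noteq> \<zero>\<^bsub>C\<^esub>}
      = finsum ?M (\<lambda>g. finsum ?M (\<lambda>i. f i (co g u) \<odot>\<^bsub>?M\<^esub> (h (q i) \<odot>\<^bsub>P\<^esub> p (free_gen R g))) (S g)) G"
      unfolding sub using G S fc qC pg
      by (subst M.M.finsum_Sigma) (auto simp: f'_def x_def intro!: P.smult_closed)
    also have "\<dots> = finsum ?M (\<lambda>g. finsum C (\<lambda>i. f i (co g u) \<otimes>\<^bsub>C\<^esub> q i) (S g) \<odot>\<^bsub>?M\<^esub> p (free_gen R g)) G"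
    proof (rule M.M.finsum_cong', goal_cases)
      case (3 g)
      have "finsum C (\<lambda>i. f i (co g u) \<otimes>\<^bsub>C\<^esub> q i) (S g) \<odot>\<^bsub>?M\<^esub> p (free_gen R g)
        = finsum ?M (\<lambda>i. (f i (co g u) \<otimes>\<^bsub>C\<^esub> q i) \<odot>\<^bsub>?M\<^esub> p (free_gen R g)) (S g)"
        using fc qC S pg G 3 by (intro M.finsum_smult_left) auto
      also have "\<dots> = finsum ?M (\<lambda>i. f i (co g u) \<odot>\<^bsub>?M\<^esub> (h (q i) \<odot>\<^bsub>P\<^esub> p (free_gen R g))) (S g)"
        using fc qC S pg G 3 cl by (intro M.M.finsum_cong') (auto simp: P.smult_closed)
      finally show ?case by simp
    qed (use fc qC S pg G in \<open>auto intro!: P.smult_closed h.R.finsum_closed\<close>)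
    finally have "M.cls (finsum ?M (\<lambda>i. f' i u \<odot>\<^bsub>?M\<^esub> x i) {i \<in> L'. f' i u \<noteq> \<zero>\<^bsub>C\<^esub>})
      = finsum M.Q (\<lambda>g. M.cls (finsum C (\<lambda>i. f i (co g u) \<otimes>\<^bsub>C\<^esub> q i) (S g) \<odot>\<^bsub>?M\<^esub> p (free_gen R g))) G"
      using fc qC S pg G by (auto intro!: M.cls_finsum P.smult_closed h.hom_closed h.R.finsum_closed)
    also have "\<dots> = finsum M.Q (\<lambda>g. M.cls (co g u \<odot>\<^bsub>?M\<^esub> p (free_gen R g))) G"
    proof (rule M.Q.M.finsum_cong', goal_cases)
      case (3 g)
      let ?c = "finsum C (\<lambda>i. f i (co g u) \<otimes>\<^bsub>C\<^esub> q i) (S g)"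
      have c: "?c \<in> carrier C" using fc qC S by (intro h.R.finsum_closed) auto
      have "co g u \<ominus>\<^bsub>C\<^esub> ?c \<in> U" using fs[OF coV[OF 8]] by (simp add: S_def)
      then have "co g u \<odot>\<^bsub>?M\<^esub> p (free_gen R g) \<ominus>\<^bsub>?M\<^esub> ?c \<odot>\<^bsub>?M\<^esub> p (free_gen R g) \<in> ideal_span ?M U"
        using co[OF uP] c pg G 3 by (intro M.ideal_span_mult_congr[OF U]) auto
      then have "M.cls (co g u \<odot>\<^bsub>?M\<^esub> p (free_gen R g)) = M.cls (?c \<odot>\<^bsub>?M\<^esub> p (free_gen R g))"
        using co[OF uP] c pg G 3 by (subst M.cls_eq) (auto simp: P.smult_closed sR[OF uP])
      then show ?case ..
    qed (use co[OF uP] sR[OF uP] pg G in \<open>auto intro!: M.cls_in simp: P.smult_closed\<close>)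
    also have "\<dots> = M.cls (finsum ?M (\<lambda>g. s u g \<odot>\<^bsub>P\<^esub> p (free_gen R g)) G)"
      using co[OF uP] pg G sR[OF uP] by (subst M.cls_finsum) (auto simp: P.smult_closed)
    also have "finsum ?M (\<lambda>g. s u g \<odot>\<^bsub>P\<^esub> p (free_gen R g)) G = finsum P (\<lambda>g. s u g \<odot>\<^bsub>P\<^esub> p (free_gen R g)) G"
      by (simp add: finsum_def finprod_def restrict_scalars_def)
    also have "\<dots> = finsum P (\<lambda>g. p (s u g \<odot>\<^bsub>?F\<^esub> free_gen R g)) G"
    proof (rule P.M.finsum_cong', goal_cases)
      case 2
      show ?case
        by (intro Pi_I module_hom_in[OF p] F.smult_closed sR[OF uP] h.S.free_gen_in G(3))
    next
      case (3 g)
      then show ?case using module_hom_smult[OF p sR[OF uP] h.S.free_gen_in[OF G(3)]] by simp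
    qed auto
    also have "\<dots> = p (finsum ?F (\<lambda>g. s u g \<odot>\<^bsub>?F\<^esub> free_gen R g) G)"
      by (intro FP.hom_finsum[OF p, symmetric] F.smult_closed sR[OF uP] h.S.free_gen_in G(3))
    also have "\<dots> = p (s u)"
      using h.S.free_expand[OF module_hom_in[OF s uP] G(1) _ G(2)] by (simp add: G_def)
    also have "\<dots> = u" using ps uP by simp
    finally have "M.cls u = M.cls (finsum ?M (\<lambda>i. f' i u \<odot>\<^bsub>?M\<^esub> x i) {i \<in> L'. f' i u \<noteq> \<zero>\<^bsub>C\<^esub>})" ..
    moreover have "finsum ?M (\<lambda>i. f' i u \<odot>\<^bsub>?M\<^esub> x i) {i \<in> L'. f' i u \<noteq> \<zero>\<^bsub>C\<^esub>} \<in> carrier ?M"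
      unfolding sub using fc qC pg G S by (intro M.M.finsum_closed) (auto simp: f'_def x_def intro!: P.smult_closed)
    ultimately show ?case using uP by (subst (asm) M.cls_eq) auto
  qed
  then show ?thesis by blast
qed

text \<open>When \<open>V\<close> annihilates \<open>M\<close>, the empty family is a dual basis.
  This serves the modules over the last quotient, which every ideal of the chain annihilates, and
  the zero module in degree 0 of the cone.\<close>

lemma dual_basis_null:
  assumes "left_module C M" "ideal_span M V = {\<zero>\<^bsub>M\<^esub>}"
  shows "dual_basis C U V e D M {} x f"
proof -
  interpret left_module C M by fact
  show ?thesis unfolding dual_basis_def using assms by (auto simp: a_minus_def M.r_neg ideal_span.zero)
qed

text \<open>The fields \<open>mult\<close> and \<open>one\<close> are fillers; only the module
  structure has a meaning.\<close>

definition dsum :: "('r, 'm, 'd) module_scheme \<Rightarrow> ('r, 'n, 'e) module_scheme \<Rightarrow> ('r, 'm \<times> 'n) module" where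
  "dsum M N = \<lparr>carrier = carrier M \<times> carrier N, mult = (\<lambda>x y. x), one = (\<zero>\<^bsub>M\<^esub>, \<zero>\<^bsub>N\<^esub>), zero = (\<zero>\<^bsub>M\<^esub>, \<zero>\<^bsub>N\<^esub>),
     add = (\<lambda>x y. (fst x \<oplus>\<^bsub>M\<^esub> fst y, snd x \<oplus>\<^bsub>N\<^esub> snd y)), smult = (\<lambda>r x. (r \<odot>\<^bsub>M\<^esub> fst x, r \<odot>\<^bsub>N\<^esub> snd x))\<rparr>"

lemma dsum_simps [simp]:
  "carrier (dsum M N) = carrier M \<times> carrier N" "zero (dsum M N) = (\<zero>\<^bsub>M\<^esub>, \<zero>\<^bsub>N\<^esub>)"
  "add (dsum M N) = (\<lambda>x y. (fst x \<oplus>\<^bsub>M\<^esub> fst y, snd x \<oplus>\<^bsub>N\<^esub> snd y))"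
  "smult (dsum M N) = (\<lambda>r x. (r \<odot>\<^bsub>M\<^esub> fst x, r \<odot>\<^bsub>N\<^esub> snd x))"
  unfolding dsum_def by simp_all

context module_hom_pair begin

lemma dsum_left_module: "left_module R (dsum M N)"
proof -
  have "abelian_group (dsum M N)"
  proof (rule abelian_groupI, goal_cases)
    case (6 x)
    then show ?case
      by (intro bexI[of _ "(\<ominus>\<^bsub>M\<^esub> fst x, \<ominus>\<^bsub>N\<^esub> snd x)"]) (auto simp: M.M.l_neg N.M.l_neg)
  qed (auto simp: M.M.a_ac N.M.a_ac)
  then show ?thesis
    by (intro left_module.intro left_module_axioms.intro M.R.ring_axioms)
       (auto simp: M.smult_closed M.smult_l_distr M.smult_r_distr M.smult_assoc1 M.smult_one
          N.smult_closed N.smult_l_distr N.smult_r_distr N.smult_assoc1 N.smult_one)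
qed

lemma dsum_homs:
  "fst \<in> module_hom R (dsum M N) M" "snd \<in> module_hom R (dsum M N) N"
  "(\<lambda>x. (x, \<zero>\<^bsub>N\<^esub>)) \<in> module_hom R M (dsum M N)" "(\<lambda>y. (\<zero>\<^bsub>M\<^esub>, y)) \<in> module_hom R N (dsum M N)"
  by (auto intro!: module_homI)

end

lemma dual_basis_dsum:
  assumes ip: "ideal_pair C U V e D" and M: "left_module C M" and N: "left_module C N"
    and a: "dual_basis C U V e D M L x f" and b: "dual_basis C U V e D N L' x' f'"
  shows "dual_basis C U V e D (dsum M N) (L <+> L')
    (case_sum (\<lambda>i. (x i, \<zero>\<^bsub>N\<^esub>)) (\<lambda>j. (\<zero>\<^bsub>M\<^esub>, x' j))) (case_sum (\<lambda>i u. f i (fst u)) (\<lambda>j u. f' j (snd u)))"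
    (is "dual_basis _ _ _ _ _ _ _ ?y ?g")
proof -
  interpret ideal_pair C U V e D by fact
  interpret M: left_module C M by fact
  interpret N: left_module C N by fact
  interpret MN: module_hom_pair C M N by unfold_locales
  interpret S: left_module C "dsum M N" by (rule MN.dsum_left_module)
  interpret SM: module_hom_pair C "dsum M N" M by unfold_locales
  interpret SN: module_hom_pair C "dsum M N" N by unfold_locales
  interpret MS: module_hom_pair C M "dsum M N" by unfold_locales
  interpret NS: module_hom_pair C N "dsum M N" by unfold_locales
  have fV: "fst u \<in> ideal_span M I" "snd u \<in> ideal_span N I" if "u \<in> ideal_span (dsum M N) I" "ideal I C" for u I
    using SM.ideal_span_hom[OF MN.dsum_homs(1) idealD(1)[OF that(2)] that(1)]
      SN.ideal_span_hom[OF MN.dsum_homs(2) idealD(1)[OF that(2)] that(1)] .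
  have pU: "(y, z) \<in> ideal_span (dsum M N) I" if "y \<in> ideal_span M I" "z \<in> ideal_span N I" "ideal I C" for y z I
  proof -
    have "y \<in> carrier M" "z \<in> carrier N"
      using M.ideal_span_carrier[OF idealD(1)[OF that(3)] that(1)]
        N.ideal_span_carrier[OF idealD(1)[OF that(3)] that(2)] .
    moreover have "(y, \<zero>\<^bsub>N\<^esub>) \<oplus>\<^bsub>dsum M N\<^esub> (\<zero>\<^bsub>M\<^esub>, z) \<in> ideal_span (dsum M N) I"
      using MS.ideal_span_hom[OF MN.dsum_homs(3) idealD(1)[OF that(3)] that(1)]
        NS.ideal_span_hom[OF MN.dsum_homs(4) idealD(1)[OF that(3)] that(2)] by (rule ideal_span.add)
    ultimately show ?thesis by simp
  qed
  have inv: "\<ominus>\<^bsub>dsum M N\<^esub> (y, z) = (\<ominus>\<^bsub>M\<^esub> y, \<ominus>\<^bsub>N\<^esub> z)" if "y \<in> carrier M" "z \<in> carrier N" for y z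
    using that by (intro S.M.minus_equality) (auto simp: M.M.l_neg N.M.l_neg)
  have set: "{i \<in> L <+> L'. ?g i u \<noteq> \<zero>\<^bsub>C\<^esub>} = Inl ` {i \<in> L. f i (fst u) \<noteq> \<zero>\<^bsub>C\<^esub>} \<union> Inr ` {i \<in> L'. f' i (snd u) \<noteq> \<zero>\<^bsub>C\<^esub>}" for u
    by auto
  note aa = a[unfolded dual_basis_def] and bb = b[unfolded dual_basis_def]
  have f1: "\<And>i u. i \<in> L \<Longrightarrow> u \<in> ideal_span M V \<Longrightarrow> f i u \<in> carrier C"
    "\<And>i u. i \<in> L' \<Longrightarrow> u \<in> ideal_span N V \<Longrightarrow> f' i u \<in> carrier C"
    "\<And>i. i \<in> L \<Longrightarrow> x i \<in> carrier M" "\<And>i. i \<in> L' \<Longrightarrow> x' i \<in> carrier N"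
    and ffin: "\<And>u. u \<in> ideal_span M V \<Longrightarrow> finite {i \<in> L. f i u \<noteq> \<zero>\<^bsub>C\<^esub>}" "\<And>u. u \<in> ideal_span N V \<Longrightarrow> finite {i \<in> L'. f' i u \<noteq> \<zero>\<^bsub>C\<^esub>}"
    and fsum: "\<And>u. u \<in> ideal_span M V \<Longrightarrow> u \<ominus>\<^bsub>M\<^esub> finsum M (\<lambda>i. f i u \<odot>\<^bsub>M\<^esub> x i) {i \<in> L. f i u \<noteq> \<zero>\<^bsub>C\<^esub>} \<in> ideal_span M U"
      "\<And>u. u \<in> ideal_span N V \<Longrightarrow> u \<ominus>\<^bsub>N\<^esub> finsum N (\<lambda>i. f' i u \<odot>\<^bsub>N\<^esub> x' i) {i \<in> L'. f' i u \<noteq> \<zero>\<^bsub>C\<^esub>} \<in> ideal_span N U"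
    using aa bb D by (auto simp: subset_iff)
  have eC: "e \<in> carrier C" using eD D by blast
  show ?thesis unfolding dual_basis_def
  proof (intro conjI ballI, goal_cases)
    case (1 i) then show ?case using f1 by auto
  next
    case (2 i) then show ?case using aa bb eC by auto
  next
    case (3 i u) then show ?case using fV[OF 3(2) V] aa bb by auto
  next
    case (4 i u) then show ?case using fV[OF 4(2) U] aa bb by auto
  next
    case (5 i u v) then show ?case using fV[OF 5(2) V] fV[OF 5(3) V] aa bb by auto
  next
    case (6 i b u) then show ?case using fV[OF 6(3) V] aa bb by auto
  next
    case (7 u) then show ?case unfolding set using fV[OF 7 V] ffin by auto
  next
    case (8 u)
    let ?A = "{i \<in> L. f i (fst u) \<noteq> \<zero>\<^bsub>C\<^esub>}" and ?B = "{i \<in> L'. f' i (snd u) \<noteq> \<zero>\<^bsub>C\<^esub>}"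
    have u: "fst u \<in> ideal_span M V" "snd u \<in> ideal_span N V" using fV[OF 8 V] .
    have uc: "fst u \<in> carrier M" "snd u \<in> carrier N"
      using u M.ideal_span_carrier[OF idealD(1)[OF V]] N.ideal_span_carrier[OF idealD(1)[OF V]] by auto
    have c1: "(f i (fst u) \<odot>\<^bsub>M\<^esub> x i) \<in> carrier M" if "i \<in> ?A" for i using that f1 u by (intro M.smult_closed) auto
    have c2: "(f' i (snd u) \<odot>\<^bsub>N\<^esub> x' i) \<in> carrier N" if "i \<in> ?B" for i using that f1 u by (intro N.smult_closed) auto
    have fin: "finite ?A" "finite ?B" using ffin u by auto
    have "finsum (dsum M N) (\<lambda>i. ?g i u \<odot>\<^bsub>dsum M N\<^esub> ?y i) (Inl ` ?A \<union> Inr ` ?B)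
      = finsum (dsum M N) (\<lambda>i. ?g i u \<odot>\<^bsub>dsum M N\<^esub> ?y i) (Inl ` ?A)
        \<oplus>\<^bsub>dsum M N\<^esub> finsum (dsum M N) (\<lambda>i. ?g i u \<odot>\<^bsub>dsum M N\<^esub> ?y i) (Inr ` ?B)"
      using fin c1 c2 f1 u by (intro S.M.finsum_Un_disjoint) auto
    also have "finsum (dsum M N) (\<lambda>i. ?g i u \<odot>\<^bsub>dsum M N\<^esub> ?y i) (Inl ` ?A)
      = finsum (dsum M N) (\<lambda>i. (f i (fst u) \<odot>\<^bsub>M\<^esub> x i, \<zero>\<^bsub>N\<^esub>)) ?A"
      using c1 f1 u by (subst S.M.finsum_reindex) (auto intro!: S.M.finsum_cong')
    also have "\<dots> = (finsum M (\<lambda>i. f i (fst u) \<odot>\<^bsub>M\<^esub> x i) ?A, \<zero>\<^bsub>N\<^esub>)"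
      using c1 by (intro MS.hom_finsum[OF MN.dsum_homs(3), symmetric]) auto
    also have "finsum (dsum M N) (\<lambda>i. ?g i u \<odot>\<^bsub>dsum M N\<^esub> ?y i) (Inr ` ?B)
      = finsum (dsum M N) (\<lambda>i. (\<zero>\<^bsub>M\<^esub>, f' i (snd u) \<odot>\<^bsub>N\<^esub> x' i)) ?B"
      using c2 f1 u by (subst S.M.finsum_reindex) (auto intro!: S.M.finsum_cong')
    also have "\<dots> = (\<zero>\<^bsub>M\<^esub>, finsum N (\<lambda>i. f' i (snd u) \<odot>\<^bsub>N\<^esub> x' i) ?B)"
      using c2 by (intro NS.hom_finsum[OF MN.dsum_homs(4), symmetric]) auto
    finally have "finsum (dsum M N) (\<lambda>i. ?g i u \<odot>\<^bsub>dsum M N\<^esub> ?y i) {i \<in> L <+> L'. ?g i u \<noteq> \<zero>\<^bsub>C\<^esub>} =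
      (finsum M (\<lambda>i. f i (fst u) \<odot>\<^bsub>M\<^esub> x i) ?A, finsum N (\<lambda>i. f' i (snd u) \<odot>\<^bsub>N\<^esub> x' i) ?B)"
      unfolding set using c1 c2 by simp
    moreover have "u \<ominus>\<^bsub>dsum M N\<^esub> (y, z) = (fst u \<ominus>\<^bsub>M\<^esub> y, snd u \<ominus>\<^bsub>N\<^esub> z)" if "y \<in> carrier M" "z \<in> carrier N" for y z
      using that uc by (simp add: a_minus_def inv)
    ultimately show ?case using pU[OF fsum(1)[OF u(1)] fsum(2)[OF u(2)] U] c1 c2 by simp
  qed
qed

section \<open>Strong idempotence from heredity steps\<close>

lemma (in left_module) minus_zero: "\<ominus>\<^bsub>M\<^esub> \<zero>\<^bsub>M\<^esub> = \<zero>\<^bsub>M\<^esub>"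
  by (rule M.minus_equality) auto

subsection \<open>Groups of homomorphisms\<close>

lemma hom_group_simps:
  "carrier (hom_group R M N) = module_hom R M N \<inter> extensional (carrier M)"
  "f \<otimes>\<^bsub>hom_group R M N\<^esub> g = (\<lambda>x\<in>carrier M. f x \<oplus>\<^bsub>N\<^esub> g x)"
  "\<one>\<^bsub>hom_group R M N\<^esub> = (\<lambda>x\<in>carrier M. \<zero>\<^bsub>N\<^esub>)"
  unfolding hom_group_def by simp_all

locale hom_group_pair = module_hom_pair R M N
  for R and M :: "('r, 'm) module" and N :: "('r, 'n) module"

lemma (in hom_group_pair) restrict_hom: "f \<in> module_hom R M N \<Longrightarrow> restrict f (carrier M) \<in> carrier (hom_group R M N)"
  unfolding hom_group_simps module_hom_def by (auto simp: M.smult_closed)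

lemma (in hom_group_pair) hom_group_comm_group: "comm_group (hom_group R M N)"
proof (rule comm_groupI)
  fix f g assume f: "f \<in> carrier (hom_group R M N)" and g: "g \<in> carrier (hom_group R M N)"
  then have fg: "f \<in> module_hom R M N" "g \<in> module_hom R M N" by (auto simp: hom_group_simps)
  show "f \<otimes>\<^bsub>hom_group R M N\<^esub> g \<in> carrier (hom_group R M N)"
    using restrict_hom[OF hom_sum[OF fg]] by (simp add: hom_group_simps)
  show "f \<otimes>\<^bsub>hom_group R M N\<^esub> g = g \<otimes>\<^bsub>hom_group R M N\<^esub> f"
    unfolding hom_group_simps using module_hom_in[OF fg(1)] module_hom_in[OF fg(2)] N.M.a_comm by (intro restrict_ext) simp
next
  show "\<one>\<^bsub>hom_group R M N\<^esub> \<in> carrier (hom_group R M N)"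
    using restrict_hom[OF zero_hom] by (simp add: hom_group_simps)
next
  fix f g k assume "f \<in> carrier (hom_group R M N)" "g \<in> carrier (hom_group R M N)" "k \<in> carrier (hom_group R M N)"
  then show "f \<otimes>\<^bsub>hom_group R M N\<^esub> g \<otimes>\<^bsub>hom_group R M N\<^esub> k = f \<otimes>\<^bsub>hom_group R M N\<^esub> (g \<otimes>\<^bsub>hom_group R M N\<^esub> k)"
    by (auto simp: hom_group_simps fun_eq_iff N.M.a_assoc module_hom_in)
next
  fix f assume "f \<in> carrier (hom_group R M N)"
  then show "\<one>\<^bsub>hom_group R M N\<^esub> \<otimes>\<^bsub>hom_group R M N\<^esub> f = f"
    by (auto simp: hom_group_simps fun_eq_iff module_hom_in extensional_def)
next
  fix f assume f: "f \<in> carrier (hom_group R M N)"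
  then have fg: "f \<in> module_hom R M N" by (auto simp: hom_group_simps)
  have "(\<lambda>x. \<ominus>\<^bsub>N\<^esub> f x) \<in> module_hom R M N"
    by (rule module_homI)
       (simp_all add: module_hom_in[OF fg] module_hom_add[OF fg] module_hom_smult[OF fg] N.M.minus_add N.smult_r_minus)
  from restrict_hom[OF this] show "\<exists>g\<in>carrier (hom_group R M N). g \<otimes>\<^bsub>hom_group R M N\<^esub> f = \<one>\<^bsub>hom_group R M N\<^esub>"
    by (rule bexI[rotated]) (auto simp: hom_group_simps fun_eq_iff N.M.l_neg module_hom_in[OF fg])
qed

lemmas restrict_hom = hom_group_pair.restrict_hom[OF hom_group_pair.intro]
lemmas hom_group_comm_group = hom_group_pair.hom_group_comm_group[OF hom_group_pair.intro]

lemma pull_group_hom: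
  assumes "left_module R M" "left_module R M'" "left_module R N" and d: "d \<in> module_hom R M' M"
  shows "group_hom (hom_group R M N) (hom_group R M' N) (\<lambda>f. compose (carrier M') f d)"
proof -
  interpret M: left_module R M by fact
  interpret M': left_module R M' by fact
  interpret N: left_module R N by fact
  interpret MN: module_hom_pair R M N by unfold_locales
  interpret M'N: module_hom_pair R M' N by unfold_locales
  interpret G: comm_group "hom_group R M N" by (rule hom_group_comm_group[OF MN.module_hom_pair_axioms])
  interpret H: comm_group "hom_group R M' N" by (rule hom_group_comm_group[OF M'N.module_hom_pair_axioms])
  show ?thesis
  proof (intro group_hom.intro group_hom_axioms.intro G.is_group H.is_group homI)
    fix f assume "f \<in> carrier (hom_group R M N)"
    then have f: "f \<in> module_hom R M N" by (simp add: hom_group_simps)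
    show "compose (carrier M') f d \<in> carrier (hom_group R M' N)"
      using restrict_hom[OF M'N.module_hom_pair_axioms module_hom_comp[OF d f]] by (simp add: compose_def)
    fix g assume "g \<in> carrier (hom_group R M N)"
    show "compose (carrier M') (f \<otimes>\<^bsub>hom_group R M N\<^esub> g) d = compose (carrier M') f d \<otimes>\<^bsub>hom_group R M' N\<^esub> compose (carrier M') g d"
      by (auto simp: hom_group_simps compose_def fun_eq_iff module_hom_in[OF d])
  qed
qed

lemma subgroup_comm_group:
  assumes "comm_group G" "subgroup H G" shows "comm_group (G\<lparr>carrier := H\<rparr>)"
proof -
  interpret G: comm_group G by fact
  interpret H: subgroup H G by fact
  interpret group "G\<lparr>carrier := H\<rparr>" using H.subgroup_is_group[OF G.is_group] .
  show ?thesis by (rule group_comm_groupI) (use G.m_comm H.mem_carrier in auto)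
qed

text \<open>\<open>C\<close> acts through the surjection \<open>h\<close>, so linearity over
  \<open>C\<close> is linearity over \<open>R\<close>.\<close>

lemma module_hom_descend:
  assumes "h ` carrier C = carrier R" and f: "f \<in> module_hom C (restrict_scalars h M) (restrict_scalars h N)"
  shows "f \<in> module_hom R M N"
proof (rule module_homI)
  show "f (r \<odot>\<^bsub>M\<^esub> x) = r \<odot>\<^bsub>N\<^esub> f x" if "r \<in> carrier R" "x \<in> carrier M" for r x
  proof -
    have "r \<in> h ` carrier C" using that(1) assms(1) by simp
    then obtain c where c: "c \<in> carrier C" "r = h c" by (rule imageE)
    show ?thesis unfolding c(2) using module_hom_smult[OF f c(1), of x] that(2) by simp
  qed
qed (use module_hom_in[OF f] module_hom_add[OF f] in auto)

lemma module_hom_restrict_scalars: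
  assumes h: "h \<in> carrier C \<rightarrow> carrier R" and f: "f \<in> module_hom R M N"
  shows "f \<in> module_hom C (restrict_scalars h M) (restrict_scalars h N)"
  by (rule module_homI) (use h module_hom_in[OF f] module_hom_add[OF f] module_hom_smult[OF f] in \<open>auto simp: Pi_iff\<close>)

lemma restrict_scalars_comp: "restrict_scalars g (restrict_scalars h M) = restrict_scalars (\<lambda>x. h (g x)) M"
  unfolding restrict_scalars_def by simp

subsection \<open>The mapping cone of a comparison map\<close>

text \<open>\<open>R\<close> is the algebra that contains the ideal \<open>I\<close>, and
  \<open>C\<close> an algebra mapping onto it. All modules are pulled back to \<open>C\<close>,
  because the chain of ideals and its dual bases live there.\<close>

locale ext_cone = h: ring_hom_ring C R h + I: ideal I R
  for C :: "('c, 'cc) ring_scheme" and R :: "('r, 'rr) ring_scheme" and h I +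
  fixes M :: "('r set, 'm) module" and N :: "('r set, 'n) module"
    and P :: "nat \<Rightarrow> ('r set, 'p) module" and d a
    and Q :: "nat \<Rightarrow> ('r, 'q) module" and e b \<phi>
  assumes surj: "h ` carrier C = carrier R"
    and M: "left_module (R Quot I) M" and N: "left_module (R Quot I) N"
    and resP: "projective_resolution (R Quot I) M P d a"
    and resQ: "projective_resolution R (restrict_scalars (\<lambda>r. I +>\<^bsub>R\<^esub> r) M) Q e b"
    and cmp: "comparison_map R Q e b (\<lambda>n. restrict_scalars (\<lambda>r. I +>\<^bsub>R\<^esub> r) (P n)) d a \<phi>"
begin

abbreviation "res \<equiv> \<lambda>r. I +>\<^bsub>R\<^esub> r"
abbreviation "h' \<equiv> \<lambda>c. I +>\<^bsub>R\<^esub> h c"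
abbreviation "Q' n \<equiv> restrict_scalars h (Q n)"
abbreviation "P' n \<equiv> restrict_scalars h' (P n)"
abbreviation "NC \<equiv> restrict_scalars h' N"
abbreviation "NR \<equiv> restrict_scalars res N"

text \<open>\<open>Q\<close> shifted by one degree. The zero module in degree 0 is encoded as the
  zero submodule of \<open>Q 0\<close>, which keeps all terms of one type.\<close>

definition Qs :: "nat \<Rightarrow> ('c, 'q) module" where
  "Qs n = (case n of 0 \<Rightarrow> (Q' 0)\<lparr>carrier := {\<zero>\<^bsub>Q 0\<^esub>}\<rparr> | Suc k \<Rightarrow> Q' k)"

definition X :: "nat \<Rightarrow> ('c, 'q \<times> 'p) module" where "X n = dsum (Qs n) (P' n)"

text \<open>The differential of the mapping cone of \<open>\<phi>\<close>, sending
  \<open>(q, p)\<close> to \<open>(- e q, \<phi> q + d p)\<close>. The sign makes the two terms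
  \<open>\<phi> (e q)\<close> cancel in the square.\<close>

definition dX :: "nat \<Rightarrow> 'q \<times> 'p \<Rightarrow> 'q \<times> 'p" where
  "dX n x = (case n of 0 \<Rightarrow> \<zero>\<^bsub>Q 0\<^esub> | Suc k \<Rightarrow> \<ominus>\<^bsub>Q k\<^esub> e k (fst x), \<phi> n (fst x) \<oplus>\<^bsub>P n\<^esub> d n (snd x))"

lemma res_ring: "ring_hom_ring R (R Quot I) res" by (rule I.rcos_ring_hom_ring)

lemma res_surj: "res ` carrier R = carrier (R Quot I)"
  by (auto simp: FactRing_def A_RCOSETS_def RCOSETS_def a_r_coset_def)

lemma h'_ring: "ring_hom_ring C (R Quot I) h'"
proof -
  interpret r: ring_hom_ring R "R Quot I" res by (rule res_ring)
  show ?thesis by (rule ring_hom_ringI[OF h.R.ring_axioms r.S.ring_axioms]) auto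
qed

lemma h'_surj: "h' ` carrier C = carrier (R Quot I)"
  using surj res_surj by (metis image_image)

lemma h'_zero: "c \<in> carrier C \<Longrightarrow> h' c = \<zero>\<^bsub>R Quot I\<^esub> \<longleftrightarrow> h c \<in> I"
proof
  assume c: "c \<in> carrier C" and "h' c = \<zero>\<^bsub>R Quot I\<^esub>"
  then have "h' c = I" by (simp add: FactRing_def)
  then show "h c \<in> I" using I.a_rcos_self[of "h c"] c by auto
next
  assume "h c \<in> I"
  then show "h' c = \<zero>\<^bsub>R Quot I\<^esub>" using I.a_rcos_const by (simp add: FactRing_def)
qed

lemma P_proj: "projective_module (R Quot I) (P n)" and Q_proj: "projective_module R (Q n)"
  using resP resQ by (auto simp: projective_resolution_def)

lemma P_mod: "left_module (R Quot I) (P n)" and Q_mod: "left_module R (Q n)"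
  using P_proj Q_proj by (auto simp: projective_module_def)

lemma PR_mod: "left_module R (restrict_scalars res (P n))"
  by (rule restrict_scalars_left_module[OF res_ring P_mod])

lemma P'_mod: "left_module C (P' n)" and Q'_mod: "left_module C (Q' n)" and NC_mod: "left_module C NC"
  and NR_mod: "left_module R NR"
  by (intro restrict_scalars_left_module[OF h'_ring] restrict_scalars_left_module[OF res_ring]
       restrict_scalars_left_module[OF h.ring_hom_ring_axioms] P_mod Q_mod N)+

lemma Qs_simps: "Qs (Suc n) = Q' n" "carrier (Qs 0) = {\<zero>\<^bsub>Q 0\<^esub>}" "zero (Qs 0) = zero (Q 0)" "add (Qs 0) = add (Q 0)"
  "smult (Qs 0) = (\<lambda>r. smult (Q 0) (h r))"
  by (auto simp: Qs_def)

lemma Qs_mod: "left_module C (Qs n)"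
proof (cases n)
  case 0
  interpret left_module C "Q' 0" by (rule Q'_mod)
  have "left_submodule C (Q' 0) {\<zero>\<^bsub>Q 0\<^esub>}"
    by (rule left_submoduleI) (use smult_r_null M.zero_closed M.l_zero in auto)
  from submodule_left_module[OF this] show ?thesis using 0 by (simp add: Qs_def)
qed (simp add: Qs_simps Q'_mod)

lemma QP_pair: "module_hom_pair C (Qs n) (P' n)"
  by (intro module_hom_pair.intro Qs_mod P'_mod)

lemma X_mod: "left_module C (X n)"
  unfolding X_def by (rule module_hom_pair.dsum_left_module[OF QP_pair])

lemma d_hom: "d n \<in> module_hom (R Quot I) (P (Suc n)) (P n)" and e_hom: "e n \<in> module_hom R (Q (Suc n)) (Q n)"
  and a_hom: "a \<in> module_hom (R Quot I) (P 0) M" and b_hom: "b \<in> module_hom R (Q 0) (restrict_scalars res M)"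
  and phi_hom: "\<phi> n \<in> module_hom R (Q n) (restrict_scalars res (P n))"
  using resP resQ cmp by (auto simp: projective_resolution_def comparison_map_def)

lemma cmp0: "y \<in> carrier (Q 0) \<Longrightarrow> a (\<phi> 0 y) = b y"
  and cmpS: "x \<in> carrier (Q (Suc n)) \<Longrightarrow> d n (\<phi> (Suc n) x) = \<phi> n (e n x)"
  using cmp by (auto simp: comparison_map_def)

lemma d_hom': "d n \<in> module_hom C (P' (Suc n)) (P' n)"
  by (rule module_hom_restrict_scalars[OF _ d_hom]) (use h'_surj in auto)

lemma e_hom': "e n \<in> module_hom C (Q' (Suc n)) (Q' n)"
  by (rule module_hom_restrict_scalars[OF _ e_hom]) (use surj in auto)

lemma phi_hom': "\<phi> n \<in> module_hom C (Q' n) (P' n)"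
  using module_hom_restrict_scalars[OF _ phi_hom, of h C] surj by (auto simp: restrict_scalars_comp)

lemma carrier_X: "carrier (X 0) = {\<zero>\<^bsub>Q 0\<^esub>} \<times> carrier (P 0)" "carrier (X (Suc n)) = carrier (Q n) \<times> carrier (P (Suc n))"
  by (auto simp: X_def Qs_simps)

lemma res_kernel:
  "{x \<in> carrier (P 0). a x = \<zero>\<^bsub>M\<^esub>} = d 0 ` carrier (P 1)"
  "{x \<in> carrier (P (Suc n)). d n x = \<zero>\<^bsub>P n\<^esub>} = d (Suc n) ` carrier (P (Suc (Suc n)))"
  "{z \<in> carrier (Q 0). b z = \<zero>\<^bsub>M\<^esub>} = e 0 ` carrier (Q 1)"
  "{z \<in> carrier (Q (Suc n)). e n z = \<zero>\<^bsub>Q n\<^esub>} = e (Suc n) ` carrier (Q (Suc (Suc n)))"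
  using resP resQ by (simp_all add: projective_resolution_def)

lemma exact_P0: "x \<in> carrier (P 0) \<Longrightarrow> a x = \<zero>\<^bsub>M\<^esub> \<Longrightarrow> \<exists>y\<in>carrier (P 1). x = d 0 y"
  and exact_PS: "x \<in> carrier (P (Suc n)) \<Longrightarrow> d n x = \<zero>\<^bsub>P n\<^esub> \<Longrightarrow> \<exists>y\<in>carrier (P (Suc (Suc n))). x = d (Suc n) y"
  and exact_Q0: "z \<in> carrier (Q 0) \<Longrightarrow> b z = \<zero>\<^bsub>M\<^esub> \<Longrightarrow> \<exists>y\<in>carrier (Q 1). z = e 0 y"
  and exact_QS: "z \<in> carrier (Q (Suc n)) \<Longrightarrow> e n z = \<zero>\<^bsub>Q n\<^esub> \<Longrightarrow> \<exists>y\<in>carrier (Q (Suc (Suc n))). z = e (Suc n) y"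
  using equalityD1[OF res_kernel(1), THEN subsetD, of x] equalityD1[OF res_kernel(2), THEN subsetD, of x n]
    equalityD1[OF res_kernel(3), THEN subsetD, of z] equalityD1[OF res_kernel(4), THEN subsetD, of z n]
  by (simp_all add: image_iff)

lemma ad: "x \<in> carrier (P 1) \<Longrightarrow> a (d 0 x) = \<zero>\<^bsub>M\<^esub>"
  and ddP: "x \<in> carrier (P (Suc (Suc n))) \<Longrightarrow> d n (d (Suc n) x) = \<zero>\<^bsub>P n\<^esub>"
  and be: "z \<in> carrier (Q 1) \<Longrightarrow> b (e 0 z) = \<zero>\<^bsub>M\<^esub>"
  and eeQ: "z \<in> carrier (Q (Suc (Suc n))) \<Longrightarrow> e n (e (Suc n) z) = \<zero>\<^bsub>Q n\<^esub>"
  using equalityD2[OF res_kernel(1), THEN subsetD, of "d 0 x"] equalityD2[OF res_kernel(2), THEN subsetD, of "d (Suc n) x" n]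
    equalityD2[OF res_kernel(3), THEN subsetD, of "e 0 z"] equalityD2[OF res_kernel(4), THEN subsetD, of "e (Suc n) z" n]
  by simp_all

lemma b_surj: "x \<in> carrier M \<Longrightarrow> \<exists>q\<in>carrier (Q 0). b q = x"
proof -
  assume "x \<in> carrier M"
  moreover have "b ` carrier (Q 0) = carrier M" using resQ by (simp add: projective_resolution_def)
  ultimately show ?thesis by (metis imageE)
qed

lemma dX_hom: "dX n \<in> module_hom C (X (Suc n)) (X n)"
proof (cases n)
  case 0
  interpret Q0: left_module C "Q' 0" by (rule Q'_mod)
  interpret P0: left_module C "P' 0" by (rule P'_mod)
  have z: "\<zero>\<^bsub>Q 0\<^esub> \<oplus>\<^bsub>Q 0\<^esub> \<zero>\<^bsub>Q 0\<^esub> = \<zero>\<^bsub>Q 0\<^esub>" "c \<in> carrier C \<Longrightarrow> h c \<odot>\<^bsub>Q 0\<^esub> \<zero>\<^bsub>Q 0\<^esub> = \<zero>\<^bsub>Q 0\<^esub>" for c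
    using Q0.M.l_zero[OF Q0.M.zero_closed] Q0.smult_r_null[of c] by simp_all
  show ?thesis unfolding 0
    apply (rule module_homI)
    using module_hom_in[OF phi_hom', of _ 0] module_hom_in[OF d_hom', of _ 0] module_hom_add[OF phi_hom', of _ 0]
      module_hom_add[OF d_hom', of _ 0] module_hom_smult[OF phi_hom', of _ _ 0] module_hom_smult[OF d_hom', of _ _ 0]
      P0.M.a_closed P0.M.a_ac P0.smult_r_distr z
    by (auto simp: X_def dX_def Qs_simps)
next
  case (Suc k)
  interpret Qk: left_module C "Q' k" by (rule Q'_mod)
  interpret Pn: left_module C "P' n" by (rule P'_mod)
  show ?thesis unfolding Suc
    apply (rule module_homI)
    using module_hom_in[OF phi_hom', of _ n] module_hom_in[OF d_hom', of _ n] module_hom_add[OF phi_hom', of _ n]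
      module_hom_add[OF d_hom', of _ n] module_hom_smult[OF phi_hom', of _ _ n] module_hom_smult[OF d_hom', of _ _ n]
      module_hom_in[OF e_hom', of _ k] module_hom_add[OF e_hom', of _ k] module_hom_smult[OF e_hom', of _ _ k]
      Pn.M.a_closed Pn.M.a_ac Pn.smult_r_distr Qk.M.minus_add Qk.smult_r_minus Qk.M.a_inv_closed Suc
    by (auto simp: X_def dX_def Qs_simps)
qed

lemma chain: "chain_complex C X dX"
proof (intro chain_complex.intro chain_complex_axioms.intro X_mod dX_hom h.R.ring_axioms)
  fix n x assume x: "x \<in> carrier (X (Suc (Suc n)))"
  then obtain q p where x': "x = (q, p)" "q \<in> carrier (Q (Suc n))" "p \<in> carrier (P (Suc (Suc n)))"
    by (auto simp: carrier_X)
  interpret Qn: left_module C "Q' n" by (rule Q'_mod)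
  interpret Qs: left_module C "Q' (Suc n)" by (rule Q'_mod)
  interpret Pn: left_module C "P' n" by (rule P'_mod)
  interpret Ps: left_module C "P' (Suc n)" by (rule P'_mod)
  interpret QP: module_hom_pair C "Q' n" "P' n" by unfold_locales
  interpret PP: module_hom_pair C "P' (Suc n)" "P' n" by unfold_locales
  have eq: "e n q \<in> carrier (Q n)" and dp: "d (Suc n) p \<in> carrier (P (Suc n))" and fq: "\<phi> (Suc n) q \<in> carrier (P (Suc n))"
    using module_hom_in[OF e_hom'] module_hom_in[OF d_hom'] module_hom_in[OF phi_hom'] x' by auto
  have feq: "\<phi> n (e n q) \<in> carrier (P n)" using module_hom_in[OF phi_hom'] eq by auto
  have "\<phi> n (\<ominus>\<^bsub>Q n\<^esub> e n q) \<oplus>\<^bsub>P n\<^esub> d n (\<phi> (Suc n) q \<oplus>\<^bsub>P (Suc n)\<^esub> d (Suc n) p)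
     = (\<ominus>\<^bsub>P n\<^esub> \<phi> n (e n q)) \<oplus>\<^bsub>P n\<^esub> (\<phi> n (e n q) \<oplus>\<^bsub>P n\<^esub> \<zero>\<^bsub>P n\<^esub>)"
    using QP.hom_minus[OF phi_hom'] module_hom_add[OF d_hom] eq dp fq cmpS[OF x'(2)] ddP[OF x'(3)] by simp
  also have "\<dots> = \<zero>\<^bsub>P n\<^esub>" using feq Pn.M.l_neg Pn.M.r_zero by simp
  finally have 1: "snd (dX n (dX (Suc n) x)) = \<zero>\<^bsub>P n\<^esub>" by (simp add: dX_def x')
  have 2: "fst (dX n (dX (Suc n) x)) = \<zero>\<^bsub>Qs n\<^esub>"
  proof (cases n)
    case (Suc k)
    interpret Qk: left_module C "Q' k" by (rule Q'_mod)
    interpret QQ: module_hom_pair C "Q' n" "Q' k" by unfold_locales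
    have "e k (\<ominus>\<^bsub>Q n\<^esub> e n q) = \<ominus>\<^bsub>Q k\<^esub> \<zero>\<^bsub>Q k\<^esub>"
      using QQ.hom_minus[of "e k" "e n q"] e_hom'[of k] Suc eq eeQ[of q k] x' by simp
    moreover have "\<ominus>\<^bsub>Q k\<^esub> (\<ominus>\<^bsub>Q k\<^esub> \<zero>\<^bsub>Q k\<^esub>) = \<zero>\<^bsub>Q k\<^esub>"
      using Qk.M.minus_minus[OF Qk.M.zero_closed] by simp
    ultimately show ?thesis using Suc by (simp add: dX_def x' Qs_simps)
  qed (simp add: dX_def Qs_simps)
  show "dX n (dX (Suc n) x) = \<zero>\<^bsub>X n\<^esub>" using 1 2 by (simp add: prod_eq_iff X_def)
qed

text \<open>The cone is acyclic because \<open>P\<close> and \<open>Q\<close> resolve the same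
  module. In degree 0, \<open>a p = b q\<close> for some \<open>q\<close>; then
  \<open>p - \<phi> 0 q\<close> lies in the kernel of \<open>a\<close> and is a boundary of
  \<open>P\<close>.\<close>

lemma cone_exact0:
  assumes x: "x \<in> carrier (X 0)" shows "\<exists>y\<in>carrier (X 1). x = dX 0 y"
proof -
  obtain p where p: "x = (\<zero>\<^bsub>Q 0\<^esub>, p)" "p \<in> carrier (P 0)" using x by (auto simp: carrier_X)
  interpret M: left_module "R Quot I" M by (rule M)
  interpret P0: left_module "R Quot I" "P 0" by (rule P_mod)
  interpret PM: module_hom_pair "R Quot I" "P 0" M by unfold_locales
  obtain q where q: "q \<in> carrier (Q 0)" "b q = a p" using b_surj module_hom_in[OF a_hom p(2)] by blast
  have fq: "\<phi> 0 q \<in> carrier (P 0)" using module_hom_in[OF phi_hom' , of q 0] q by simp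
  have "a (p \<ominus>\<^bsub>P 0\<^esub> \<phi> 0 q) = \<zero>\<^bsub>M\<^esub>"
    using PM.hom_diff[OF a_hom p(2) fq] cmp0[OF q(1)] q module_hom_in[OF a_hom p(2)] by (simp add: a_minus_def M.M.r_neg)
  then obtain y where y: "y \<in> carrier (P 1)" "p \<ominus>\<^bsub>P 0\<^esub> \<phi> 0 q = d 0 y"
    using exact_P0[of "p \<ominus>\<^bsub>P 0\<^esub> \<phi> 0 q"] p fq by auto
  have "\<phi> 0 q \<oplus>\<^bsub>P 0\<^esub> d 0 y = p" unfolding y(2)[symmetric]
    using p fq by (simp add: a_minus_def P0.M.a_comm[of p] P0.M.r_neg2)
  then show ?thesis using q y p by (intro bexI[of _ "(q, y)"]) (auto simp: dX_def carrier_X)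
qed

text \<open>The component \<open>q\<close> is a cycle, for \<open>n = 0\<close> in the kernel of
  \<open>b\<close> because \<open>a\<close> kills \<open>\<phi> 0 q + d 0 p = 0\<close>; so
  \<open>q = e n q'\<close>. Then \<open>p + \<phi> (Suc n) q'\<close> is a cycle of
  \<open>P\<close>, and a preimage of it, paired with \<open>- q'\<close>, is the element
  sought.\<close>

lemma cone_exactS:
  assumes x: "x \<in> carrier (X (Suc n))" and dx: "dX n x = \<zero>\<^bsub>X n\<^esub>"
  shows "\<exists>y\<in>carrier (X (Suc (Suc n))). x = dX (Suc n) y"
proof -
  obtain q p where qp: "x = (q, p)" "q \<in> carrier (Q n)" "p \<in> carrier (P (Suc n))" using x by (auto simp: carrier_X)
  interpret Qn: left_module C "Q' n" by (rule Q'_mod)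
  interpret Qs: left_module C "Q' (Suc n)" by (rule Q'_mod)
  interpret Pn: left_module C "P' n" by (rule P'_mod)
  interpret Ps: left_module C "P' (Suc n)" by (rule P'_mod)
  interpret QP: module_hom_pair C "Q' n" "P' n" by unfold_locales
  interpret QQ: module_hom_pair C "Q' (Suc n)" "Q' n" by unfold_locales
  interpret QPs: module_hom_pair C "Q' (Suc n)" "P' (Suc n)" by unfold_locales
  interpret PP: module_hom_pair C "P' (Suc n)" "P' n" by unfold_locales
  have fq: "\<phi> n q \<in> carrier (P n)" and dp: "d n p \<in> carrier (P n)"
    using module_hom_in[OF phi_hom', of q n] module_hom_in[OF d_hom', of p n] qp by auto
  have s: "\<phi> n q \<oplus>\<^bsub>P n\<^esub> d n p = \<zero>\<^bsub>P n\<^esub>" using dx by (simp add: dX_def qp X_def)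
  have "\<exists>q'\<in>carrier (Q (Suc n)). q = e n q'"
  proof (cases n)
    case 0
    interpret M: left_module "R Quot I" M by (rule M)
    interpret P0: left_module "R Quot I" "P 0" by (rule P_mod)
    interpret PM: module_hom_pair "R Quot I" "P 0" M by unfold_locales
    have "a (\<phi> 0 q \<oplus>\<^bsub>P 0\<^esub> d 0 p) = \<zero>\<^bsub>M\<^esub>" using s 0 PM.hom_zero[OF a_hom] by simp
    then have "b q \<oplus>\<^bsub>M\<^esub> \<zero>\<^bsub>M\<^esub> = \<zero>\<^bsub>M\<^esub>"
      using module_hom_add[OF a_hom, of "\<phi> 0 q" "d 0 p"] fq dp qp 0 cmp0[of q] ad[of p] by simp
    then have "b q = \<zero>\<^bsub>M\<^esub>" using module_hom_in[OF b_hom, of q] qp 0 by simp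
    then show ?thesis using exact_Q0[of q] qp 0 by simp
  next
    case (Suc k)
    interpret Qk: left_module C "Q' k" by (rule Q'_mod)
    have "\<ominus>\<^bsub>Q k\<^esub> e k q = \<zero>\<^bsub>Q k\<^esub>" using dx Suc by (simp add: dX_def qp X_def Qs_simps)
    moreover have "e k q \<in> carrier (Q k)" using module_hom_in[OF e_hom, of q k] qp Suc by simp
    ultimately have "e k q = \<zero>\<^bsub>Q k\<^esub>"
      using Qk.M.minus_minus[of "e k q"] Qk.minus_zero by simp
    then show ?thesis using exact_QS[of q k] qp Suc by simp
  qed
  then obtain q' where q': "q' \<in> carrier (Q (Suc n))" "q = e n q'" by blast
  have fq': "\<phi> (Suc n) q' \<in> carrier (P (Suc n))" using module_hom_in[OF phi_hom', of q' "Suc n"] q' by simp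
  have "d n (p \<oplus>\<^bsub>P (Suc n)\<^esub> \<phi> (Suc n) q') = \<zero>\<^bsub>P n\<^esub>"
    using module_hom_add[OF d_hom' , of p n "\<phi> (Suc n) q'"] qp fq' cmpS[OF q'(1)] s q' Pn.M.a_comm[of "d n p" "\<phi> n q"] fq dp by simp
  then obtain p' where p': "p' \<in> carrier (P (Suc (Suc n)))" "p \<oplus>\<^bsub>P (Suc n)\<^esub> \<phi> (Suc n) q' = d (Suc n) p'"
    using exact_PS[of "p \<oplus>\<^bsub>P (Suc n)\<^esub> \<phi> (Suc n) q'" n] qp fq' Ps.M.a_closed[of p "\<phi> (Suc n) q'"] by auto
  have mq: "\<ominus>\<^bsub>Q (Suc n)\<^esub> q' \<in> carrier (Q (Suc n))" using Qs.M.a_inv_closed[of q'] q' by simp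
  have "\<phi> (Suc n) (\<ominus>\<^bsub>Q (Suc n)\<^esub> q') \<oplus>\<^bsub>P (Suc n)\<^esub> d (Suc n) p' = p"
    unfolding p'(2)[symmetric] using QPs.hom_minus[OF phi_hom', of q'] q' qp fq' Ps.M.a_comm[of p "\<phi> (Suc n) q'"]
      Ps.M.r_neg1[of "\<phi> (Suc n) q'" p] by simp
  moreover have "\<ominus>\<^bsub>Q n\<^esub> e n (\<ominus>\<^bsub>Q (Suc n)\<^esub> q') = q"
    using QQ.hom_minus[OF e_hom', of q'] q' qp Qn.M.minus_minus[of q] by simp
  ultimately show ?thesis using p' mq qp
    by (intro bexI[of _ "(\<ominus>\<^bsub>Q (Suc n)\<^esub> q', p')"]) (auto simp: dX_def carrier_X)
qed

subsection \<open>From the cone to \<open>Ext\<close>\<close>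

text \<open>The hypothesis \<open>HE\<close> says that the complex of homomorphisms from the cone to
  \<open>N\<close> is exact in positive degrees. Such a homomorphism is a pair of a cochain on
  \<open>Q\<close> and a cochain on \<open>P\<close>, so exactness means that pulling back along
  \<open>\<phi>\<close> is bijective on cohomology.\<close>

lemma ext_map_iso:
  assumes HE: "\<And>n f. f \<in> module_hom C (X (Suc n)) NC \<Longrightarrow> (\<And>x. x \<in> carrier (X (Suc (Suc n))) \<Longrightarrow> f (dX (Suc n) x) = \<zero>\<^bsub>N\<^esub>) \<Longrightarrow>
      \<exists>g\<in>module_hom C (X n) NC. \<forall>x\<in>carrier (X (Suc n)). g (dX n x) = f x"
    and i: "i \<ge> 1"
  shows "ext_map R Q e NR \<phi> i \<in> iso (ext_group (R Quot I) P d N i) (ext_group R Q e NR i)"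
proof -
  obtain k where k: "i = Suc k" using i by (cases i) auto
  let ?HP = "\<lambda>n. hom_group (R Quot I) (P n) N" and ?HQ = "\<lambda>n. hom_group R (Q n) NR"
  let ?pd = "\<lambda>n f. compose (carrier (P (Suc n))) f (d n)" and ?pe = "\<lambda>n f. compose (carrier (Q (Suc n))) f (e n)"
  let ?ph = "\<lambda>f. compose (carrier (Q i)) f (\<phi> i)"
  let ?ZP = "ext_cocycles (R Quot I) P d N i" and ?BP = "ext_coboundaries (R Quot I) P d N i"
  let ?ZQ = "ext_cocycles R Q e NR i" and ?BQ = "ext_coboundaries R Q e NR i"
  interpret N: left_module C NC by (rule NC_mod)
  interpret NN: left_module "R Quot I" N by (rule N)
  have HPg: "comm_group (?HP n)" for n by (intro hom_group_comm_group module_hom_pair.intro P_mod N)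
  have HQg: "comm_group (?HQ n)" for n by (intro hom_group_comm_group module_hom_pair.intro Q_mod NR_mod)
  interpret HP: comm_group "?HP i" by (rule HPg)
  interpret HQ: comm_group "?HQ i" by (rule HQg)
  have pd: "group_hom (?HP n) (?HP (Suc n)) (?pd n)" for n by (rule pull_group_hom[OF P_mod P_mod N d_hom])
  have pe: "group_hom (?HQ n) (?HQ (Suc n)) (?pe n)" for n by (rule pull_group_hom[OF Q_mod Q_mod NR_mod e_hom])
  have incl: "f \<in> carrier (hom_group R (restrict_scalars res (P n)) NR)" if "f \<in> carrier (?HP n)" for f n
    using that module_hom_restrict_scalars[of res R "R Quot I" f "P n" N] res_surj by (auto simp: hom_group_simps)
  interpret ph: group_hom "hom_group R (restrict_scalars res (P i)) NR" "?HQ i" ?ph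
    by (rule pull_group_hom[OF PR_mod Q_mod NR_mod phi_hom])
  have ph_closed: "?ph f \<in> carrier (?HQ i)" if "f \<in> carrier (?HP i)" for f using incl[OF that] ph.hom_closed by blast
  have ph_mult: "?ph (f \<otimes>\<^bsub>?HP i\<^esub> g) = ?ph f \<otimes>\<^bsub>?HQ i\<^esub> ?ph g" if "f \<in> carrier (?HP i)" "g \<in> carrier (?HP i)" for f g
    using ph.hom_mult[OF incl[OF that(1)] incl[OF that(2)]] by (simp add: hom_group_simps)
  have ZP: "?ZP = kernel (?HP i) (?HP (Suc i)) (?pd i)" and ZQ: "?ZQ = kernel (?HQ i) (?HQ (Suc i)) (?pe i)"
    by (auto simp: ext_cocycles_def kernel_def)
  have BP: "?BP = ?pd k ` carrier (?HP k)" and BQ: "?BQ = ?pe k ` carrier (?HQ k)"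
    by (simp_all add: ext_coboundaries_def k)
  have sZP: "subgroup ?ZP (?HP i)" and sZQ: "subgroup ?ZQ (?HQ i)"
    unfolding ZP ZQ using group_hom.subgroup_kernel[OF pd] group_hom.subgroup_kernel[OF pe] by auto
  have sBQ: "subgroup ?BQ (?HQ i)"
    unfolding BQ using group_hom.img_is_subgroup[OF pe[of k]] by (simp add: k)
  have BPcar: "?BP \<subseteq> carrier (?HP i)" unfolding BP using group_hom.hom_closed[OF pd[of k]] by (auto simp: k)
  have ph_d: "?ph (?pd k g) = ?pe k (compose (carrier (Q k)) g (\<phi> k))" if "g \<in> carrier (?HP k)" for g
  proof
    fix x show "?ph (?pd k g) x = ?pe k (compose (carrier (Q k)) g (\<phi> k)) x"
      using module_hom_in[OF phi_hom, of x i] module_hom_in[OF e_hom, of x k] cmpS[of x k] k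
      by (auto simp: compose_def)
  qed
  have phk: "compose (carrier (Q k)) g (\<phi> k) \<in> carrier (?HQ k)" if "g \<in> carrier (?HP k)" for g
    using group_hom.hom_closed[OF pull_group_hom[OF PR_mod Q_mod NR_mod phi_hom] incl[OF that]] .
  have BP_BQ: "?ph f \<in> ?BQ" if "f \<in> ?BP" for f
    using that ph_d phk unfolding BP BQ by auto
  have BP_ZP: "?BP \<subseteq> ?ZP"
  proof
    fix f assume "f \<in> ?BP"
    then obtain g where g: "g \<in> carrier (?HP k)" "f = ?pd k g" unfolding BP by blast
    interpret PN: module_hom_pair "R Quot I" "P k" N by (intro module_hom_pair.intro P_mod N)
    have "g \<zero>\<^bsub>P k\<^esub> = \<zero>\<^bsub>N\<^esub>" using g PN.hom_zero by (simp add: hom_group_simps)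
    then have "?pd i f = \<one>\<^bsub>?HP (Suc i)\<^esub>"
      using g ddP module_hom_in[OF d_hom] k by (auto simp: compose_def hom_group_simps fun_eq_iff)
    then show "f \<in> ?ZP" using \<open>f \<in> ?BP\<close> BPcar by (auto simp: ext_cocycles_def)
  qed
  have BQ_ZQ: "?BQ \<subseteq> ?ZQ"
  proof
    fix f assume f: "f \<in> ?BQ"
    then obtain g where g: "g \<in> carrier (?HQ k)" "f = ?pe k g" unfolding BQ by blast
    interpret QN: module_hom_pair R "Q k" NR by (intro module_hom_pair.intro Q_mod NR_mod)
    have "g \<zero>\<^bsub>Q k\<^esub> = \<zero>\<^bsub>N\<^esub>" using g QN.hom_zero by (simp add: hom_group_simps)
    then have "?pe i f = \<one>\<^bsub>?HQ (Suc i)\<^esub>"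
      using g eeQ module_hom_in[OF e_hom] k by (auto simp: compose_def hom_group_simps fun_eq_iff)
    then show "f \<in> ?ZQ" using f subgroup.subset[OF sBQ] by (auto simp: ext_cocycles_def)
  qed
  have ZP_ZQ: "?ph f \<in> ?ZQ" if f: "f \<in> ?ZP" for f
  proof -
    have fc: "f \<in> carrier (?HP i)" and fd: "?pd i f = \<one>\<^bsub>?HP (Suc i)\<^esub>" using f by (auto simp: ext_cocycles_def)
    have fd': "f (d i y) = \<zero>\<^bsub>N\<^esub>" if "y \<in> carrier (P (Suc i))" for y
      using fun_cong[OF fd, of y] that by (simp add: compose_def hom_group_simps)
    have "?pe i (?ph f) = \<one>\<^bsub>?HQ (Suc i)\<^esub>"
    proof
      fix x show "?pe i (?ph f) x = \<one>\<^bsub>?HQ (Suc i)\<^esub> x"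
        using module_hom_in[OF e_hom, of x i] cmpS[of x i] fd'[of "\<phi> (Suc i) x"] module_hom_in[OF phi_hom, of x "Suc i"]
        by (auto simp: compose_def hom_group_simps)
    qed
    then show ?thesis using ph_closed[OF fc] by (simp add: ext_cocycles_def)
  qed
  have phi_c: "q \<in> carrier (Q n) \<Longrightarrow> \<phi> n q \<in> carrier (P n)" for q n using module_hom_in[OF phi_hom, of q n] by simp
  have e_c: "q \<in> carrier (Q (Suc n)) \<Longrightarrow> e n q \<in> carrier (Q n)" for q n using module_hom_in[OF e_hom, of q n] by simp
  have d_c: "q \<in> carrier (P (Suc n)) \<Longrightarrow> d n q \<in> carrier (P n)" for q n using module_hom_in[OF d_hom, of q n] by simp
  have QN: "module_hom_pair R (Q n) NR" and PN: "module_hom_pair (R Quot I) (P n) N" for n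
    by (intro module_hom_pair.intro Q_mod NR_mod P_mod N)+
  \<comment> \<open>The component on \<open>Q\<close> is linear over \<open>R\<close> and the one on
    \<open>P\<close> over \<open>R Quot I\<close>, because \<open>C\<close> acts on them through the
    surjections \<open>h\<close> and \<open>h'\<close>.\<close>
  have comp: "\<exists>g1 g2. g1 \<in> carrier (?HQ n) \<and> g2 \<in> carrier (?HP (Suc n)) \<and> 
      (\<forall>q\<in>carrier (Q n). \<forall>p\<in>carrier (P (Suc n)). g (q, p) = g1 q \<oplus>\<^bsub>N\<^esub> g2 p)"
    if g: "g \<in> module_hom C (X (Suc n)) NC" for g n
  proof -
    interpret QP: module_hom_pair C "Qs (Suc n)" "P' (Suc n)" by (rule QP_pair)
    note hs = QP.dsum_homs(3,4)[folded X_def]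
    have 1: "(\<lambda>q. g (q, \<zero>\<^bsub>P (Suc n)\<^esub>)) \<in> module_hom R (Q n) NR"
      by (rule module_hom_descend[OF surj]) (use module_hom_comp[OF hs(1) g] in \<open>simp add: Qs_simps restrict_scalars_comp\<close>)
    have 2: "(\<lambda>p. g (\<zero>\<^bsub>Q n\<^esub>, p)) \<in> module_hom (R Quot I) (P (Suc n)) N"
      by (rule module_hom_descend[OF h'_surj]) (use module_hom_comp[OF hs(2) g] in \<open>simp add: Qs_simps\<close>)
    have 3: "g (q, p) = g (q, \<zero>\<^bsub>P (Suc n)\<^esub>) \<oplus>\<^bsub>N\<^esub> g (\<zero>\<^bsub>Q n\<^esub>, p)" if "q \<in> carrier (Q n)" "p \<in> carrier (P (Suc n))" for q p
      using module_hom_add[OF g, of "(q, \<zero>\<^bsub>P (Suc n)\<^esub>)" "(\<zero>\<^bsub>Q n\<^esub>, p)"] that QP.M.M.zero_closed QP.N.M.zero_closed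
        QP.M.M.r_zero[of q] QP.N.M.l_zero[of p] by (simp add: X_def Qs_simps)
    show ?thesis
      using restrict_hom[OF QN 1] restrict_hom[OF PN 2] 3
      by (intro exI[of _ "restrict (\<lambda>q. g (q, \<zero>\<^bsub>P (Suc n)\<^esub>)) (carrier (Q n))"]
           exI[of _ "restrict (\<lambda>p. g (\<zero>\<^bsub>Q n\<^esub>, p)) (carrier (P (Suc n)))"]) auto
  qed
  have comp0: "\<exists>g2. g2 \<in> carrier (?HP 0) \<and> (\<forall>p\<in>carrier (P 0). g (\<zero>\<^bsub>Q 0\<^esub>, p) = g2 p)"
    if g: "g \<in> module_hom C (X 0) NC" for g
  proof -
    interpret QP: module_hom_pair C "Qs 0" "P' 0" by (rule QP_pair)
    note hs = QP.dsum_homs(3,4)[folded X_def]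
    have 2: "(\<lambda>p. g (\<zero>\<^bsub>Q 0\<^esub>, p)) \<in> module_hom (R Quot I) (P 0) N"
      by (rule module_hom_descend[OF h'_surj]) (use module_hom_comp[OF hs(2) g] in \<open>simp add: Qs_simps\<close>)
    show ?thesis
      using restrict_hom[OF PN 2]
      by (intro exI[of _ "restrict (\<lambda>p. g (\<zero>\<^bsub>Q 0\<^esub>, p)) (carrier (P 0))"]) auto
  qed
  have hom_pair: "(\<lambda>x. f1 (fst x) \<oplus>\<^bsub>N\<^esub> f2 (snd x)) \<in> module_hom C (X (Suc n)) NC"
    if f1: "f1 \<in> carrier (?HQ n)" and f2: "f2 \<in> carrier (?HP (Suc n))" for f1 f2 n
  proof -
    interpret QP: module_hom_pair C "Qs (Suc n)" "P' (Suc n)" by (rule QP_pair)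
    have 1: "f1 \<in> module_hom C (Q' n) NC"
      using module_hom_restrict_scalars[of h C R f1 "Q n" NR] f1 surj by (auto simp: hom_group_simps restrict_scalars_comp)
    have 2: "f2 \<in> module_hom C (P' (Suc n)) NC"
      using module_hom_restrict_scalars[of h' C "R Quot I" f2 "P (Suc n)" N] f2 h'_surj by (auto simp: hom_group_simps)
    note hs = QP.dsum_homs(1,2)[folded X_def, unfolded Qs_simps]
    interpret XN: module_hom_pair C "X (Suc n)" NC by (intro module_hom_pair.intro X_mod NC_mod)
    show ?thesis using XN.hom_sum[OF module_hom_comp[OF hs(1) 1] module_hom_comp[OF hs(2) 2]] by simp
  qed
  text \<open>Injectivity: a cocycle pulling back to a coboundary \<open>g \<circ> e\<close> yields the cocycle \<open>(g, f)\<close> of the cone.\<close>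
  have inj: "f \<in> ?BP" if f: "f \<in> ?ZP" and fB: "?ph f \<in> ?BQ" for f
  proof -
    have fc: "f \<in> carrier (?HP (Suc k))" and fd: "?pd i f = \<one>\<^bsub>?HP (Suc i)\<^esub>" using f k by (auto simp: ext_cocycles_def)
    have fd': "f (d i y) = \<zero>\<^bsub>N\<^esub>" if "y \<in> carrier (P (Suc i))" for y
      using fun_cong[OF fd, of y] that by (simp add: compose_def hom_group_simps)
    obtain g where g: "g \<in> carrier (?HQ k)" and fg: "?ph f = ?pe k g" using fB unfolding BQ by blast
    have fg': "f (\<phi> i q) = g (e k q)" if "q \<in> carrier (Q i)" for q
      using fun_cong[OF fg, of q] that k by (simp add: compose_def)
    have fh: "f \<in> module_hom (R Quot I) (P i) N" and gh: "g \<in> module_hom R (Q k) NR"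
      using fc g k by (auto simp: hom_group_simps)
    have "\<exists>g'\<in>module_hom C (X k) NC. \<forall>x\<in>carrier (X (Suc k)). g' (dX k x) = g (fst x) \<oplus>\<^bsub>N\<^esub> f (snd x)"
    proof (rule HE[OF hom_pair[OF g fc]])
      fix x assume "x \<in> carrier (X (Suc (Suc k)))"
      then obtain q p where x: "x = (q, p)" "q \<in> carrier (Q i)" "p \<in> carrier (P (Suc i))" by (auto simp: carrier_X k)
      have c: "\<phi> i q \<in> carrier (P i)" "d i p \<in> carrier (P i)" "e k q \<in> carrier (Q k)"
        using x phi_c d_c e_c k by auto
      have gc: "g (e k q) \<in> carrier N" using module_hom_in[OF gh c(3)] by simp
      have "g (\<ominus>\<^bsub>Q k\<^esub> e k q) = \<ominus>\<^bsub>N\<^esub> g (e k q)" using module_hom_pair.hom_minus[OF QN gh c(3)] by simp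
      moreover have "f (\<phi> i q \<oplus>\<^bsub>P i\<^esub> d i p) = g (e k q) \<oplus>\<^bsub>N\<^esub> \<zero>\<^bsub>N\<^esub>"
        using module_hom_add[OF fh c(1,2)] fd' fg' x by simp
      ultimately show "g (fst (dX (Suc k) x)) \<oplus>\<^bsub>N\<^esub> f (snd (dX (Suc k) x)) = \<zero>\<^bsub>N\<^esub>"
        using gc by (simp add: dX_def x k NN.M.l_neg)
    qed
    then obtain g' where g': "g' \<in> module_hom C (X k) NC"
      and eq: "\<And>x. x \<in> carrier (X (Suc k)) \<Longrightarrow> g' (dX k x) = g (fst x) \<oplus>\<^bsub>N\<^esub> f (snd x)" by blast
    interpret Qk: left_module R "Q k" by (rule Q_mod)
    interpret Pi: left_module "R Quot I" "P k" by (rule P_mod)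
    have g0: "g \<zero>\<^bsub>Q k\<^esub> = \<zero>\<^bsub>N\<^esub>" using module_hom_pair.hom_zero[OF QN gh] by simp
    have phi0: "\<phi> k \<zero>\<^bsub>Q k\<^esub> = \<zero>\<^bsub>P k\<^esub>"
      using module_hom_pair.hom_zero[OF module_hom_pair.intro[OF Q_mod PR_mod] phi_hom] by simp
    have fd2: "g' (dX k (\<zero>\<^bsub>Q k\<^esub>, p)) = f p" if p: "p \<in> carrier (P (Suc k))" for p
      using eq[of "(\<zero>\<^bsub>Q k\<^esub>, p)"] p g0 module_hom_in[OF fh, of p] k by (simp add: carrier_X)
    \<comment> \<open>The \<open>P\<close> component of \<open>g'\<close> is the cochain sought. In
      degree 0 the cone has a trivial \<open>Q\<close> component, hence the separate case.\<close>
    have "\<exists>g2\<in>carrier (?HP k). \<forall>p\<in>carrier (P (Suc k)). f p = g2 (d k p)"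
    proof (cases k)
      case 0
      obtain g2 where "g2 \<in> carrier (?HP 0)" "\<And>p. p \<in> carrier (P 0) \<Longrightarrow> g' (\<zero>\<^bsub>Q 0\<^esub>, p) = g2 p"
        using comp0 g' 0 by blast
      then show ?thesis using fd2 phi0 d_c[of _ k] Pi.M.l_zero 0 by (intro bexI[of _ g2] ballI) (auto simp: dX_def)
    next
      case (Suc j)
      obtain g1 g2 where g2: "g1 \<in> carrier (?HQ j)" "g2 \<in> carrier (?HP k)"
        "\<And>q p. q \<in> carrier (Q j) \<Longrightarrow> p \<in> carrier (P k) \<Longrightarrow> g' (q, p) = g1 q \<oplus>\<^bsub>N\<^esub> g2 p"
        using comp[of g' j] g' Suc by blast
      interpret Qj: left_module R "Q j" by (rule Q_mod)
      have e0: "e j \<zero>\<^bsub>Q k\<^esub> = \<zero>\<^bsub>Q j\<^esub>"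
        using module_hom_pair.hom_zero[OF module_hom_pair.intro[OF Q_mod Q_mod] e_hom[of j]] Suc by simp
      have m0: "\<ominus>\<^bsub>Q j\<^esub> \<zero>\<^bsub>Q j\<^esub> = \<zero>\<^bsub>Q j\<^esub>" by (rule Qj.M.minus_equality) auto
      have g10: "g1 \<zero>\<^bsub>Q j\<^esub> = \<zero>\<^bsub>N\<^esub>" using module_hom_pair.hom_zero[OF QN, of g1] g2(1) by (simp add: hom_group_simps)
      have "f p = g2 (d k p)" if p: "p \<in> carrier (P (Suc k))" for p
      proof -
        have "g2 (d k p) \<in> carrier N" using g2(2) d_c[OF p] module_hom_in by (fastforce simp: hom_group_simps)
        moreover have "f p = g1 \<zero>\<^bsub>Q j\<^esub> \<oplus>\<^bsub>N\<^esub> g2 (d k p)"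
        proof -
          have "dX k (\<zero>\<^bsub>Q k\<^esub>, p) = (\<ominus>\<^bsub>Q j\<^esub> \<zero>\<^bsub>Q j\<^esub>, \<zero>\<^bsub>P k\<^esub> \<oplus>\<^bsub>P k\<^esub> d k p)"
            using phi0 e0 Suc by (simp add: dX_def)
          then show ?thesis
            using fd2[OF p] g2(3)[OF Qj.M.zero_closed d_c[OF p]] unfolding m0 Pi.M.l_zero[OF d_c[OF p]] by simp
        qed
        ultimately show ?thesis using g10 by simp
      qed
      then show ?thesis using g2(2) by blast
    qed
    then obtain g2 where g2: "g2 \<in> carrier (?HP k)" "\<And>p. p \<in> carrier (P (Suc k)) \<Longrightarrow> f p = g2 (d k p)" by blast
    have "f = ?pd k g2"
      using fc g2(2) by (auto simp: fun_eq_iff compose_def hom_group_simps extensional_def)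
    then show ?thesis unfolding BP using g2(1) by blast
  qed
  text \<open>Surjectivity: a cocycle \<open>g\<close> on \<open>Q\<close> is the cocycle \<open>(g, 0)\<close> of the cone.\<close>
  have sur: "\<exists>f\<in>?ZP. \<exists>\<beta>\<in>?BQ. g = \<beta> \<otimes>\<^bsub>?HQ i\<^esub> ?ph f" if g: "g \<in> ?ZQ" for g
  proof -
    have gc: "g \<in> carrier (?HQ i)" and ge: "?pe i g = \<one>\<^bsub>?HQ (Suc i)\<^esub>" using g by (auto simp: ext_cocycles_def)
    have ge': "g (e i q) = \<zero>\<^bsub>N\<^esub>" if "q \<in> carrier (Q (Suc i))" for q
      using fun_cong[OF ge, of q] that by (simp add: compose_def hom_group_simps)
    have gh: "g \<in> module_hom R (Q i) NR" using gc by (simp add: hom_group_simps)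
    interpret HPS: comm_group "?HP (Suc i)" by (rule HPg)
    have "\<exists>g'\<in>module_hom C (X i) NC. \<forall>x\<in>carrier (X (Suc i)). g' (dX i x) = g (fst x) \<oplus>\<^bsub>N\<^esub> \<one>\<^bsub>?HP (Suc i)\<^esub> (snd x)"
    proof (rule HE[OF hom_pair[OF gc HPS.one_closed]])
      fix x assume "x \<in> carrier (X (Suc (Suc i)))"
      then obtain q p where x: "x = (q, p)" "q \<in> carrier (Q (Suc i))" "p \<in> carrier (P (Suc (Suc i)))" by (auto simp: carrier_X)
      have c: "\<phi> (Suc i) q \<oplus>\<^bsub>P (Suc i)\<^esub> d (Suc i) p \<in> carrier (P (Suc i))" "e i q \<in> carrier (Q i)"
        using abelian_groupE(1)[OF left_module.axioms(2)[OF P_mod] phi_c[OF x(2)] d_c[OF x(3)]] e_c[OF x(2)] .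
      have "\<ominus>\<^bsub>N\<^esub> \<zero>\<^bsub>N\<^esub> = \<zero>\<^bsub>N\<^esub>" by (rule NN.M.minus_equality) auto
      then have "g (\<ominus>\<^bsub>Q i\<^esub> e i q) = \<zero>\<^bsub>N\<^esub>" using module_hom_pair.hom_minus[OF QN gh c(2)] ge' x by simp
      then show "g (fst (dX (Suc i) x)) \<oplus>\<^bsub>N\<^esub> \<one>\<^bsub>?HP (Suc i)\<^esub> (snd (dX (Suc i) x)) = \<zero>\<^bsub>N\<^esub>"
        using c(1) by (simp add: dX_def x hom_group_simps)
    qed
    then obtain g' where g': "g' \<in> module_hom C (X i) NC"
      and eq: "\<And>x. x \<in> carrier (X (Suc i)) \<Longrightarrow> g' (dX i x) = g (fst x) \<oplus>\<^bsub>N\<^esub> \<one>\<^bsub>?HP (Suc i)\<^esub> (snd x)" by blast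
    obtain g1 g2 where g12: "g1 \<in> carrier (?HQ k)" "g2 \<in> carrier (?HP i)"
        "\<And>q p. q \<in> carrier (Q k) \<Longrightarrow> p \<in> carrier (P i) \<Longrightarrow> g' (q, p) = g1 q \<oplus>\<^bsub>N\<^esub> g2 p"
      using comp[of g' k] g' k by blast
    have h12: "g1 \<in> module_hom R (Q k) NR" "g2 \<in> module_hom (R Quot I) (P i) N" using g12 by (auto simp: hom_group_simps)
    \<comment> \<open>At \<open>q = 0\<close> this shows that \<open>g2\<close> is a cocycle, at
      \<open>p = 0\<close> that \<open>g\<close> is the pullback of \<open>g2\<close> up to a
      coboundary.\<close>
    have key: "g1 (\<ominus>\<^bsub>Q k\<^esub> e k q) \<oplus>\<^bsub>N\<^esub> g2 (\<phi> i q \<oplus>\<^bsub>P i\<^esub> d i p) = g q"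
      if q: "q \<in> carrier (Q i)" and p: "p \<in> carrier (P (Suc i))" for q p
    proof -
      interpret Qk: left_module R "Q k" by (rule Q_mod)
      interpret Pi: left_module "R Quot I" "P i" by (rule P_mod)
      have "\<ominus>\<^bsub>Q k\<^esub> e k q \<in> carrier (Q k)" "\<phi> i q \<oplus>\<^bsub>P i\<^esub> d i p \<in> carrier (P i)" "g q \<in> carrier N"
        using Pi.M.a_closed[OF phi_c[OF q] d_c[OF p]] Qk.M.a_inv_closed[of "e k q"] e_c[of q k] q k module_hom_in[OF gh q]
        by simp_all
      then show ?thesis using g12(3) eq[of "(q, p)"] q p by (simp add: carrier_X dX_def k hom_group_simps)
    qed
    interpret Qi: left_module R "Q i" by (rule Q_mod)
    interpret Qk: left_module R "Q k" by (rule Q_mod)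
    interpret Pi: left_module "R Quot I" "P i" by (rule P_mod)
    interpret Ps: left_module "R Quot I" "P (Suc i)" by (rule P_mod)
    interpret PP: module_hom_pair "R Quot I" "P (Suc i)" "P i" by unfold_locales
    have z: "e k \<zero>\<^bsub>Q i\<^esub> = \<zero>\<^bsub>Q k\<^esub>" "\<phi> i \<zero>\<^bsub>Q i\<^esub> = \<zero>\<^bsub>P i\<^esub>" "g \<zero>\<^bsub>Q i\<^esub> = \<zero>\<^bsub>N\<^esub>" "g1 \<zero>\<^bsub>Q k\<^esub> = \<zero>\<^bsub>N\<^esub>" "\<ominus>\<^bsub>Q k\<^esub> \<zero>\<^bsub>Q k\<^esub> = \<zero>\<^bsub>Q k\<^esub>"
      using module_hom_pair.hom_zero[OF module_hom_pair.intro[OF Q_mod Q_mod] e_hom[of k]]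
        module_hom_pair.hom_zero[OF module_hom_pair.intro[OF Q_mod PR_mod] phi_hom[of i]]
        module_hom_pair.hom_zero[OF QN gh] module_hom_pair.hom_zero[OF QN h12(1)] Qk.M.minus_equality[of "\<zero>\<^bsub>Q k\<^esub>" "\<zero>\<^bsub>Q k\<^esub>"] k
      by simp_all
    have "g2 (d i p) = \<zero>\<^bsub>N\<^esub>" if p: "p \<in> carrier (P (Suc i))" for p
      using key[OF Qi.M.zero_closed p] z d_c[OF p] module_hom_in[OF h12(2) d_c[OF p]] by simp
    then have g2Z: "g2 \<in> ?ZP" using g12(2) by (auto simp: ext_cocycles_def compose_def hom_group_simps)
    \<comment> \<open>The sign of \<open>dX\<close> is moved into the cochain, so that the
      correction term is literally a coboundary.\<close>
    define g1' where "g1' = (\<lambda>x\<in>carrier (Q k). g1 (\<ominus>\<^bsub>Q k\<^esub> x))"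
    have g1': "g1' \<in> carrier (?HQ k)"
    proof -
      interpret QN: module_hom_pair R "Q k" NR by (rule QN)
      have "(\<lambda>x. g1 (\<ominus>\<^bsub>Q k\<^esub> x)) \<in> module_hom R (Q k) NR"
        by (rule module_hom_comp[OF _ h12(1)], rule module_homI) (auto simp: Qk.M.minus_add Qk.smult_r_minus)
      from restrict_hom[OF QN.module_hom_pair_axioms this] show ?thesis by (simp add: g1'_def)
    qed
    have "g = ?pe k g1' \<otimes>\<^bsub>?HQ i\<^esub> ?ph g2"
    proof
      fix q show "g q = (?pe k g1' \<otimes>\<^bsub>?HQ i\<^esub> ?ph g2) q"
      proof (cases "q \<in> carrier (Q i)")
        case True
        have "d i \<zero>\<^bsub>P (Suc i)\<^esub> = \<zero>\<^bsub>P i\<^esub>" using PP.hom_zero[OF d_hom] .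
        then have "g1 (\<ominus>\<^bsub>Q k\<^esub> e k q) \<oplus>\<^bsub>N\<^esub> g2 (\<phi> i q) = g q"
          using key[OF True Ps.M.zero_closed] phi_c[OF True] by simp
        then show ?thesis using True e_c k by (simp add: hom_group_simps compose_def g1'_def)
      next
        case False
        then show ?thesis using gc by (auto simp: hom_group_simps extensional_def)
      qed
    qed
    then show ?thesis using g2Z g1' unfolding BQ by blast
  qed
  interpret ZPg: comm_group "(?HP i)\<lparr>carrier := ?ZP\<rparr>" by (rule subgroup_comm_group[OF HPg sZP])
  interpret ZQg: comm_group "(?HQ i)\<lparr>carrier := ?ZQ\<rparr>" by (rule subgroup_comm_group[OF HQg sZQ])
  have sBQ': "subgroup ?BQ ((?HQ i)\<lparr>carrier := ?ZQ\<rparr>)"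
    using HQ.subgroup_incl[OF sBQ sZQ BQ_ZQ] .
  have nBQ: "normal ?BQ ((?HQ i)\<lparr>carrier := ?ZQ\<rparr>)" by (rule ZQg.subgroup_imp_normal[OF sBQ'])
  interpret B: normal ?BQ "(?HQ i)\<lparr>carrier := ?ZQ\<rparr>" by (rule nBQ)
  interpret Fg: group "ext_group R Q e NR i" unfolding ext_group_def by (rule B.factorgroup_is_group)
  \<comment> \<open>The pullback with values in the cohomology of \<open>Q\<close>. It is onto with
    kernel \<open>?BP\<close>, so the first isomorphism theorem gives the isomorphism of
    \<open>Ext\<close> groups.\<close>
  let ?h = "\<lambda>f. ?BQ #>\<^bsub>?HQ i\<^esub> ?ph f"
  have rc: "?BQ #>\<^bsub>(?HQ i)\<lparr>carrier := ?ZQ\<rparr>\<^esub> x = ?BQ #>\<^bsub>?HQ i\<^esub> x" for x by (simp add: r_coset_def)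
  have carF: "carrier (ext_group R Q e NR i) = {?BQ #>\<^bsub>?HQ i\<^esub> x | x. x \<in> ?ZQ}"
    by (auto simp: ext_group_def FactGroup_def RCOSETS_def rc)
  interpret hh: group_hom "(?HP i)\<lparr>carrier := ?ZP\<rparr>" "ext_group R Q e NR i" ?h
  proof (intro group_hom.intro group_hom_axioms.intro ZPg.is_group Fg.is_group homI)
    fix f assume f: "f \<in> carrier ((?HP i)\<lparr>carrier := ?ZP\<rparr>)"
    then show "?h f \<in> carrier (ext_group R Q e NR i)" using ZP_ZQ by (auto simp: carF)
    fix g assume g: "g \<in> carrier ((?HP i)\<lparr>carrier := ?ZP\<rparr>)"
    have "?h f \<otimes>\<^bsub>ext_group R Q e NR i\<^esub> ?h g = ?BQ #>\<^bsub>?HQ i\<^esub> (?ph f \<otimes>\<^bsub>?HQ i\<^esub> ?ph g)"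
      using B.rcos_sum[of "?ph f" "?ph g"] f g ZP_ZQ by (simp add: ext_group_def rc)
    then show "?h (f \<otimes>\<^bsub>(?HP i)\<lparr>carrier := ?ZP\<rparr>\<^esub> g) = ?h f \<otimes>\<^bsub>ext_group R Q e NR i\<^esub> ?h g"
      using ph_mult[of f g] f g subgroup.subset[OF sZP] by (simp add: subset_iff)
  qed
  have one: "\<one>\<^bsub>ext_group R Q e NR i\<^esub> = ?BQ" by (simp add: ext_group_def FactGroup_def)
  have ker: "kernel ((?HP i)\<lparr>carrier := ?ZP\<rparr>) (ext_group R Q e NR i) ?h = ?BP"
  proof
    show "kernel ((?HP i)\<lparr>carrier := ?ZP\<rparr>) (ext_group R Q e NR i) ?h \<subseteq> ?BP"
    proof
      fix f assume "f \<in> kernel ((?HP i)\<lparr>carrier := ?ZP\<rparr>) (ext_group R Q e NR i) ?h"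
      then have f: "f \<in> ?ZP" "?h f = ?BQ" by (auto simp: kernel_def one)
      have "?ph f \<in> carrier (?HQ i)" using f ZP_ZQ subgroup.subset[OF sZQ] by blast
      then have "?ph f \<in> ?BQ" using HQ.rcos_self[OF _ sBQ] f(2) by blast
      then show "f \<in> ?BP" using inj f by blast
    qed
    show "?BP \<subseteq> kernel ((?HP i)\<lparr>carrier := ?ZP\<rparr>) (ext_group R Q e NR i) ?h"
      using BP_ZP BP_BQ HQ.coset_join2[OF _ sBQ] subgroup.subset[OF sBQ] by (auto simp: kernel_def one subset_iff)
  qed
  have img: "?h ` carrier ((?HP i)\<lparr>carrier := ?ZP\<rparr>) = carrier (ext_group R Q e NR i)"
  proof
    show "carrier (ext_group R Q e NR i) \<subseteq> ?h ` carrier ((?HP i)\<lparr>carrier := ?ZP\<rparr>)"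
    proof
      fix Y assume "Y \<in> carrier (ext_group R Q e NR i)"
      then obtain g where g: "g \<in> ?ZQ" "Y = ?BQ #>\<^bsub>?HQ i\<^esub> g" by (auto simp: carF)
      obtain f \<beta> where f: "f \<in> ?ZP" "\<beta> \<in> ?BQ" "g = \<beta> \<otimes>\<^bsub>?HQ i\<^esub> ?ph f" using sur[OF g(1)] by blast
      have c: "?ph f \<in> carrier (?HQ i)" "\<beta> \<in> carrier (?HQ i)" using f ZP_ZQ subgroup.subset[OF sZQ] subgroup.subset[OF sBQ] by blast+
      have "Y = (?BQ #>\<^bsub>?HQ i\<^esub> \<beta>) #>\<^bsub>?HQ i\<^esub> ?ph f"
        unfolding g f(3) using HQ.coset_mult_assoc[OF subgroup.subset[OF sBQ] c(2,1)] by simp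
      also have "?BQ #>\<^bsub>?HQ i\<^esub> \<beta> = ?BQ" using HQ.coset_join2[OF c(2) sBQ f(2)] .
      finally show "Y \<in> ?h ` carrier ((?HP i)\<lparr>carrier := ?ZP\<rparr>)" using f by auto
    qed
  qed (use hh.hom_closed in blast)
  have "(\<lambda>Y. the_elem (?h ` Y)) \<in> iso (((?HP i)\<lparr>carrier := ?ZP\<rparr>) Mod ?BP) (ext_group R Q e NR i)"
    using hh.FactGroup_iso_set[OF img] unfolding ker .
  moreover have "ext_map R Q e NR \<phi> i = (\<lambda>Y. the_elem (?h ` Y))" by (simp add: ext_map_def fun_eq_iff)
  ultimately show ?thesis unfolding ext_group_def[of "R Quot I"] by simp
qed

end

section \<open>Climbing the chain of ideals\<close>

text \<open>The unit alone is a dual basis of the regular module. This is the step in which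
  \<open>V\<close> and \<open>D\<close> are all of \<open>C\<close>, as \<open>hom_exact\<close>
  requires.\<close>

lemma heredity_step_top:
  assumes "ring C" "ideal U C"
  shows "heredity_step C U (carrier C) \<one>\<^bsub>C\<^esub> (carrier C) {undefined} (\<lambda>_. \<one>\<^bsub>C\<^esub>) (\<lambda>_ u. u)"
proof -
  interpret ring C by fact
  interpret U: ideal U C by fact
  have "u \<ominus>\<^bsub>C\<^esub> finsum C (\<lambda>i. u \<otimes>\<^bsub>C\<^esub> \<one>\<^bsub>C\<^esub>) {i \<in> {undefined}. u \<noteq> \<zero>\<^bsub>C\<^esub>} \<in> U" if "u \<in> carrier C" for u
  proof (cases "u = \<zero>\<^bsub>C\<^esub>")
    case False
    then have set: "{i \<in> {undefined}. u \<noteq> \<zero>\<^bsub>C\<^esub>} = {undefined}" by auto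
    have "finsum C (\<lambda>i. u \<otimes>\<^bsub>C\<^esub> \<one>\<^bsub>C\<^esub>) {undefined} = u" using that by simp
    then show ?thesis unfolding set using that by (simp add: a_minus_def r_neg)
  qed (simp add: a_minus_def)
  then show ?thesis unfolding heredity_step_def ideal_pair_def ideal_pair_axioms_def
    using assms ring.oneideal[OF assms(1)] U.a_subset by auto
qed

text \<open>Modulo \<open>T 0\<close>, the kernel of \<open>h\<close>, exactness of the cone is its
  acyclicity. Each heredity step passes exactness on to the next ideal, up to \<open>T l\<close>,
  the preimage of \<open>I\<close>. This ideal annihilates \<open>N\<close>, so the trivial step
  then gives exactness of the homomorphisms into \<open>N\<close>, which is what
  \<open>ext_map_iso\<close> asks for.\<close>

theorem strong_idempotentI:
  fixes C :: "('a, 'ca) ring_scheme" and R :: "('b, 'cb) ring_scheme" and L :: "nat \<Rightarrow> 'i set"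
  assumes h: "ring_hom_ring C R h" and surj: "h ` carrier C = carrier R" and I: "ideal I R"
    and T0: "T 0 = {c \<in> carrier C. h c = \<zero>\<^bsub>R\<^esub>}" and Tl: "T l = {c \<in> carrier C. h c \<in> I}"
    and T: "\<And>t. t \<le> l \<Longrightarrow> ideal (T t) C"
    and step: "\<And>t. t < l \<Longrightarrow> heredity_step C (T t) (T (Suc t)) (e t) (D t) (L t) (q t) (f t)"
  shows "strong_idempotent TYPE('m) TYPE('n) TYPE('p) TYPE('q) I R"
  unfolding strong_idempotent_def Let_def
proof (intro conjI I allI impI)
  fix M :: "('b set, 'm) module" and N :: "('b set, 'n) module" and P :: "nat \<Rightarrow> ('b set, 'p) module" and d a
    and Q :: "nat \<Rightarrow> ('b, 'q) module" and eQ b \<phi> i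
  assume *: "left_module (R Quot I) M \<and> left_module (R Quot I) N \<and> projective_resolution (R Quot I) M P d a \<and>
    projective_resolution R (restrict_scalars ((+>\<^bsub>R\<^esub>) I) M) Q eQ b \<and>
    comparison_map R Q eQ b (\<lambda>n. restrict_scalars ((+>\<^bsub>R\<^esub>) I) (P n)) d a \<phi>" and i: "1 \<le> (i :: nat)"
  interpret ext_cone C R h I M N P d a Q eQ b \<phi>
    using * h surj I by (simp add: ext_cone_def ext_cone_axioms_def)
  have Tsub: "T t \<subseteq> T (Suc t)" if "t < l" for t
    using step[OF that] by (simp add: heredity_step_def ideal_pair_def ideal_pair_axioms_def)
  have T_le: "T t \<subseteq> T t'" if "t \<le> t'" "t' \<le> l" for t t'
    using that(1,2)
  proof (induction t' rule: dec_induct)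
    case (step n)
    then show ?case using Tsub[of n] by auto
  qed simp
  have ker: "c \<in> T t" if "c \<in> carrier C" "h c = \<zero>\<^bsub>R\<^esub>" "t \<le> l" for c t
    using that T_le[of 0 t] T0 by auto
  have kerP: "h' c = \<zero>\<^bsub>R Quot I\<^esub>" if "c \<in> T t" "t \<le> l" for c t
    using that T_le[of t l] Tl h'_zero by auto
  have killP: "h' c \<odot>\<^bsub>P n\<^esub> x = \<zero>\<^bsub>P n\<^esub>" if "c \<in> T t" "t \<le> l" "x \<in> carrier (P n)" for c t x n
    using left_module.smult_l_null[OF P_mod that(3)] kerP[OF that(1,2)] by simp
  \<comment> \<open>Every \<open>T t\<close> annihilates the modules \<open>P n\<close>, so on the
    way up only \<open>Q\<close> needs a dual basis. It is projective over \<open>R\<close>, and the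
    kernel \<open>T 0\<close> of \<open>h\<close> is contained in all \<open>T t\<close>.\<close>
  have spanP: "ideal_span (P' n) (T t) = {\<zero>\<^bsub>P' n\<^esub>}" if "t \<le> l" for n t
    by (rule left_module.ideal_span_annihilated[OF P'_mod]) (use killP that in auto)
  have span0: "ideal_span (Qs 0) V = {\<zero>\<^bsub>Qs 0\<^esub>}" if "V \<subseteq> carrier C" for V
  proof
    show "ideal_span (Qs 0) V \<subseteq> {\<zero>\<^bsub>Qs 0\<^esub>}"
    proof
      fix x assume "x \<in> ideal_span (Qs 0) V"
      then have "x \<in> carrier (Qs 0)" by (rule left_module.ideal_span_carrier[OF Qs_mod that])
      then show "x \<in> {\<zero>\<^bsub>Qs 0\<^esub>}" by (simp add: Qs_simps)
    qed
  qed (simp add: ideal_span.zero)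
  have dbQ: "\<exists>(K :: ('q \<times> 'j) set) x g. dual_basis C U V e' D' (Qs n) K x g"
    if "heredity_step C U V e' D' (K' :: 'j set) q' f'" "\<And>c. c \<in> carrier C \<Longrightarrow> h c = \<zero>\<^bsub>R\<^esub> \<Longrightarrow> c \<in> U" for U V e' D' K' q' f' n
  proof (cases n)
    case 0
    have "V \<subseteq> carrier C" using that(1) idealD(1) by (auto simp: heredity_step_def ideal_pair_def ideal_pair_axioms_def)
    from dual_basis_null[OF Qs_mod span0[OF this]] show ?thesis unfolding 0 by blast
  next
    case (Suc k)
    show ?thesis unfolding Suc Qs_simps
      by (rule dual_basis_projective[OF that(1) h surj that(2) Q_proj])
  qed
  have ip: "ideal_pair C U V e' D'" if "heredity_step C U V e' D' K' q' f'" for U V e' D' K' q' f'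
    using that by (simp add: heredity_step_def)
  interpret ch: chain_complex C X dX by (rule chain)
  have ex: "exact_mod (T t) X dX" if "t \<le> l" for t
    using that
  proof (induction t)
    case 0
    have z: "x \<ominus>\<^bsub>X n\<^esub> x \<in> ideal_span (X n) (T 0)" if "x \<in> carrier (X n)" for n x
    proof -
      interpret Xn: left_module C "X n" by (rule X_mod)
      show ?thesis using that by (simp add: a_minus_def Xn.M.r_neg ideal_span.zero)
    qed
    \<comment> \<open>Both components of the cone are modules over \<open>R\<close>, so the kernel
      of \<open>h\<close> annihilates them.\<close>
    have s: "ideal_span (X n) (T 0) = {\<zero>\<^bsub>X n\<^esub>}" for n
    proof (rule left_module.ideal_span_annihilated[OF X_mod])
      fix c x assume c: "c \<in> T 0" and x: "x \<in> carrier (X n)"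
      obtain y z where yz: "x = (y, z)" "y \<in> carrier (Qs n)" "z \<in> carrier (P n)" using x by (auto simp: X_def)
      have "c \<odot>\<^bsub>Qs n\<^esub> y = \<zero>\<^bsub>Qs n\<^esub>"
      proof (cases n)
        case 0
        then show ?thesis using left_module.smult_closed[OF Qs_mod, of c y 0] c T0 yz by (auto simp: Qs_simps)
      next
        case (Suc k)
        then show ?thesis using c T0 yz left_module.smult_l_null[OF Q_mod, of y k] by (simp add: Qs_simps)
      qed
      then show "c \<odot>\<^bsub>X n\<^esub> x = \<zero>\<^bsub>X n\<^esub>" using killP[OF c _ yz(3)] by (simp add: X_def yz)
    qed
    show ?case unfolding exact_mod_def
    proof (intro conjI ballI allI impI)
      fix x assume x: "x \<in> carrier (X 0)"
      show "\<exists>y\<in>carrier (X 1). x \<ominus>\<^bsub>X 0\<^esub> dX 0 y \<in> ideal_span (X 0) (T 0)" using cone_exact0[OF x] z[OF x] by metis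
    next
      fix n x assume x: "x \<in> carrier (X (Suc n))" and dx: "dX n x \<in> ideal_span (X n) (T 0)"
      show "\<exists>y\<in>carrier (X (Suc (Suc n))). x \<ominus>\<^bsub>X (Suc n)\<^esub> dX (Suc n) y \<in> ideal_span (X (Suc n)) (T 0)"
        using cone_exactS[OF x] dx z[OF x] s[of n] by (metis singletonD)
    qed
  next
    case (Suc t)
    note st = step[of t, OF Suc_le_lessD[OF Suc.prems]]
    have db: "\<exists>(K :: (('q \<times> 'i) + 'i) set) x g. dual_basis C (T t) (T (Suc t)) (e t) (D t) (X n) K x g" for n
    proof -
      obtain K :: "('q \<times> 'i) set" and x g where 1: "dual_basis C (T t) (T (Suc t)) (e t) (D t) (Qs n) K x g"
        using dbQ[OF st] ker Suc.prems by (metis Suc_leD)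
      have 2: "dual_basis C (T t) (T (Suc t)) (e t) (D t) (P' n) ({} :: 'i set) (\<lambda>_. undefined) (\<lambda>_ _. undefined)"
        by (rule dual_basis_null[OF P'_mod spanP[OF Suc.prems]])
      show ?thesis unfolding X_def using dual_basis_dsum[OF ip[OF st] Qs_mod P'_mod 1 2] by blast
    qed
    interpret resolved_complex C X dX "T t" "T (Suc t)" "e t" "D t" "TYPE(('q \<times> 'i) + 'i)"
      using ip[OF st] db Suc by (intro resolved_complex.intro resolved_complex_axioms.intro chain) auto
    show ?case by (rule exact_mod_step)
  qed
  \<comment> \<open>In the last step \<open>P\<close> needs a dual basis as well. It is projective
    over \<open>R Quot I\<close>, and the kernel of \<open>h'\<close> is \<open>T l\<close>, the
    smaller ideal of this step.\<close>
  note top = heredity_step_top[OF h.R.ring_axioms T[OF order_refl]]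
  have db: "\<exists>(K :: (('q \<times> 'i) + ('p \<times> 'i)) set) x g. dual_basis C (T l) (carrier C) \<one>\<^bsub>C\<^esub> (carrier C) (X n) K x g" for n
  proof -
    obtain K :: "('q \<times> 'i) set" and x g where 1: "dual_basis C (T l) (carrier C) \<one>\<^bsub>C\<^esub> (carrier C) (Qs n) K x g"
      using dbQ[OF top] ker by (metis order_refl)
    have "\<exists>(K :: ('p \<times> 'i) set) x g. dual_basis C (T l) (carrier C) \<one>\<^bsub>C\<^esub> (carrier C) (P' n) K x g"
      by (rule dual_basis_projective[OF top h'_ring h'_surj _ P_proj]) (use h'_zero Tl in auto)
    then obtain K' :: "('p \<times> 'i) set" and x' g' where 2: "dual_basis C (T l) (carrier C) \<one>\<^bsub>C\<^esub> (carrier C) (P' n) K' x' g'"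
      by blast
    show ?thesis unfolding X_def using dual_basis_dsum[OF ip[OF top] Qs_mod P'_mod 1 2] by blast
  qed
  interpret rc: resolved_complex C X dX "T l" "carrier C" "\<one>\<^bsub>C\<^esub>" "carrier C" "TYPE(('q \<times> 'i) + ('p \<times> 'i))"
    using ip[OF top] db ex by (intro resolved_complex.intro resolved_complex_axioms.intro chain) auto
  show "ext_map R Q eQ NR \<phi> i \<in> iso (ext_group (R Quot I) P d N i) (ext_group R Q eQ NR i)"
  proof (rule ext_map_iso[OF _ i])
    fix n g assume g: "g \<in> module_hom C (X (Suc n)) NC"
      and gd: "\<And>x. x \<in> carrier (X (Suc (Suc n))) \<Longrightarrow> g (dX (Suc n) x) = \<zero>\<^bsub>N\<^esub>"
    show "\<exists>g'\<in>module_hom C (X n) NC. \<forall>x\<in>carrier (X (Suc n)). g' (dX n x) = g x"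
    proof (rule rc.hom_exact[OF refl refl NC_mod _ g])
      show "c \<odot>\<^bsub>NC\<^esub> y = \<zero>\<^bsub>NC\<^esub>" if "c \<in> T l" "y \<in> carrier NC" for c y
        using left_module.smult_l_null[OF N, of y] kerP[OF that(1)] that(2) by simp
    qed (use gd in simp)
  qed
qed

section \<open>Tensor products\<close>

subsection \<open>Vector spaces given by generators and relations\<close>

text \<open>Common ground of tensor products of two spaces and of families: a free space modulo
  relations, where maps are lifted and compared on generators.\<close>

locale presented = field K for K :: "'k ring" +
  fixes X :: "'x set" and rel :: "('x \<Rightarrow> 'k) set"
  assumes rel: "rel \<subseteq> carrier (free_module K X)"
begin

abbreviation "F \<equiv> free_module K X"
abbreviation "null \<equiv> lspan K F rel"
abbreviation "pr x \<equiv> null +>\<^bsub>F\<^esub> free_gen K x"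

sublocale F: kspace K F
  by (intro kspace.intro field_axioms free_left_module)

sublocale quot_mod K F null
  by (intro quot_mod.intro quot_mod_axioms.intro free_left_module F.lspan_submodule rel)

lemma pr_in: "x \<in> X \<Longrightarrow> pr x \<in> carrier Q"
  by (intro cls_in free_gen_in)

lemma pr_generate:
  assumes U: "left_submodule K Q U" and g: "\<And>x. x \<in> X \<Longrightarrow> pr x \<in> U"
  shows "U = carrier Q"
proof -
  have "{v \<in> carrier F. cls v \<in> U} = carrier F"
    by (rule free_submodule_eq[OF MQ.hom_vimage[OF cls_hom U]]) (use g free_gen_in in auto)
  then show ?thesis using left_submoduleD(1)[OF U] by (auto simp: quot_carrier)
qed

lemma pr_lift:
  assumes N: "left_module K N" and g: "g \<in> X \<rightarrow> carrier N" and r: "\<And>r. r \<in> rel \<Longrightarrow> free_lift K N g r = \<zero>\<^bsub>N\<^esub>"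
  shows "\<exists>f\<in>module_hom K Q N. \<forall>x\<in>X. f (pr x) = g x"
proof -
  interpret N: left_module K N by fact
  interpret FN: module_hom_pair K F N by unfold_locales
  have h: "free_lift K N g \<in> module_hom K F N" by (rule N.free_lift_hom[OF g])
  have "left_submodule K N {\<zero>\<^bsub>N\<^esub>}" by (rule left_submoduleI) auto
  from FN.hom_vimage[OF h this] have "null \<subseteq> {v \<in> carrier F. free_lift K N g v \<in> {\<zero>\<^bsub>N\<^esub>}}"
    by (rule F.lspan_minimal[rotated]) (use r rel in auto)
  then have "free_lift K N g u = \<zero>\<^bsub>N\<^esub>" if "u \<in> null" for u using that by blast
  from quot_lift[OF N h this] obtain f where f: "f \<in> module_hom K Q N"
    "\<And>x. x \<in> carrier F \<Longrightarrow> f (cls x) = free_lift K N g x" by blast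
  have "f (pr x) = g x" if "x \<in> X" for x
    using f(2)[OF free_gen_in[OF that]] N.free_lift_gen[of g x] g that by auto
  then show ?thesis using f(1) by blast
qed

lemma pr_hom_eq:
  assumes N: "left_module K N" and f: "f \<in> module_hom K Q N" and g: "g \<in> module_hom K Q N"
    and eq: "\<And>x. x \<in> X \<Longrightarrow> f (pr x) = g (pr x)" and z: "z \<in> carrier Q"
  shows "f z = g z"
proof -
  interpret N: left_module K N by fact
  interpret QN: module_hom_pair K Q N by unfold_locales
  have "{x \<in> carrier Q. f x = g x} = carrier Q"
    by (rule pr_generate[OF QN.hom_equalizer[OF f g]]) (use eq pr_in in auto)
  then show ?thesis using z by blast
qed

end

subsection \<open>Tensor products of two spaces\<close>

locale tensor_pair = field K + V: left_module K V + W: left_module K W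
  for K :: "'k ring" and V :: "('k, 'v) module" and W :: "('k, 'w) module"
begin

sublocale P: presented K "carrier V \<times> carrier W" "tensor_relations K V W"
proof
  interpret F: left_module K "free_module K (carrier V \<times> carrier W)" by (rule free_left_module)
  have g: "v \<in> carrier V \<Longrightarrow> w \<in> carrier W \<Longrightarrow> free_gen K (v, w) \<in> carrier (free_module K (carrier V \<times> carrier W))" for v w
    by (rule free_gen_in) auto
  show "tensor_relations K V W \<subseteq> carrier (free_module K (carrier V \<times> carrier W))"
    unfolding tensor_relations_def Let_def
    by (auto intro!: F.M.minus_closed F.M.a_closed g F.smult_closed V.smult_closed W.smult_closed)
qed

abbreviation "T \<equiv> tensor K V W"
abbreviation "pt \<equiv> pure_tensor K V W"

lemma T_eq: "T = P.Q" by (simp add: tensor_def tensor_null_def)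
lemma pt_eq: "pt v w = P.pr (v, w)" by (simp add: pure_tensor_def tensor_null_def)

sublocale T: left_module K T unfolding T_eq by (rule P.quot_left_module)

lemma pt_in: "v \<in> carrier V \<Longrightarrow> w \<in> carrier W \<Longrightarrow> pt v w \<in> carrier T"
  unfolding T_eq pt_eq by (intro P.pr_in) auto

lemma free_gen_pair: "v \<in> carrier V \<Longrightarrow> w \<in> carrier W \<Longrightarrow> free_gen K (v, w) \<in> carrier P.F"
  by (rule free_gen_in) auto

lemma pt_add_left:
  assumes "v \<in> carrier V" "v' \<in> carrier V" "w \<in> carrier W"
  shows "pt (v \<oplus>\<^bsub>V\<^esub> v') w = pt v w \<oplus>\<^bsub>T\<^esub> pt v' w"
proof -
  have "free_gen K (v \<oplus>\<^bsub>V\<^esub> v', w) \<ominus>\<^bsub>P.F\<^esub> (free_gen K (v, w) \<oplus>\<^bsub>P.F\<^esub> free_gen K (v', w)) \<in> tensor_relations K V W"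
    using assms unfolding tensor_relations_def Let_def by blast
  then have "P.cls (free_gen K (v \<oplus>\<^bsub>V\<^esub> v', w)) = P.cls (free_gen K (v, w) \<oplus>\<^bsub>P.F\<^esub> free_gen K (v', w))"
    using assms by (subst P.cls_eq) (auto intro!: free_gen_pair P.F.V.M.a_closed P.F.lspan_incl[OF P.rel])
  then show ?thesis unfolding T_eq pt_eq using assms by (simp add: P.cls_add free_gen_pair)
qed

lemma pt_add_right:
  assumes "v \<in> carrier V" "w \<in> carrier W" "w' \<in> carrier W"
  shows "pt v (w \<oplus>\<^bsub>W\<^esub> w') = pt v w \<oplus>\<^bsub>T\<^esub> pt v w'"
proof -
  have "free_gen K (v, w \<oplus>\<^bsub>W\<^esub> w') \<ominus>\<^bsub>P.F\<^esub> (free_gen K (v, w) \<oplus>\<^bsub>P.F\<^esub> free_gen K (v, w')) \<in> tensor_relations K V W"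
    using assms unfolding tensor_relations_def Let_def by blast
  then have "P.cls (free_gen K (v, w \<oplus>\<^bsub>W\<^esub> w')) = P.cls (free_gen K (v, w) \<oplus>\<^bsub>P.F\<^esub> free_gen K (v, w'))"
    using assms by (subst P.cls_eq) (auto intro!: free_gen_pair P.F.V.M.a_closed P.F.lspan_incl[OF P.rel])
  then show ?thesis unfolding T_eq pt_eq using assms by (simp add: P.cls_add free_gen_pair)
qed

lemma pt_smult_left:
  assumes "k \<in> carrier K" "v \<in> carrier V" "w \<in> carrier W"
  shows "pt (k \<odot>\<^bsub>V\<^esub> v) w = k \<odot>\<^bsub>T\<^esub> pt v w"
proof -
  have "free_gen K (k \<odot>\<^bsub>V\<^esub> v, w) \<ominus>\<^bsub>P.F\<^esub> k \<odot>\<^bsub>P.F\<^esub> free_gen K (v, w) \<in> tensor_relations K V W"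
    using assms unfolding tensor_relations_def Let_def by blast
  then have "P.cls (free_gen K (k \<odot>\<^bsub>V\<^esub> v, w)) = P.cls (k \<odot>\<^bsub>P.F\<^esub> free_gen K (v, w))"
    using assms by (subst P.cls_eq) (auto intro!: free_gen_pair P.F.V.smult_closed V.smult_closed P.F.lspan_incl[OF P.rel])
  then show ?thesis unfolding T_eq pt_eq using assms by (simp add: P.cls_smult free_gen_pair)
qed

lemma pt_smult_right:
  assumes "k \<in> carrier K" "v \<in> carrier V" "w \<in> carrier W"
  shows "pt v (k \<odot>\<^bsub>W\<^esub> w) = k \<odot>\<^bsub>T\<^esub> pt v w"
proof -
  have "free_gen K (v, k \<odot>\<^bsub>W\<^esub> w) \<ominus>\<^bsub>P.F\<^esub> k \<odot>\<^bsub>P.F\<^esub> free_gen K (v, w) \<in> tensor_relations K V W"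
    using assms unfolding tensor_relations_def Let_def by blast
  then have "P.cls (free_gen K (v, k \<odot>\<^bsub>W\<^esub> w)) = P.cls (k \<odot>\<^bsub>P.F\<^esub> free_gen K (v, w))"
    using assms by (subst P.cls_eq) (auto intro!: free_gen_pair P.F.V.smult_closed W.smult_closed P.F.lspan_incl[OF P.rel])
  then show ?thesis unfolding T_eq pt_eq using assms by (simp add: P.cls_smult free_gen_pair)
qed

lemma pt_left_hom: "w \<in> carrier W \<Longrightarrow> (\<lambda>v. pt v w) \<in> module_hom K V T"
  by (rule module_homI) (auto simp: pt_in pt_add_left pt_smult_left)

lemma pt_right_hom: "v \<in> carrier V \<Longrightarrow> (\<lambda>w. pt v w) \<in> module_hom K W T"
  by (rule module_homI) (auto simp: pt_in pt_add_right pt_smult_right)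

lemma tensor_generate:
  assumes "left_submodule K T U" "\<And>v w. v \<in> carrier V \<Longrightarrow> w \<in> carrier W \<Longrightarrow> pt v w \<in> U"
  shows "U = carrier T"
  using assms P.pr_generate[of U] unfolding T_eq pt_eq by auto

lemma tensor_induct [consumes 1, case_names pure add]:
  assumes x: "x \<in> carrier T" and p: "\<And>v w. v \<in> carrier V \<Longrightarrow> w \<in> carrier W \<Longrightarrow> Q (pt v w)"
    and a: "\<And>x y. x \<in> carrier T \<Longrightarrow> y \<in> carrier T \<Longrightarrow> Q x \<Longrightarrow> Q y \<Longrightarrow> Q (x \<oplus>\<^bsub>T\<^esub> y)"
  shows "Q x"
proof -
  \<comment> \<open>The predicate \<open>Q\<close> need not be stable under scalars, so all
    multiples are included; for a pure tensor the scalar is absorbed by the first factor.\<close>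
  let ?U = "{x \<in> carrier T. \<forall>k\<in>carrier K. Q (k \<odot>\<^bsub>T\<^esub> x)}"
  have q0: "Q \<zero>\<^bsub>T\<^esub>" using p[OF V.M.zero_closed W.M.zero_closed]
    pt_smult_left[OF zero_closed V.M.zero_closed W.M.zero_closed] pt_in[OF V.M.zero_closed W.M.zero_closed]
    V.smult_l_null[OF V.M.zero_closed] by simp
  have "?U = carrier T"
  proof (rule tensor_generate[OF left_submoduleI])
    fix v w assume "v \<in> carrier V" "w \<in> carrier W"
    then show "pt v w \<in> ?U" using p by (auto simp: pt_in pt_smult_left[symmetric] V.smult_closed)
  qed (use a q0 in \<open>auto simp: T.smult_closed T.smult_r_distr T.smult_assoc1[symmetric]\<close>)
  then have "Q (\<one>\<^bsub>K\<^esub> \<odot>\<^bsub>T\<^esub> x)" using x by blast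
  then show ?thesis using x by (simp add: T.smult_one)
qed

lemma tensor_lift:
  assumes N: "left_module K N"
    and l: "\<And>w. w \<in> carrier W \<Longrightarrow> (\<lambda>v. g v w) \<in> module_hom K V N"
    and r: "\<And>v. v \<in> carrier V \<Longrightarrow> (\<lambda>w. g v w) \<in> module_hom K W N"
  shows "\<exists>f\<in>module_hom K T N. \<forall>v\<in>carrier V. \<forall>w\<in>carrier W. f (pt v w) = g v w"
proof -
  interpret N: left_module K N by fact
  interpret FN: module_hom_pair K P.F N by unfold_locales
  let ?g = "\<lambda>(v, w). g v w" and ?G = "\<lambda>x. free_lift K N (\<lambda>(v, w). g v w) x"
  have gN: "v \<in> carrier V \<Longrightarrow> w \<in> carrier W \<Longrightarrow> g v w \<in> carrier N" for v w using module_hom_in[OF l] by blast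
  have g: "?g \<in> carrier V \<times> carrier W \<rightarrow> carrier N" using gN by auto
  have h: "?G \<in> module_hom K P.F N" by (rule N.free_lift_hom[OF g])
  have gen: "?G (free_gen K (v, w)) = g v w" if "v \<in> carrier V" "w \<in> carrier W" for v w
    using N.free_lift_gen[of ?g "(v, w)"] gN that by simp
  have d: "?G (x \<ominus>\<^bsub>P.F\<^esub> y) = \<zero>\<^bsub>N\<^esub>" if "x \<in> carrier P.F" "y \<in> carrier P.F" "?G x = ?G y" for x y
    using FN.hom_diff[OF h that(1,2)] that(3) module_hom_in[OF h that(2)] by (simp add: a_minus_def N.M.r_neg)
  have "?G u = \<zero>\<^bsub>N\<^esub>" if "u \<in> tensor_relations K V W" for u
    using that unfolding tensor_relations_def Let_def
    apply (elim UnE CollectE exE conjE; hypsubst)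
    by (rule d; simp add: free_gen_pair P.F.V.smult_closed V.smult_closed W.smult_closed gen
        module_hom_add[OF h] module_hom_smult[OF h] module_hom_add[OF l] module_hom_add[OF r]
        module_hom_smult[OF l] module_hom_smult[OF r])+
  from P.pr_lift[OF N g this] show ?thesis unfolding T_eq pt_eq by auto
qed

lemma tensor_hom_eq:
  assumes N: "left_module K N" and f: "f \<in> module_hom K T N" and g: "g \<in> module_hom K T N"
    and eq: "\<And>v w. v \<in> carrier V \<Longrightarrow> w \<in> carrier W \<Longrightarrow> f (pt v w) = g (pt v w)" and z: "z \<in> carrier T"
  shows "f z = g z"
  using P.pr_hom_eq[OF N f[unfolded T_eq] g[unfolded T_eq] _ z[unfolded T_eq]] eq unfolding pt_eq by auto

end

subsection \<open>Tensor products of families\<close>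

text \<open>The field as a space over itself, the target of linear functionals:
  \<open>module_hom\<close> expects records with a scalar multiplication.\<close>

definition ring_module :: "'k ring \<Rightarrow> ('k, 'k) module" where
  "ring_module K = \<lparr>carrier = carrier K, mult = mult K, one = one K, zero = zero K, add = add K, smult = mult K\<rparr>"

lemma ring_module_simps [simp]:
  "carrier (ring_module K) = carrier K" "zero (ring_module K) = zero K" "add (ring_module K) = add K"
  "smult (ring_module K) = mult K"
  by (simp_all add: ring_module_def)

lemma ring_module_left_module: assumes "ring K" shows "left_module K (ring_module K)"
proof -
  interpret ring K by fact
  have "abelian_group (ring_module K)"
  proof (rule abelian_groupI, goal_cases)
    case (6 x) then show ?case by (intro bexI[of _ "\<ominus>\<^bsub>K\<^esub> x"]) (auto simp: l_neg)
  qed (auto simp: a_ac)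
  then show ?thesis
    by (intro left_module.intro left_module_axioms.intro ring_axioms) (auto simp: l_distr r_distr m_assoc)
qed

locale mtensor_family = field K for K :: "'k ring" +
  fixes I :: "'i set" and V :: "'i \<Rightarrow> ('k, 'v) module"
  assumes V: "\<And>i. i \<in> I \<Longrightarrow> left_module K (V i)"
begin

abbreviation "X \<equiv> (\<Pi>\<^sub>E i\<in>I. carrier (V i))"

lemma upd_in: "t \<in> X \<Longrightarrow> i \<in> I \<Longrightarrow> u \<in> carrier (V i) \<Longrightarrow> t(i := u) \<in> X"
  by (auto simp: PiE_def extensional_def)

lemma V_closed:
  "i \<in> I \<Longrightarrow> u \<in> carrier (V i) \<Longrightarrow> v \<in> carrier (V i) \<Longrightarrow> u \<oplus>\<^bsub>V i\<^esub> v \<in> carrier (V i)"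
  "i \<in> I \<Longrightarrow> k \<in> carrier K \<Longrightarrow> u \<in> carrier (V i) \<Longrightarrow> k \<odot>\<^bsub>V i\<^esub> u \<in> carrier (V i)"
proof -
  assume i: "i \<in> I"
  interpret left_module K "V i" using V[OF i] .
  show "u \<in> carrier (V i) \<Longrightarrow> v \<in> carrier (V i) \<Longrightarrow> u \<oplus>\<^bsub>V i\<^esub> v \<in> carrier (V i)" by simp
  show "k \<in> carrier K \<Longrightarrow> u \<in> carrier (V i) \<Longrightarrow> k \<odot>\<^bsub>V i\<^esub> u \<in> carrier (V i)" by (rule smult_closed)
qed

sublocale P: presented K X "mtensor_relations K I V"
proof
  interpret F: left_module K "free_module K X" by (rule free_left_module)
  show "mtensor_relations K I V \<subseteq> carrier (free_module K X)"
    unfolding mtensor_relations_def Let_def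
    by (auto intro!: F.M.minus_closed F.M.a_closed F.smult_closed free_gen_in upd_in V_closed)
qed

abbreviation "T \<equiv> mtensor K I V"

lemma T_eq: "T = P.Q" by (simp add: mtensor_def mtensor_null_def)
lemma mpure_eq: "mpure K I V t = P.pr t" by (simp add: mpure_def mtensor_null_def)

lemma T_left_module: "left_module K T" unfolding T_eq by (rule P.quot_left_module)

lemma mpure_in: "t \<in> X \<Longrightarrow> mpure K I V t \<in> carrier T"
  unfolding T_eq mpure_eq by (rule P.pr_in)

lemma mtensor_generate:
  assumes "left_submodule K T U" "\<And>t. t \<in> X \<Longrightarrow> mpure K I V t \<in> U"
  shows "U = carrier T"
  using assms P.pr_generate[of U] unfolding T_eq mpure_eq by auto

lemma mtensor_lift:
  assumes N: "left_module K N" and g: "g \<in> X \<rightarrow> carrier N"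
    and ga: "\<And>t i u v. t \<in> X \<Longrightarrow> i \<in> I \<Longrightarrow> u \<in> carrier (V i) \<Longrightarrow> v \<in> carrier (V i) \<Longrightarrow>
      g (t(i := u \<oplus>\<^bsub>V i\<^esub> v)) = g (t(i := u)) \<oplus>\<^bsub>N\<^esub> g (t(i := v))"
    and gs: "\<And>t i k u. t \<in> X \<Longrightarrow> i \<in> I \<Longrightarrow> k \<in> carrier K \<Longrightarrow> u \<in> carrier (V i) \<Longrightarrow>
      g (t(i := k \<odot>\<^bsub>V i\<^esub> u)) = k \<odot>\<^bsub>N\<^esub> g (t(i := u))"
  shows "\<exists>f\<in>module_hom K T N. \<forall>t\<in>X. f (mpure K I V t) = g t"
proof -
  interpret N: left_module K N by fact
  interpret FN: module_hom_pair K P.F N by unfold_locales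
  have h: "free_lift K N g \<in> module_hom K P.F N" by (rule N.free_lift_hom[OF g])
  have gen: "free_lift K N g (free_gen K t) = g t" if "t \<in> X" for t
    using N.free_lift_gen[of g t] g that by auto
  have d: "free_lift K N g (x \<ominus>\<^bsub>P.F\<^esub> y) = \<zero>\<^bsub>N\<^esub>" if "x \<in> carrier P.F" "y \<in> carrier P.F" "free_lift K N g x = free_lift K N g y" for x y
    using FN.hom_diff[OF h that(1,2)] that(3) module_hom_in[OF h that(2)] by (simp add: a_minus_def N.M.r_neg)
  have "free_lift K N g u = \<zero>\<^bsub>N\<^esub>" if "u \<in> mtensor_relations K I V" for u
    using that unfolding mtensor_relations_def Let_def
    apply (elim UnE CollectE exE conjE; hypsubst)
    by (rule d; simp add: free_gen_in upd_in V_closed P.F.V.smult_closed gen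
        module_hom_add[OF h] module_hom_smult[OF h] ga gs)+
  from P.pr_lift[OF N g this] show ?thesis unfolding T_eq mpure_eq by auto
qed

end

section \<open>Graded algebras and their monomials\<close>

subsection \<open>Graded algebras\<close>

lemma kalgebra_iff:
  "kalgebra K A \<Longrightarrow> field K \<and> left_module K A \<and> ring A"
  unfolding kalgebra_def using vectorspaceD by blast

text \<open>Linear extension from the free space on \<open>B\<close> is bijective, and the entries
  of its inverse are the coordinate functionals.\<close>

lemma (in kspace) coordinates:
  assumes B: "vectorspace.basis K V B"
  obtains c where "\<And>b. b \<in> B \<Longrightarrow> c b \<in> module_hom K V (ring_module K)"
    "\<And>b b'. b \<in> B \<Longrightarrow> b' \<in> B \<Longrightarrow> c b b' = (if b' = b then \<one>\<^bsub>K\<^esub> else \<zero>\<^bsub>K\<^esub>)"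
proof -
  let ?F = "free_module K B"
  have BV: "B \<subseteq> carrier V" and li: "vs.lin_indpt B" and gen: "vs.gen_set B"
    using B unfolding vs.basis_def by auto
  interpret F: left_module K ?F by (rule free_left_module)
  interpret FV: module_hom_pair K ?F V by unfold_locales
  let ?L = "free_lift K V (\<lambda>b. b)"
  have id: "(\<lambda>b. b) \<in> B \<rightarrow> carrier V" using BV by auto
  have L: "?L \<in> module_hom K ?F V" by (rule V.free_lift_hom[OF id])
  have gL: "?L (free_gen K b) = b" if "b \<in> B" for b using V.free_lift_gen[of "\<lambda>b. b" b] BV that by auto
  have z: "v = \<zero>\<^bsub>?F\<^esub>" if v: "v \<in> carrier ?F" "?L v = \<zero>\<^bsub>V\<^esub>" for v
  proof (rule ccontr)
    assume "v \<noteq> \<zero>\<^bsub>?F\<^esub>"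
    then obtain b where b: "v b \<noteq> \<zero>\<^bsub>K\<^esub>" by (auto simp: free_module_simps fun_eq_iff)
    let ?S = "{x. v x \<noteq> \<zero>\<^bsub>K\<^esub>}"
    have "finite ?S" "?S \<subseteq> B" "v \<in> ?S \<rightarrow> carrier K" using v by (auto simp: free_module_simps)
    moreover have "vs.lincomb v ?S = \<zero>\<^bsub>V\<^esub>" using v(2) by (simp add: vs.lincomb_def free_lift_def)
    ultimately show False using li b unfolding vs.lin_dep_def by blast
  qed
  have inj: "inj_on ?L (carrier ?F)"
  proof (rule inj_onI)
    fix x y assume xy: "x \<in> carrier ?F" "y \<in> carrier ?F" "?L x = ?L y"
    have "?L (x \<ominus>\<^bsub>?F\<^esub> y) = \<zero>\<^bsub>V\<^esub>"
      using FV.hom_diff[OF L xy(1,2)] xy(3) module_hom_in[OF L xy(2)] by (simp add: a_minus_def V.M.r_neg)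
    then have "x \<ominus>\<^bsub>?F\<^esub> y = \<zero>\<^bsub>?F\<^esub>" using xy by (intro z) simp_all
    then show "x = y" using xy(1,2) by (rule F.diff_zeroD)
  qed
  have surj: "?L ` carrier ?F = carrier V"
  proof -
    have "lspan K V B \<subseteq> ?L ` carrier ?F"
    proof (rule lspan_minimal[OF _ FV.hom_image[OF L]], rule subsetI)
      fix b assume "b \<in> B"
      then show "b \<in> ?L ` carrier ?F" using imageI[OF free_gen_in, of b B ?L] gL by simp
    qed
    then show ?thesis using gen module_hom_in[OF L] by auto
  qed
  define linv where "linv = inv_into (carrier ?F) ?L"
  have linv: "linv x \<in> carrier ?F" "?L (linv x) = x" if "x \<in> carrier V" for x
    using that surj inv_into_into[of x ?L "carrier ?F"] f_inv_into_f[of x ?L "carrier ?F"]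
    unfolding linv_def by simp_all
  have invL: "linv (?L v) = v" if "v \<in> carrier ?F" for v unfolding linv_def using inj that by simp
  have linvh: "linv \<in> module_hom K V ?F"
  proof (rule module_homI)
    fix x y assume xy: "x \<in> carrier V" "y \<in> carrier V"
    have "?L (linv x \<oplus>\<^bsub>?F\<^esub> linv y) = x \<oplus>\<^bsub>V\<^esub> y" using linv xy by (simp add: module_hom_add[OF L])
    then show "linv (x \<oplus>\<^bsub>V\<^esub> y) = linv x \<oplus>\<^bsub>?F\<^esub> linv y" using invL[of "linv x \<oplus>\<^bsub>?F\<^esub> linv y"] linv xy by simp
  next
    fix k x assume k: "k \<in> carrier K" and x: "x \<in> carrier V"
    have "?L (k \<odot>\<^bsub>?F\<^esub> linv x) = k \<odot>\<^bsub>V\<^esub> x" using linv x k by (simp add: module_hom_smult[OF L])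
    then show "linv (k \<odot>\<^bsub>V\<^esub> x) = k \<odot>\<^bsub>?F\<^esub> linv x" using invL[of "k \<odot>\<^bsub>?F\<^esub> linv x"] linv x k F.smult_closed by simp
  qed (rule linv)
  show ?thesis
  proof (rule that[of "\<lambda>b x. linv x b"])
    fix b assume "b \<in> B"
    show "(\<lambda>x. linv x b) \<in> module_hom K V (ring_module K)"
      using linvh unfolding module_hom_def by (auto simp: free_module_simps Pi_iff)
    fix b' assume "b' \<in> B"
    then have "linv b' = free_gen K b'" using invL[OF free_gen_in, of b'] gL by simp
    then show "linv b' b = (if b' = b then \<one>\<^bsub>K\<^esub> else \<zero>\<^bsub>K\<^esub>)" by (simp add: free_gen_def)
  qed
qed

locale gralg = field K + G: comm_monoid G for K :: "'k ring" and G :: "'g monoid" +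
  fixes A :: "('k, 'a) module" (structure) and gr :: "'g \<Rightarrow> 'a set"
  assumes A: "graded_algebra K G A gr"
begin

lemma A_kalgebra: "kalgebra K A" using A by (simp add: graded_algebra_def)

sublocale A: ring A using kalgebra_iff[OF A_kalgebra] by blast
sublocale L: kspace K A using kalgebra_iff[OF A_kalgebra] by (simp add: kspace_def)

lemma smult_mult: "k \<in> carrier K \<Longrightarrow> x \<in> carrier A \<Longrightarrow> y \<in> carrier A \<Longrightarrow> (k \<odot> x) \<otimes> y = k \<odot> (x \<otimes> y)"
  "k \<in> carrier K \<Longrightarrow> x \<in> carrier A \<Longrightarrow> y \<in> carrier A \<Longrightarrow> x \<otimes> (k \<odot> y) = k \<odot> (x \<otimes> y)"
  using kalgebra.smult_mult_left[OF A_kalgebra] kalgebra.smult_mult_right[OF A_kalgebra] by auto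

lemma mult_left_hom: "x \<in> carrier A \<Longrightarrow> (\<lambda>y. x \<otimes> y) \<in> module_hom K A A"
  by (rule module_homI) (auto simp: smult_mult A.r_distr)

lemma mult_right_hom: "y \<in> carrier A \<Longrightarrow> (\<lambda>x. x \<otimes> y) \<in> module_hom K A A"
  by (rule module_homI) (auto simp: smult_mult A.l_distr)

lemma gr_sub: "g \<in> carrier G \<Longrightarrow> left_submodule K A (gr g)"
proof -
  assume "g \<in> carrier G"
  then have "VectorSpace.subspace K (gr g) A" using A by (simp add: graded_algebra_def)
  then have "submodule K (gr g) A" by (simp add: subspace_def)
  then show ?thesis by (auto simp: submodule_def intro!: left_submoduleI)
qed

lemma gr_carrier: "g \<in> carrier G \<Longrightarrow> x \<in> gr g \<Longrightarrow> x \<in> carrier A"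
  using left_submoduleD(2)[OF gr_sub] .

lemma gr_mult: "g \<in> carrier G \<Longrightarrow> h \<in> carrier G \<Longrightarrow> x \<in> gr g \<Longrightarrow> y \<in> gr h \<Longrightarrow> x \<otimes> y \<in> gr (g \<otimes>\<^bsub>G\<^esub> h)"
  using A by (simp add: graded_algebra_def)

lemma gr_one: "\<one> \<in> gr \<one>\<^bsub>G\<^esub>" using A by (simp add: graded_algebra_def)

section \<open>Homogeneous components\<close>

definition is_dec where
  "is_dec a f \<longleftrightarrow> f \<in> (\<Pi>\<^sub>E g\<in>carrier G. gr g) \<and> finite {g \<in> carrier G. f g \<noteq> \<zero>} \<and>
        a = finsum A f {g \<in> carrier G. f g \<noteq> \<zero>}"

definition dec where "dec a = (THE f. is_dec a f)"

lemma dec: assumes "a \<in> carrier A" shows "is_dec a (dec a)" and "\<And>f. is_dec a f \<Longrightarrow> dec a = f"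
proof -
  have e: "\<exists>!f. is_dec a f" using A assms unfolding graded_algebra_def is_dec_def by blast
  show "is_dec a (dec a)" unfolding dec_def by (rule theI'[OF e])
  show "\<And>f. is_dec a f \<Longrightarrow> dec a = f" unfolding dec_def using e by (rule the1_equality)
qed

text \<open>By uniqueness, a finite sum of homogeneous elements of different degrees is its own
  decomposition; all components are computed from this.\<close>

lemma dec_eqI:
  assumes F: "finite F" "F \<subseteq> carrier G" "\<And>g. g \<in> F \<Longrightarrow> f g \<in> gr g" and g: "g \<in> carrier G"
  shows "dec (finsum A f F) g = (if g \<in> F then f g else \<zero>)"
proof -
  let ?f = "\<lambda>g\<in>carrier G. if g \<in> F then f g else \<zero>"
  have fA: "f g \<in> carrier A" if "g \<in> F" for g using that F gr_carrier by blast
  have sub: "{g \<in> carrier G. ?f g \<noteq> \<zero>} \<subseteq> F" by auto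
  have "finsum A ?f {g \<in> carrier G. ?f g \<noteq> \<zero>} = finsum A ?f F"
    by (rule A.finsum_support) (use F sub fA in auto)
  also have "\<dots> = finsum A f F" using F fA by (intro A.finsum_cong') auto
  finally have "is_dec (finsum A f F) ?f"
    unfolding is_dec_def using F finite_subset[OF sub] left_submoduleD(3)[OF gr_sub] by auto
  then have "dec (finsum A f F) = ?f" using fA by (intro dec(2) A.finsum_closed) auto
  then show ?thesis using g by simp
qed

lemma dec_in: "a \<in> carrier A \<Longrightarrow> g \<in> carrier G \<Longrightarrow> dec a g \<in> gr g"
  using dec(1)[of a] by (auto simp: is_dec_def)

lemma dec_finite: "a \<in> carrier A \<Longrightarrow> finite {g \<in> carrier G. dec a g \<noteq> \<zero>}"
  using dec(1)[of a] by (auto simp: is_dec_def)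

lemma dec_sum: "a \<in> carrier A \<Longrightarrow> a = finsum A (dec a) {g \<in> carrier G. dec a g \<noteq> \<zero>}"
  using dec(1)[of a] by (simp add: is_dec_def)

lemma dec_sum_superset:
  assumes "a \<in> carrier A" "finite F" "F \<subseteq> carrier G" "{g \<in> carrier G. dec a g \<noteq> \<zero>} \<subseteq> F"
  shows "a = finsum A (dec a) F"
proof -
  have "finsum A (dec a) {g \<in> carrier G. dec a g \<noteq> \<zero>} = finsum A (dec a) F"
    by (rule A.finsum_support) (use assms dec_in gr_carrier in auto)
  then show ?thesis using dec_sum[OF assms(1)] by simp
qed

lemma dec_homogeneous:
  assumes "x \<in> gr g" "g \<in> carrier G" "h \<in> carrier G"
  shows "dec x h = (if h = g then x else \<zero>)"
  using dec_eqI[of "{g}" "\<lambda>_. x" h] assms gr_carrier by auto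

lemma dec_hom:
  assumes g: "g \<in> carrier G" shows "(\<lambda>a. dec a g) \<in> module_hom K A A"
proof (rule module_homI)
  fix x y assume x: "x \<in> carrier A" and y: "y \<in> carrier A"
  let ?F = "{g \<in> carrier G. dec x g \<noteq> \<zero>} \<union> {g \<in> carrier G. dec y g \<noteq> \<zero>}"
  have F: "finite ?F" "?F \<subseteq> carrier G" using dec_finite x y by auto
  have c: "dec x h \<in> gr h" "dec y h \<in> gr h" "dec x h \<in> carrier A" "dec y h \<in> carrier A" if "h \<in> carrier G" for h
    using that dec_in x y gr_carrier by auto
  have "x \<oplus> y = finsum A (dec x) ?F \<oplus> finsum A (dec y) ?F"
    using dec_sum_superset[OF x F] dec_sum_superset[OF y F] by auto
  also have "\<dots> = finsum A (\<lambda>h. dec x h \<oplus> dec y h) ?F" using F c by (intro A.finsum_addf[symmetric]) auto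
  finally have s: "x \<oplus> y = finsum A (\<lambda>h. dec x h \<oplus> dec y h) ?F" .
  have "dec (x \<oplus> y) g = (if g \<in> ?F then dec x g \<oplus> dec y g else \<zero>)"
    unfolding s using F c left_submoduleD(4)[OF gr_sub] g by (intro dec_eqI) auto
  then show "dec (x \<oplus> y) g = dec x g \<oplus> dec y g" using g by auto
next
  fix k x assume k: "k \<in> carrier K" and x: "x \<in> carrier A"
  let ?F = "{g \<in> carrier G. dec x g \<noteq> \<zero>}"
  have F: "finite ?F" "?F \<subseteq> carrier G" using dec_finite x by auto
  have c: "dec x h \<in> gr h" "dec x h \<in> carrier A" if "h \<in> carrier G" for h
    using that dec_in x gr_carrier by auto
  have s: "k \<odot> x = finsum A (\<lambda>h. k \<odot> dec x h) ?F"
    using dec_sum[OF x] L.V.smult_finsum[OF k, of ?F "dec x"] c by simp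
  have "dec (k \<odot> x) g = (if g \<in> ?F then k \<odot> dec x g else \<zero>)"
    unfolding s using F c left_submoduleD(5)[OF gr_sub] g k by (intro dec_eqI) auto
  then show "dec (k \<odot> x) g = k \<odot> dec x g" using g k by auto
qed (use dec_in g gr_carrier in auto)

lemma gr_disjoint:
  assumes "x \<in> gr g" "x \<in> gr h" "g \<in> carrier G" "h \<in> carrier G" "x \<noteq> \<zero>" shows "g = h"
  using dec_homogeneous[of x g g] dec_homogeneous[of x h g] assms by (auto split: if_splits)

lemma gr_degree_eq: "x \<in> gr g \<Longrightarrow> g \<in> carrier G \<Longrightarrow> x \<noteq> \<zero> \<Longrightarrow> gr_degree G gr x = g"
  unfolding gr_degree_def using gr_disjoint by (intro the_equality) auto

text \<open>The projection to degree \<open>g\<close> fixes the members of \<open>M\<close> of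
  degree \<open>g\<close> and kills those of other degrees, so it maps the span of \<open>M\<close>
  into the span of \<open>M \<inter> gr g\<close>.\<close>

lemma homogeneous_span:
  assumes M: "M \<subseteq> (\<Union>g\<in>carrier G. gr g)" and x: "x \<in> lspan K A M" "x \<in> gr g" and g: "g \<in> carrier G"
  shows "x \<in> lspan K A (M \<inter> gr g)"
proof -
  have MA: "M \<subseteq> carrier A" "M \<inter> gr g \<subseteq> carrier A" using M gr_carrier by auto
  have U: "left_submodule K A (lspan K A (M \<inter> gr g))" by (rule L.lspan_submodule[OF MA(2)])
  interpret AA: module_hom_pair K A A by unfold_locales
  have "lspan K A M \<subseteq> {y \<in> carrier A. dec y g \<in> lspan K A (M \<inter> gr g)}"
  proof (rule L.lspan_minimal[OF _ AA.hom_vimage[OF dec_hom[OF g] U]])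
    show "M \<subseteq> {y \<in> carrier A. dec y g \<in> lspan K A (M \<inter> gr g)}"
    proof
      fix y assume y: "y \<in> M"
      then obtain h where h: "h \<in> carrier G" "y \<in> gr h" using M by blast
      have "dec y g \<in> lspan K A (M \<inter> gr g)"
        using dec_homogeneous[OF h(2,1) g] y h left_submoduleD(3)[OF U] L.lspan_incl[OF MA(2), of y] by auto
      then show "y \<in> {y \<in> carrier A. dec y g \<in> lspan K A (M \<inter> gr g)}" using y MA by auto
    qed
  qed
  then show ?thesis using x dec_homogeneous[OF x(2) g g] by auto
qed

lemma span_mult:
  assumes M: "M \<subseteq> carrier A" "M' \<subseteq> carrier A" and U: "left_submodule K A U"
    and MM: "\<And>a b. a \<in> M \<Longrightarrow> b \<in> M' \<Longrightarrow> a \<otimes> b \<in> U"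
    and x: "x \<in> lspan K A M" and y: "y \<in> lspan K A M'"
  shows "x \<otimes> y \<in> U"
proof -
  interpret AA: module_hom_pair K A A by unfold_locales
  have 1: "a \<otimes> y \<in> U" if "a \<in> M" for a
  proof -
    have "lspan K A M' \<subseteq> {y \<in> carrier A. a \<otimes> y \<in> U}"
      by (rule L.lspan_minimal[OF _ AA.hom_vimage[OF mult_left_hom U]]) (use MM that M in auto)
    then show ?thesis using y by auto
  qed
  have yA: "y \<in> carrier A" using y left_submoduleD(2)[OF L.lspan_submodule[OF M(2)]] by blast
  have "lspan K A M \<subseteq> {x \<in> carrier A. x \<otimes> y \<in> U}"
    by (rule L.lspan_minimal[OF _ AA.hom_vimage[OF mult_right_hom[OF yA] U]]) (use 1 M in auto)
  then show ?thesis using x by auto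
qed

section \<open>Ordered products\<close>

lemma foldr_mult: "set xs \<subseteq> carrier A \<Longrightarrow> y \<in> carrier A \<Longrightarrow> foldr (\<otimes>) xs y = foldr (\<otimes>) xs \<one> \<otimes> y"
proof (induction xs)
  case (Cons x xs)
  have "foldr (\<otimes>) xs \<one> \<in> carrier A" using Cons.prems by (induction xs) auto
  then show ?case using Cons by (simp add: A.m_assoc)
qed simp

lemma iprod_closed: "(\<And>k. k \<in> {i..j} \<Longrightarrow> t k \<in> carrier A) \<Longrightarrow> iprod A t i j \<in> carrier A"
proof -
  assume *: "\<And>k. k \<in> {i..j} \<Longrightarrow> t k \<in> carrier A"
  have "foldr (\<otimes>) xs \<one> \<in> carrier A" if "set xs \<subseteq> carrier A" for xs
    using that by (induction xs) auto
  moreover have "set (map t [i..<Suc j]) \<subseteq> carrier A" using * by auto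
  ultimately show ?thesis unfolding iprod_def by blast
qed

lemma iprod_empty: "j < i \<Longrightarrow> iprod A t i j = \<one>"
  by (simp add: iprod_def)

text \<open>Either factor may be empty, the left one for \<open>i = Suc k\<close> and the right one
  for \<open>k = j\<close>. Monomials are cut below at arbitrary places, including their
  ends.\<close>

lemma iprod_split:
  assumes "i \<le> Suc k" "k \<le> j" "\<And>l. l \<in> {i..j} \<Longrightarrow> t l \<in> carrier A"
  shows "iprod A t i j = iprod A t i k \<otimes> iprod A t (Suc k) j"
proof -
  have "[i..<Suc j] = [i..<Suc k] @ [Suc k..<Suc j]"
    using upt_add_eq_append[of i "Suc k" "j - k"] assms by (simp del: upt_Suc)
  moreover have "set (map t [i..<Suc k]) \<subseteq> carrier A" using assms by auto
  moreover have "iprod A t (Suc k) j \<in> carrier A" using assms by (intro iprod_closed) auto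
  ultimately show ?thesis
    using foldr_mult[of "map t [i..<Suc k]" "iprod A t (Suc k) j"] by (simp add: iprod_def del: upt_Suc)
qed

lemma iprod_cong: "(\<And>k. k \<in> {i..j} \<Longrightarrow> t k = t' k) \<Longrightarrow> iprod A t i j = iprod A t' i j"
  unfolding iprod_def by (intro arg_cong[of _ _ "\<lambda>xs. foldr _ xs _"]) auto

lemma iprod_single: "t i \<in> carrier A \<Longrightarrow> iprod A t i i = t i"
  by (simp add: iprod_def)

end

subsection \<open>The monomial basis\<close>

locale monomials = gralg K G A gr
  for K :: "'k ring" and G :: "'g monoid" and A :: "('k, 'a) module" (structure) and gr :: "'g \<Rightarrow> 'a set" +
  fixes m :: nat and As :: "nat \<Rightarrow> 'a set" and J :: "nat \<Rightarrow> 'a set"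
  assumes m: "1 \<le> m"
    and As: "\<forall>i\<in>{1..m}. graded_subalgebra K G A gr (As i)"
    and A_tensor: "graded_tensor_decomposition K G A gr m As"
    and A_block: "\<forall>i j. 1 \<le> i \<and> i < j \<and> j \<le> m \<longrightarrow> graded_subalgebra K G A gr (tensor_block K A As i j)"
    and J: "\<forall>i\<in>{1..m}. vectorspace.basis K (A\<lparr>carrier := As i\<rparr>) (J i) \<and> J i \<subseteq> (\<Union>g\<in>carrier G. gr g)"
begin

lemma subalgebra:
  assumes "graded_subalgebra K G A gr U"
  shows "U \<subseteq> carrier A" "left_module K (A\<lparr>carrier := U\<rparr>)" "\<one> \<in> U"
    "\<And>x y. x \<in> U \<Longrightarrow> y \<in> U \<Longrightarrow> x \<otimes> y \<in> U" "left_submodule K A U"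
proof -
  have ka: "kalgebra K (A\<lparr>carrier := U\<rparr>)" and sub: "U \<subseteq> carrier A"
    using assms by (auto simp: graded_subalgebra_def graded_algebra_def)
  show "U \<subseteq> carrier A" by (rule sub)
  show lm: "left_module K (A\<lparr>carrier := U\<rparr>)" using kalgebra_iff[OF ka] by blast
  interpret r: ring "A\<lparr>carrier := U\<rparr>" using kalgebra_iff[OF ka] by blast
  interpret l: left_module K "A\<lparr>carrier := U\<rparr>" by (rule lm)
  show "\<one> \<in> U" "\<And>x y. x \<in> U \<Longrightarrow> y \<in> U \<Longrightarrow> x \<otimes> y \<in> U" using r.one_closed r.m_closed by auto
  show "left_submodule K A U"
    by (rule left_submoduleI) (use sub r.zero_closed r.a_closed l.smult_closed in auto)
qed

lemmas As_sub = subalgebra[OF As[rule_format]]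

lemma J_basis: "i \<in> {1..m} \<Longrightarrow> vectorspace.basis K (A\<lparr>carrier := As i\<rparr>) (J i)"
  and J_homogeneous: "i \<in> {1..m} \<Longrightarrow> b \<in> J i \<Longrightarrow> \<exists>g\<in>carrier G. b \<in> gr g"
  using J by blast+

lemma As_kspace: "i \<in> {1..m} \<Longrightarrow> kspace K (A\<lparr>carrier := As i\<rparr>)"
  by (intro kspace.intro field_axioms As_sub(2))

lemma J_As: "i \<in> {1..m} \<Longrightarrow> b \<in> J i \<Longrightarrow> b \<in> As i"
  and J_span: "i \<in> {1..m} \<Longrightarrow> x \<in> As i \<Longrightarrow> x \<in> lspan K A (J i)"
proof -
  assume i: "i \<in> {1..m}"
  interpret V: kspace K "A\<lparr>carrier := As i\<rparr>" by (rule As_kspace[OF i])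
  have B: "J i \<subseteq> As i" "V.vs.gen_set (J i)" using J_basis[OF i] unfolding V.vs.basis_def by auto
  then show "b \<in> J i \<Longrightarrow> b \<in> As i" by blast
  have JA: "J i \<subseteq> carrier A" using B As_sub(1)[OF i] by blast
  note sp = left_submoduleD[OF L.lspan_submodule[OF JA]]
  have "left_submodule K (A\<lparr>carrier := As i\<rparr>) (lspan K A (J i) \<inter> As i)"
    by (rule left_submoduleI) (use sp left_submoduleD[OF As_sub(5)[OF i]] in auto)
  then have "lspan K (A\<lparr>carrier := As i\<rparr>) (J i) \<subseteq> lspan K A (J i) \<inter> As i"
    by (rule V.lspan_minimal[rotated]) (use B L.lspan_incl[OF JA] in auto)
  then show "x \<in> As i \<Longrightarrow> x \<in> lspan K A (J i)" using B by auto
qed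

lemma As_carrier: "i \<in> {1..m} \<Longrightarrow> x \<in> As i \<Longrightarrow> x \<in> carrier A"
  using As_sub(1) by blast

lemma J_carrier: "i \<in> {1..m} \<Longrightarrow> x \<in> J i \<Longrightarrow> x \<in> carrier A"
  using J_As As_carrier by blast

text \<open>Extensionality makes an index determined by its factors at \<open>1..m\<close>, so that
  distinct indices belong to distinct basis elements.\<close>

definition Xi :: "(nat \<Rightarrow> 'a) set" where "Xi = (\<Pi>\<^sub>E k\<in>{1..m}. J k)"

lemma XiD: "a \<in> Xi \<Longrightarrow> k \<in> {1..m} \<Longrightarrow> a k \<in> J k"
  and Xi_carrier: "a \<in> Xi \<Longrightarrow> k \<in> {1..m} \<Longrightarrow> a k \<in> carrier A"
  and Xi_As: "a \<in> Xi \<Longrightarrow> k \<in> {1..m} \<Longrightarrow> a k \<in> As k"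
  using J_carrier[of k "a k"] J_As[of k "a k"] by (auto simp: Xi_def PiE_iff)

definition Mon :: "nat \<Rightarrow> nat \<Rightarrow> 'a set" where "Mon i j = (\<lambda>a. iprod A a i j) ` Xi"

definition w :: "(nat \<Rightarrow> 'a) \<Rightarrow> 'a" where "w a = iprod A a 1 m"

lemma Mon_w [simp]: "Mon (Suc 0) m = w ` Xi" by (simp add: Mon_def w_def)

lemma Xi_iprod_closed: "a \<in> Xi \<Longrightarrow> 1 \<le> i \<Longrightarrow> j \<le> m \<Longrightarrow> iprod A a i j \<in> carrier A"
  by (rule iprod_closed) (use Xi_carrier in auto)

lemma Xi_iprod_split:
  "a \<in> Xi \<Longrightarrow> 1 \<le> i \<Longrightarrow> i \<le> Suc k \<Longrightarrow> k \<le> j \<Longrightarrow> j \<le> m \<Longrightarrow> iprod A a i j = iprod A a i k \<otimes> iprod A a (Suc k) j"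
  by (rule iprod_split) (use Xi_carrier in auto)

lemma Mon_carrier: "1 \<le> i \<Longrightarrow> j \<le> m \<Longrightarrow> Mon i j \<subseteq> carrier A"
  using Xi_iprod_closed by (auto simp: Mon_def)

lemma J_nonempty: "\<one> \<noteq> \<zero> \<Longrightarrow> i \<in> {1..m} \<Longrightarrow> J i \<noteq> {}"
proof
  assume n: "\<one> \<noteq> \<zero>" and i: "i \<in> {1..m}" and e: "J i = {}"
  have "left_submodule K A {\<zero>}" by (rule left_submoduleI) auto
  then have "lspan K A (J i) \<subseteq> {\<zero>}" by (rule L.lspan_minimal[rotated]) (simp add: e)
  then show False using J_span[OF i As_sub(3)[OF i]] n by auto
qed

text \<open>Multilinearity, carried out from the right end: each factor is expanded in its basis and
  put in front of monomials in the later factors.\<close>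

lemma iprod_mon_span:
  assumes "1 \<le> i" "i \<le> j" "j \<le> m" "\<And>k. k \<in> {i..j} \<Longrightarrow> t k \<in> As k"
  shows "iprod A t i j \<in> lspan K A (Mon i j)"
proof (cases "\<one> = \<zero>")
  \<comment> \<open>In the zero algebra the bases may be empty, and then \<open>Xi\<close> provides
    no monomials; but all elements are zero.\<close>
  case True
  have "x = \<zero>" if "x \<in> carrier A" for x using that True A.l_one A.l_null by metis
  moreover have "iprod A t i j \<in> carrier A" using assms As_carrier[OF _ assms(4)] by (intro iprod_closed) auto
  ultimately show ?thesis using left_submoduleD(3)[OF L.lspan_submodule[OF Mon_carrier]] assms by metis
next
  case False
  define M where "M l = (\<lambda>a. iprod A a l j) ` {a. \<forall>k\<in>{l..j}. a k \<in> J k}" for l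
  have MA: "M l \<subseteq> carrier A" if "1 \<le> l" for l
  proof
    fix x assume "x \<in> M l"
    then obtain a where a: "x = iprod A a l j" "\<And>k. k \<in> {l..j} \<Longrightarrow> a k \<in> J k" by (auto simp: M_def)
    show "x \<in> carrier A" unfolding a(1) using J_carrier[OF _ a(2)] that assms by (intro iprod_closed) auto
  qed
  have JA: "J l \<subseteq> carrier A" if "l \<in> {1..m}" for l using J_carrier that by auto
  have tA: "t k \<in> carrier A" if "k \<in> {i..j}" for k using As_carrier[OF _ assms(4)[OF that]] that assms by auto
  have "iprod A t l j \<in> lspan K A (M l)" if "i \<le> l" "l \<le> Suc j" for l
    using that(2,1)
  proof (induction rule: inc_induct)
    case base
    have "iprod A t (Suc j) j \<in> M (Suc j)" by (auto simp: M_def iprod_empty)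
    then show ?case using L.lspan_incl[OF MA] assms by simp
  next
    case (step l)
    have l: "l \<in> {1..m}" "l \<in> {i..j}" using step assms by auto
    have "iprod A t l j = t l \<otimes> iprod A t (Suc l) j"
      using iprod_split[of l l j t] iprod_single[of t l] tA step l by auto
    moreover have "t l \<otimes> iprod A t (Suc l) j \<in> lspan K A (M l)"
    proof (rule span_mult[OF JA[OF l(1)] MA L.lspan_submodule[OF MA]])
      show "iprod A t (Suc l) j \<in> lspan K A (M (Suc l))" using step by simp
      show "t l \<in> lspan K A (J l)" using J_span[OF l(1)] assms(4)[OF l(2)] .
      fix a b assume a: "a \<in> J l" and b: "b \<in> M (Suc l)"
      then obtain c where c: "b = iprod A c (Suc l) j" "\<And>k. k \<in> {Suc l..j} \<Longrightarrow> c k \<in> J k" by (auto simp: M_def)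
      let ?c = "c(l := a)"
      have "\<forall>k\<in>{l..j}. ?c k \<in> J k" using a c by auto
      moreover have "iprod A ?c l j = iprod A ?c l l \<otimes> iprod A ?c (Suc l) j"
        using a c(2) l J_carrier assms by (intro iprod_split) (auto intro: J_carrier[OF l(1) a] J_carrier[OF _ c(2)])
      then have "iprod A ?c l j = a \<otimes> b"
        using iprod_single[of ?c l] J_carrier[OF l(1) a] iprod_cong[of "Suc l" j ?c c] c by auto
      ultimately have "a \<otimes> b \<in> M l" unfolding M_def by (intro image_eqI[of _ _ "c(l := a)"]) simp_all
      then show "a \<otimes> b \<in> lspan K A (M l)" using L.lspan_incl[OF MA] l by auto
    qed (use l in auto)
    ultimately show ?case by simp
  qed
  from this[of i] have "iprod A t i j \<in> lspan K A (M i)" using assms by simp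
  moreover have "M i \<subseteq> Mon i j"
  proof
    fix x assume "x \<in> M i"
    then obtain a where a: "x = iprod A a i j" "\<And>k. k \<in> {i..j} \<Longrightarrow> a k \<in> J k" by (auto simp: M_def)
    \<comment> \<open>Factors outside \<open>{i..j}\<close> have no influence on the product, but an
      index in \<open>Xi\<close> must have them; \<open>J_nonempty\<close> supplies them.\<close>
    define a' where "a' = (\<lambda>k\<in>{1..m}. if k \<in> {i..j} then a k else SOME b. b \<in> J k)"
    have "a' k \<in> J k" if "k \<in> {1..m}" for k
      using a(2) that J_nonempty[OF False that] some_in_eq by (auto simp: a'_def)
    then have "a' \<in> Xi" by (auto simp: Xi_def a'_def)
    moreover have "x = iprod A a' i j" unfolding a by (rule iprod_cong) (use assms in \<open>auto simp: a'_def\<close>)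
    ultimately show "x \<in> Mon i j" by (auto simp: Mon_def)
  qed
  then have "lspan K A (M i) \<subseteq> lspan K A (Mon i j)"
    using L.lspan_incl[OF Mon_carrier] assms by (intro L.lspan_minimal L.lspan_submodule Mon_carrier) auto
  ultimately show ?thesis by blast
qed

lemma block_eq:
  assumes "1 \<le> i" "i \<le> j" "j \<le> m"
  shows "tensor_block K A As i j = lspan K A (Mon i j)"
proof
  have c: "{iprod A t i j |t. \<forall>k\<in>{i..j}. t k \<in> As k} \<subseteq> carrier A"
  proof
    fix x assume "x \<in> {iprod A t i j |t. \<forall>k\<in>{i..j}. t k \<in> As k}"
    then obtain a where a: "x = iprod A a i j" "\<And>k. k \<in> {i..j} \<Longrightarrow> a k \<in> As k" by auto
    show "x \<in> carrier A" unfolding a(1) using As_carrier[OF _ a(2)] assms by (intro iprod_closed) auto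
  qed
  show "tensor_block K A As i j \<subseteq> lspan K A (Mon i j)" unfolding tensor_block_def
    using iprod_mon_span[OF assms] by (intro L.lspan_minimal L.lspan_submodule Mon_carrier) (use assms in auto)
  show "lspan K A (Mon i j) \<subseteq> tensor_block K A As i j" unfolding tensor_block_def
  proof (intro L.lspan_minimal L.lspan_submodule c subsetI)
    fix x assume "x \<in> Mon i j"
    then have "x \<in> {iprod A t i j |t. \<forall>k\<in>{i..j}. t k \<in> As k}" using Xi_As assms by (fastforce simp: Mon_def)
    then show "x \<in> lspan K A {iprod A t i j |t. \<forall>k\<in>{i..j}. t k \<in> As k}" using L.lspan_incl[OF c] by blast
  qed
qed

text \<open>For \<open>i < j\<close> this is the hypothesis on the blocks, for \<open>i = j\<close>
  the block is \<open>As i\<close> itself. It allows left parts and right parts of monomials to be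
  multiplied separately.\<close>

lemma block_mult:
  assumes ij: "1 \<le> i" "i \<le> j" "j \<le> m" and x: "x \<in> lspan K A (Mon i j)" and y: "y \<in> lspan K A (Mon i j)"
  shows "x \<otimes> y \<in> lspan K A (Mon i j)"
proof (cases "i = j")
  case True
  have i: "i \<in> {1..m}" using ij by auto
  have "Mon i i \<subseteq> As i" using iprod_single Xi_As[OF _ i] Xi_carrier[OF _ i] by (auto simp: Mon_def)
  then have "lspan K A (Mon i i) \<subseteq> As i" using As_sub(5)[OF i] by (rule L.lspan_minimal)
  then have "x \<otimes> y \<in> As i" using x y True As_sub(4)[OF i] by blast
  then show ?thesis using iprod_mon_span[of i i "\<lambda>_. x \<otimes> y"] ij True iprod_single[of "\<lambda>_. x \<otimes> y" i] As_carrier[OF i] by auto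
next
  case False
  then show ?thesis using subalgebra(4)[OF A_block[rule_format, of i j]] block_eq[OF ij] x y ij by auto
qed

text \<open>The inverse of the multiplication map leads from \<open>A\<close> to the tensor product.
  There the product of coordinate functionals of the factors is multilinear, so it defines a
  functional, and on monomials it is a product of Kronecker deltas.\<close>

lemma lam_exists:
  obtains lam where "\<And>a. a \<in> Xi \<Longrightarrow> lam a \<in> module_hom K A (ring_module K)"
    "\<And>a b. a \<in> Xi \<Longrightarrow> b \<in> Xi \<Longrightarrow> lam a (w b) = (if a = b then \<one>\<^bsub>K\<^esub> else \<zero>\<^bsub>K\<^esub>)"
    "lspan K A (w ` Xi) = carrier A"
proof -
  define V where "V i = A\<lparr>carrier := As i\<rparr>" for i
  interpret mt: mtensor_family K "{1..m}" V
    by (intro mtensor_family.intro mtensor_family_axioms.intro field_axioms) (simp only: V_def As_sub(2))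
  define TT where "TT = mt.T"
  interpret T: left_module K TT unfolding TT_def by (rule mt.T_left_module)
  interpret TA: module_hom_pair K TT A by unfold_locales
  have "\<exists>f\<in>module_hom K TT A. (\<forall>t\<in>mt.X. f (mpure K {1..m} V t) = iprod A t 1 m) \<and> bij_betw f (carrier TT) (carrier A)"
    using A_tensor unfolding graded_tensor_decomposition_def Let_def V_def[abs_def] TT_def by simp blast
  then obtain f where f: "f \<in> module_hom K TT A" and fp: "\<And>t. t \<in> mt.X \<Longrightarrow> f (mpure K {1..m} V t) = iprod A t 1 m"
    and bij: "bij_betw f (carrier TT) (carrier A)" by blast
  define linv where "linv = inv_into (carrier TT) f"
  have linv: "linv x \<in> carrier TT" "f (linv x) = x" if "x \<in> carrier A" for x
    using that bij inv_into_into[of x f "carrier TT"] f_inv_into_f[of x f "carrier TT"]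
    unfolding linv_def bij_betw_def by simp_all
  have invf: "linv (f v) = v" if "v \<in> carrier TT" for v
    unfolding linv_def using bij that by (simp add: bij_betw_def)
  have linvh: "linv \<in> module_hom K A TT"
  proof (rule module_homI)
    fix x y assume xy: "x \<in> carrier A" "y \<in> carrier A"
    have "f (linv x \<oplus>\<^bsub>TT\<^esub> linv y) = x \<oplus> y" using linv xy module_hom_add[OF f, of "linv x" "linv y"] by simp
    then show "linv (x \<oplus> y) = linv x \<oplus>\<^bsub>TT\<^esub> linv y" using invf[of "linv x \<oplus>\<^bsub>TT\<^esub> linv y"] linv xy by simp
  next
    fix k x assume k: "k \<in> carrier K" and x: "x \<in> carrier A"
    have "f (k \<odot>\<^bsub>TT\<^esub> linv x) = k \<odot> x" using linv x k module_hom_smult[OF f, of k "linv x"] by simp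
    then show "linv (k \<odot> x) = k \<odot>\<^bsub>TT\<^esub> linv x" using invf[of "k \<odot>\<^bsub>TT\<^esub> linv x"] linv x k T.smult_closed by simp
  qed (rule linv)
  have "\<exists>c. (\<forall>b\<in>J i. c b \<in> module_hom K (A\<lparr>carrier := As i\<rparr>) (ring_module K)) \<and>
    (\<forall>b\<in>J i. \<forall>b'\<in>J i. c b b' = (if b' = b then \<one>\<^bsub>K\<^esub> else \<zero>\<^bsub>K\<^esub>))" if i: "i \<in> {1..m}" for i
    using kspace.coordinates[OF As_kspace[OF i] J_basis[OF i]] by metis
  then obtain c where c: "\<And>i b. i \<in> {1..m} \<Longrightarrow> b \<in> J i \<Longrightarrow> c i b \<in> module_hom K (A\<lparr>carrier := As i\<rparr>) (ring_module K)"
    and cd: "\<And>i b b'. i \<in> {1..m} \<Longrightarrow> b \<in> J i \<Longrightarrow> b' \<in> J i \<Longrightarrow> c i b b' = (if b' = b then \<one>\<^bsub>K\<^esub> else \<zero>\<^bsub>K\<^esub>)"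
    by metis
  have ck: "c i b x \<in> carrier K" if "i \<in> {1..m}" "b \<in> J i" "x \<in> As i" for i b x
    using module_hom_in[OF c[OF that(1,2)], of x] that(3) by simp
  have ckt: "c k (a k) (t k) \<in> carrier K" if "a \<in> Xi" "t \<in> mt.X" "k \<in> {1..m}" for a t k
    using ck[OF that(3) XiD[OF that(1,3)]] PiE_mem[OF that(2,3)] by (simp add: V_def)
  define g where "g a t = finprod K (\<lambda>k. c k (a k) (t k)) {1..m}" for a t
  have gup: "g a (t(i := u)) = c i (a i) u \<otimes>\<^bsub>K\<^esub> finprod K (\<lambda>k. c k (a k) (t k)) ({1..m} - {i})"
    if "a \<in> Xi" "t \<in> mt.X" "i \<in> {1..m}" "u \<in> As i" for a t i u
  proof -
    have e: "{1..m} = insert i ({1..m} - {i})" using that by auto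
    have "g a (t(i := u)) = finprod K (\<lambda>k. c k (a k) ((t(i := u)) k)) (insert i ({1..m} - {i}))"
      unfolding g_def using e by simp
    also have "\<dots> = c i (a i) u \<otimes>\<^bsub>K\<^esub> finprod K (\<lambda>k. c k (a k) ((t(i := u)) k)) ({1..m} - {i})"
      using ckt[OF that(1,2)] ck[OF that(3) XiD[OF that(1,3)] that(4)] by (subst finprod_insert) auto
    also have "finprod K (\<lambda>k. c k (a k) ((t(i := u)) k)) ({1..m} - {i}) = finprod K (\<lambda>k. c k (a k) (t k)) ({1..m} - {i})"
      using ckt[OF that(1,2)] by (intro finprod_cong') auto
    finally show ?thesis .
  qed
  have gcl: "finprod K (\<lambda>k. c k (a k) (t k)) F \<in> carrier K" if "a \<in> Xi" "t \<in> mt.X" "F \<subseteq> {1..m}" for a t F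
    using ckt[OF that(1,2)] that(3) by (intro finprod_closed) (auto simp: subset_iff)
  have "\<exists>l\<in>module_hom K TT (ring_module K). \<forall>t\<in>mt.X. l (mpure K {1..m} V t) = g a t" if a: "a \<in> Xi" for a
  proof (rule mt.mtensor_lift[folded TT_def, OF ring_module_left_module[OF ring_axioms]])
    show "g a \<in> mt.X \<rightarrow> carrier (ring_module K)" using gcl[OF a] by (auto simp: g_def)
    fix t i u assume t: "t \<in> mt.X" and i: "i \<in> {1..m}" and u: "u \<in> carrier (V i)"
    have u': "u \<in> As i" using u by (simp add: V_def)
    note ci = c[OF i XiD[OF a i]]
    have fc: "finprod K (\<lambda>k. c k (a k) (t k)) ({1..m} - {i}) \<in> carrier K" by (rule gcl[OF a t]) auto
    show "g a (t(i := k \<odot>\<^bsub>V i\<^esub> u)) = k \<odot>\<^bsub>ring_module K\<^esub> g a (t(i := u))" if k: "k \<in> carrier K" for k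
      using gup[OF a t i u'] gup[OF a t i, of "k \<odot> u"] left_submoduleD(5)[OF As_sub(5)[OF i] k u'] module_hom_smult[OF ci k, of u]
        fc ck[OF i XiD[OF a i] u'] u' k by (simp add: V_def m_assoc)
    fix v assume v: "v \<in> carrier (V i)"
    have v': "v \<in> As i" using v by (simp add: V_def)
    show "g a (t(i := u \<oplus>\<^bsub>V i\<^esub> v)) = g a (t(i := u)) \<oplus>\<^bsub>ring_module K\<^esub> g a (t(i := v))"
      using gup[OF a t i u'] gup[OF a t i v'] gup[OF a t i, of "u \<oplus> v"] left_submoduleD(4)[OF As_sub(5)[OF i] u' v'] module_hom_add[OF ci, of u v]
        fc ck[OF i XiD[OF a i] u'] ck[OF i XiD[OF a i] v'] u' v' by (simp add: V_def l_distr)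
  qed
  then obtain l where l: "\<And>a. a \<in> Xi \<Longrightarrow> l a \<in> module_hom K TT (ring_module K)"
    "\<And>a t. a \<in> Xi \<Longrightarrow> t \<in> mt.X \<Longrightarrow> l a (mpure K {1..m} V t) = g a t" by metis
  have XiX: "b \<in> mt.X" if "b \<in> Xi" for b using that Xi_As[OF that] by (auto simp: Xi_def V_def PiE_def extensional_def)
  show ?thesis
  proof (rule that[of "\<lambda>a x. l a (linv x)"])
    show "(\<lambda>x. l a (linv x)) \<in> module_hom K A (ring_module K)" if "a \<in> Xi" for a
      by (rule module_hom_comp[OF linvh l(1)[OF that]])
    fix a b assume a: "a \<in> Xi" and b: "b \<in> Xi"
    have "linv (w b) = mpure K {1..m} V b" using fp[OF XiX[OF b]] invf[OF mt.mpure_in[folded TT_def, OF XiX[OF b]]] by (simp add: w_def)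
    then have "l a (linv (w b)) = finprod K (\<lambda>k. if b k = a k then \<one>\<^bsub>K\<^esub> else \<zero>\<^bsub>K\<^esub>) {1..m}"
      using l(2)[OF a XiX[OF b]] cd XiD a b unfolding g_def by (auto intro!: finprod_cong')
    also have "\<dots> = (if a = b then \<one>\<^bsub>K\<^esub> else \<zero>\<^bsub>K\<^esub>)"
    proof (cases "a = b")
      case False
      then obtain i where i: "i \<in> {1..m}" "a i \<noteq> b i" using a b unfolding Xi_def by (meson PiE_ext)
      have e: "{1..m} = insert i ({1..m} - {i})" using i by auto
      have "finprod K (\<lambda>k. if b k = a k then \<one>\<^bsub>K\<^esub> else \<zero>\<^bsub>K\<^esub>) (insert i ({1..m} - {i})) = \<zero>\<^bsub>K\<^esub>"
        using i by (subst finprod_insert) (auto intro!: l_null finprod_closed)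
      then show ?thesis using e False by simp
    qed simp
    finally show "l a (linv (w b)) = (if a = b then \<one>\<^bsub>K\<^esub> else \<zero>\<^bsub>K\<^esub>)" .
  next
    have "{x \<in> carrier TT. f x \<in> lspan K A (Mon 1 m)} = carrier TT"
    proof (rule mt.mtensor_generate[folded TT_def, OF TA.hom_vimage[OF f L.lspan_submodule[OF Mon_carrier]]])
      fix t assume t: "t \<in> mt.X"
      show "mpure K {1..m} V t \<in> {x \<in> carrier TT. f x \<in> lspan K A (Mon 1 m)}"
        using mt.mpure_in[folded TT_def, OF t] fp[OF t] iprod_mon_span[of 1 m t] m PiE_mem[OF t] by (simp add: V_def)
    qed auto
    then have "f v \<in> lspan K A (Mon 1 m)" if "v \<in> carrier TT" for v using that by blast
    then have "carrier A \<subseteq> lspan K A (Mon 1 m)" using linv by (metis subsetI)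
    then show "lspan K A (w ` Xi) = carrier A"
      using left_submoduleD(1)[OF L.lspan_submodule[OF Mon_carrier[of 1 m]]] by auto
  qed
qed

definition lam where
  "lam = (SOME l. (\<forall>a\<in>Xi. l a \<in> module_hom K A (ring_module K)) \<and>
     (\<forall>a\<in>Xi. \<forall>b\<in>Xi. l a (w b) = (if a = b then \<one>\<^bsub>K\<^esub> else \<zero>\<^bsub>K\<^esub>)))"

lemma lam_hom: "a \<in> Xi \<Longrightarrow> lam a \<in> module_hom K A (ring_module K)"
  and lam_w: "a \<in> Xi \<Longrightarrow> b \<in> Xi \<Longrightarrow> lam a (w b) = (if a = b then \<one>\<^bsub>K\<^esub> else \<zero>\<^bsub>K\<^esub>)"
proof -
  obtain l where "\<And>a. a \<in> Xi \<Longrightarrow> l a \<in> module_hom K A (ring_module K)"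
    "\<And>a b. a \<in> Xi \<Longrightarrow> b \<in> Xi \<Longrightarrow> l a (w b) = (if a = b then \<one>\<^bsub>K\<^esub> else \<zero>\<^bsub>K\<^esub>)" using lam_exists by metis
  then have "(\<forall>a\<in>Xi. l a \<in> module_hom K A (ring_module K)) \<and>
     (\<forall>a\<in>Xi. \<forall>b\<in>Xi. l a (w b) = (if a = b then \<one>\<^bsub>K\<^esub> else \<zero>\<^bsub>K\<^esub>))" by blast
  from someI[of "\<lambda>l. (\<forall>a\<in>Xi. l a \<in> module_hom K A (ring_module K)) \<and>
     (\<forall>a\<in>Xi. \<forall>b\<in>Xi. l a (w b) = (if a = b then \<one>\<^bsub>K\<^esub> else \<zero>\<^bsub>K\<^esub>))", OF this]
  show "a \<in> Xi \<Longrightarrow> lam a \<in> module_hom K A (ring_module K)"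
    "a \<in> Xi \<Longrightarrow> b \<in> Xi \<Longrightarrow> lam a (w b) = (if a = b then \<one>\<^bsub>K\<^esub> else \<zero>\<^bsub>K\<^esub>)"
    unfolding lam_def by blast+
qed

lemma w_span: "lspan K A (w ` Xi) = carrier A" using lam_exists by metis

lemma w_closed: "a \<in> Xi \<Longrightarrow> w a \<in> carrier A" unfolding w_def by (rule Xi_iprod_closed) auto

lemma w_generate:
  assumes "left_submodule K A U" "\<And>a. a \<in> Xi \<Longrightarrow> w a \<in> U" "x \<in> carrier A"
  shows "x \<in> U"
  using L.lspan_minimal[of "w ` Xi" U] assms w_span by auto

lemma w_hom_eq:
  assumes N: "left_module K N" and f: "f \<in> module_hom K A N" and g: "g \<in> module_hom K A N"
    and eq: "\<And>a. a \<in> Xi \<Longrightarrow> f (w a) = g (w a)" and x: "x \<in> carrier A"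
  shows "f x = g x"
proof -
  interpret N: left_module K N by fact
  interpret AN: module_hom_pair K A N by unfold_locales
  show ?thesis using w_generate[OF AN.hom_equalizer[OF f g] _ x] eq w_closed by auto
qed

lemma lam_in: "a \<in> Xi \<Longrightarrow> x \<in> carrier A \<Longrightarrow> lam a x \<in> carrier K"
  using module_hom_in[OF lam_hom] by fastforce

lemma lam_add: "a \<in> Xi \<Longrightarrow> x \<in> carrier A \<Longrightarrow> y \<in> carrier A \<Longrightarrow> lam a (x \<oplus> y) = lam a x \<oplus>\<^bsub>K\<^esub> lam a y"
  using module_hom_add[OF lam_hom] by fastforce

lemma lam_smult: "a \<in> Xi \<Longrightarrow> k \<in> carrier K \<Longrightarrow> x \<in> carrier A \<Longrightarrow> lam a (k \<odot> x) = k \<otimes>\<^bsub>K\<^esub> lam a x"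
  using module_hom_smult[OF lam_hom] by fastforce

lemma lam_zero: "a \<in> Xi \<Longrightarrow> lam a \<zero> = \<zero>\<^bsub>K\<^esub>"
  using module_hom_pair.hom_zero[OF module_hom_pair.intro[OF L.V.left_module_axioms ring_module_left_module[OF ring_axioms]] lam_hom] by simp

lemma lam_finite: "x \<in> carrier A \<Longrightarrow> finite {a \<in> Xi. lam a x \<noteq> \<zero>\<^bsub>K\<^esub>}"
proof -
  assume x: "x \<in> carrier A"
  have "x \<in> {x \<in> carrier A. finite {a \<in> Xi. lam a x \<noteq> \<zero>\<^bsub>K\<^esub>}}"
  proof (rule w_generate[OF left_submoduleI _ x])
    fix y z assume y: "y \<in> {x \<in> carrier A. finite {a \<in> Xi. lam a x \<noteq> \<zero>\<^bsub>K\<^esub>}}" and z: "z \<in> {x \<in> carrier A. finite {a \<in> Xi. lam a x \<noteq> \<zero>\<^bsub>K\<^esub>}}"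
    have "{a \<in> Xi. lam a (y \<oplus> z) \<noteq> \<zero>\<^bsub>K\<^esub>} \<subseteq> {a \<in> Xi. lam a y \<noteq> \<zero>\<^bsub>K\<^esub>} \<union> {a \<in> Xi. lam a z \<noteq> \<zero>\<^bsub>K\<^esub>}"
      using y z by (auto simp: lam_add)
    then show "y \<oplus> z \<in> {x \<in> carrier A. finite {a \<in> Xi. lam a x \<noteq> \<zero>\<^bsub>K\<^esub>}}"
      using y z by (auto elim: finite_subset)
  next
    fix k y assume k: "k \<in> carrier K" and y: "y \<in> {x \<in> carrier A. finite {a \<in> Xi. lam a x \<noteq> \<zero>\<^bsub>K\<^esub>}}"
    have "{a \<in> Xi. lam a (k \<odot> y) \<noteq> \<zero>\<^bsub>K\<^esub>} \<subseteq> {a \<in> Xi. lam a y \<noteq> \<zero>\<^bsub>K\<^esub>}"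
      using y k by (auto simp: lam_smult)
    then show "k \<odot> y \<in> {x \<in> carrier A. finite {a \<in> Xi. lam a x \<noteq> \<zero>\<^bsub>K\<^esub>}}"
      using y k L.V.smult_closed by (auto elim: finite_subset)
  next
    fix a assume a: "a \<in> Xi"
    have "{b \<in> Xi. lam b (w a) \<noteq> \<zero>\<^bsub>K\<^esub>} \<subseteq> {a}" using lam_w[OF _ a] by (auto split: if_splits)
    then show "w a \<in> {x \<in> carrier A. finite {a \<in> Xi. lam a x \<noteq> \<zero>\<^bsub>K\<^esub>}}" using w_closed[OF a] by (auto elim: finite_subset)
  next
    have "{a \<in> Xi. lam a \<zero> \<noteq> \<zero>\<^bsub>K\<^esub>} = {}" by (auto simp: lam_zero)
    from finite.emptyI[where ?'a = "nat \<Rightarrow> 'a", folded this]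
    show "\<zero> \<in> {x \<in> carrier A. finite {a \<in> Xi. lam a x \<noteq> \<zero>\<^bsub>K\<^esub>}}" by blast
  qed auto
  then show ?thesis by simp
qed

text \<open>Linear maps on \<open>A\<close> may be prescribed on monomials. The product of
  \<open>C\<close> and the functionals of the dual bases are defined in this way.\<close>

lemma lin_ext:
  assumes N: "left_module K N" and g: "\<And>a. a \<in> Xi \<Longrightarrow> g a \<in> carrier N"
  shows "\<exists>f\<in>module_hom K A N. \<forall>a\<in>Xi. f (w a) = g a"
proof -
  interpret N: left_module K N by fact
  define c where "c x = (\<lambda>a. if a \<in> Xi then lam a x else \<zero>\<^bsub>K\<^esub>)" for x
  have c: "c \<in> module_hom K A (free_module K Xi)"
  proof (rule module_homI)
    fix x assume x: "x \<in> carrier A"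
    have "finite {a. c x a \<noteq> \<zero>\<^bsub>K\<^esub>}"
      by (rule finite_subset[OF _ lam_finite[OF x]]) (auto simp: c_def)
    then show "c x \<in> carrier (free_module K Xi)" using x by (auto simp: c_def free_module_simps lam_in)
  qed (auto simp: c_def free_module_simps lam_add lam_smult)
  have cw: "c (w a) = free_gen K a" if "a \<in> Xi" for a
  proof
    fix b show "c (w a) b = free_gen K a b" using lam_w[of b a] that by (auto simp: c_def free_gen_def)
  qed
  have h: "free_lift K N g \<in> module_hom K (free_module K Xi) N" using g by (intro N.free_lift_hom) auto
  show ?thesis using module_hom_comp[OF c h] cw N.free_lift_gen[of g, OF g]
    by (intro bexI[of _ "\<lambda>x. free_lift K N g (c x)"]) auto
qed

lemma w_expand: "x \<in> carrier A \<Longrightarrow> x = finsum A (\<lambda>a. lam a x \<odot> w a) {a \<in> Xi. lam a x \<noteq> \<zero>\<^bsub>K\<^esub>}"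
proof -
  assume x: "x \<in> carrier A"
  have c: "lam a y \<odot> w a \<in> carrier A" if "a \<in> Xi" "y \<in> carrier A" for a y
    using that lam_in w_closed L.V.smult_closed by blast
  have sup: "finsum A (\<lambda>a. lam a y \<odot> w a) {a \<in> Xi. lam a y \<noteq> \<zero>\<^bsub>K\<^esub>} = finsum A (\<lambda>a. lam a y \<odot> w a) F"
    if "y \<in> carrier A" "finite F" "{a \<in> Xi. lam a y \<noteq> \<zero>\<^bsub>K\<^esub>} \<subseteq> F" "F \<subseteq> Xi" for y F
    by (rule A.finsum_support) (use that c w_closed in \<open>auto simp: subset_iff\<close>)
  let ?U = "{x \<in> carrier A. x = finsum A (\<lambda>a. lam a x \<odot> w a) {a \<in> Xi. lam a x \<noteq> \<zero>\<^bsub>K\<^esub>}}"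
  have "x \<in> ?U"
  proof (rule w_generate[OF left_submoduleI _ x])
    fix y z assume y: "y \<in> ?U" and z: "z \<in> ?U"
    let ?F = "{a \<in> Xi. lam a y \<noteq> \<zero>\<^bsub>K\<^esub>} \<union> {a \<in> Xi. lam a z \<noteq> \<zero>\<^bsub>K\<^esub>}"
    have yz: "y \<in> carrier A" "z \<in> carrier A" using y z by auto
    have F: "finite ?F" "?F \<subseteq> Xi" using lam_finite yz by auto
    have "finsum A (\<lambda>a. lam a (y \<oplus> z) \<odot> w a) ?F = finsum A (\<lambda>a. lam a y \<odot> w a \<oplus> lam a z \<odot> w a) ?F"
      using F c yz by (intro A.finsum_cong') (auto simp: lam_add lam_in w_closed L.V.smult_l_distr)
    also have "\<dots> = finsum A (\<lambda>a. lam a y \<odot> w a) ?F \<oplus> finsum A (\<lambda>a. lam a z \<odot> w a) ?F"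
      using F c yz by (intro A.finsum_addf) auto
    also have "\<dots> = y \<oplus> z" using sup[OF yz(1) F(1) _ F(2)] sup[OF yz(2) F(1) _ F(2)] y z by auto
    finally have 1: "finsum A (\<lambda>a. lam a (y \<oplus> z) \<odot> w a) ?F = y \<oplus> z" .
    have "{a \<in> Xi. lam a (y \<oplus> z) \<noteq> \<zero>\<^bsub>K\<^esub>} \<subseteq> ?F" using yz by (auto simp: lam_add)
    from sup[OF A.a_closed[OF yz] F(1) this F(2)] 1 yz show "y \<oplus> z \<in> ?U" by simp
  next
    fix k y assume k: "k \<in> carrier K" and y: "y \<in> ?U"
    let ?F = "{a \<in> Xi. lam a y \<noteq> \<zero>\<^bsub>K\<^esub>}"
    have yA: "y \<in> carrier A" using y by auto
    have F: "finite ?F" "?F \<subseteq> Xi" using lam_finite yA by auto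
    have "finsum A (\<lambda>a. lam a (k \<odot> y) \<odot> w a) ?F = finsum A (\<lambda>a. k \<odot> (lam a y \<odot> w a)) ?F"
      using F c yA k by (intro A.finsum_cong') (auto simp: lam_smult lam_in w_closed L.V.smult_assoc1 intro: L.V.smult_closed)
    also have "\<dots> = k \<odot> finsum A (\<lambda>a. lam a y \<odot> w a) ?F"
      using F c yA k by (intro L.V.smult_finsum[symmetric]) auto
    also have "\<dots> = k \<odot> y" using y by auto
    finally have 1: "finsum A (\<lambda>a. lam a (k \<odot> y) \<odot> w a) ?F = k \<odot> y" .
    have "{a \<in> Xi. lam a (k \<odot> y) \<noteq> \<zero>\<^bsub>K\<^esub>} \<subseteq> ?F" using yA k by (auto simp: lam_smult)
    from sup[OF L.V.smult_closed[OF k yA] F(1) this F(2)] 1 k yA show "k \<odot> y \<in> ?U" by (simp add: L.V.smult_closed)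
  next
    fix a assume a: "a \<in> Xi"
    have "finsum A (\<lambda>b. lam b (w a) \<odot> w b) {a} = w a" using a w_closed[OF a] lam_w by (simp add: L.V.smult_one)
    moreover have "{b \<in> Xi. lam b (w a) \<noteq> \<zero>\<^bsub>K\<^esub>} \<subseteq> {a}" using lam_w[OF _ a] by (auto split: if_splits)
    ultimately show "w a \<in> ?U" using sup[OF w_closed[OF a], of "{a}"] a w_closed by auto
  next
    have e: "{a \<in> Xi. lam a \<zero> \<noteq> \<zero>\<^bsub>K\<^esub>} = {}" by (auto simp: lam_zero)
    show "\<zero> \<in> ?U" unfolding mem_Collect_eq e by simp
  qed auto
  then show ?thesis by simp
qed

section \<open>Degrees of partial products\<close>

definition dg where "dg a i j = gr_degree G gr (iprod A a i j)"

text \<open>If a partial product vanished, so would \<open>w a\<close>, against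
  \<open>lam a (w a) = \<one>\<close>. Hence every partial product has a well-defined
  degree.\<close>

lemma iprod_nonzero:
  assumes a: "a \<in> Xi" and "1 \<le> i" "j \<le> m" "i \<le> Suc j"
  shows "iprod A a i j \<noteq> \<zero>"
proof
  assume z: "iprod A a i j = \<zero>"
  have "iprod A a i m = iprod A a i j \<otimes> iprod A a (Suc j) m" using Xi_iprod_split[OF a, of i j m] assms by auto
  then have 1: "iprod A a i m = \<zero>" using z Xi_iprod_closed[OF a, of "Suc j" m] by simp
  have "w a = iprod A a 1 (i - 1) \<otimes> iprod A a i m" unfolding w_def using Xi_iprod_split[OF a, of 1 "i - 1" m] assms by auto
  then have "w a = \<zero>" using 1 Xi_iprod_closed[OF a, of 1 "i - 1"] assms by simp
  then show False using lam_w[OF a a] lam_zero[OF a] by simp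
qed

lemma iprod_homogeneous: "a \<in> Xi \<Longrightarrow> 1 \<le> i \<Longrightarrow> j \<le> m \<Longrightarrow> \<exists>g\<in>carrier G. iprod A a i j \<in> gr g"
proof (cases "i \<le> Suc j")
  case True
  assume a: "a \<in> Xi" and i: "1 \<le> i" and j: "j \<le> m"
  show ?thesis using True i
  proof (induction rule: inc_induct)
    case base
    then show ?case using gr_one by (auto simp: iprod_empty)
  next
    case (step l)
    then obtain g where g: "g \<in> carrier G" "iprod A a (Suc l) j \<in> gr g" by auto
    have l: "l \<in> {1..m}" using step j by auto
    obtain h where h: "h \<in> carrier G" "a l \<in> gr h" using J_homogeneous[OF l XiD[OF a l]] by blast
    have "iprod A a l j = a l \<otimes> iprod A a (Suc l) j"
      using Xi_iprod_split[OF a, of l l j] step j iprod_single Xi_carrier[OF a l] by auto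
    then show ?case using gr_mult[OF h(1) g(1) h(2) g(2)] h g by auto
  qed
qed (use gr_one in \<open>auto simp: iprod_empty\<close>)

lemma dg_closed: "a \<in> Xi \<Longrightarrow> 1 \<le> i \<Longrightarrow> j \<le> m \<Longrightarrow> i \<le> Suc j \<Longrightarrow> dg a i j \<in> carrier G"
  and dg_in: "a \<in> Xi \<Longrightarrow> 1 \<le> i \<Longrightarrow> j \<le> m \<Longrightarrow> i \<le> Suc j \<Longrightarrow> iprod A a i j \<in> gr (dg a i j)"
proof -
  assume a: "a \<in> Xi" "1 \<le> i" "j \<le> m" "i \<le> Suc j"
  obtain g where g: "g \<in> carrier G" "iprod A a i j \<in> gr g" using iprod_homogeneous[OF a(1-3)] by blast
  then have "dg a i j = g" unfolding dg_def using gr_degree_eq iprod_nonzero[OF a] by blast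
  then show "dg a i j \<in> carrier G" "iprod A a i j \<in> gr (dg a i j)" using g by auto
qed

lemma dg_eqI: "a \<in> Xi \<Longrightarrow> 1 \<le> i \<Longrightarrow> j \<le> m \<Longrightarrow> i \<le> Suc j \<Longrightarrow> iprod A a i j \<in> gr g \<Longrightarrow> g \<in> carrier G \<Longrightarrow> dg a i j = g"
  unfolding dg_def using gr_degree_eq iprod_nonzero by blast

lemma dg_split:
  assumes a: "a \<in> Xi" and "1 \<le> i" "i \<le> Suc k" "k \<le> j" "j \<le> m"
  shows "dg a i j = dg a i k \<otimes>\<^bsub>G\<^esub> dg a (Suc k) j"
  by (rule dg_eqI[OF a])
     (use assms Xi_iprod_split[OF assms] gr_mult dg_in[OF a] dg_closed[OF a] in auto)

lemma dg_empty: "a \<in> Xi \<Longrightarrow> j \<le> m \<Longrightarrow> dg a (Suc j) j = \<one>\<^bsub>G\<^esub>"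
  by (rule dg_eqI) (use gr_one in \<open>auto simp: iprod_empty\<close>)

lemma dg_cong: "(\<And>k. k \<in> {i..j} \<Longrightarrow> a k = b k) \<Longrightarrow> dg a i j = dg b i j"
  unfolding dg_def using iprod_cong by metis

text \<open>By \<open>homogeneous_span\<close> a homogeneous element is a combination of monomials
  of its own degree.\<close>

lemma lam_homogeneous:
  assumes a: "a \<in> Xi" and g: "g \<in> carrier G" and x: "x \<in> gr g" and n: "lam a x \<noteq> \<zero>\<^bsub>K\<^esub>"
  shows "dg a 1 m = g"
proof (rule ccontr)
  assume d: "dg a 1 m \<noteq> g"
  have "Mon 1 m \<subseteq> (\<Union>g\<in>carrier G. gr g)" using iprod_homogeneous by (auto simp: Mon_def)
  then have x': "x \<in> lspan K A (Mon 1 m \<inter> gr g)"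
    using homogeneous_span[of "Mon 1 m" x g] x g w_span gr_carrier[OF g x] by auto
  have "left_submodule K A {x \<in> carrier A. lam a x = \<zero>\<^bsub>K\<^esub>}"
    by (rule left_submoduleI) (auto simp: lam_zero[OF a] lam_add[OF a] lam_smult[OF a] L.V.smult_closed)
  then have "lspan K A (Mon 1 m \<inter> gr g) \<subseteq> {x \<in> carrier A. lam a x = \<zero>\<^bsub>K\<^esub>}"
  proof (rule L.lspan_minimal[rotated], safe)
    fix y assume y: "y \<in> Mon 1 m" "y \<in> gr g"
    then obtain b where b: "b \<in> Xi" "y = w b" by auto
    then have "dg b 1 m = g" using dg_eqI[OF b(1)] y g m by (auto simp: w_def)
    then have "a \<noteq> b" using d by blast
    then show "lam a y = \<zero>\<^bsub>K\<^esub>" using lam_w[OF a b(1)] b by simp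
    show "y \<in> carrier A" using b w_closed by simp
  qed
  then show False using x' n by auto
qed

section \<open>Recombination of left and right parts\<close>

definition merge :: "nat \<Rightarrow> (nat \<Rightarrow> 'a) \<Rightarrow> (nat \<Rightarrow> 'a) \<Rightarrow> nat \<Rightarrow> 'a" where
  "merge j a b = (\<lambda>k. if k \<le> j then a k else b k)"

lemma merge_Xi: "a \<in> Xi \<Longrightarrow> b \<in> Xi \<Longrightarrow> merge j a b \<in> Xi"
  by (auto simp: Xi_def merge_def PiE_iff extensional_def)

lemma merge_iprod:
  "l \<le> j \<Longrightarrow> iprod A (merge j a b) i l = iprod A a i l"
  "j < i \<Longrightarrow> iprod A (merge j a b) i l = iprod A b i l"
  by (rule iprod_cong, simp add: merge_def)+

lemma merge_dg:
  "l \<le> j \<Longrightarrow> dg (merge j a b) i l = dg a i l"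
  "j < i \<Longrightarrow> dg (merge j a b) i l = dg b i l"
  by (rule dg_cong, simp add: merge_def)+

lemma w_merge: "a \<in> Xi \<Longrightarrow> b \<in> Xi \<Longrightarrow> 1 \<le> j \<Longrightarrow> j \<le> m \<Longrightarrow> w (merge j a b) = iprod A a 1 j \<otimes> iprod A b (Suc j) m"
  using Xi_iprod_split[OF merge_Xi, of a b 1 j m j] by (simp add: merge_iprod w_def)

end

section \<open>The algebra \<open>C\<close>\<close>

lemma maps_alg_simps [simp]:
  "carrier (maps_alg K S) = S \<rightarrow>\<^sub>E carrier K" "zero (maps_alg K S) = (\<lambda>x\<in>S. \<zero>\<^bsub>K\<^esub>)"
  "one (maps_alg K S) = (\<lambda>x\<in>S. \<one>\<^bsub>K\<^esub>)"
  "add (maps_alg K S) = (\<lambda>f g. \<lambda>x\<in>S. f x \<oplus>\<^bsub>K\<^esub> g x)" "mult (maps_alg K S) = (\<lambda>f g. \<lambda>x\<in>S. f x \<otimes>\<^bsub>K\<^esub> g x)"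
  "smult (maps_alg K S) = (\<lambda>k f. \<lambda>x\<in>S. k \<otimes>\<^bsub>K\<^esub> f x)"
  unfolding maps_alg_def by simp_all

lemma PiE_in: "b \<in> S \<rightarrow>\<^sub>E X \<Longrightarrow> x \<in> S \<Longrightarrow> b x \<in> X"
  by auto

lemma (in ring) maps_left_module:
  fixes S :: "'s set" and K :: "'a ring"
  assumes K: "ring K" shows "left_module K (maps_alg K S)"
proof -
  interpret K: ring K by fact
  have "abelian_group (maps_alg K S)"
  proof (rule abelian_groupI, goal_cases)
    case (6 x) then show ?case
      by (intro bexI[of _ "\<lambda>i\<in>S. \<ominus>\<^bsub>K\<^esub> x i"]) (auto simp: K.l_neg PiE_in)
  next
    case (5 x) then show ?case by (auto simp: fun_eq_iff PiE_in extensional_def PiE_iff)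
  qed (auto simp: K.a_ac PiE_in intro!: restrict_ext)
  then show ?thesis
    by (intro left_module.intro left_module_axioms.intro K.ring_axioms)
      (auto simp: K.l_distr K.r_distr K.m_assoc PiE_in fun_eq_iff PiE_iff extensional_def intro!: restrict_ext)
qed

lemma (in module_hom_pair) hom_scale:
  assumes c: "cring R" and f: "f \<in> module_hom R M N" and k: "k \<in> carrier R"
  shows "(\<lambda>x. k \<odot>\<^bsub>N\<^esub> f x) \<in> module_hom R M N"
proof -
  interpret cring R by fact
  show ?thesis
    by (rule module_homI)
       (auto simp: module_hom_in[OF f] module_hom_add[OF f] module_hom_smult[OF f] N.smult_closed k N.smult_r_distr
         N.smult_assoc1[symmetric] m_comm[of k])
qed

locale smash_setup = monomials K G A gr m As J
  for K :: "'k ring" and G :: "'g monoid" and A :: "('k, 'a) module" (structure) and gr :: "'g \<Rightarrow> 'a set"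
    and m :: nat and As :: "nat \<Rightarrow> 'a set" and J :: "nat \<Rightarrow> 'a set" +
  fixes S :: "'s set" and act :: "'g \<Rightarrow> 's \<Rightarrow> 's"
  assumes act: "effective_action G S act"
begin

lemma act_closed: "g \<in> carrier G \<Longrightarrow> x \<in> S \<Longrightarrow> act g x \<in> S"
  and act_one: "x \<in> S \<Longrightarrow> act \<one>\<^bsub>G\<^esub> x = x"
  and act_mult: "g \<in> carrier G \<Longrightarrow> h \<in> carrier G \<Longrightarrow> x \<in> S \<Longrightarrow> act (g \<otimes>\<^bsub>G\<^esub> h) x = act g (act h x)"
  using act by (auto simp: effective_action_def monoid_action_def)

abbreviation "B \<equiv> maps_alg K S"

sublocale B: left_module K B by (rule maps_left_module[OF ring_axioms])
sublocale TB: tensor_pair K A B by unfold_locales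

abbreviation "T \<equiv> tensor K A B"
abbreviation "pt \<equiv> pure_tensor K A B"
abbreviation "sh b g \<equiv> map_shift S act b g"

lemma sh_in: "b \<in> carrier B \<Longrightarrow> g \<in> carrier G \<Longrightarrow> sh b g \<in> carrier B"
  by (auto simp: map_shift_def act_closed PiE_in)

lemma B_mult_in: "b \<in> carrier B \<Longrightarrow> b' \<in> carrier B \<Longrightarrow> b \<otimes>\<^bsub>B\<^esub> b' \<in> carrier B"
  by (auto simp: PiE_in)

lemma sh_mult_in: "b \<in> carrier B \<Longrightarrow> g \<in> carrier G \<Longrightarrow> b' \<in> carrier B \<Longrightarrow> sh b g \<otimes>\<^bsub>B\<^esub> b' \<in> carrier B"
  using B_mult_in[OF sh_in] .

lemma sh_mult_add:
  "b1 \<in> carrier B \<Longrightarrow> b2 \<in> carrier B \<Longrightarrow> g \<in> carrier G \<Longrightarrow> b' \<in> carrier B \<Longrightarrow>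
    sh (b1 \<oplus>\<^bsub>B\<^esub> b2) g \<otimes>\<^bsub>B\<^esub> b' = (sh b1 g \<otimes>\<^bsub>B\<^esub> b') \<oplus>\<^bsub>B\<^esub> (sh b2 g \<otimes>\<^bsub>B\<^esub> b')"
  "b \<in> carrier B \<Longrightarrow> b1 \<in> carrier B \<Longrightarrow> b2 \<in> carrier B \<Longrightarrow> g \<in> carrier G \<Longrightarrow>
    sh b g \<otimes>\<^bsub>B\<^esub> (b1 \<oplus>\<^bsub>B\<^esub> b2) = (sh b g \<otimes>\<^bsub>B\<^esub> b1) \<oplus>\<^bsub>B\<^esub> (sh b g \<otimes>\<^bsub>B\<^esub> b2)"
  "k \<in> carrier K \<Longrightarrow> b \<in> carrier B \<Longrightarrow> g \<in> carrier G \<Longrightarrow> b' \<in> carrier B \<Longrightarrow>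
    sh (k \<odot>\<^bsub>B\<^esub> b) g \<otimes>\<^bsub>B\<^esub> b' = k \<odot>\<^bsub>B\<^esub> (sh b g \<otimes>\<^bsub>B\<^esub> b')"
  "k \<in> carrier K \<Longrightarrow> b \<in> carrier B \<Longrightarrow> g \<in> carrier G \<Longrightarrow> b' \<in> carrier B \<Longrightarrow>
    sh b g \<otimes>\<^bsub>B\<^esub> (k \<odot>\<^bsub>B\<^esub> b') = k \<odot>\<^bsub>B\<^esub> (sh b g \<otimes>\<^bsub>B\<^esub> b')"
  by (auto simp: map_shift_def act_closed PiE_in l_distr r_distr m_assoc m_lcomm intro!: restrict_ext)

lemma TT: "module_hom_pair K T T" and AT: "module_hom_pair K A T"
  by (intro module_hom_pair.intro TB.T.left_module_axioms L.V.left_module_axioms)+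

lemmas T_hom_sum = module_hom_pair.hom_sum[OF TT] module_hom_pair.hom_sum[OF AT]
lemmas T_hom_scale = module_hom_pair.hom_scale[OF TT cring_axioms] module_hom_pair.hom_scale[OF AT cring_axioms]
lemmas w_eq = w_hom_eq[OF TB.T.left_module_axioms]
lemmas t_eq = TB.tensor_hom_eq[OF TB.T.left_module_axioms]

text \<open>The product \<open>(a \<otimes> b)(a' \<otimes> b')\<close> is extended linearly in one factor at a time: \<open>nn a b b'\<close> in \<open>a'\<close>,
  \<open>rr a' b'\<close> in \<open>a \<otimes> b\<close>, and \<open>mu x\<close>, the product with \<open>x\<close> on the left, in \<open>a' \<otimes> b'\<close>.\<close>

definition nn where
  "nn a b b' = (SOME f. f \<in> module_hom K A T \<and>
     (\<forall>c\<in>Xi. f (w c) = pt (a \<otimes> w c) (sh b (dg c 1 m) \<otimes>\<^bsub>B\<^esub> b')))"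

lemma dgm: "c \<in> Xi \<Longrightarrow> dg c 1 m \<in> carrier G" and w_gr: "c \<in> Xi \<Longrightarrow> w c \<in> gr (dg c 1 m)"
  using dg_closed[of c 1 m] dg_in[of c 1 m] by (auto simp: w_def)

lemma nn:
  assumes "a \<in> carrier A" "b \<in> carrier B" "b' \<in> carrier B"
  shows "nn a b b' \<in> module_hom K A T"
    "\<And>c. c \<in> Xi \<Longrightarrow> nn a b b' (w c) = pt (a \<otimes> w c) (sh b (dg c 1 m) \<otimes>\<^bsub>B\<^esub> b')"
proof -
  have "\<exists>f. f \<in> module_hom K A T \<and> (\<forall>c\<in>Xi. f (w c) = pt (a \<otimes> w c) (sh b (dg c 1 m) \<otimes>\<^bsub>B\<^esub> b'))"
    using lin_ext[OF TB.T.left_module_axioms, of "\<lambda>c. pt (a \<otimes> w c) (sh b (dg c 1 m) \<otimes>\<^bsub>B\<^esub> b')"]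
      TB.pt_in[OF A.m_closed[OF assms(1) w_closed] sh_mult_in[OF assms(2) dgm assms(3)]] by blast
  from someI_ex[OF this] show "nn a b b' \<in> module_hom K A T"
    "\<And>c. c \<in> Xi \<Longrightarrow> nn a b b' (w c) = pt (a \<otimes> w c) (sh b (dg c 1 m) \<otimes>\<^bsub>B\<^esub> b')"
    unfolding nn_def by blast+
qed

text \<open>\<open>nn\<close> is prescribed on monomials, each with its own degree. A homogeneous
  \<open>x\<close> is a combination of monomials of the same degree \<open>g\<close>, so the formula
  extends to it.\<close>

lemma nn_homogeneous:
  assumes a: "a \<in> carrier A" and b: "b \<in> carrier B" "b' \<in> carrier B" and g: "g \<in> carrier G" and x: "x \<in> gr g"
  shows "nn a b b' x = pt (a \<otimes> x) (sh b g \<otimes>\<^bsub>B\<^esub> b')"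
proof -
  have M: "w ` Xi \<subseteq> (\<Union>g\<in>carrier G. gr g)" using w_gr dgm by blast
  have h: "(\<lambda>x. pt (a \<otimes> x) (sh b g \<otimes>\<^bsub>B\<^esub> b')) \<in> module_hom K A T"
    by (rule module_hom_comp[OF mult_left_hom[OF a] TB.pt_left_hom[OF sh_mult_in[OF b(1) g b(2)]]])
  have "x \<in> lspan K A (w ` Xi \<inter> gr g)"
    using homogeneous_span[OF M _ x g] w_span gr_carrier[OF g x] by blast
  moreover have "lspan K A (w ` Xi \<inter> gr g) \<subseteq> {x \<in> carrier A. nn a b b' x = pt (a \<otimes> x) (sh b g \<otimes>\<^bsub>B\<^esub> b')}"
  proof (rule L.lspan_minimal[OF _ module_hom_pair.hom_equalizer[OF AT nn(1)[OF a b] h]], rule subsetI)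
    fix y assume "y \<in> w ` Xi \<inter> gr g"
    then obtain c where y: "y = w c" and c: "c \<in> Xi" "w c \<in> gr g" by blast
    then have "dg c 1 m = g" using dg_eqI[of c 1 m g] g by (auto simp: w_def)
    then have "nn a b b' (w c) = pt (a \<otimes> w c) (sh b g \<otimes>\<^bsub>B\<^esub> b')" using nn(2)[OF a b c(1)] by simp
    then show "y \<in> {x \<in> carrier A. nn a b b' x = pt (a \<otimes> x) (sh b g \<otimes>\<^bsub>B\<^esub> b')}"
      using y w_closed[OF c(1)] by blast
  qed
  ultimately show ?thesis by blast
qed

lemma nn_lin:
  assumes a: "a \<in> carrier A" and b: "b \<in> carrier B" and b': "b' \<in> carrier B" and x: "x \<in> carrier A"
  shows "a2 \<in> carrier A \<Longrightarrow> nn (a \<oplus> a2) b b' x = nn a b b' x \<oplus>\<^bsub>T\<^esub> nn a2 b b' x"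
    "b2 \<in> carrier B \<Longrightarrow> nn a (b \<oplus>\<^bsub>B\<^esub> b2) b' x = nn a b b' x \<oplus>\<^bsub>T\<^esub> nn a b2 b' x"
    "b2 \<in> carrier B \<Longrightarrow> nn a b (b' \<oplus>\<^bsub>B\<^esub> b2) x = nn a b b' x \<oplus>\<^bsub>T\<^esub> nn a b b2 x"
    "k \<in> carrier K \<Longrightarrow> nn (k \<odot> a) b b' x = k \<odot>\<^bsub>T\<^esub> nn a b b' x"
    "k \<in> carrier K \<Longrightarrow> nn a (k \<odot>\<^bsub>B\<^esub> b) b' x = k \<odot>\<^bsub>T\<^esub> nn a b b' x"
    "k \<in> carrier K \<Longrightarrow> nn a b (k \<odot>\<^bsub>B\<^esub> b') x = k \<odot>\<^bsub>T\<^esub> nn a b b' x"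
proof -
  show "nn (a \<oplus> a2) b b' x = nn a b b' x \<oplus>\<^bsub>T\<^esub> nn a2 b b' x" if "a2 \<in> carrier A"
  proof (rule w_eq[OF nn(1)[OF A.a_closed[OF a that] b b'] T_hom_sum(2)[OF nn(1)[OF a b b'] nn(1)[OF that b b']] _ x])
    fix c assume c: "c \<in> Xi"
    show "nn (a \<oplus> a2) b b' (w c) = nn a b b' (w c) \<oplus>\<^bsub>T\<^esub> nn a2 b b' (w c)"
      unfolding nn(2)[OF A.a_closed[OF a that] b b' c] nn(2)[OF a b b' c] nn(2)[OF that b b' c] A.l_distr[OF a that w_closed[OF c]]
      by (rule TB.pt_add_left[OF A.m_closed[OF a w_closed[OF c]] A.m_closed[OF that w_closed[OF c]] sh_mult_in[OF b dgm[OF c] b']])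
  qed
  show "nn a (b \<oplus>\<^bsub>B\<^esub> b2) b' x = nn a b b' x \<oplus>\<^bsub>T\<^esub> nn a b2 b' x" if "b2 \<in> carrier B"
  proof (rule w_eq[OF nn(1)[OF a B.M.a_closed[OF b that] b'] T_hom_sum(2)[OF nn(1)[OF a b b'] nn(1)[OF a that b']] _ x])
    fix c assume c: "c \<in> Xi"
    show "nn a (b \<oplus>\<^bsub>B\<^esub> b2) b' (w c) = nn a b b' (w c) \<oplus>\<^bsub>T\<^esub> nn a b2 b' (w c)"
      unfolding nn(2)[OF a B.M.a_closed[OF b that] b' c] nn(2)[OF a b b' c] nn(2)[OF a that b' c] sh_mult_add(1)[OF b that dgm[OF c] b']
      by (rule TB.pt_add_right[OF A.m_closed[OF a w_closed[OF c]] sh_mult_in[OF b dgm[OF c] b'] sh_mult_in[OF that dgm[OF c] b']])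
  qed
  show "nn a b (b' \<oplus>\<^bsub>B\<^esub> b2) x = nn a b b' x \<oplus>\<^bsub>T\<^esub> nn a b b2 x" if "b2 \<in> carrier B"
  proof (rule w_eq[OF nn(1)[OF a b B.M.a_closed[OF b' that]] T_hom_sum(2)[OF nn(1)[OF a b b'] nn(1)[OF a b that]] _ x])
    fix c assume c: "c \<in> Xi"
    show "nn a b (b' \<oplus>\<^bsub>B\<^esub> b2) (w c) = nn a b b' (w c) \<oplus>\<^bsub>T\<^esub> nn a b b2 (w c)"
      unfolding nn(2)[OF a b B.M.a_closed[OF b' that] c] nn(2)[OF a b b' c] nn(2)[OF a b that c] sh_mult_add(2)[OF b b' that dgm[OF c]]
      by (rule TB.pt_add_right[OF A.m_closed[OF a w_closed[OF c]] sh_mult_in[OF b dgm[OF c] b'] sh_mult_in[OF b dgm[OF c] that]])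
  qed
  show "nn (k \<odot> a) b b' x = k \<odot>\<^bsub>T\<^esub> nn a b b' x" if k: "k \<in> carrier K"
  proof (rule w_eq[OF nn(1)[OF L.V.smult_closed[OF k a] b b'] T_hom_scale(2)[OF nn(1)[OF a b b'] k] _ x])
    fix c assume c: "c \<in> Xi"
    show "nn (k \<odot> a) b b' (w c) = k \<odot>\<^bsub>T\<^esub> nn a b b' (w c)"
      unfolding nn(2)[OF L.V.smult_closed[OF k a] b b' c] nn(2)[OF a b b' c] smult_mult(1)[OF k a w_closed[OF c]]
      by (rule TB.pt_smult_left[OF k A.m_closed[OF a w_closed[OF c]] sh_mult_in[OF b dgm[OF c] b']])
  qed
  show "nn a (k \<odot>\<^bsub>B\<^esub> b) b' x = k \<odot>\<^bsub>T\<^esub> nn a b b' x" if k: "k \<in> carrier K"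
  proof (rule w_eq[OF nn(1)[OF a B.smult_closed[OF k b] b'] T_hom_scale(2)[OF nn(1)[OF a b b'] k] _ x])
    fix c assume c: "c \<in> Xi"
    show "nn a (k \<odot>\<^bsub>B\<^esub> b) b' (w c) = k \<odot>\<^bsub>T\<^esub> nn a b b' (w c)"
      unfolding nn(2)[OF a B.smult_closed[OF k b] b' c] nn(2)[OF a b b' c] sh_mult_add(3)[OF k b dgm[OF c] b']
      by (rule TB.pt_smult_right[OF k A.m_closed[OF a w_closed[OF c]] sh_mult_in[OF b dgm[OF c] b']])
  qed
  show "nn a b (k \<odot>\<^bsub>B\<^esub> b') x = k \<odot>\<^bsub>T\<^esub> nn a b b' x" if k: "k \<in> carrier K"
  proof (rule w_eq[OF nn(1)[OF a b B.smult_closed[OF k b']] T_hom_scale(2)[OF nn(1)[OF a b b'] k] _ x])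
    fix c assume c: "c \<in> Xi"
    show "nn a b (k \<odot>\<^bsub>B\<^esub> b') (w c) = k \<odot>\<^bsub>T\<^esub> nn a b b' (w c)"
      unfolding nn(2)[OF a b B.smult_closed[OF k b'] c] nn(2)[OF a b b' c] sh_mult_add(4)[OF k b dgm[OF c] b']
      by (rule TB.pt_smult_right[OF k A.m_closed[OF a w_closed[OF c]] sh_mult_in[OF b dgm[OF c] b']])
  qed
qed

definition rr where
  "rr a' b' = (SOME f. f \<in> module_hom K T T \<and> (\<forall>a\<in>carrier A. \<forall>b\<in>carrier B. f (pt a b) = nn a b b' a'))"

lemma rr:
  assumes a': "a' \<in> carrier A" and b': "b' \<in> carrier B"
  shows "rr a' b' \<in> module_hom K T T" "\<And>a b. a \<in> carrier A \<Longrightarrow> b \<in> carrier B \<Longrightarrow> rr a' b' (pt a b) = nn a b b' a'"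
proof -
  have "\<exists>f\<in>module_hom K T T. \<forall>a\<in>carrier A. \<forall>b\<in>carrier B. f (pt a b) = nn a b b' a'"
  proof (rule TB.tensor_lift[OF TB.T.left_module_axioms])
    show "(\<lambda>v. nn v u b' a') \<in> module_hom K A T" if u: "u \<in> carrier B" for u
    proof (rule module_homI)
      fix v assume v: "v \<in> carrier A"
      show "nn v u b' a' \<in> carrier T" by (rule module_hom_in[OF nn(1)[OF v u b'] a'])
      show "nn (v \<oplus> v2) u b' a' = nn v u b' a' \<oplus>\<^bsub>T\<^esub> nn v2 u b' a'" if "v2 \<in> carrier A" for v2
        by (rule nn_lin(1)[OF v u b' a' that])
      show "nn (k \<odot> v) u b' a' = k \<odot>\<^bsub>T\<^esub> nn v u b' a'" if "k \<in> carrier K" for k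
        by (rule nn_lin(4)[OF v u b' a' that])
    qed
    show "(\<lambda>u. nn v u b' a') \<in> module_hom K B T" if v: "v \<in> carrier A" for v
    proof (rule module_homI)
      fix u assume u: "u \<in> carrier B"
      show "nn v u b' a' \<in> carrier T" by (rule module_hom_in[OF nn(1)[OF v u b'] a'])
      show "nn v (u \<oplus>\<^bsub>B\<^esub> u2) b' a' = nn v u b' a' \<oplus>\<^bsub>T\<^esub> nn v u2 b' a'" if "u2 \<in> carrier B" for u2
        by (rule nn_lin(2)[OF v u b' a' that])
      show "nn v (k \<odot>\<^bsub>B\<^esub> u) b' a' = k \<odot>\<^bsub>T\<^esub> nn v u b' a'" if "k \<in> carrier K" for k
        by (rule nn_lin(5)[OF v u b' a' that])
    qed
  qed
  then have "\<exists>f. f \<in> module_hom K T T \<and> (\<forall>a\<in>carrier A. \<forall>b\<in>carrier B. f (pt a b) = nn a b b' a')" by blast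
  from someI_ex[OF this] show "rr a' b' \<in> module_hom K T T"
    "\<And>a b. a \<in> carrier A \<Longrightarrow> b \<in> carrier B \<Longrightarrow> rr a' b' (pt a b) = nn a b b' a'"
    unfolding rr_def by blast+
qed

lemma rr_lin:
  assumes a: "a \<in> carrier A" and b: "b \<in> carrier B" and x: "x \<in> carrier T"
  shows "a2 \<in> carrier A \<Longrightarrow> rr (a \<oplus> a2) b x = rr a b x \<oplus>\<^bsub>T\<^esub> rr a2 b x"
    "b2 \<in> carrier B \<Longrightarrow> rr a (b \<oplus>\<^bsub>B\<^esub> b2) x = rr a b x \<oplus>\<^bsub>T\<^esub> rr a b2 x"
    "k \<in> carrier K \<Longrightarrow> rr (k \<odot> a) b x = k \<odot>\<^bsub>T\<^esub> rr a b x"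
    "k \<in> carrier K \<Longrightarrow> rr a (k \<odot>\<^bsub>B\<^esub> b) x = k \<odot>\<^bsub>T\<^esub> rr a b x"
proof -
  show "rr (a \<oplus> a2) b x = rr a b x \<oplus>\<^bsub>T\<^esub> rr a2 b x" if a2: "a2 \<in> carrier A"
  proof (rule t_eq[OF rr(1)[OF A.a_closed[OF a a2] b] T_hom_sum(1)[OF rr(1)[OF a b] rr(1)[OF a2 b]] _ x])
    fix v u assume v: "v \<in> carrier A" and u: "u \<in> carrier B"
    show "rr (a \<oplus> a2) b (pt v u) = rr a b (pt v u) \<oplus>\<^bsub>T\<^esub> rr a2 b (pt v u)"
      unfolding rr(2)[OF A.a_closed[OF a a2] b v u] rr(2)[OF a b v u] rr(2)[OF a2 b v u]
      by (rule module_hom_add[OF nn(1)[OF v u b] a a2])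
  qed
  show "rr a (b \<oplus>\<^bsub>B\<^esub> b2) x = rr a b x \<oplus>\<^bsub>T\<^esub> rr a b2 x" if b2: "b2 \<in> carrier B"
  proof (rule t_eq[OF rr(1)[OF a B.M.a_closed[OF b b2]] T_hom_sum(1)[OF rr(1)[OF a b] rr(1)[OF a b2]] _ x])
    fix v u assume v: "v \<in> carrier A" and u: "u \<in> carrier B"
    show "rr a (b \<oplus>\<^bsub>B\<^esub> b2) (pt v u) = rr a b (pt v u) \<oplus>\<^bsub>T\<^esub> rr a b2 (pt v u)"
      unfolding rr(2)[OF a B.M.a_closed[OF b b2] v u] rr(2)[OF a b v u] rr(2)[OF a b2 v u]
      by (rule nn_lin(3)[OF v u b a b2])
  qed
  show "rr (k \<odot> a) b x = k \<odot>\<^bsub>T\<^esub> rr a b x" if k: "k \<in> carrier K"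
  proof (rule t_eq[OF rr(1)[OF L.V.smult_closed[OF k a] b] T_hom_scale(1)[OF rr(1)[OF a b] k] _ x])
    fix v u assume v: "v \<in> carrier A" and u: "u \<in> carrier B"
    show "rr (k \<odot> a) b (pt v u) = k \<odot>\<^bsub>T\<^esub> rr a b (pt v u)"
      unfolding rr(2)[OF L.V.smult_closed[OF k a] b v u] rr(2)[OF a b v u]
      by (rule module_hom_smult[OF nn(1)[OF v u b] k a])
  qed
  show "rr a (k \<odot>\<^bsub>B\<^esub> b) x = k \<odot>\<^bsub>T\<^esub> rr a b x" if k: "k \<in> carrier K"
  proof (rule t_eq[OF rr(1)[OF a B.smult_closed[OF k b]] T_hom_scale(1)[OF rr(1)[OF a b] k] _ x])
    fix v u assume v: "v \<in> carrier A" and u: "u \<in> carrier B"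
    show "rr a (k \<odot>\<^bsub>B\<^esub> b) (pt v u) = k \<odot>\<^bsub>T\<^esub> rr a b (pt v u)"
      unfolding rr(2)[OF a B.smult_closed[OF k b] v u] rr(2)[OF a b v u]
      by (rule nn_lin(6)[OF v u b a k])
  qed
qed

definition mu where
  "mu x = (SOME f. f \<in> module_hom K T T \<and> (\<forall>a\<in>carrier A. \<forall>b\<in>carrier B. f (pt a b) = rr a b x))"

lemma mu:
  assumes x: "x \<in> carrier T"
  shows "mu x \<in> module_hom K T T" "\<And>a b. a \<in> carrier A \<Longrightarrow> b \<in> carrier B \<Longrightarrow> mu x (pt a b) = rr a b x"
proof -
  have "\<exists>f\<in>module_hom K T T. \<forall>a\<in>carrier A. \<forall>b\<in>carrier B. f (pt a b) = rr a b x"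
  proof (rule TB.tensor_lift[OF TB.T.left_module_axioms])
    show "(\<lambda>v. rr v u x) \<in> module_hom K A T" if u: "u \<in> carrier B" for u
    proof (rule module_homI)
      fix v assume v: "v \<in> carrier A"
      show "rr v u x \<in> carrier T" by (rule module_hom_in[OF rr(1)[OF v u] x])
      show "rr (v \<oplus> v2) u x = rr v u x \<oplus>\<^bsub>T\<^esub> rr v2 u x" if "v2 \<in> carrier A" for v2
        by (rule rr_lin(1)[OF v u x that])
      show "rr (k \<odot> v) u x = k \<odot>\<^bsub>T\<^esub> rr v u x" if "k \<in> carrier K" for k
        by (rule rr_lin(3)[OF v u x that])
    qed
    show "(\<lambda>u. rr v u x) \<in> module_hom K B T" if v: "v \<in> carrier A" for v
    proof (rule module_homI)
      fix u assume u: "u \<in> carrier B"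
      show "rr v u x \<in> carrier T" by (rule module_hom_in[OF rr(1)[OF v u] x])
      show "rr v (u \<oplus>\<^bsub>B\<^esub> u2) x = rr v u x \<oplus>\<^bsub>T\<^esub> rr v u2 x" if "u2 \<in> carrier B" for u2
        by (rule rr_lin(2)[OF v u x that])
      show "rr v (k \<odot>\<^bsub>B\<^esub> u) x = k \<odot>\<^bsub>T\<^esub> rr v u x" if "k \<in> carrier K" for k
        by (rule rr_lin(4)[OF v u x that])
    qed
  qed
  then have "\<exists>f. f \<in> module_hom K T T \<and> (\<forall>a\<in>carrier A. \<forall>b\<in>carrier B. f (pt a b) = rr a b x)" by blast
  from someI_ex[OF this] show "mu x \<in> module_hom K T T"
    "\<And>a b. a \<in> carrier A \<Longrightarrow> b \<in> carrier B \<Longrightarrow> mu x (pt a b) = rr a b x"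
    unfolding mu_def by blast+
qed

lemma mu_left:
  assumes y: "y \<in> carrier T" shows "(\<lambda>x. mu x y) \<in> module_hom K T T"
proof (rule module_homI)
  fix x assume x: "x \<in> carrier T"
  show "mu x y \<in> carrier T" using module_hom_in[OF mu(1)[OF x] y] .
  show "mu (k \<odot>\<^bsub>T\<^esub> x) y = k \<odot>\<^bsub>T\<^esub> mu x y" if k: "k \<in> carrier K" for k
  proof (rule t_eq[OF mu(1)[OF TB.T.smult_closed[OF k x]] T_hom_scale(1)[OF mu(1)[OF x] k] _ y])
    fix v u assume v: "v \<in> carrier A" and u: "u \<in> carrier B"
    show "mu (k \<odot>\<^bsub>T\<^esub> x) (pt v u) = k \<odot>\<^bsub>T\<^esub> mu x (pt v u)"
      unfolding mu(2)[OF TB.T.smult_closed[OF k x] v u] mu(2)[OF x v u] by (rule module_hom_smult[OF rr(1)[OF v u] k x])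
  qed
  fix x2 assume x2: "x2 \<in> carrier T"
  show "mu (x \<oplus>\<^bsub>T\<^esub> x2) y = mu x y \<oplus>\<^bsub>T\<^esub> mu x2 y"
  proof (rule t_eq[OF mu(1)[OF TB.T.M.a_closed[OF x x2]] T_hom_sum(1)[OF mu(1)[OF x] mu(1)[OF x2]] _ y])
    fix v u assume v: "v \<in> carrier A" and u: "u \<in> carrier B"
    show "mu (x \<oplus>\<^bsub>T\<^esub> x2) (pt v u) = mu x (pt v u) \<oplus>\<^bsub>T\<^esub> mu x2 (pt v u)"
      unfolding mu(2)[OF TB.T.M.a_closed[OF x x2] v u] mu(2)[OF x v u] mu(2)[OF x2 v u] by (rule module_hom_add[OF rr(1)[OF v u] x x2])
  qed
qed

lemma mu_pt:
  assumes "g \<in> carrier G" "a \<in> carrier A" "b \<in> carrier B" "a' \<in> gr g" "b' \<in> carrier B"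
  shows "mu (pt a b) (pt a' b') = pt (a \<otimes> a') (sh b g \<otimes>\<^bsub>B\<^esub> b')"
  using mu(2)[OF TB.pt_in[OF assms(2,3)] gr_carrier[OF assms(1,4)] assms(5)]
    rr(2)[OF gr_carrier[OF assms(1,4)] assms(5,2,3)] nn_homogeneous[OF assms(2,3,5,1,4)] by simp

text \<open>The map \<open>mu\<close> has the properties that characterize
  \<open>smash_mult\<close>. They determine it because monomials, which are homogeneous, span
  \<open>A\<close> and pure tensors span \<open>T\<close>; outside the carriers extensionality fixes
  the values.\<close>

lemma smash_mult_eq: "smash_mult K G S act A gr = (\<lambda>x\<in>carrier T. \<lambda>y\<in>carrier T. mu x y)"
  unfolding smash_mult_def Let_def
proof (rule the_equality, goal_cases)
  case 1
  have 1: "(\<lambda>y. (\<lambda>x\<in>carrier T. \<lambda>y\<in>carrier T. mu x y) x y) \<in> module_hom K T T" if "x \<in> carrier T" for x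
    using mu(1)[OF that] that TB.T.M.a_closed TB.T.smult_closed by (auto simp: module_hom_def)
  have 2: "(\<lambda>x. (\<lambda>x\<in>carrier T. \<lambda>y\<in>carrier T. mu x y) x y) \<in> module_hom K T T" if "y \<in> carrier T" for y
    using mu_left[OF that] that TB.T.M.a_closed TB.T.smult_closed by (auto simp: module_hom_def)
  show ?case
    by (intro conjI ballI 1 2) (use module_hom_in[OF mu(1)] TB.pt_in gr_carrier mu_pt in \<open>auto simp del: maps_alg_simps\<close>)
next
  case (2 \<nu>)
  then have ext: "\<nu> \<in> carrier T \<rightarrow>\<^sub>E carrier T \<rightarrow>\<^sub>E carrier T"
    and r: "\<And>x. x \<in> carrier T \<Longrightarrow> (\<lambda>y. \<nu> x y) \<in> module_hom K T T"
    and l: "\<And>y. y \<in> carrier T \<Longrightarrow> (\<lambda>x. \<nu> x y) \<in> module_hom K T T"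
    and p: "\<And>g a b a' b'. g \<in> carrier G \<Longrightarrow> a \<in> carrier A \<Longrightarrow> b \<in> carrier B \<Longrightarrow> a' \<in> gr g \<Longrightarrow> b' \<in> carrier B \<Longrightarrow>
       \<nu> (pt a b) (pt a' b') = pt (a \<otimes> a') (sh b g \<otimes>\<^bsub>B\<^esub> b')" by blast+
  have e1: "\<nu> (pt a b) (pt a' b') = mu (pt a b) (pt a' b')"
    if "a \<in> carrier A" "b \<in> carrier B" "a' \<in> carrier A" "b' \<in> carrier B" for a b a' b'
    by (rule w_eq[OF module_hom_comp[OF TB.pt_left_hom[OF that(4)] r[OF TB.pt_in[OF that(1,2)]]]
          module_hom_comp[OF TB.pt_left_hom[OF that(4)] mu(1)[OF TB.pt_in[OF that(1,2)]]] _ that(3)])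
      (use p[OF dgm that(1,2) w_gr that(4)] mu_pt[OF dgm that(1,2) w_gr that(4)] in simp)
  have e2: "\<nu> (pt a b) y = mu (pt a b) y" if "a \<in> carrier A" "b \<in> carrier B" "y \<in> carrier T" for a b y
    by (rule t_eq[OF r[OF TB.pt_in[OF that(1,2)]] mu(1)[OF TB.pt_in[OF that(1,2)]] _ that(3)]) (rule e1[OF that(1,2)])
  have e3: "\<nu> x y = mu x y" if "x \<in> carrier T" "y \<in> carrier T" for x y
    by (rule t_eq[OF l[OF that(2)] mu_left[OF that(2)] _ that(1)]) (rule e2[OF _ _ that(2)])
  show ?case
  proof (rule PiE_ext[OF ext])
    show "(\<lambda>x\<in>carrier T. \<lambda>y\<in>carrier T. mu x y) \<in> carrier T \<rightarrow>\<^sub>E carrier T \<rightarrow>\<^sub>E carrier T"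
      using module_hom_in[OF mu(1)] by auto
    fix x assume x: "x \<in> carrier T"
    show "\<nu> x = (\<lambda>x\<in>carrier T. \<lambda>y\<in>carrier T. mu x y) x"
    proof (rule PiE_ext[of _ "carrier T" "\<lambda>_. carrier T"])
      show "\<nu> x \<in> carrier T \<rightarrow>\<^sub>E carrier T" using ext x by (rule PiE_mem)
      show "(\<lambda>x\<in>carrier T. \<lambda>y\<in>carrier T. mu x y) x \<in> carrier T \<rightarrow>\<^sub>E carrier T"
        using x module_hom_in[OF mu(1)] by auto
    qed (use x e3 in simp)
  qed
qed

section \<open>Ring axioms for the smash product\<close>

abbreviation "C \<equiv> smash K G S act A gr"

lemma C_simps: "carrier C = carrier T" "zero C = zero T" "add C = add T" "smult C = smult T"
  "one C = pt \<one> \<one>\<^bsub>B\<^esub>"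
  unfolding smash_def by (simp_all del: maps_alg_simps)

lemma C_mult: "x \<in> carrier C \<Longrightarrow> y \<in> carrier C \<Longrightarrow> x \<otimes>\<^bsub>C\<^esub> y = mu x y"
  unfolding C_simps by (simp add: smash_def smash_mult_eq del: maps_alg_simps)

lemma pt_C: "a \<in> carrier A \<Longrightarrow> b \<in> carrier B \<Longrightarrow> pt a b \<in> carrier C"
  unfolding C_simps by (rule TB.pt_in)

lemma C_pt_mult:
  assumes "g \<in> carrier G" "a \<in> carrier A" "b \<in> carrier B" "a' \<in> gr g" "b' \<in> carrier B"
  shows "pt a b \<otimes>\<^bsub>C\<^esub> pt a' b' = pt (a \<otimes> a') (sh b g \<otimes>\<^bsub>B\<^esub> b')"
  using mu_pt[OF assms] C_mult pt_C assms gr_carrier by (simp del: maps_alg_simps)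

lemma C_left_module: "left_module K C"
proof -
  have "abelian_group C"
    using TB.T.M.abelian_group_axioms
    unfolding abelian_group_def abelian_monoid_def abelian_group_axioms_def by (simp add: C_simps(1-3))
  then show ?thesis
    by (intro left_module.intro left_module_axioms.intro ring_axioms)
      (simp_all only: C_simps TB.T.smult_closed TB.T.smult_l_distr TB.T.smult_r_distr TB.T.smult_assoc1 TB.T.smult_one)
qed

sublocale CM: left_module K C by (rule C_left_module)

lemma C_homs: "module_hom K C N = module_hom K T N" "module_hom K N C = module_hom K N T"
  unfolding module_hom_def C_simps by auto

lemma C_mult_homs:
  "x \<in> carrier C \<Longrightarrow> (\<lambda>y. x \<otimes>\<^bsub>C\<^esub> y) \<in> module_hom K C C"
  "y \<in> carrier C \<Longrightarrow> (\<lambda>x. x \<otimes>\<^bsub>C\<^esub> y) \<in> module_hom K C C"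
proof -
  show "(\<lambda>y. x \<otimes>\<^bsub>C\<^esub> y) \<in> module_hom K C C" if x: "x \<in> carrier C"
    using mu(1)[of x] x CM.M.a_closed CM.smult_closed unfolding module_hom_def
    by (auto simp: C_mult) (simp_all add: C_simps Pi_iff)
  show "(\<lambda>x. x \<otimes>\<^bsub>C\<^esub> y) \<in> module_hom K C C" if y: "y \<in> carrier C"
    using mu_left[of y] y CM.M.a_closed CM.smult_closed unfolding module_hom_def
    by (auto simp: C_mult) (simp_all add: C_simps Pi_iff)
qed

text \<open>The product is given by a formula only when the first component of the right factor is
  homogeneous. Splitting \<open>a\<close> into homogeneous components reduces everything to such
  generators.\<close>

lemma smash_induct [consumes 1, case_names pure add]:
  assumes x: "x \<in> carrier C" and p: "\<And>g a b. g \<in> carrier G \<Longrightarrow> a \<in> gr g \<Longrightarrow> b \<in> carrier B \<Longrightarrow> P (pt a b)"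
    and ad: "\<And>x y. x \<in> carrier C \<Longrightarrow> y \<in> carrier C \<Longrightarrow> P x \<Longrightarrow> P y \<Longrightarrow> P (x \<oplus>\<^bsub>C\<^esub> y)"
  shows "P x"
  using x[unfolded C_simps]
proof (induction rule: TB.tensor_induct)
  case (pure a b)
  interpret AT: module_hom_pair K A T by (rule AT)
  let ?F = "{g \<in> carrier G. dec a g \<noteq> \<zero>}"
  have c: "dec a g \<in> gr g" "dec a g \<in> carrier A" if "g \<in> ?F" for g using that dec_in pure gr_carrier by auto
  have z: "P \<zero>\<^bsub>T\<^esub>"
    using p[OF G.one_closed left_submoduleD(3)[OF gr_sub[OF G.one_closed]] pure(2)] AT.hom_zero[OF TB.pt_left_hom[OF pure(2)]] by simp
  have e: "pt a b = finsum T (\<lambda>g. pt (dec a g) b) ?F"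
    using AT.hom_finsum[OF TB.pt_left_hom[OF pure(2)], of ?F "dec a"] c dec_sum[OF pure(1)] by simp
  have f: "finite ?F" by (rule dec_finite[OF pure(1)])
  have ptc: "pt (dec a g) b \<in> carrier T" if "g \<in> ?F" for g using c[OF that] pure TB.pt_in by blast
  have "P (finsum T (\<lambda>g. pt (dec a g) b) F) \<and> finsum T (\<lambda>g. pt (dec a g) b) F \<in> carrier T" if "F \<subseteq> ?F" for F
    using finite_subset[OF that f] that
  proof (induction F)
    case (insert g F)
    then have s: "finsum T (\<lambda>g. pt (dec a g) b) (insert g F) = pt (dec a g) b \<oplus>\<^bsub>T\<^esub> finsum T (\<lambda>g. pt (dec a g) b) F"
      using ptc by (intro TB.T.M.finsum_insert) auto
    show ?case unfolding s
      using insert ptc[of g] p[of g "dec a g" b] c[of g] pure(2) ad[of "pt (dec a g) b" "finsum T (\<lambda>g. pt (dec a g) b) F"]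
      by (simp add: C_simps TB.T.M.a_closed del: maps_alg_simps)
  qed (simp add: z)
  then show ?case unfolding e by blast
next
  case (add x y)
  then show ?case using ad[of x y] by (simp add: C_simps)
qed

text \<open>Shifting by \<open>g\<close> and then by \<open>h\<close> evaluates at
  \<open>act g (act h x)\<close>, that is, shifts by the product; associativity of \<open>C\<close>
  rests on this.\<close>

lemma B_mult_assoc:
  assumes "b1 \<in> carrier B" "b2 \<in> carrier B" "b3 \<in> carrier B" "g \<in> carrier G" "h \<in> carrier G"
  shows "sh (sh b1 g \<otimes>\<^bsub>B\<^esub> b2) h \<otimes>\<^bsub>B\<^esub> b3 = sh b1 (g \<otimes>\<^bsub>G\<^esub> h) \<otimes>\<^bsub>B\<^esub> (sh b2 h \<otimes>\<^bsub>B\<^esub> b3)"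
  using assms by (auto simp: map_shift_def act_closed act_mult PiE_in m_assoc intro!: restrict_ext)

lemma B_one: "b \<in> carrier B \<Longrightarrow> g \<in> carrier G \<Longrightarrow> sh \<one>\<^bsub>B\<^esub> g \<otimes>\<^bsub>B\<^esub> b = b"
  "b \<in> carrier B \<Longrightarrow> sh b \<one>\<^bsub>G\<^esub> \<otimes>\<^bsub>B\<^esub> \<one>\<^bsub>B\<^esub> = b" "\<one>\<^bsub>B\<^esub> \<in> carrier B"
  by (auto simp: map_shift_def act_closed act_one PiE_in fun_eq_iff PiE_iff extensional_def)

lemma C_m_closed: "x \<in> carrier C \<Longrightarrow> y \<in> carrier C \<Longrightarrow> x \<otimes>\<^bsub>C\<^esub> y \<in> carrier C"
  using module_hom_in[OF C_mult_homs(1)] .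

lemma C_distr: "x \<in> carrier C \<Longrightarrow> y \<in> carrier C \<Longrightarrow> z \<in> carrier C \<Longrightarrow> (x \<oplus>\<^bsub>C\<^esub> y) \<otimes>\<^bsub>C\<^esub> z = x \<otimes>\<^bsub>C\<^esub> z \<oplus>\<^bsub>C\<^esub> y \<otimes>\<^bsub>C\<^esub> z"
  "x \<in> carrier C \<Longrightarrow> y \<in> carrier C \<Longrightarrow> z \<in> carrier C \<Longrightarrow> z \<otimes>\<^bsub>C\<^esub> (x \<oplus>\<^bsub>C\<^esub> y) = z \<otimes>\<^bsub>C\<^esub> x \<oplus>\<^bsub>C\<^esub> z \<otimes>\<^bsub>C\<^esub> y"
  using module_hom_add[OF C_mult_homs(2)] module_hom_add[OF C_mult_homs(1)] by auto

lemma C_assoc: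
  assumes x: "x \<in> carrier C" and y: "y \<in> carrier C" and z: "z \<in> carrier C"
  shows "(x \<otimes>\<^bsub>C\<^esub> y) \<otimes>\<^bsub>C\<^esub> z = x \<otimes>\<^bsub>C\<^esub> (y \<otimes>\<^bsub>C\<^esub> z)"
  using x
proof (induction rule: smash_induct)
  case (pure g1 a1 b1)
  note 1 = pure gr_carrier[OF pure(1,2)]
  note c1 = pt_C[OF 1(4,3)]
  show ?case using y
  proof (induction rule: smash_induct)
    case (pure g2 a2 b2)
    note 2 = pure gr_carrier[OF pure(1,2)]
    note c2 = pt_C[OF 2(4,3)]
    show ?case using z
    proof (induction rule: smash_induct)
      case (pure g3 a3 b3)
      note 3 = pure gr_carrier[OF pure(1,2)]
      show ?case
        unfolding C_pt_mult[OF 2(1) 1(4,3) 2(2,3)] C_pt_mult[OF 3(1) 2(4,3) 3(2,3)]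
          C_pt_mult[OF 3(1) A.m_closed[OF 1(4) 2(4)] sh_mult_in[OF 1(3) 2(1,3)] 3(2,3)]
          C_pt_mult[OF G.m_closed[OF 2(1) 3(1)] 1(4,3) gr_mult[OF 2(1) 3(1) 2(2) 3(2)] sh_mult_in[OF 2(3) 3(1,3)]]
          A.m_assoc[OF 1(4) 2(4) 3(4)] B_mult_assoc[OF 1(3) 2(3) 3(3) 2(1) 3(1)] ..
    next
      case (add x y)
      then show ?case using c1 c2 by (simp add: C_distr C_m_closed)
    qed
  next
    case (add x y)
    then show ?case using c1 z by (simp add: C_distr C_m_closed)
  qed
next
  case (add x x')
  then show ?case using y z by (simp add: C_distr C_m_closed)
qed

lemma C_one: assumes "x \<in> carrier C" shows "\<one>\<^bsub>C\<^esub> \<otimes>\<^bsub>C\<^esub> x = x" "x \<otimes>\<^bsub>C\<^esub> \<one>\<^bsub>C\<^esub> = x"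
proof -
  have o: "\<one>\<^bsub>C\<^esub> \<in> carrier C" unfolding C_simps(5) by (rule pt_C[OF A.one_closed B_one(3)])
  show "\<one>\<^bsub>C\<^esub> \<otimes>\<^bsub>C\<^esub> x = x" using assms
  proof (induction rule: smash_induct)
    case (pure g a b)
    then show ?case unfolding C_simps(5)
      using C_pt_mult[OF pure(1) A.one_closed B_one(3) pure(2,3)] B_one(1)[OF pure(3,1)] gr_carrier[OF pure(1,2)] by simp
  qed (use o in \<open>simp add: C_distr\<close>)
  show "x \<otimes>\<^bsub>C\<^esub> \<one>\<^bsub>C\<^esub> = x" using assms
  proof (induction rule: smash_induct)
    case (pure g a b)
    then show ?case unfolding C_simps(5)
      using C_pt_mult[OF G.one_closed gr_carrier[OF pure(1,2)] pure(3) gr_one B_one(3)] B_one(2)[OF pure(3)] gr_carrier[OF pure(1,2)] by simp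
  qed (use o in \<open>simp add: C_distr\<close>)
qed

lemma C_ring: "ring C"
proof (rule ringI[OF CM.M.abelian_group_axioms])
  show "Group.monoid C"
    by (rule monoidI) (use C_m_closed C_assoc C_one in \<open>simp_all add: C_simps(5) pt_C[OF A.one_closed B_one(3)] del: maps_alg_simps\<close>)
qed (simp_all add: C_distr)

sublocale C: ring C by (rule C_ring)

lemma C_kalgebra: "kalgebra K C"
  by (intro kalgebra.intro kalgebra_axioms.intro C_ring vectorspace_iff[THEN iffD2] conjI field_axioms C_left_module)
     (use module_hom_smult[OF C_mult_homs(1)] module_hom_smult[OF C_mult_homs(2)] in auto)

subsection \<open>Evaluation at a point\<close>

text \<open>The component of an element of \<open>C\<close> at the point \<open>y\<close>, with
  values in \<open>A\<close>. Elements of \<open>C\<close> are studied below through these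
  components.\<close>

definition ev where
  "ev y = (SOME f. f \<in> module_hom K T A \<and> (\<forall>a\<in>carrier A. \<forall>b\<in>carrier B. f (pt a b) = b y \<odot> a))"

lemma ev:
  assumes y: "y \<in> S"
  shows "ev y \<in> module_hom K C A" "\<And>a b. a \<in> carrier A \<Longrightarrow> b \<in> carrier B \<Longrightarrow> ev y (pt a b) = b y \<odot> a"
proof -
  have "\<exists>f\<in>module_hom K T A. \<forall>a\<in>carrier A. \<forall>b\<in>carrier B. f (pt a b) = b y \<odot> a"
  proof (rule TB.tensor_lift[OF L.V.left_module_axioms])
    show "(\<lambda>v. u y \<odot> v) \<in> module_hom K A A" if "u \<in> carrier B" for u
      using that y by (intro module_homI)
        (auto simp: PiE_in L.V.smult_closed L.V.smult_r_distr L.V.smult_assoc1[symmetric] m_comm)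
    show "(\<lambda>u. u y \<odot> v) \<in> module_hom K B A" if "v \<in> carrier A" for v
      using that y by (intro module_homI)
        (auto simp: PiE_in L.V.smult_closed L.V.smult_l_distr L.V.smult_assoc1)
  qed
  then have "\<exists>f. f \<in> module_hom K T A \<and> (\<forall>a\<in>carrier A. \<forall>b\<in>carrier B. f (pt a b) = b y \<odot> a)" by blast
  from someI_ex[OF this] show "ev y \<in> module_hom K C A"
    "\<And>a b. a \<in> carrier A \<Longrightarrow> b \<in> carrier B \<Longrightarrow> ev y (pt a b) = b y \<odot> a"
    unfolding ev_def C_homs by blast+
qed

lemma CA: "module_hom_pair K C A" and CC: "module_hom_pair K C C" and AC: "module_hom_pair K A C"
  by (intro module_hom_pair.intro C_left_module L.V.left_module_axioms)+

lemma ev_in: "y \<in> S \<Longrightarrow> c \<in> carrier C \<Longrightarrow> ev y c \<in> carrier A"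
  using module_hom_in[OF ev(1)] .

lemma ev_add: "y \<in> S \<Longrightarrow> c \<in> carrier C \<Longrightarrow> d \<in> carrier C \<Longrightarrow> ev y (c \<oplus>\<^bsub>C\<^esub> d) = ev y c \<oplus> ev y d"
  using module_hom_add[OF ev(1)] .

text \<open>Moving a map past a homogeneous \<open>a\<close> of degree \<open>g\<close> shifts it by
  \<open>g\<close>, so right multiplication by \<open>a\<close> takes the component at
  \<open>act g y\<close> to the component at \<open>y\<close>. This is the link between products in
  \<open>C\<close> and paths in \<open>S\<close>.\<close>

lemma ev_mult:
  assumes y: "y \<in> S" and c: "c \<in> carrier C" and g: "g \<in> carrier G" "a \<in> gr g" and b: "b \<in> carrier B"
  shows "ev y (c \<otimes>\<^bsub>C\<^esub> pt a b) = b y \<odot> (ev (act g y) c \<otimes> a)"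
  using c
proof (induction rule: smash_induct)
  case (pure h a' b')
  note aA = gr_carrier[OF g] gr_carrier[OF pure(1,2)]
  note gy = act_closed[OF g(1) y]
  have "(sh b' g \<otimes>\<^bsub>B\<^esub> b) y = b' (act g y) \<otimes>\<^bsub>K\<^esub> b y" using y by (simp add: map_shift_def)
  moreover have "b' (act g y) \<in> carrier K" "b y \<in> carrier K" using pure(3) b y gy by (auto simp: PiE_in)
  ultimately show ?case
    using C_pt_mult[OF g(1) aA(2) pure(3) g(2) b] ev(2)[OF y A.m_closed[OF aA(2) aA(1)] sh_mult_in[OF pure(3) g(1) b]]
      ev(2)[OF gy aA(2) pure(3)] aA by (simp add: smult_mult L.V.smult_assoc1[symmetric] m_comm del: maps_alg_simps)
next
  case (add x x')
  note aA = gr_carrier[OF g]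
  note gy = act_closed[OF g(1) y]
  note p = pt_C[OF aA b]
  have "b y \<in> carrier K" using b y by (auto simp: PiE_in)
  then show ?case using add p aA gy y
    by (simp add: C_distr ev_add C_m_closed ev_in A.l_distr L.V.smult_r_distr del: maps_alg_simps)
qed

end

section \<open>Two-sided ideals generated by an element\<close>

context ring begin

lemma two_sided_ideal:
  assumes x: "x \<in> carrier R" shows "ideal (two_sided R x) R"
proof -
  let ?H = "{a \<otimes> x \<otimes> b | a b. a \<in> carrier R \<and> b \<in> carrier R}"
  have H: "?H \<subseteq> carrier R" using x by auto
  have sg: "subgroup (two_sided R x) (add_monoid R)"
    unfolding two_sided_def by (rule add.generate_is_subgroup[OF H])
  have c: "u \<in> carrier R" if "u \<in> two_sided R x" for u using subgroup.subset[OF sg] that by auto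
  have "u \<otimes> r \<in> two_sided R x \<and> r \<otimes> u \<in> two_sided R x" if r: "r \<in> carrier R" and u: "u \<in> two_sided R x" for u r
    using u[unfolded two_sided_def]
  proof (induction rule: generate.induct)
    case one
    then show ?case using r subgroup.one_closed[OF sg] by simp
  next
    case (incl h)
    then obtain a b where h: "h = a \<otimes> x \<otimes> b" "a \<in> carrier R" "b \<in> carrier R" by blast
    have "h \<otimes> r = a \<otimes> x \<otimes> (b \<otimes> r)" "r \<otimes> h = (r \<otimes> a) \<otimes> x \<otimes> b" using h x r by (simp_all add: m_assoc)
    then show ?case unfolding two_sided_def using h r by (metis (mono_tags, lifting) generate.incl m_closed mem_Collect_eq)
  next
    case (inv h)
    then obtain a b where h: "h = a \<otimes> x \<otimes> b" "a \<in> carrier R" "b \<in> carrier R" by blast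
    have "(\<ominus> h) \<otimes> r = \<ominus> (a \<otimes> x \<otimes> (b \<otimes> r))" "r \<otimes> (\<ominus> h) = \<ominus> ((r \<otimes> a) \<otimes> x \<otimes> b)"
      using h x r by (simp_all add: m_assoc l_minus r_minus)
    moreover have "a \<otimes> x \<otimes> (b \<otimes> r) \<in> ?H" "(r \<otimes> a) \<otimes> x \<otimes> b \<in> ?H" using h r by blast+
    ultimately show ?case unfolding two_sided_def using generate.inv[of _ ?H "add_monoid R"] by (simp add: a_inv_def[symmetric])
  next
    case (eng h1 h2)
    have "h1 \<in> two_sided R x" "h2 \<in> two_sided R x" using eng by (simp_all add: two_sided_def)
    then have "h1 \<in> carrier R" "h2 \<in> carrier R" using c by auto
    then show ?case using eng r subgroup.m_closed[OF sg] by (simp add: l_distr r_distr)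
  qed
  then show ?thesis by (intro idealI ring_axioms sg) auto
qed

lemma two_sided_mem: "x \<in> carrier R \<Longrightarrow> a \<in> carrier R \<Longrightarrow> b \<in> carrier R \<Longrightarrow> a \<otimes> x \<otimes> b \<in> two_sided R x"
  unfolding two_sided_def by (rule generate.incl) blast

lemma two_sided_minimal:
  assumes x: "x \<in> carrier R" and U: "subgroup U (add_monoid R)"
    and m: "\<And>a b. a \<in> carrier R \<Longrightarrow> b \<in> carrier R \<Longrightarrow> a \<otimes> x \<otimes> b \<in> U"
  shows "two_sided R x \<subseteq> U"
  unfolding two_sided_def by (rule add.generate_subgroup_incl[OF _ U]) (use m in blast)

end

text \<open>This identifies the ideals of \<open>C(Y j)\<close> in the theorem with images of the
  ideals \<open>TI k\<close> of \<open>C\<close>.\<close>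

lemma two_sided_image:
  assumes h: "ring_hom_ring C R h" and surj: "h ` carrier C = carrier R" and x: "x \<in> carrier C"
  shows "h ` two_sided C x = two_sided R (h x)"
proof -
  interpret h: ring_hom_ring C R h by fact
  interpret I: ideal "two_sided C x" C by (rule h.R.two_sided_ideal[OF x])
  interpret I': ideal "two_sided R (h x)" R by (rule h.S.two_sided_ideal) (use x in simp)
  have hh: "group_hom (add_monoid C) (add_monoid R) h"
    by (intro group_hom.intro group_hom_axioms.intro h.R.add.is_group h.S.add.is_group homI) auto
  have 1: "subgroup (h ` two_sided C x) (add_monoid R)"
    by (rule group_hom.subgroup_img_is_subgroup[OF hh I.a_subgroup])
  show ?thesis
  proof
    show "two_sided R (h x) \<subseteq> h ` two_sided C x"
    proof (rule h.S.two_sided_minimal[OF _ 1])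
      fix a b assume "a \<in> carrier R" "b \<in> carrier R"
      then obtain a' b' where ab: "a = h a'" "b = h b'" "a' \<in> carrier C" "b' \<in> carrier C" using surj by (metis imageE)
      then have "a \<otimes>\<^bsub>R\<^esub> h x \<otimes>\<^bsub>R\<^esub> b = h (a' \<otimes>\<^bsub>C\<^esub> x \<otimes>\<^bsub>C\<^esub> b')" using x by simp
      then show "a \<otimes>\<^bsub>R\<^esub> h x \<otimes>\<^bsub>R\<^esub> b \<in> h ` two_sided C x" using h.R.two_sided_mem[OF x ab(3,4)] by blast
    qed (use x in simp)
    have "subgroup {u \<in> carrier C. h u \<in> two_sided R (h x)} (add_monoid C)"
      by (rule h.R.add.subgroupI) (auto simp: a_inv_def[symmetric] intro!: exI[of _ "\<zero>\<^bsub>C\<^esub>"])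
    then have "two_sided C x \<subseteq> {u \<in> carrier C. h u \<in> two_sided R (h x)}"
      by (rule h.R.two_sided_minimal[OF x]) (use x h.S.two_sided_mem[of "h x"] in simp)
    then show "h ` two_sided C x \<subseteq> two_sided R (h x)" by blast
  qed
qed

lemma quot_ring:
  assumes "ideal I (R :: ('k, 'a) module)"
  shows "ring (quot_module R I)" "ring_hom_ring R (quot_module R I) (\<lambda>x. I +>\<^bsub>R\<^esub> x)"
    "(\<lambda>x. I +>\<^bsub>R\<^esub> x) ` carrier R = carrier (quot_module R I)"
proof -
  interpret I: ideal I R by fact
  interpret F: ring "R Quot I" by (rule I.quotient_is_ring)
  \<comment> \<open>\<open>quot_module\<close> differs from \<open>FactRing\<close> only by the
    scalar multiplication, so the ring axioms carry over field by field.\<close>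
  have s: "carrier (quot_module R I) = carrier (R Quot I)" "mult (quot_module R I) = mult (R Quot I)"
    "one (quot_module R I) = one (R Quot I)" "zero (quot_module R I) = zero (R Quot I)" "add (quot_module R I) = add (R Quot I)"
    by (simp_all add: quot_module_def FactRing_def)
  have "abelian_group (quot_module R I)"
  proof (rule abelian_groupI, goal_cases)
    case (6 x)
    then show ?case by (intro bexI[of _ "\<ominus>\<^bsub>R Quot I\<^esub> x"]) (auto simp: s F.l_neg)
  qed (auto simp: s F.a_ac)
  moreover have "Group.monoid (quot_module R I)"
    using F.monoid_axioms unfolding Group.monoid_def by (simp add: s)
  ultimately show r: "ring (quot_module R I)"
    by (intro ringI) (simp_all add: s F.l_distr F.r_distr)
  have h: "(+>\<^bsub>R\<^esub>) I \<in> ring_hom R (R Quot I)" by (rule I.rcos_ring_hom)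
  show "ring_hom_ring R (quot_module R I) (\<lambda>x. I +>\<^bsub>R\<^esub> x)"
    by (rule ring_hom_ringI2[OF I.ring_axioms r]) (use h in \<open>simp add: ring_hom_def s\<close>)
  show "(\<lambda>x. I +>\<^bsub>R\<^esub> x) ` carrier R = carrier (quot_module R I)"
    by (auto simp: quot_module_simps A_RCOSETS_def RCOSETS_def a_r_coset_def)
qed

section \<open>Paths of monomials in \<open>S\<close>\<close>

locale convex_setup = smash_setup K G A gr m As J S act
  for K :: "'k ring" and G :: "'g monoid" and A :: "('k, 'a) module" (structure) and gr :: "'g \<Rightarrow> 'a set"
    and m :: nat and As :: "nat \<Rightarrow> 'a set" and J :: "nat \<Rightarrow> 'a set"
    and S :: "'s set" and act :: "'g \<Rightarrow> 's \<Rightarrow> 's" +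
  fixes Z :: "nat \<Rightarrow> 's set" and Gs :: "nat \<Rightarrow> 'g set" and Y :: "nat \<Rightarrow> 's set"
  assumes Y_def: "Y = (\<lambda>j. \<Union>i\<in>{1..j}. Z i)"
    and Z: "\<forall>i\<in>{1..m}. Z i \<subseteq> S" "disjoint_family_on Z {1..m}"
    and Y: "finite (Y m)" "act_convex act (carrier G) S (Y m)"
    and cond1: "\<forall>i\<in>{1..m}. \<forall>g\<in>carrier G - Gs i. As i \<inter> gr g = {\<zero>}"
    and cond2: "\<forall>i j. 1 \<le> i \<and> i \<le> j \<and> j \<le> m \<longrightarrow> act_set act (Gs j) (Z i) \<inter> Y m \<subseteq> (\<Union>k\<in>{i..j}. Z k)"
    and cond3: "\<forall>i j. 1 \<le> i \<and> i < j \<and> j \<le> m \<longrightarrow> act_set act (Gs i) (Y j) \<inter> Y m = Y j"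
begin

lemma Y_mono: "i \<le> j \<Longrightarrow> Y i \<subseteq> Y j"
  unfolding Y_def by (rule UN_mono) auto

lemma Y_S: "j \<le> m \<Longrightarrow> y \<in> Y j \<Longrightarrow> y \<in> S"
  using Z(1) by (auto simp: Y_def)

lemma Y_Ym: "j \<le> m \<Longrightarrow> y \<in> Y j \<Longrightarrow> y \<in> Y m"
  using Y_mono by blast

lemma Y_finite: "j \<le> m \<Longrightarrow> finite (Y j)"
  using Y(1) Y_mono finite_subset by blast

lemma Y_Suc: "Y (Suc j) = Y j \<union> Z (Suc j)"
  unfolding Y_def using atLeastAtMostSuc_conv[of 1 j] by auto

lemma Z_Y_disjoint: "Suc j \<le> m \<Longrightarrow> y \<in> Z (Suc j) \<Longrightarrow> y \<notin> Y j"
proof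
  assume a: "Suc j \<le> m" "y \<in> Z (Suc j)" "y \<in> Y j"
  then obtain i where i: "i \<in> {1..j}" "y \<in> Z i" by (auto simp: Y_def)
  then have "Z i \<inter> Z (Suc j) = {}" using Z(2) a unfolding disjoint_family_on_def by auto
  then show False using i a by blast
qed

text \<open>The path of \<open>y\<close> under a monomial: the point reached once the factors
  \<open>a m\<close>, ..., \<open>a k\<close> have acted. Index \<open>Suc m\<close> is the start
  and index 1 the end.\<close>

definition pos where "pos a k y = act (dg a k m) y"

lemma pos_S: "a \<in> Xi \<Longrightarrow> 1 \<le> k \<Longrightarrow> k \<le> Suc m \<Longrightarrow> y \<in> S \<Longrightarrow> pos a k y \<in> S"
  unfolding pos_def using act_closed dg_closed by auto

lemma pos_start: "a \<in> Xi \<Longrightarrow> y \<in> S \<Longrightarrow> pos a (Suc m) y = y"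
  by (simp add: pos_def dg_empty act_one)

lemma pos_split:
  assumes "a \<in> Xi" "1 \<le> i" "i \<le> Suc k" "k \<le> m" "y \<in> S"
  shows "pos a i y = act (dg a i k) (pos a (Suc k) y)"
  unfolding pos_def using dg_split[of a i k m] assms act_mult dg_closed[of a] by auto

text \<open>Condition 1 enters here: \<open>a k\<close> is a nonzero homogeneous element of
  \<open>As k\<close>, so its degree lies in \<open>Gs k\<close>.\<close>

lemma dg_single: "a \<in> Xi \<Longrightarrow> k \<in> {1..m} \<Longrightarrow> dg a k k \<in> Gs k"
proof (rule ccontr)
  assume a: "a \<in> Xi" and k: "k \<in> {1..m}" and n: "dg a k k \<notin> Gs k"
  have "iprod A a k k \<in> As k \<inter> gr (dg a k k)"
    using dg_in[OF a, of k k] k iprod_single[of a k] Xi_As[OF a k] Xi_carrier[OF a k] by auto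
  moreover have "As k \<inter> gr (dg a k k) = {\<zero>}" using cond1[rule_format, OF k, of "dg a k k"] k n dg_closed[OF a, of k k] by auto
  ultimately have "iprod A a k k = \<zero>" by blast
  then show False using iprod_nonzero[OF a, of k k] k by auto
qed

lemma pos_step: "a \<in> Xi \<Longrightarrow> k \<in> {1..m} \<Longrightarrow> y \<in> S \<Longrightarrow> \<exists>g\<in>Gs k. pos a k y = act g (pos a (Suc k) y)"
  using pos_split[of a k k y] dg_single[of a k] by auto

text \<open>\<open>act h y\<close> lies between \<open>y\<close> and its image under the product in
  the preorder of the action.\<close>

lemma convexD:
  assumes "g \<in> carrier G" "h \<in> carrier G" "y \<in> Y m" "act (g \<otimes>\<^bsub>G\<^esub> h) y \<in> Y m"
  shows "act h y \<in> Y m"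
proof -
  have y: "y \<in> S" using Y_S assms(3) by blast
  have "act_le act (carrier G) y (act h y)" "act_le act (carrier G) (act h y) (act (g \<otimes>\<^bsub>G\<^esub> h) y)"
    unfolding act_le_def using assms y act_mult by auto
  then show ?thesis using Y(2) assms act_closed[OF assms(2) y] unfolding act_convex_def by blast
qed

text \<open>By condition 2 a factor of index \<open>n\<close> with \<open>n > j\<close> moves
  \<open>Z (Suc j)\<close> only into blocks of index between \<open>j + 1\<close> and
  \<open>n\<close>, and \<open>Z (Suc j)\<close> is the only such block in \<open>Y (Suc j)\<close>.
  So a path in \<open>Y (Suc j)\<close> that has met this block stays in it while the right part
  acts.\<close>

lemma stay_Z:
  assumes a: "a \<in> Xi" and y: "y \<in> S" and j: "Suc j \<le> m"
    and l: "l \<le> Suc m" "pos a l y \<in> Z (Suc j)" and p: "\<And>k. k \<in> {Suc j..m} \<Longrightarrow> pos a k y \<in> Y (Suc j)"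
    and k: "Suc j \<le> k" "k \<le> l"
  shows "pos a k y \<in> Z (Suc j)"
  using k(2,1)
proof (induction rule: inc_induct)
  case base
  then show ?case using l by simp
next
  case (step n)
  have n: "n \<in> {Suc j..m}" "n \<in> {1..m}" using step l by auto
  obtain g where g: "g \<in> Gs n" "pos a n y = act g (pos a (Suc n) y)" using pos_step[OF a n(2) y] by blast
  have "pos a (Suc n) y \<in> Z (Suc j)" using step by simp
  then have "pos a n y \<in> act_set act (Gs n) (Z (Suc j)) \<inter> Y m"
    using g p[OF n(1)] Y_Ym[OF j] unfolding act_set_def by blast
  moreover have "act_set act (Gs n) (Z (Suc j)) \<inter> Y m \<subseteq> (\<Union>k\<in>{Suc j..n}. Z k)"
    using cond2[rule_format, of "Suc j" n] n by simp
  ultimately obtain i where i: "i \<in> {Suc j..n}" "pos a n y \<in> Z i" by blast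
  show ?case
  proof (cases "i = Suc j")
    case False
    obtain i' where i': "i' \<in> {1..Suc j}" "pos a n y \<in> Z i'" using p[OF n(1)] by (auto simp: Y_def)
    then have "Z i \<inter> Z i' = {}" using Z(2) i n False unfolding disjoint_family_on_def by auto
    then show ?thesis using i i' by blast
  qed (use i in simp)
qed

text \<open>Let a factor of index \<open>n \<le> j\<close> act on a point of \<open>Z i\<close>,
  \<open>i \<le> j\<close>. If \<open>i \<le> n\<close>, condition 2 leads into blocks between
  \<open>i\<close> and \<open>n\<close>; otherwise \<open>n < j\<close> and condition 3 applies. So
  a left part that runs in \<open>Y m\<close> does not leave \<open>Y j\<close>.\<close>

lemma stay_Y:
  assumes a: "a \<in> Xi" and y: "y \<in> S" and j: "1 \<le> j" "j \<le> m"
    and l: "pos a (Suc j) y \<in> Y j" and p: "\<And>k. k \<in> {1..j} \<Longrightarrow> pos a k y \<in> Y m"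
    and k: "1 \<le> k" "k \<le> Suc j"
  shows "pos a k y \<in> Y j"
  using k(2,1)
proof (induction rule: inc_induct)
  case base
  then show ?case using l by simp
next
  case (step n)
  have n: "n \<in> {1..j}" "n \<in> {1..m}" using step j by auto
  obtain g where g: "g \<in> Gs n" "pos a n y = act g (pos a (Suc n) y)" using pos_step[OF a n(2) y] by blast
  have 1: "pos a (Suc n) y \<in> Y j" using step by simp
  then obtain i where i: "i \<in> {1..j}" "pos a (Suc n) y \<in> Z i" by (auto simp: Y_def)
  show ?case
  proof (cases "i \<le> n")
    case True
    have "pos a n y \<in> act_set act (Gs n) (Z i) \<inter> Y m"
      using g p[OF n(1)] i unfolding act_set_def by blast
    then have "pos a n y \<in> (\<Union>k\<in>{i..n}. Z k)" using cond2 True i n by (meson atLeastAtMost_iff subsetD)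
    then show ?thesis using i n by (auto simp: Y_def)
  next
    case False
    have "pos a n y \<in> act_set act (Gs n) (Y j) \<inter> Y m"
      using g p[OF n(1)] 1 unfolding act_set_def by blast
    moreover have "1 \<le> n \<and> n < j \<and> j \<le> m" using False i n j by auto
    ultimately show ?thesis using cond3 by blast
  qed
qed

section \<open>Good monomials and products that leave \<open>Y j\<close>\<close>

definition Good where "Good j y = {a \<in> Xi. y \<in> Y j \<and> (\<forall>k\<in>{1..m}. pos a k y \<in> Y j)}"

text \<open>The elements of \<open>A\<close> without good coordinates. At a point outside
  \<open>Y j\<close> no monomial is good and the condition is empty.\<close>

definition NG where "NG j y = {x \<in> carrier A. \<forall>a\<in>Good j y. lam a x = \<zero>\<^bsub>K\<^esub>}"

lemma NG_sub: "left_submodule K A (NG j y)"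
  by (rule left_submoduleI)
     (auto simp: NG_def Good_def lam_zero lam_add lam_smult L.V.smult_closed)

lemma Good_mono: "i \<le> j \<Longrightarrow> Good i y \<subseteq> Good j y"
  using Y_mono[of i j] by (auto simp: Good_def)

lemma NG_mono: "i \<le> j \<Longrightarrow> NG j y \<subseteq> NG i y"
  using Good_mono[of i j y] by (auto simp: NG_def)

lemma w_NG: "a \<in> Xi \<Longrightarrow> a \<notin> Good j y \<Longrightarrow> w a \<in> NG j y"
  unfolding NG_def using lam_w w_closed by (auto simp: Good_def)

lemma NG_notin: "y \<notin> Y j \<Longrightarrow> NG j y = carrier A"
  by (auto simp: NG_def Good_def)

definition NG_absorbs where
  "NG_absorbs j \<longleftrightarrow> (\<forall>y\<in>S. \<forall>g\<in>carrier G. \<forall>x'\<in>gr g. \<forall>x\<in>carrier A. act g y \<notin> Y j \<longrightarrow> x \<otimes> x' \<in> NG j y)"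

lemma w_homogeneous_span: "x \<in> gr g \<Longrightarrow> g \<in> carrier G \<Longrightarrow> x \<in> lspan K A (w ` Xi \<inter> gr g)"
  using homogeneous_span[of "w ` Xi" x g] w_gr dgm w_span gr_carrier by blast

lemma AA: "module_hom_pair K A A" by unfold_locales

lemma homogeneous_generate:
  assumes U: "left_submodule K A U" and f: "f \<in> module_hom K A A" and g: "g \<in> carrier G" and x: "x \<in> gr g"
    and w: "\<And>d. d \<in> Xi \<Longrightarrow> dg d 1 m = g \<Longrightarrow> f (w d) \<in> U"
  shows "f x \<in> U"
proof -
  have "lspan K A (w ` Xi \<inter> gr g) \<subseteq> {x \<in> carrier A. f x \<in> U}"
  proof (rule L.lspan_minimal[OF _ module_hom_pair.hom_vimage[OF AA f U]], rule subsetI)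
    fix y assume "y \<in> w ` Xi \<inter> gr g"
    then obtain d where d: "d \<in> Xi" "y = w d" "w d \<in> gr g" by blast
    then have "dg d 1 m = g" using dg_eqI[of d 1 m g] g by (auto simp: w_def)
    then show "y \<in> {x \<in> carrier A. f x \<in> U}" using w[OF d(1)] d w_closed by auto
  qed
  then show ?thesis using w_homogeneous_span[OF x g] by blast
qed

text \<open>Monomials occurring in a product of homogeneous elements have the product degree. If one
  of them were good, its path would end in \<open>Y m\<close>, and convexity would put
  \<open>act g y\<close> into \<open>Y m\<close>.\<close>

lemma NG_absorbs_top: "NG_absorbs m"
  unfolding NG_absorbs_def
proof (intro ballI impI)
  fix y g x' x assume y: "y \<in> S" and g: "g \<in> carrier G" and x': "x' \<in> gr g" and x: "x \<in> carrier A" and n: "act g y \<notin> Y m"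
  have x'A: "x' \<in> carrier A" using gr_carrier g x' by blast
  have "x \<in> {x \<in> carrier A. x \<otimes> x' \<in> NG m y}"
  proof (rule w_generate[OF module_hom_pair.hom_vimage[OF AA mult_right_hom[OF x'A] NG_sub] _ x])
    fix c assume c: "c \<in> Xi"
    have "lam a (w c \<otimes> x') = \<zero>\<^bsub>K\<^esub>" if a: "a \<in> Good m y" for a
    proof (rule ccontr)
      assume nz: "lam a (w c \<otimes> x') \<noteq> \<zero>\<^bsub>K\<^esub>"
      have aX: "a \<in> Xi" and yY: "y \<in> Y m" and pY: "pos a 1 y \<in> Y m" using a m by (auto simp: Good_def)
      have "dg a 1 m = dg c 1 m \<otimes>\<^bsub>G\<^esub> g"
        by (rule lam_homogeneous[OF aX _ gr_mult[OF dgm[OF c] g w_gr[OF c] x'] nz]) (use dgm[OF c] g in simp)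
      then have "act (dg c 1 m \<otimes>\<^bsub>G\<^esub> g) y \<in> Y m" using pY by (simp add: pos_def)
      then show False using convexD[OF dgm[OF c] g yY] n by blast
    qed
    then show "w c \<in> {x \<in> carrier A. x \<otimes> x' \<in> NG m y}" using w_closed[OF c] x'A by (auto simp: NG_def)
  qed
  then show "x \<otimes> x' \<in> NG m y" by blast
qed

text \<open>Since good monomials for \<open>j\<close> are good for \<open>Suc j\<close>, the
  induction hypothesis settles every product that can be cut at a point outside
  \<open>Y (Suc j)\<close>. What remains is rewritten with right parts that all move
  \<open>y\<close> into \<open>Z (Suc j)\<close>, outside \<open>Y j\<close>, so that no good
  monomial can occur.\<close>

lemma NG_absorbs_step:
  assumes j: "1 \<le> j" "Suc j \<le> m" and cl: "NG_absorbs (Suc j)"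
  shows "NG_absorbs j"
  unfolding NG_absorbs_def
proof (intro ballI impI)
  fix y g x' x assume y: "y \<in> S" and g: "g \<in> carrier G" and x': "x' \<in> gr g" and x: "x \<in> carrier A" and n: "act g y \<notin> Y j"
  have x'A: "x' \<in> carrier A" using gr_carrier g x' by blast
  have jm: "j \<le> m" using j by simp
  have NGs: "u \<in> NG j y" if "u \<in> NG (Suc j) y" for u using NG_mono[of j "Suc j" y] that by auto
  have CL: "x1 \<otimes> x2 \<in> NG j y" if "h \<in> carrier G" "x2 \<in> gr h" "x1 \<in> carrier A" "act h y \<notin> Y (Suc j)" for x1 x2 h
    using cl that y NGs unfolding NG_absorbs_def by blast
  consider "y \<notin> Y j" | "act g y \<notin> Y (Suc j)" | "y \<in> Y j" "act g y \<in> Z (Suc j)" using n Y_Suc by blast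
  then show "x \<otimes> x' \<in> NG j y"
  proof cases
    case 1
    then show ?thesis using x x'A by (simp add: NG_notin)
  next
    case 2
    then show ?thesis using CL[OF g x' x] by blast
  next
    case 3
    define z where "z = act g y"
    have zZ: "z \<in> Z (Suc j)" using 3 by (simp add: z_def)
    \<comment> \<open>By linearity both factors may be monomials; those replacing \<open>x'\<close>
      have the same degree \<open>g\<close>, so they still move \<open>y\<close> to
      \<open>z\<close>.\<close>
    have main: "w c \<otimes> w b \<in> NG j y" if c: "c \<in> Xi" and b: "b \<in> Xi" and bg: "dg b 1 m = g" for c b
    proof -
      note cA = Xi_iprod_closed[OF c] and bA = Xi_iprod_closed[OF b]
      note wc = w_closed[OF c] and wb = w_closed[OF b]
      have pb1: "pos b 1 y = z" using bg by (simp add: pos_def z_def)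
      \<comment> \<open>If one of the two paths leaves \<open>Y (Suc j)\<close>, the product is cut
        at that factor and the induction hypothesis applies to the cut.\<close>
      consider k where "k \<in> {1..m}" "pos b k y \<notin> Y (Suc j)" | k where "k \<in> {1..m}" "pos c k z \<notin> Y (Suc j)"
        | "\<And>k. k \<in> {1..m} \<Longrightarrow> pos b k y \<in> Y (Suc j)" "\<And>k. k \<in> {1..m} \<Longrightarrow> pos c k z \<in> Y (Suc j)" by blast
      then show ?thesis
      proof cases
        case (1 k)
        have "w b = iprod A b 1 (k - 1) \<otimes> iprod A b k m" unfolding w_def using Xi_iprod_split[OF b, of 1 "k - 1" m] 1 by auto
        then have "w c \<otimes> w b = (w c \<otimes> iprod A b 1 (k - 1)) \<otimes> iprod A b k m"
          using wc bA[of 1 "k - 1"] bA[of k m] 1 by (auto simp: A.m_assoc)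
        also have "\<dots> \<in> NG j y"
        proof (rule CL)
          show "dg b k m \<in> carrier G" "iprod A b k m \<in> gr (dg b k m)" using dg_closed[OF b] dg_in[OF b] 1 by auto
          show "w c \<otimes> iprod A b 1 (k - 1) \<in> carrier A" using wc bA[of 1 "k - 1"] 1 by auto
          show "act (dg b k m) y \<notin> Y (Suc j)" using 1 by (simp add: pos_def)
        qed
        finally show ?thesis .
      next
        case (2 k)
        have "w c = iprod A c 1 (k - 1) \<otimes> iprod A c k m" unfolding w_def using Xi_iprod_split[OF c, of 1 "k - 1" m] 2 by auto
        then have "w c \<otimes> w b = iprod A c 1 (k - 1) \<otimes> (iprod A c k m \<otimes> w b)"
          using wb cA[of 1 "k - 1"] cA[of k m] 2 by (auto simp: A.m_assoc)
        also have "\<dots> \<in> NG j y"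
        proof (rule CL)
          have d: "dg c k m \<in> carrier G" "iprod A c k m \<in> gr (dg c k m)" using dg_closed[OF c] dg_in[OF c] 2 by auto
          show "dg c k m \<otimes>\<^bsub>G\<^esub> g \<in> carrier G" using d g by simp
          show "iprod A c k m \<otimes> w b \<in> gr (dg c k m \<otimes>\<^bsub>G\<^esub> g)" using gr_mult[OF d(1) dgm[OF b] d(2) w_gr[OF b]] bg by simp
          show "iprod A c 1 (k - 1) \<in> carrier A" using cA[of 1 "k - 1"] 2 by auto
          show "act (dg c k m \<otimes>\<^bsub>G\<^esub> g) y \<notin> Y (Suc j)" using 2 act_mult[OF d(1) g y] by (simp add: pos_def z_def)
        qed
        finally show ?thesis .
      next
        case 3
        define u where "u = pos b (Suc j) y"
        have uS: "u \<in> S" unfolding u_def using pos_S[OF b _ _ y] j by simp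
        \<comment> \<open>Otherwise the right part of \<open>b\<close> would end in
          \<open>Y j\<close>, and \<open>stay_Y\<close> would keep the path there up to its end
          \<open>z\<close>, which lies in \<open>Z (Suc j)\<close>.\<close>
        have uZ: "u \<in> Z (Suc j)"
        proof (rule ccontr)
          assume "u \<notin> Z (Suc j)"
          then have "u \<in> Y j" using 3(1)[of "Suc j"] j Y_Suc by (auto simp: u_def)
          then have u: "pos b (Suc j) y \<in> Y j" by (simp add: u_def)
          have "pos b k y \<in> Y m" if "k \<in> {1..j}" for k
            by (rule Y_Ym[OF j(2) 3(1)]) (use that jm in auto)
          from stay_Y[OF b y j(1) jm u this, of 1] have "pos b 1 y \<in> Y j" by simp
          then show False using pb1 zZ Z_Y_disjoint[OF j(2)] by blast
        qed
        define h where "h = dg c (Suc j) m \<otimes>\<^bsub>G\<^esub> dg b 1 j"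
        have dc: "dg c (Suc j) m \<in> carrier G" "iprod A c (Suc j) m \<in> gr (dg c (Suc j) m)"
          and db: "dg b 1 j \<in> carrier G" "iprod A b 1 j \<in> gr (dg b 1 j)"
          and db': "dg b (Suc j) m \<in> carrier G" "iprod A b (Suc j) m \<in> gr (dg b (Suc j) m)"
          using dg_closed[OF c] dg_in[OF c] dg_closed[OF b] dg_in[OF b] j by auto
        have cl': "iprod A c 1 j \<in> carrier A" "iprod A c (Suc j) m \<in> carrier A" "iprod A b 1 j \<in> carrier A" "iprod A b (Suc j) m \<in> carrier A"
          using cA bA j by auto
        \<comment> \<open>In the middle product a right part of \<open>c\<close> stands before a
          left part of \<open>b\<close>, so it belongs to neither block. It is expanded in monomials
          \<open>d\<close> of all of \<open>A\<close>, each of which is placed back between the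
          outer parts.\<close>
        let ?f = "\<lambda>M. iprod A c 1 j \<otimes> (M \<otimes> iprod A b (Suc j) m)"
        have "?f (iprod A c (Suc j) m \<otimes> iprod A b 1 j) \<in> NG j y"
        proof (rule homogeneous_generate[OF NG_sub module_hom_comp[OF mult_right_hom[OF cl'(4)] mult_left_hom[OF cl'(1)]]
              G.m_closed[OF dc(1) db(1)] gr_mult[OF dc(1) db(1) dc(2) db(2)]])
          fix d assume d: "d \<in> Xi"
          note dA = Xi_iprod_closed[OF d]
          show "?f (w d) \<in> NG j y"
          proof (cases "\<exists>k\<in>{1..m}. pos d k u \<notin> Y (Suc j)")
            case True
            then obtain k where k: "k \<in> {1..m}" "pos d k u \<notin> Y (Suc j)" by blast
            have d': "dg d k m \<in> carrier G" "iprod A d k m \<in> gr (dg d k m)" "iprod A d 1 (k - 1) \<in> carrier A" "iprod A d k m \<in> carrier A"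
              using dg_closed[OF d] dg_in[OF d] dA k by auto
            have "w d = iprod A d 1 (k - 1) \<otimes> iprod A d k m" unfolding w_def using Xi_iprod_split[OF d, of 1 "k - 1" m] k by auto
            then have "?f (w d) = (iprod A c 1 j \<otimes> iprod A d 1 (k - 1)) \<otimes> (iprod A d k m \<otimes> iprod A b (Suc j) m)"
              using d' cl' by (simp add: A.m_assoc)
            also have "\<dots> \<in> NG j y"
            proof (rule CL[OF G.m_closed[OF d'(1) db'(1)] gr_mult[OF d'(1) db'(1) d'(2) db'(2)]])
              show "act (dg d k m \<otimes>\<^bsub>G\<^esub> dg b (Suc j) m) y \<notin> Y (Suc j)"
                using k act_mult[OF d'(1) db'(1) y] by (simp add: pos_def u_def)
            qed (use d' cl' in simp)
            finally show ?thesis .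
          next
            case False
            \<comment> \<open>Now the path of \<open>d\<close> from \<open>u\<close> runs in
              \<open>Y (Suc j)\<close>, so by \<open>stay_Z\<close> the right part of
              \<open>d\<close> keeps it in \<open>Z (Suc j)\<close>. Multiplying left parts and
              right parts separately yields monomials whose right parts all have degree
              \<open>\<delta>\<close> and so move \<open>y\<close> into
              \<open>Z (Suc j)\<close>.\<close>
            define \<delta> where "\<delta> = dg d (Suc j) m \<otimes>\<^bsub>G\<^esub> dg b (Suc j) m"
            have d': "dg d (Suc j) m \<in> carrier G" "iprod A d (Suc j) m \<in> gr (dg d (Suc j) m)" "iprod A d 1 j \<in> carrier A" "iprod A d (Suc j) m \<in> carrier A"
              using dg_closed[OF d] dg_in[OF d] dA j by auto
            have "pos d (Suc j) u \<in> Z (Suc j)"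
              by (rule stay_Z[OF d uS j(2), of "Suc m"]) (use False uZ pos_start[OF d uS] j in auto)
            then have dZ: "act \<delta> y \<in> Z (Suc j)" using act_mult[OF d'(1) db'(1) y] by (simp add: pos_def u_def \<delta>_def)
            have \<delta>G: "\<delta> \<in> carrier G" using d' db' by (simp add: \<delta>_def)
            have M1: "Mon 1 j \<subseteq> carrier A" and M2: "Mon (Suc j) m \<subseteq> carrier A" using Mon_carrier j by auto
            have in1: "iprod A e i k \<in> lspan K A (Mon i k)" if "e \<in> Xi" "1 \<le> i" "k \<le> m" for e i k
              using L.lspan_incl[OF Mon_carrier] that by (auto simp: Mon_def)
            have 1: "iprod A c 1 j \<otimes> iprod A d 1 j \<in> lspan K A (Mon 1 j)"
              using block_mult[of 1 j] in1 c d j by auto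
            have 2: "iprod A d (Suc j) m \<otimes> iprod A b (Suc j) m \<in> lspan K A (Mon (Suc j) m)"
              using block_mult[of "Suc j" m] in1 b d j by auto
            have "Mon (Suc j) m \<subseteq> (\<Union>g\<in>carrier G. gr g)" using iprod_homogeneous by (auto simp: Mon_def)
            then have 3: "iprod A d (Suc j) m \<otimes> iprod A b (Suc j) m \<in> lspan K A (Mon (Suc j) m \<inter> gr \<delta>)"
              using homogeneous_span[OF _ 2 _ \<delta>G] gr_mult[OF d'(1) db'(1) d'(2) db'(2)] by (simp add: \<delta>_def)
            have "?f (w d) = (iprod A c 1 j \<otimes> iprod A d 1 j) \<otimes> (iprod A d (Suc j) m \<otimes> iprod A b (Suc j) m)"
              unfolding w_def using Xi_iprod_split[OF d, of 1 j m] j d' cl' by (simp add: A.m_assoc)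
            also have "\<dots> \<in> NG j y"
            proof (rule span_mult[OF M1 _ NG_sub _ 1 3])
              fix s t assume s: "s \<in> Mon 1 j" and t: "t \<in> Mon (Suc j) m \<inter> gr \<delta>"
              obtain s' t' where s': "s' \<in> Xi" "s = iprod A s' 1 j" and t': "t' \<in> Xi" "t = iprod A t' (Suc j) m" "iprod A t' (Suc j) m \<in> gr \<delta>"
                using s t by (auto simp: Mon_def)
              have dt: "dg t' (Suc j) m = \<delta>" using dg_eqI[OF t'(1)] t'(3) \<delta>G j by auto
              have "pos (merge j s' t') (Suc j) y = act \<delta> y" by (simp add: pos_def merge_dg dt)
              then have "merge j s' t' \<notin> Good j y"
                using dZ Z_Y_disjoint[OF j(2)] j by (force simp: Good_def)
              then have "w (merge j s' t') \<in> NG j y" using w_NG merge_Xi s' t' by blast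
              then show "s \<otimes> t \<in> NG j y" using w_merge[OF s'(1) t'(1) j(1) jm] s' t' by simp
            qed (use M2 in auto)
            finally show ?thesis .
          qed
        qed
        moreover have "w c \<otimes> w b = ?f (iprod A c (Suc j) m \<otimes> iprod A b 1 j)"
          unfolding w_def using Xi_iprod_split[OF c, of 1 j m] Xi_iprod_split[OF b, of 1 j m] j cl' by (simp add: A.m_assoc)
        ultimately show ?thesis by simp
      qed
    qed
    have "w c \<otimes> x' \<in> NG j y" if c: "c \<in> Xi" for c
      by (rule homogeneous_generate[OF NG_sub mult_left_hom[OF w_closed[OF c]] g x']) (rule main[OF c])
    then have "x \<in> {x \<in> carrier A. x \<otimes> x' \<in> NG j y}"
      using w_closed by (intro w_generate[OF module_hom_pair.hom_vimage[OF AA mult_right_hom[OF x'A] NG_sub] _ x]) auto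
    then show ?thesis by blast
  qed
qed

lemma NG_absorbs: "1 \<le> j \<Longrightarrow> j \<le> m \<Longrightarrow> NG_absorbs j"
proof -
  assume j: "1 \<le> j" and jm: "j \<le> m"
  show ?thesis using jm j
  proof (induction rule: inc_induct)
    case (step n)
    then show ?case using NG_absorbs_step[of n] by auto
  qed (rule NG_absorbs_top)
qed

end

context convex_setup begin

section \<open>The ideals defining \<open>C(Y\<^sub>j)\<close>\<close>

abbreviation "ind X \<equiv> indicator_map K S X"

definition "ch j = pt \<one> (ind (S - Y j))"
definition "TI j = two_sided C (ch j)"
text \<open>The description of \<open>TI j\<close> by coordinates. It admits a membership test,
  which the description by generators does not.\<close>

definition "RH j = {c \<in> carrier C. \<forall>y\<in>Y j. ev y c \<in> NG j y}"

lemma ind_in: "ind X \<in> carrier B"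
  by (auto simp: indicator_map_def)

lemma ch_in: "ch j \<in> carrier C"
  unfolding ch_def by (rule pt_C[OF A.one_closed ind_in])

lemma TI_ideal: "ideal (TI j) C" unfolding TI_def by (rule C.two_sided_ideal[OF ch_in])

lemma ch_TI: "ch j \<in> TI j"
  unfolding TI_def using C.two_sided_mem[OF ch_in C.one_closed C.one_closed] ch_in by simp

lemma TI_in: "c \<in> TI j \<Longrightarrow> c \<in> carrier C" using idealD(2)[OF TI_ideal] .

lemma TI_sub: "left_submodule K C (TI j)"
proof (rule left_submoduleI)
  fix k c assume k: "k \<in> carrier K" and c: "c \<in> TI j"
  have "k \<odot>\<^bsub>C\<^esub> c = (k \<odot>\<^bsub>C\<^esub> \<one>\<^bsub>C\<^esub>) \<otimes>\<^bsub>C\<^esub> c"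
    using kalgebra.smult_mult_left[OF C_kalgebra k C.one_closed TI_in[OF c]] TI_in[OF c] by simp
  then show "k \<odot>\<^bsub>C\<^esub> c \<in> TI j" using idealD(6)[OF TI_ideal CM.smult_closed[OF k C.one_closed] c] by simp
qed (use idealD[OF TI_ideal] in auto)

lemma pt_ch: "a \<in> carrier A \<Longrightarrow> b \<in> carrier B \<Longrightarrow> pt a b \<otimes>\<^bsub>C\<^esub> ch j = pt a (b \<otimes>\<^bsub>B\<^esub> ind (S - Y j))"
proof -
  assume a: "a \<in> carrier A" and b: "b \<in> carrier B"
  have "sh b \<one>\<^bsub>G\<^esub> = b" using b by (auto simp: map_shift_def act_one fun_eq_iff PiE_iff extensional_def)
  then show ?thesis unfolding ch_def using C_pt_mult[OF G.one_closed a b gr_one ind_in] a by simp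
qed

lemma RH_sub: "left_submodule K C (RH j)" if j: "j \<le> m"
proof (rule left_submoduleI)
  note s = left_submoduleD[OF NG_sub]
  have z: "ev y \<zero>\<^bsub>C\<^esub> = \<zero>" if "y \<in> Y j" for y
    using module_hom_pair.hom_zero[OF CA ev(1)[OF Y_S[OF j that]]] .
  show "\<zero>\<^bsub>C\<^esub> \<in> RH j" using z s(3) by (simp add: RH_def)
  show "c \<oplus>\<^bsub>C\<^esub> d \<in> RH j" if "c \<in> RH j" "d \<in> RH j" for c d
    using that s(4) ev_add Y_S[OF j] by (simp add: RH_def)
  show "k \<odot>\<^bsub>C\<^esub> c \<in> RH j" if "k \<in> carrier K" "c \<in> RH j" for k c
    using that s(5) module_hom_smult[OF ev(1)] Y_S[OF j] CM.smult_closed by (simp add: RH_def)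
qed (auto simp: RH_def)

text \<open>At \<open>y\<close>, right multiplication by an element of degree \<open>g\<close> uses
  the component of \<open>a \<otimes> ch j\<close> at \<open>act g y\<close>. This component is zero
  if \<open>act g y\<close> lies in \<open>Y j\<close>; otherwise \<open>NG_absorbs\<close>
  applies.\<close>

lemma TI_RH: assumes j: "1 \<le> j" "j \<le> m" shows "TI j \<subseteq> RH j"
  unfolding TI_def
proof (rule C.two_sided_minimal[OF ch_in])
  show "subgroup (RH j) (add_monoid C)"
    using abelian_subgroup.axioms(1)[OF CM.submodule_subgroup[OF RH_sub[OF j(2)]]] by (simp add: additive_subgroup_def)
  fix a b assume a: "a \<in> carrier C" and b: "b \<in> carrier C"
  have ac: "a \<otimes>\<^bsub>C\<^esub> ch j \<in> carrier C" using a ch_in by simp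
  show "a \<otimes>\<^bsub>C\<^esub> ch j \<otimes>\<^bsub>C\<^esub> b \<in> RH j" using b
  proof (induction rule: smash_induct)
    case (pure g a' b')
    have a'A: "a' \<in> carrier A" using gr_carrier[OF pure(1,2)] .
    have "ev y (a \<otimes>\<^bsub>C\<^esub> ch j \<otimes>\<^bsub>C\<^esub> pt a' b') \<in> NG j y" if y: "y \<in> Y j" for y
    proof -
      have yS: "y \<in> S" using Y_S[OF j(2) y] .
      note gy = act_closed[OF pure(1) yS]
      have b'y: "b' y \<in> carrier K" using pure(3) yS by (auto simp: PiE_in)
      have "ev (act g y) (a \<otimes>\<^bsub>C\<^esub> ch j) = ind (S - Y j) (act g y) \<odot> (ev (act \<one>\<^bsub>G\<^esub> (act g y)) a \<otimes> \<one>)"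
        unfolding ch_def by (rule ev_mult[OF gy a G.one_closed gr_one ind_in])
      also have "\<dots> = ind (S - Y j) (act g y) \<odot> ev (act g y) a" using act_one[OF gy] ev_in[OF gy a] by simp
      finally have e: "ev (act g y) (a \<otimes>\<^bsub>C\<^esub> ch j) = ind (S - Y j) (act g y) \<odot> ev (act g y) a" .
      have "ev (act g y) (a \<otimes>\<^bsub>C\<^esub> ch j) \<otimes> a' \<in> NG j y"
      proof (cases "act g y \<in> Y j")
        case True
        then have "ev (act g y) (a \<otimes>\<^bsub>C\<^esub> ch j) = \<zero>" unfolding e using gy ev_in[OF gy a] by (simp add: indicator_map_def)
        then show ?thesis using a'A left_submoduleD(3)[OF NG_sub] by simp
      next
        case False
        then show ?thesis using NG_absorbs[OF j] yS pure ev_in[OF gy ac] unfolding NG_absorbs_def by blast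
      qed
      then show ?thesis unfolding ev_mult[OF yS ac pure(1-3)] using left_submoduleD(5)[OF NG_sub b'y] by blast
    qed
    then show ?case using pt_C[OF a'A pure(3)] ac by (simp add: RH_def)
  next
    case (add x y)
    then show ?case using ac left_submoduleD(4)[OF RH_sub[OF j(2)]] by (simp add: C.r_distr)
  qed
qed

lemma sh_mult_ind:
  assumes b: "b \<in> carrier B" and g: "g \<in> carrier G" and y: "y \<in> S"
  shows "sh b g \<otimes>\<^bsub>B\<^esub> ind {y} = b (act g y) \<odot>\<^bsub>B\<^esub> ind {y}"
proof
  fix x
  have bK: "b (act g x) \<in> carrier K" if "x \<in> S" for x using PiE_in[of b S "carrier K"] b act_closed[OF g that] by simp
  show "(sh b g \<otimes>\<^bsub>B\<^esub> ind {y}) x = (b (act g y) \<odot>\<^bsub>B\<^esub> ind {y}) x"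
    using bK[OF y] bK[of x] by (cases "x = y") (simp_all add: map_shift_def indicator_map_def)
qed

lemma sh_ind_mult:
  assumes g: "g \<in> carrier G" and y: "y \<in> S" and X: "act g y \<in> X"
  shows "sh (ind X) g \<otimes>\<^bsub>B\<^esub> ind {y} = ind {y}"
proof -
  have "ind X (act g y) = \<one>\<^bsub>K\<^esub>" using act_closed[OF g y] X by (simp add: indicator_map_def)
  then show ?thesis using sh_mult_ind[OF ind_in g y, of X] B.smult_one[OF ind_in] by (simp only:)
qed

text \<open>As \<open>act g y\<close> is outside \<open>Y j\<close>, the idempotent
  \<open>ch j\<close> can be inserted between \<open>x\<close> and \<open>x'\<close>.\<close>

lemma pt_factor:
  assumes x: "x \<in> carrier A" and g: "g \<in> carrier G" "x' \<in> gr g" and y: "y \<in> S" and n: "act g y \<notin> Y j"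
  shows "pt (x \<otimes> x') (ind {y}) \<in> TI j"
proof -
  have "pt x \<one>\<^bsub>B\<^esub> \<otimes>\<^bsub>C\<^esub> ch j = pt x (ind (S - Y j))"
    unfolding ch_def using C_pt_mult[OF G.one_closed x B_one(3) gr_one ind_in] B_one(1)[OF ind_in G.one_closed] x by simp
  moreover have "sh (ind (S - Y j)) g \<otimes>\<^bsub>B\<^esub> ind {y} = ind {y}"
    using n act_closed[OF g(1) y] by (intro sh_ind_mult[OF g(1) y]) simp
  ultimately have "pt x \<one>\<^bsub>B\<^esub> \<otimes>\<^bsub>C\<^esub> ch j \<otimes>\<^bsub>C\<^esub> pt x' (ind {y}) = pt (x \<otimes> x') (ind {y})"
    using C_pt_mult[OF g(1) x ind_in g(2) ind_in] by simp
  then show ?thesis unfolding TI_def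
    using C.two_sided_mem[OF ch_in pt_C[OF x B_one(3)] pt_C[OF gr_carrier[OF g] ind_in]] by metis
qed

text \<open>Stated for partial products because \<open>ff_TI\<close> applies it to left parts of
  monomials.\<close>

lemma bad_TI:
  assumes a: "a \<in> Xi" and i: "1 \<le> i" "l \<le> m" and k: "k \<in> {i..l}" and z: "z \<in> S" and n: "act (dg a k l) z \<notin> Y j"
  shows "pt (iprod A a i l) (ind {z}) \<in> TI j"
proof -
  have "iprod A a i l = iprod A a i (k - 1) \<otimes> iprod A a k l" using Xi_iprod_split[OF a, of i "k - 1" l] i k by auto
  then show ?thesis
    using pt_factor[OF Xi_iprod_closed[OF a] dg_closed[OF a] dg_in[OF a] z n, of i "k - 1"] i k by auto
qed

lemma bad_w_TI:
  assumes a: "a \<in> Xi" "a \<notin> Good j y" and y: "y \<in> Y j" and j: "j \<le> m"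
  shows "pt (w a) (ind {y}) \<in> TI j"
proof -
  obtain k where k: "k \<in> {1..m}" "pos a k y \<notin> Y j" using a y by (auto simp: Good_def)
  then show ?thesis unfolding w_def using bad_TI[OF a(1), of 1 m k y j] Y_S[OF j y] by (simp add: pos_def)
qed

lemma pt_ind_hom: "(\<lambda>x. pt x (ind {y})) \<in> module_hom K A C"
  unfolding C_homs by (rule TB.pt_left_hom[OF ind_in])

lemma NG_TI:
  assumes x: "x \<in> NG j y" and y: "y \<in> Y j" and j: "j \<le> m"
  shows "pt x (ind {y}) \<in> TI j"
proof -
  have xA: "x \<in> carrier A" using x by (simp add: NG_def)
  let ?F = "{a \<in> Xi. lam a x \<noteq> \<zero>\<^bsub>K\<^esub>}"
  have "pt x (ind {y}) = finsum C (\<lambda>a. pt (lam a x \<odot> w a) (ind {y})) ?F"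
    using module_hom_pair.hom_finsum[OF AC pt_ind_hom, of ?F "\<lambda>a. lam a x \<odot> w a" y] w_expand[OF xA]
      L.V.smult_closed lam_in w_closed xA by simp
  also have "\<dots> \<in> TI j"
  proof (rule CM.submodule_finsum[OF TI_sub])
    fix a assume a: "a \<in> ?F"
    then have "a \<notin> Good j y" using x by (auto simp: NG_def)
    then have "pt (w a) (ind {y}) \<in> TI j" using bad_w_TI a y j by blast
    then show "pt (lam a x \<odot> w a) (ind {y}) \<in> TI j"
      using module_hom_smult[OF pt_ind_hom, of "lam a x" "w a" y] a lam_in xA w_closed left_submoduleD(5)[OF TI_sub] by simp
  qed
  finally show ?thesis .
qed

text \<open>\<open>c\<close> times the indicator of \<open>Y j\<close>, written as the sum of its
  components at the finitely many points of \<open>Y j\<close>.\<close>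

definition sm where "sm j c = finsum C (\<lambda>y. pt (ev y c) (ind {y})) (Y j)"

lemma sm_hom: "j \<le> m \<Longrightarrow> sm j \<in> module_hom K C C"
  unfolding sm_def[abs_def] using Y_S
  by (intro CM.finsum_module_hom[OF C_left_module] module_hom_comp[OF ev(1) pt_ind_hom]) auto

lemma B_decomp:
  assumes F: "finite F" "F \<subseteq> S" and b: "b \<in> carrier B"
  shows "b = (b \<otimes>\<^bsub>B\<^esub> ind (S - F)) \<oplus>\<^bsub>B\<^esub> finsum B (\<lambda>y. b y \<odot>\<^bsub>B\<^esub> ind {y}) F"
  using F
proof (induction F)
  case empty
  have "finsum B (\<lambda>y. b y \<odot>\<^bsub>B\<^esub> ind {y}) {} = \<zero>\<^bsub>B\<^esub>" by (rule B.M.finsum_empty)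
  then show ?case using b by (auto simp: indicator_map_def PiE_in fun_eq_iff PiE_iff extensional_def)
next
  case (insert y F)
  note y = insert.hyps(2) and yF = insert.prems and IH = insert.IH
  have yS: "y \<in> S" and FS: "F \<subseteq> S" using yF by auto
  have c: "b z \<odot>\<^bsub>B\<^esub> ind {z} \<in> carrier B" if "z \<in> S" for z
    using PiE_in[of b S "carrier K" z] b that by (intro B.smult_closed[OF _ ind_in]) simp
  have cF: "(\<lambda>y. b y \<odot>\<^bsub>B\<^esub> ind {y}) \<in> F \<rightarrow> carrier B" using c FS by (auto simp del: maps_alg_simps)
  have fc: "finsum B (\<lambda>y. b y \<odot>\<^bsub>B\<^esub> ind {y}) F \<in> carrier B" by (rule B.M.finsum_closed[OF cF])
  have 1: "finsum B (\<lambda>y. b y \<odot>\<^bsub>B\<^esub> ind {y}) (insert y F) = b y \<odot>\<^bsub>B\<^esub> ind {y} \<oplus>\<^bsub>B\<^esub> finsum B (\<lambda>y. b y \<odot>\<^bsub>B\<^esub> ind {y}) F"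
    by (rule B.M.finsum_insert[OF insert.hyps cF c[OF yS]])
  have 2: "b \<otimes>\<^bsub>B\<^esub> ind (S - F) = (b \<otimes>\<^bsub>B\<^esub> ind (S - insert y F)) \<oplus>\<^bsub>B\<^esub> (b y \<odot>\<^bsub>B\<^esub> ind {y})"
  proof
    fix x
    show "(b \<otimes>\<^bsub>B\<^esub> ind (S - F)) x = ((b \<otimes>\<^bsub>B\<^esub> ind (S - insert y F)) \<oplus>\<^bsub>B\<^esub> (b y \<odot>\<^bsub>B\<^esub> ind {y})) x"
      using y PiE_in[of b S "carrier K" x] PiE_in[of b S "carrier K" y] yS b
      by (cases "x \<in> S"; cases "x = y") (simp_all add: indicator_map_def)
  qed
  have 3: "b \<otimes>\<^bsub>B\<^esub> ind (S - insert y F) \<in> carrier B" by (rule B_mult_in[OF b ind_in])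
  show ?case
    unfolding 1 using IH[OF FS] unfolding 2 B.M.a_assoc[OF 3 c[OF yS] fc] .
qed

text \<open>The difference is \<open>c\<close> times \<open>ch j\<close>, a multiple of the
  generator of the ideal.\<close>

lemma C_mod_TI:
  assumes j: "j \<le> m" and c: "c \<in> carrier C"
  shows "c \<ominus>\<^bsub>C\<^esub> sm j c \<in> TI j"
  using c
proof (induction rule: smash_induct)
  case (pure g a b)
  note a = gr_carrier[OF pure(1,2)]
  have F: "finite (Y j)" "Y j \<subseteq> S" using Y_finite j Y_S by auto
  have bK: "b y \<in> carrier K" if "y \<in> Y j" for y using pure(3) that F by (auto simp: PiE_in)
  have ab: "a \<in> carrier A" "pt a b \<in> carrier C" using a pt_C pure by auto
  have AB: "module_hom_pair K B C" by (intro module_hom_pair.intro B.left_module_axioms C_left_module)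
  have rh: "(\<lambda>u. pt a u) \<in> module_hom K B C" unfolding C_homs by (rule TB.pt_right_hom[OF a])
  have "sm j (pt a b) = finsum C (\<lambda>y. pt a (b y \<odot>\<^bsub>B\<^esub> ind {y})) (Y j)" unfolding sm_def
  proof (rule CM.M.finsum_cong', goal_cases)
    case (3 y)
    then have yS: "y \<in> S" using F by blast
    show ?case unfolding ev(2)[OF yS a pure(3)] using TB.pt_smult_left[OF bK[OF 3] a ind_in] TB.pt_smult_right[OF bK[OF 3] a ind_in] by simp
  next
    case 2
    show ?case using pt_C[OF a B.smult_closed[OF bK ind_in]] by blast
  qed simp
  also have "\<dots> = pt a (finsum B (\<lambda>y. b y \<odot>\<^bsub>B\<^esub> ind {y}) (Y j))"
    using B.smult_closed[OF bK ind_in] by (intro module_hom_pair.hom_finsum[OF AB rh, symmetric]) blast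
  finally have s: "sm j (pt a b) = pt a (finsum B (\<lambda>y. b y \<odot>\<^bsub>B\<^esub> ind {y}) (Y j))" .
  have fc: "finsum B (\<lambda>y. b y \<odot>\<^bsub>B\<^esub> ind {y}) (Y j) \<in> carrier B"
    using B.smult_closed[OF bK ind_in] by (intro B.M.finsum_closed) blast
  have bi: "b \<otimes>\<^bsub>B\<^esub> ind (S - Y j) \<in> carrier B" by (rule B_mult_in[OF pure(3) ind_in])
  have "pt a b = pt a (b \<otimes>\<^bsub>B\<^esub> ind (S - Y j)) \<oplus>\<^bsub>C\<^esub> sm j (pt a b)"
    unfolding s using B_decomp[OF F pure(3)] module_hom_add[OF rh bi fc] by simp
  moreover have "pt a (b \<otimes>\<^bsub>B\<^esub> ind (S - Y j)) \<in> carrier C" "sm j (pt a b) \<in> carrier C"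
    unfolding s using pt_C[OF a bi] pt_C[OF a fc] by simp_all
  ultimately have "pt a b \<ominus>\<^bsub>C\<^esub> sm j (pt a b) = pt a (b \<otimes>\<^bsub>B\<^esub> ind (S - Y j))"
    by (metis CM.M.a_assoc CM.M.a_inv_closed CM.M.r_neg CM.M.r_zero a_minus_def)
  also have "\<dots> = pt a b \<otimes>\<^bsub>C\<^esub> ch j" using pt_ch[OF a pure(3)] by simp
  finally show ?case using idealD(6)[OF TI_ideal ab(2) ch_TI] by simp
next
  case (add x y)
  have s: "sm j x \<in> carrier C" "sm j y \<in> carrier C" using module_hom_in[OF sm_hom[OF j]] add by auto
  have "(x \<oplus>\<^bsub>C\<^esub> y) \<ominus>\<^bsub>C\<^esub> sm j (x \<oplus>\<^bsub>C\<^esub> y) = (x \<ominus>\<^bsub>C\<^esub> sm j x) \<oplus>\<^bsub>C\<^esub> (y \<ominus>\<^bsub>C\<^esub> sm j y)"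
    using add(1,2) s module_hom_add[OF sm_hom[OF j] add(1,2)] by (simp add: a_minus_def CM.M.minus_add CM.M.a_ac)
  then show ?case using idealD(4)[OF TI_ideal add(3,4)] by simp
qed

lemma RH_TI: assumes j: "j \<le> m" shows "RH j \<subseteq> TI j"
proof
  fix c assume c: "c \<in> RH j"
  then have cC: "c \<in> carrier C" by (simp add: RH_def)
  have s: "sm j c \<in> TI j" unfolding sm_def
    using NG_TI[OF _ _ j] c by (intro CM.submodule_finsum[OF TI_sub]) (auto simp: RH_def)
  have "(c \<ominus>\<^bsub>C\<^esub> sm j c) \<oplus>\<^bsub>C\<^esub> sm j c = c" using cC TI_in[OF s] by (simp add: a_minus_def CM.M.a_assoc CM.M.l_neg)
  then show "c \<in> TI j" using idealD(4)[OF TI_ideal C_mod_TI[OF j cC] s] by simp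
qed

lemma TI_iff: "1 \<le> j \<Longrightarrow> j \<le> m \<Longrightarrow> c \<in> TI j \<longleftrightarrow> c \<in> carrier C \<and> (\<forall>y\<in>Y j. ev y c \<in> NG j y)"
  using TI_RH[of j] RH_TI[of j] by (auto simp: RH_def)

lemma TI_mono: "1 \<le> i \<Longrightarrow> i \<le> j \<Longrightarrow> j \<le> m \<Longrightarrow> TI j \<subseteq> TI i"
  using TI_iff[of i] TI_iff[of j] Y_mono[of i j] NG_mono[of i j] by fastforce

lemma ev_pt_ind:
  assumes "y \<in> S" "x \<in> carrier A"
  shows "ev y (pt x (ind {z})) = (if y = z then x else \<zero>)"
  using ev(2)[OF assms(1,2) ind_in, of "{z}"] assms by (cases "y = z") (simp_all add: indicator_map_def L.V.smult_one)

subsection \<open>The basis of \<open>C(Y\<^sub>j)\<close>\<close>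

lemma quot_TI: "quot_mod K C (TI j)"
  by (intro quot_mod.intro quot_mod_axioms.intro C_left_module TI_sub)

text \<open>The classes span because \<open>C\<close> is spanned modulo the ideal by monomials at
  points of \<open>Y j\<close>, and those that are not good vanish by \<open>bad_w_TI\<close>. They
  are independent because the coordinates at good monomials vanish on \<open>TI j\<close> and so
  descend to the quotient.\<close>

lemma basis_TI:
  assumes j: "1 \<le> j" "j \<le> m"
  shows "vectorspace.basis K (quot_module C (TI j)) {TI j +>\<^bsub>C\<^esub> pt (w a) (ind {y}) | a y. a \<in> Good j y}" (is "vectorspace.basis K _ ?B")
proof -
  interpret q: quot_mod K C "TI j" by (rule quot_TI)
  interpret V: kspace K q.Q by (intro kspace.intro field_axioms q.quot_left_module)
  have GX: "a \<in> Xi" "y \<in> Y j" "y \<in> S" if "a \<in> Good j y" for a y using that Y_S[OF j(2)] by (auto simp: Good_def)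
  have BV: "?B \<subseteq> carrier q.Q" using q.cls_in pt_C[OF w_closed ind_in] GX by blast
  show ?thesis
  proof (rule V.basisI[OF BV])
    show "carrier q.Q \<subseteq> lspan K q.Q ?B"
    proof
      fix X assume "X \<in> carrier q.Q"
      then obtain c where c: "c \<in> carrier C" "X = q.cls c" unfolding q.quot_carrier by blast
      have pe: "pt (ev y c) (ind {y}) \<in> carrier C" if "y \<in> Y j" for y
        using pt_C[OF ev_in[OF Y_S[OF j(2) that] c(1)] ind_in] .
      have sc: "sm j c \<in> carrier C" using module_hom_in[OF sm_hom[OF j(2)] c(1)] .
      have "X = q.cls (sm j c)" using C_mod_TI[OF j(2) c(1)] c q.cls_eq[OF c(1) sc] by simp
      also have "\<dots> = finsum q.Q (\<lambda>y. q.cls (pt (ev y c) (ind {y}))) (Y j)"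
        unfolding sm_def by (rule q.cls_finsum) (rule pe)
      also have "\<dots> \<in> lspan K q.Q ?B"
      proof (rule q.Q.submodule_finsum[OF V.lspan_submodule[OF BV]])
        fix y assume y: "y \<in> Y j"
        have AQ: "module_hom_pair K A q.Q" by (intro module_hom_pair.intro L.V.left_module_axioms q.quot_left_module)
        have h: "(\<lambda>x. q.cls (pt x (ind {y}))) \<in> module_hom K A q.Q" by (rule module_hom_comp[OF pt_ind_hom q.cls_hom])
        have "ev y c \<in> {x \<in> carrier A. q.cls (pt x (ind {y})) \<in> lspan K q.Q ?B}"
        proof (rule w_generate[OF module_hom_pair.hom_vimage[OF AQ h V.lspan_submodule[OF BV]] _ ev_in[OF Y_S[OF j(2) y] c(1)]])
          fix a assume a: "a \<in> Xi"
          have "q.cls (pt (w a) (ind {y})) \<in> lspan K q.Q ?B"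
          proof (cases "a \<in> Good j y")
            case True
            then show ?thesis by (intro V.lspan_incl[OF BV]) blast
          next
            case False
            then have "q.cls (pt (w a) (ind {y})) = \<zero>\<^bsub>q.Q\<^esub>"
              using bad_w_TI[OF a False y j(2)] TI_in q.cls_eq_zero by blast
            then show ?thesis using left_submoduleD(3)[OF V.lspan_submodule[OF BV]] by simp
          qed
          then show "w a \<in> {x \<in> carrier A. q.cls (pt x (ind {y})) \<in> lspan K q.Q ?B}" using w_closed[OF a] by simp
        qed
        then show "q.cls (pt (ev y c) (ind {y})) \<in> lspan K q.Q ?B" by blast
      qed
      finally show "X \<in> lspan K q.Q ?B" .
    qed
    fix X assume "X \<in> ?B"
    then obtain a y where a: "a \<in> Good j y" "X = q.cls (pt (w a) (ind {y}))" by blast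
    note aX = GX[OF a(1)]
    have h: "(\<lambda>c. lam a (ev y c)) \<in> module_hom K C (ring_module K)" by (rule module_hom_comp[OF ev(1)[OF aX(3)] lam_hom[OF aX(1)]])
    have z: "lam a (ev y u) = \<zero>\<^bsub>ring_module K\<^esub>" if "u \<in> TI j" for u
      using that TI_iff[OF j] aX(2) a(1) by (auto simp: NG_def)
    obtain f where f: "f \<in> module_hom K q.Q (ring_module K)" and fc: "\<And>c. c \<in> carrier C \<Longrightarrow> f (q.cls c) = lam a (ev y c)"
      using q.quot_lift[OF ring_module_left_module[OF ring_axioms] h z] by blast
    have fb: "f (q.cls (pt (w a') (ind {y'}))) = (if y = y' \<and> a = a' then \<one>\<^bsub>K\<^esub> else \<zero>\<^bsub>K\<^esub>)" if "a' \<in> Good j y'" for a' y'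
      using fc[OF pt_C[OF w_closed[OF GX(1)[OF that]] ind_in]] ev_pt_ind[OF aX(3) w_closed[OF GX(1)[OF that]], of y']
        lam_w[OF aX(1) GX(1)[OF that]] lam_zero[OF aX(1)] by auto
    show "\<exists>f. (\<forall>x\<in>carrier q.Q. f x \<in> carrier K) \<and>
       (\<forall>x\<in>carrier q.Q. \<forall>y\<in>carrier q.Q. f (x \<oplus>\<^bsub>q.Q\<^esub> y) = f x \<oplus>\<^bsub>K\<^esub> f y) \<and>
       (\<forall>k\<in>carrier K. \<forall>x\<in>carrier q.Q. f (k \<odot>\<^bsub>q.Q\<^esub> x) = k \<otimes>\<^bsub>K\<^esub> f x) \<and>
       f X = \<one>\<^bsub>K\<^esub> \<and> (\<forall>b'\<in>?B. b' \<noteq> X \<longrightarrow> f b' = \<zero>\<^bsub>K\<^esub>)"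
    proof (intro exI[of _ f] conjI ballI impI)
      show "f X = \<one>\<^bsub>K\<^esub>" using fb[OF a(1)] a(2) by simp
      fix X' assume X': "X' \<in> ?B" "X' \<noteq> X"
      then obtain a' y' where a': "a' \<in> Good j y'" "X' = q.cls (pt (w a') (ind {y'}))" by blast
      then have "\<not> (y = y' \<and> a = a')" using X'(2) a(2) by blast
      then show "f X' = \<zero>\<^bsub>K\<^esub>" using fb[OF a'(1)] a'(2) by simp
    qed (use module_hom_in[OF f] module_hom_add[OF f] module_hom_smult[OF f] in auto)
  qed
qed

subsection \<open>The dual bases\<close>

text \<open>The right part \<open>b (j+1) \<cdots> b m\<close> of a monomial is indexed by the monomial whose first \<open>j\<close> factors are those
  of \<open>b0\<close>; \<open>rho j b\<close> extracts the left parts of the monomials with right part \<open>b\<close>.\<close>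

definition "b0 = (SOME b. b \<in> Xi)"

lemma b0_in: "a \<in> Xi \<Longrightarrow> b0 \<in> Xi" unfolding b0_def by (rule someI[of "\<lambda>b. b \<in> Xi"])

definition rho where
  "rho j b = (SOME f. f \<in> module_hom K A A \<and> (\<forall>d\<in>Xi. f (w d) = (if merge j b0 d = b then iprod A d 1 j else \<zero>)))"

lemma rho:
  assumes j: "j \<le> m"
  shows "rho j b \<in> module_hom K A A" "\<And>d. d \<in> Xi \<Longrightarrow> rho j b (w d) = (if merge j b0 d = b then iprod A d 1 j else \<zero>)"
proof -
  have "\<exists>f\<in>module_hom K A A. \<forall>d\<in>Xi. f (w d) = (if merge j b0 d = b then iprod A d 1 j else \<zero>)"
    by (rule lin_ext[OF L.V.left_module_axioms]) (use Xi_iprod_closed j in auto)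
  then have "\<exists>f. f \<in> module_hom K A A \<and> (\<forall>d\<in>Xi. f (w d) = (if merge j b0 d = b then iprod A d 1 j else \<zero>))" by blast
  from someI_ex[OF this] show "rho j b \<in> module_hom K A A"
    "\<And>d. d \<in> Xi \<Longrightarrow> rho j b (w d) = (if merge j b0 d = b then iprod A d 1 j else \<zero>)"
    unfolding rho_def by blast+
qed

lemma Mon_in: "e \<in> Xi \<Longrightarrow> 1 \<le> i \<Longrightarrow> k \<le> m \<Longrightarrow> iprod A e i k \<in> lspan K A (Mon i k)"
  by (rule L.lspan_incl[OF Mon_carrier]) (auto simp: Mon_def)

lemma rho_block:
  assumes j: "1 \<le> j" "j \<le> m"
  shows "x \<in> carrier A \<Longrightarrow> rho j b x \<in> lspan K A (Mon 1 j)"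
proof -
  assume x: "x \<in> carrier A"
  note sub = L.lspan_submodule[OF Mon_carrier[of 1 j]]
  have "x \<in> {x \<in> carrier A. rho j b x \<in> lspan K A (Mon 1 j)}"
  proof (rule w_generate[OF module_hom_pair.hom_vimage[OF AA rho(1)[OF j(2)] sub] _ x])
    fix d assume d: "d \<in> Xi"
    show "w d \<in> {x \<in> carrier A. rho j b x \<in> lspan K A (Mon 1 j)}"
      using rho(2)[OF j(2) d] Mon_in[OF d, of 1 j] left_submoduleD(3)[OF sub] j w_closed[OF d] by auto
  qed (use j in auto)
  then show ?thesis by blast
qed

lemma block_carrier: "1 \<le> i \<Longrightarrow> k \<le> m \<Longrightarrow> a \<in> lspan K A (Mon i k) \<Longrightarrow> a \<in> carrier A"
  using left_submoduleD(2)[OF L.lspan_submodule[OF Mon_carrier]] by blast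

text \<open>Left multiplication by the subalgebra of the first \<open>j\<close> factors changes only
  left parts, so it commutes with \<open>rho j b\<close>. The linearity of the dual basis over
  \<open>DD j\<close> comes from here.\<close>

lemma rho_mult:
  assumes j: "1 \<le> j" "j \<le> m" and a: "a \<in> lspan K A (Mon 1 j)" and x: "x \<in> carrier A"
  shows "rho j b (a \<otimes> x) = a \<otimes> rho j b x"
proof -
  note rh = rho[OF j(2)]
  have aA: "a \<in> carrier A" using block_carrier[OF _ j(2) a] by simp
  have 1: "rho j b (a' \<otimes> iprod A d (Suc j) m) = (if merge j b0 d = b then a' else \<zero>)"
    if d: "d \<in> Xi" and a': "a' \<in> lspan K A (Mon 1 j)" for d a'
  proof -
    have dA: "iprod A d (Suc j) m \<in> carrier A" using Xi_iprod_closed[OF d] by simp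
    have "(\<lambda>x. if merge j b0 d = b then x else \<zero>) \<in> module_hom K A A" by (rule module_homI) (auto simp: L.V.smult_closed)
    from module_hom_pair.hom_equalizer[OF AA module_hom_comp[OF mult_right_hom[OF dA] rh(1)] this]
    have "lspan K A (Mon 1 j) \<subseteq> {x \<in> carrier A. rho j b (x \<otimes> iprod A d (Suc j) m) = (if merge j b0 d = b then x else \<zero>)}"
    proof (rule L.lspan_minimal[rotated], intro subsetI)
      fix u assume "u \<in> Mon 1 j"
      then obtain e where e: "e \<in> Xi" "u = iprod A e 1 j" by (auto simp: Mon_def)
      have mm: "merge j b0 (merge j e d) = merge j b0 d" by (auto simp: merge_def)
      have "u \<otimes> iprod A d (Suc j) m = w (merge j e d)" using w_merge[OF e(1) d j] e by simp
      then show "u \<in> {x \<in> carrier A. rho j b (x \<otimes> iprod A d (Suc j) m) = (if merge j b0 d = b then x else \<zero>)}"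
        using rh(2)[OF merge_Xi[OF e(1) d]] e Xi_iprod_closed[OF e(1), of 1 j] j by (simp add: mm merge_iprod)
    qed
    then show ?thesis using a' by blast
  qed
  show ?thesis
  proof (rule w_hom_eq[OF L.V.left_module_axioms module_hom_comp[OF mult_left_hom[OF aA] rh(1)] module_hom_comp[OF rh(1) mult_left_hom[OF aA]] _ x])
    fix d assume d: "d \<in> Xi"
    have dA: "iprod A d 1 j \<in> carrier A" "iprod A d (Suc j) m \<in> carrier A" using Xi_iprod_closed[OF d] j by auto
    have "w d = iprod A d 1 j \<otimes> iprod A d (Suc j) m" unfolding w_def using Xi_iprod_split[OF d, of 1 j m] j by simp
    then have "a \<otimes> w d = (a \<otimes> iprod A d 1 j) \<otimes> iprod A d (Suc j) m" using aA dA by (simp add: A.m_assoc)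
    then show "rho j b (a \<otimes> w d) = a \<otimes> rho j b (w d)"
      using 1[OF d block_mult[of 1 j, OF _ j a Mon_in[OF d]]] j rh(2)[OF d] aA by simp
  qed
qed

text \<open>Attaching the right part \<open>b\<close> to the extracted left parts restores the
  portion of \<open>x\<close> whose monomials have right part \<open>b\<close>.\<close>

lemma lam_rho:
  assumes j: "1 \<le> j" "j \<le> m" and a: "a \<in> Xi" and b: "b \<in> Xi" and x: "x \<in> carrier A"
  shows "lam a (rho j b x \<otimes> iprod A b (Suc j) m) = (if merge j b0 a = b then lam a x else \<zero>\<^bsub>K\<^esub>)"
proof -
  have bA: "iprod A b (Suc j) m \<in> carrier A" using Xi_iprod_closed[OF b] by simp
  have N: "left_module K (ring_module K)" by (rule ring_module_left_module[OF ring_axioms])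
  have h: "(\<lambda>x. if merge j b0 a = b then lam a x else \<zero>\<^bsub>K\<^esub>) \<in> module_hom K A (ring_module K)"
    by (rule module_homI) (auto simp: lam_in[OF a] lam_add[OF a] lam_smult[OF a])
  show ?thesis
  proof (rule w_hom_eq[OF N module_hom_comp[OF module_hom_comp[OF rho(1)[OF j(2)] mult_right_hom[OF bA]] lam_hom[OF a]] h _ x])
    fix d assume d: "d \<in> Xi"
    show "lam a (rho j b (w d) \<otimes> iprod A b (Suc j) m) = (if merge j b0 a = b then lam a (w d) else \<zero>\<^bsub>K\<^esub>)"
    proof (cases "merge j b0 d = b")
      case True
      have "iprod A b (Suc j) m = iprod A d (Suc j) m" using True merge_iprod(2)[of j "Suc j" b0 d m] by simp
      then have "rho j b (w d) \<otimes> iprod A b (Suc j) m = w d"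
        unfolding rho(2)[OF j(2) d] using True Xi_iprod_split[OF d, of 1 j m] j by (simp add: w_def)
      then show ?thesis using lam_w[OF a d] True by auto
    next
      case False
      then show ?thesis using rho(2)[OF j(2) d] bA lam_w[OF a d] lam_zero[OF a] by auto
    qed
  qed
qed

lemma rho_finite:
  assumes j: "j \<le> m" and x: "x \<in> carrier A"
  shows "finite {b \<in> Xi. rho j b x \<noteq> \<zero>}"
proof (rule finite_subset)
  let ?F = "{a \<in> Xi. lam a x \<noteq> \<zero>\<^bsub>K\<^esub>}"
  show "finite (merge j b0 ` ?F)" using lam_finite[OF x] by simp
  show "{b \<in> Xi. rho j b x \<noteq> \<zero>} \<subseteq> merge j b0 ` ?F"
  proof
    fix b assume b: "b \<in> {b \<in> Xi. rho j b x \<noteq> \<zero>}"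
    show "b \<in> merge j b0 ` ?F"
    proof (rule ccontr)
      assume n: "b \<notin> merge j b0 ` ?F"
      have c: "lam a x \<odot> w a \<in> carrier A" if "a \<in> ?F" for a using that lam_in x w_closed L.V.smult_closed by auto
      have "rho j b x = finsum A (\<lambda>a. rho j b (lam a x \<odot> w a)) ?F"
        using module_hom_pair.hom_finsum[OF AA rho(1)[OF j], of ?F "\<lambda>a. lam a x \<odot> w a" b] w_expand[OF x] c by simp
      also have "\<dots> = finsum A (\<lambda>a. \<zero>) ?F"
      proof (rule A.finsum_cong', goal_cases)
        case (3 a)
        then have "merge j b0 a \<noteq> b" using n by blast
        then show ?case using 3 module_hom_smult[OF rho(1)[OF j], of "lam a x" "w a" b] rho(2)[OF j, of a b] lam_in x w_closed by simp
      qed auto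
      finally show False using b by simp
    qed
  qed
qed

section \<open>The elements and functionals of the dual basis\<close>

text \<open>Only the products themselves, not their span: \<open>dual_basis\<close> asks for no
  closure of \<open>D\<close>, and \<open>ch j\<close> and all values of the functionals have this
  form.\<close>

definition "DD j = {pt a \<beta> | a \<beta>. a \<in> lspan K A (Mon 1 j) \<and> \<beta> \<in> carrier B}"

definition "LL j = {(b, y). b \<in> Xi \<and> (\<forall>k\<le>j. b k = b0 k) \<and> y \<in> Y (Suc j) \<and>
   (\<forall>k\<in>{Suc j..m}. pos b k y \<in> Y (Suc j)) \<and> pos b (Suc j) y \<in> Z (Suc j)}"

definition "qq j = (\<lambda>(b, y). pt (iprod A b (Suc j) m) (ind {y}))"

text \<open>The indicator map marks the point where the right part ends and the left part begins to
  act. It makes the product with \<open>qq j (b, y)\<close> the portion of \<open>u\<close> at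
  \<open>y\<close> with right part \<open>b\<close>, and it makes the functional compatible with
  left multiplication by maps on \<open>S\<close>.\<close>

definition "ff j = (\<lambda>(b, y) c. pt (rho j b (ev y c)) (ind {pos b (Suc j) y}))"

lemma C_hom_eq:
  assumes N: "left_module K N" and f: "f \<in> module_hom K C N" and g: "g \<in> module_hom K C N"
    and eq: "\<And>d b. d \<in> Xi \<Longrightarrow> b \<in> carrier B \<Longrightarrow> f (pt (w d) b) = g (pt (w d) b)" and c: "c \<in> carrier C"
  shows "f c = g c"
proof (rule TB.tensor_hom_eq[OF N f[unfolded C_homs] g[unfolded C_homs] _ c[unfolded C_simps]])
  fix v u assume v: "v \<in> carrier A" and u: "u \<in> carrier B"
  show "f (pt v u) = g (pt v u)"
    by (rule w_hom_eq[OF N module_hom_comp[OF TB.pt_left_hom[OF u] f[unfolded C_homs]] module_hom_comp[OF TB.pt_left_hom[OF u] g[unfolded C_homs]] _ v])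
       (rule eq[OF _ u])
qed

lemma ff_hom: "j \<le> m \<Longrightarrow> y \<in> S \<Longrightarrow> ff j (b, y) \<in> module_hom K C C"
proof -
  assume j: "j \<le> m" and y: "y \<in> S"
  have "(\<lambda>c. pt (rho j b (ev y c)) (ind {pos b (Suc j) y})) \<in> module_hom K C C"
    by (rule module_hom_comp[OF module_hom_comp[OF ev(1)[OF y] rho(1)[OF j]] pt_ind_hom])
  then show ?thesis by (simp add: ff_def)
qed

text \<open>If a monomial \<open>e\<close> has right part \<open>b\<close>, its left part carries
  the end point of \<open>b\<close> to the point to which all of \<open>e\<close> carries
  \<open>y\<close>, so the map \<open>\<beta>\<close> is evaluated at the same point on both sides.
  For other monomials both sides vanish.\<close>

lemma ff_mult:
  assumes j: "1 \<le> j" "Suc j \<le> m" and i: "(b, y) \<in> LL j" and d: "d \<in> DD j" and u: "u \<in> carrier C"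
  shows "ff j (b, y) (d \<otimes>\<^bsub>C\<^esub> u) = d \<otimes>\<^bsub>C\<^esub> ff j (b, y) u"
proof -
  have jm: "j \<le> m" using j by simp
  have b: "b \<in> Xi" and yS: "y \<in> S" using i Y_S[OF j(2)] by (auto simp: LL_def)
  obtain a \<beta> where a: "a \<in> lspan K A (Mon 1 j)" and \<beta>: "\<beta> \<in> carrier B" and d: "d = pt a \<beta>" using d by (auto simp: DD_def)
  have aA: "a \<in> carrier A" using block_carrier[OF _ jm a] by simp
  have dC: "pt a \<beta> \<in> carrier C" by (rule pt_C[OF aA \<beta>])
  define z where "z = pos b (Suc j) y"
  have zS: "z \<in> S" unfolding z_def using pos_S[OF b _ _ yS, of "Suc j"] j by simp
  show ?thesis unfolding d
  proof (rule C_hom_eq[OF C_left_module module_hom_comp[OF C_mult_homs(1)[OF dC] ff_hom[OF jm yS]]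
        module_hom_comp[OF ff_hom[OF jm yS] C_mult_homs(1)[OF dC]] _ u])
    fix e b' assume e: "e \<in> Xi" and b': "b' \<in> carrier B"
    let ?g = "dg e 1 m"
    note wA = w_closed[OF e]
    have gy: "act ?g y \<in> S" by (rule act_closed[OF dgm[OF e] yS])
    have k1: "b' y \<in> carrier K" "\<beta> (act ?g y) \<in> carrier K" using b' \<beta> yS gy by (auto simp: PiE_in)
    have "ev y (pt a \<beta> \<otimes>\<^bsub>C\<^esub> pt (w e) b') = (b' y \<otimes>\<^bsub>K\<^esub> \<beta> (act ?g y)) \<odot> (a \<otimes> w e)"
      using ev_mult[OF yS dC dgm[OF e] w_gr[OF e] b'] ev(2)[OF gy aA \<beta>] k1 aA wA by (simp add: smult_mult L.V.smult_assoc1 del: maps_alg_simps)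
    then have L: "ff j (b, y) (pt a \<beta> \<otimes>\<^bsub>C\<^esub> pt (w e) b') = pt ((b' y \<otimes>\<^bsub>K\<^esub> \<beta> (act ?g y)) \<odot> (a \<otimes> rho j b (w e))) (ind {z})"
      using module_hom_smult[OF rho(1)[OF jm], of "b' y \<otimes>\<^bsub>K\<^esub> \<beta> (act ?g y)" "a \<otimes> w e" b] k1 aA wA
        rho_mult[OF j(1) jm a wA] by (simp add: ff_def z_def)
    have "ev y (pt (w e) b') = b' y \<odot> w e" by (rule ev(2)[OF yS wA b'])
    then have R: "ff j (b, y) (pt (w e) b') = pt (b' y \<odot> rho j b (w e)) (ind {z})"
      using module_hom_smult[OF rho(1)[OF jm] k1(1) wA, of b] by (simp add: ff_def z_def)
    show "ff j (b, y) (pt a \<beta> \<otimes>\<^bsub>C\<^esub> pt (w e) b') = pt a \<beta> \<otimes>\<^bsub>C\<^esub> ff j (b, y) (pt (w e) b')"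
    proof (cases "merge j b0 e = b")
      case False
      then have r0: "rho j b (w e) = \<zero>" using rho(2)[OF jm e] by simp
      have "pt \<zero> (ind {z}) = \<zero>\<^bsub>C\<^esub>" using module_hom_pair.hom_zero[OF AC pt_ind_hom] .
      then show ?thesis unfolding L R r0 using aA k1 dC by simp
    next
      case True
      let ?h = "dg e 1 j"
      have re: "rho j b (w e) = iprod A e 1 j" using rho(2)[OF jm e] True by simp
      have hG: "?h \<in> carrier G" and hr: "iprod A e 1 j \<in> gr ?h" using dg_closed[OF e, of 1 j] dg_in[OF e, of 1 j] j by auto
      have eA: "iprod A e 1 j \<in> carrier A" using gr_carrier[OF hG hr] .
      have "pos b (Suc j) y = pos e (Suc j) y" unfolding pos_def using True merge_dg(2)[of j "Suc j" b0 e m] by simp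
      then have hz: "act ?h z = act ?g y" using pos_split[OF e, of 1 j y] j yS by (simp add: pos_def z_def)
      have "pt a \<beta> \<otimes>\<^bsub>C\<^esub> pt (b' y \<odot> iprod A e 1 j) (ind {z}) = pt (a \<otimes> (b' y \<odot> iprod A e 1 j)) (sh \<beta> ?h \<otimes>\<^bsub>B\<^esub> ind {z})"
        using C_pt_mult[OF hG aA \<beta> left_submoduleD(5)[OF gr_sub[OF hG] k1(1) hr] ind_in] .
      also have "sh \<beta> ?h \<otimes>\<^bsub>B\<^esub> ind {z} = \<beta> (act ?g y) \<odot>\<^bsub>B\<^esub> ind {z}"
        using sh_mult_ind[OF \<beta> hG zS] by (simp only: hz)
      also have "pt (a \<otimes> (b' y \<odot> iprod A e 1 j)) (\<beta> (act ?g y) \<odot>\<^bsub>B\<^esub> ind {z})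
         = pt (\<beta> (act ?g y) \<odot> (a \<otimes> (b' y \<odot> iprod A e 1 j))) (ind {z})"
        using TB.pt_smult_right[OF k1(2) _ ind_in] TB.pt_smult_left[OF k1(2) _ ind_in] aA eA k1 L.V.smult_closed by (simp del: maps_alg_simps)
      also have "\<beta> (act ?g y) \<odot> (a \<otimes> (b' y \<odot> iprod A e 1 j)) = (b' y \<otimes>\<^bsub>K\<^esub> \<beta> (act ?g y)) \<odot> (a \<otimes> iprod A e 1 j)"
        using aA eA k1 by (simp add: smult_mult L.V.smult_assoc1[symmetric] m_comm)
      finally show ?thesis unfolding L R re by simp
    qed
  qed
qed

text \<open>A monomial that has right part \<open>b\<close> and is not good for \<open>Suc j\<close>
  leaves \<open>Y (Suc j)\<close> only while its left part acts. So its left part, taken at the end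
  point of \<open>b\<close>, already lies in \<open>TI (Suc j)\<close>.\<close>

lemma ff_TI:
  assumes j: "1 \<le> j" "Suc j \<le> m" and i: "(b, y) \<in> LL j" and u: "u \<in> TI (Suc j)"
  shows "ff j (b, y) u \<in> TI (Suc j)"
proof -
  have jm: "j \<le> m" using j by simp
  have b: "b \<in> Xi" and y: "y \<in> Y (Suc j)" and p: "\<And>k. k \<in> {Suc j..m} \<Longrightarrow> pos b k y \<in> Y (Suc j)" using i by (auto simp: LL_def)
  have yS: "y \<in> S" using Y_S[OF j(2) y] .
  define z where "z = pos b (Suc j) y"
  have zS: "z \<in> S" unfolding z_def using pos_S[OF b _ _ yS, of "Suc j"] j by simp
  define x where "x = ev y u"
  have x: "x \<in> NG (Suc j) y" using u TI_iff[of "Suc j" u] j y by (simp add: x_def)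
  have xA: "x \<in> carrier A" using x by (simp add: NG_def)
  let ?F = "{a \<in> Xi. lam a x \<noteq> \<zero>\<^bsub>K\<^esub>}"
  have h: "(\<lambda>x. pt (rho j b x) (ind {z})) \<in> module_hom K A C" by (rule module_hom_comp[OF rho(1)[OF jm] pt_ind_hom])
  have c: "lam a x \<odot> w a \<in> carrier A" if "a \<in> ?F" for a using that lam_in xA w_closed L.V.smult_closed by auto
  have "pt (rho j b x) (ind {z}) = finsum C (\<lambda>a. pt (rho j b (lam a x \<odot> w a)) (ind {z})) ?F"
    using module_hom_pair.hom_finsum[OF AC h, of ?F "\<lambda>a. lam a x \<odot> w a"] w_expand[OF xA] c by simp
  also have "\<dots> \<in> TI (Suc j)"
  proof (rule CM.submodule_finsum[OF TI_sub])
    fix a assume a: "a \<in> ?F"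
    have aX: "a \<in> Xi" and aK: "lam a x \<in> carrier K" using a lam_in xA by auto
    have "pt (rho j b (w a)) (ind {z}) \<in> TI (Suc j)"
    proof (cases "merge j b0 a = b")
      case True
      have "a \<notin> Good (Suc j) y" using a x by (auto simp: NG_def)
      then obtain k where k: "k \<in> {1..m}" "pos a k y \<notin> Y (Suc j)" using aX y by (auto simp: Good_def)
      have pe: "pos a l y = pos b l y" if "Suc j \<le> l" for l unfolding pos_def using True merge_dg(2)[of j l b0 a m] that by simp
      then have kj: "k \<in> {1..j}" using p k by (metis atLeastAtMost_iff not_less_eq_eq)
      have "act (dg a k j) z \<notin> Y (Suc j)" using k kj pos_split[OF aX, of k j y] yS jm pe[of "Suc j"] by (simp add: z_def)
      then have "pt (iprod A a 1 j) (ind {z}) \<in> TI (Suc j)" using bad_TI[OF aX, of 1 j k z "Suc j"] kj jm zS by auto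
      then show ?thesis using rho(2)[OF jm aX] True by simp
    next
      case False
      then have "rho j b (w a) = \<zero>" using rho(2)[OF jm aX] by simp
      then show ?thesis using module_hom_pair.hom_zero[OF AC pt_ind_hom[of z]] left_submoduleD(3)[OF TI_sub] by simp
    qed
    then show "pt (rho j b (lam a x \<odot> w a)) (ind {z}) \<in> TI (Suc j)"
      using module_hom_smult[OF h aK w_closed[OF aX]] left_submoduleD(5)[OF TI_sub aK] by simp
  qed
  finally show ?thesis by (simp add: ff_def x_def z_def)
qed

lemma ff_qq:
  assumes j: "1 \<le> j" "Suc j \<le> m" and i: "(b, y) \<in> LL j" and u: "u \<in> carrier C"
  shows "ff j (b, y) u \<otimes>\<^bsub>C\<^esub> qq j (b, y) = pt (rho j b (ev y u) \<otimes> iprod A b (Suc j) m) (ind {y})"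
proof -
  have jm: "j \<le> m" using j by simp
  have b: "b \<in> Xi" and yS: "y \<in> S" using i Y_S[OF j(2)] by (auto simp: LL_def)
  let ?g = "dg b (Suc j) m"
  have g: "?g \<in> carrier G" "iprod A b (Suc j) m \<in> gr ?g" using dg_closed[OF b] dg_in[OF b] j by auto
  have r: "rho j b (ev y u) \<in> carrier A" using module_hom_in[OF rho(1)[OF jm] ev_in[OF yS u]] .
  have "sh (ind {pos b (Suc j) y}) ?g \<otimes>\<^bsub>B\<^esub> ind {y} = ind {y}"
    by (intro sh_ind_mult[OF g(1) yS]) (simp add: pos_def)
  then show ?thesis using C_pt_mult[OF g(1) r ind_in g(2) ind_in] by (simp add: ff_def qq_def del: maps_alg_simps)
qed

lemma LL_complete:
  assumes j: "1 \<le> j" "Suc j \<le> m" and a: "a \<in> Good (Suc j) y" and n: "(merge j b0 a, y) \<notin> LL j"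
  shows "a \<in> Good j y"
proof -
  have jm: "j \<le> m" using j by simp
  have aX: "a \<in> Xi" and y: "y \<in> Y (Suc j)" and p: "\<And>k. k \<in> {1..m} \<Longrightarrow> pos a k y \<in> Y (Suc j)" using a by (auto simp: Good_def)
  have yS: "y \<in> S" using Y_S[OF j(2) y] .
  have p': "pos a k y \<in> Y (Suc j)" if "k \<in> {Suc j..m}" for k using p that by auto
  have pe: "pos (merge j b0 a) k y = pos a k y" if "Suc j \<le> k" for k unfolding pos_def using merge_dg(2)[of j k b0 a m] that by simp
  have "pos a (Suc j) y \<notin> Z (Suc j)"
    using n merge_Xi[OF b0_in[OF aX] aX] y p' pe by (auto simp: LL_def merge_def)
  then have nZ: "pos a l y \<notin> Z (Suc j)" if "Suc j \<le> l" "l \<le> Suc m" for l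
    using stay_Z[OF aX yS j(2) that(2) _ p', of "Suc j"] that by auto
  have yY: "y \<in> Y j" using nZ[of "Suc m"] pos_start[OF aX yS] j y Y_Suc by auto
  have up: "pos a l y \<in> Y j" if "Suc j \<le> l" "l \<le> m" for l using nZ[of l] p'[of l] that Y_Suc by auto
  have "pos a k y \<in> Y j" if "k \<in> {1..m}" for k
  proof (cases "Suc j \<le> k")
    case False
    have "pos a l y \<in> Y m" if "l \<in> {1..j}" for l using Y_Ym[OF j(2) p] that jm by auto
    from stay_Y[OF aX yS j(1) jm up[OF order_refl j(2)] this] show ?thesis using that False by auto
  qed (use up that in auto)
  then show ?thesis using aX yY by (simp add: Good_def)
qed

section \<open>Verification of the heredity step\<close>

theorem heredity_step_TI:
  assumes j: "1 \<le> j" "Suc j \<le> m"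
  shows "heredity_step C (TI (Suc j)) (TI j) (ch j) (DD j) (LL j) (qq j) (ff j)"
proof -
  have jm: "j \<le> m" using j by simp
  have LX: "b \<in> Xi" "y \<in> Y (Suc j)" "y \<in> S" "b = merge j b0 b" "pos b (Suc j) y \<notin> Y j" if "(b, y) \<in> LL j" for b y
    using that Y_S[OF j(2)] Z_Y_disjoint[OF j(2)] by (auto simp: LL_def merge_def fun_eq_iff)
  have o: "\<one> \<in> lspan K A (Mon 1 j)"
  proof -
    have "foldr (\<otimes>) (map (\<lambda>_. \<one>) xs) \<one> = \<one>" for xs :: "nat list" by (induction xs) auto
    then have "iprod A (\<lambda>_. \<one>) 1 j = \<one>" unfolding iprod_def .
    then show ?thesis using iprod_mon_span[of 1 j "\<lambda>_. \<one>"] As_sub(3) j by auto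
  qed
  have DC: "DD j \<subseteq> carrier C" using block_carrier[OF _ jm] pt_C by (auto simp: DD_def simp del: maps_alg_simps)
  have ip: "ideal_pair C (TI (Suc j)) (TI j) (ch j) (DD j)"
  proof (intro ideal_pair.intro ideal_pair_axioms.intro C_ring TI_ideal TI_mono ch_TI DC)
    show "ch j \<in> DD j" unfolding DD_def ch_def using o ind_in[of "S - Y j"] by blast
  qed (use j in auto)
  have qC: "qq j (b, y) \<in> carrier C" if "(b, y) \<in> LL j" for b y
    using pt_C[OF Xi_iprod_closed[OF LX(1)[OF that]] ind_in, of "Suc j" m] by (simp add: qq_def)
  have eq: "ch j \<otimes>\<^bsub>C\<^esub> qq j (b, y) = qq j (b, y)" if "(b, y) \<in> LL j" for b y
  proof -
    note l = LX[OF that]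
    have g: "dg b (Suc j) m \<in> carrier G" "iprod A b (Suc j) m \<in> gr (dg b (Suc j) m)" using dg_closed[OF l(1)] dg_in[OF l(1)] j by auto
    have "sh (ind (S - Y j)) (dg b (Suc j) m) \<otimes>\<^bsub>B\<^esub> ind {y} = ind {y}"
      using l(5) act_closed[OF g(1) l(3)] by (intro sh_ind_mult[OF g(1) l(3)]) (simp add: pos_def)
    then show ?thesis using C_pt_mult[OF g(1) A.one_closed ind_in g(2) ind_in] gr_carrier[OF g] by (simp add: ch_def qq_def del: maps_alg_simps)
  qed
  have fD: "ff j (b, y) u \<in> DD j" if "(b, y) \<in> LL j" "u \<in> carrier C" for b y u
    using rho_block[OF j(1) jm ev_in[OF LX(3)[OF that(1)] that(2)]] ind_in by (auto simp: ff_def DD_def simp del: maps_alg_simps)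
  have fin: "finite {i \<in> LL j. ff j i u \<noteq> \<zero>\<^bsub>C\<^esub>}" if u: "u \<in> carrier C" for u
  proof (rule finite_subset)
    show "finite (\<Union>y\<in>Y (Suc j). {b \<in> Xi. rho j b (ev y u) \<noteq> \<zero>} \<times> {y})"
      using Y_finite[OF j(2)] rho_finite[OF jm ev_in[OF Y_S[OF j(2)] u]] by auto
    show "{i \<in> LL j. ff j i u \<noteq> \<zero>\<^bsub>C\<^esub>} \<subseteq> (\<Union>y\<in>Y (Suc j). {b \<in> Xi. rho j b (ev y u) \<noteq> \<zero>} \<times> {y})"
    proof
      fix i assume "i \<in> {i \<in> LL j. ff j i u \<noteq> \<zero>\<^bsub>C\<^esub>}"
      then obtain b y where i: "i = (b, y)" "(b, y) \<in> LL j" "ff j (b, y) u \<noteq> \<zero>\<^bsub>C\<^esub>" by (cases i) auto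
      then have "rho j b (ev y u) \<noteq> \<zero>"
        using module_hom_pair.hom_zero[OF AC pt_ind_hom] by (auto simp: ff_def)
      then show "i \<in> (\<Union>y\<in>Y (Suc j). {b \<in> Xi. rho j b (ev y u) \<noteq> \<zero>} \<times> {y})" using i LX by auto
    qed
  qed
  have sum: "u \<ominus>\<^bsub>C\<^esub> finsum C (\<lambda>i. ff j i u \<otimes>\<^bsub>C\<^esub> qq j i) {i \<in> LL j. ff j i u \<noteq> \<zero>\<^bsub>C\<^esub>} \<in> TI (Suc j)" if u: "u \<in> TI j" for u
  proof -
    let ?F = "{i \<in> LL j. ff j i u \<noteq> \<zero>\<^bsub>C\<^esub>}" and ?s = "\<lambda>i. ff j i u \<otimes>\<^bsub>C\<^esub> qq j i"
    have uC: "u \<in> carrier C" using TI_in u .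
    have F: "finite ?F" by (rule fin[OF uC])
    have sC: "?s i \<in> carrier C" if "i \<in> LL j" for i
      using that fD[of "fst i" "snd i" u] qC[of "fst i" "snd i"] uC DC by auto
    have SC: "finsum C ?s ?F \<in> carrier C" using sC by (intro CM.M.finsum_closed) auto
    have "ev y (u \<ominus>\<^bsub>C\<^esub> finsum C ?s ?F) \<in> NG (Suc j) y" if y: "y \<in> Y (Suc j)" for y
    proof -
      have yS: "y \<in> S" using Y_S[OF j(2) y] .
      have "lam a (ev y (finsum C ?s ?F)) = lam a (ev y u)" if a: "a \<in> Good (Suc j) y" for a
      proof -
        have aX: "a \<in> Xi" using a by (simp add: Good_def)
        have h: "(\<lambda>c. lam a (ev y c)) \<in> module_hom K C (ring_module K)" by (rule module_hom_comp[OF ev(1)[OF yS] lam_hom[OF aX]])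
        have CR: "module_hom_pair K C (ring_module K)" by (intro module_hom_pair.intro C_left_module ring_module_left_module[OF ring_axioms])
        \<comment> \<open>The only index whose term can have a coordinate at \<open>a\<close> in the
          component at \<open>y\<close>: the right part of \<open>a\<close>, in normalized
          form.\<close>
        define i0 where "i0 = (merge j b0 a, y)"
        have t: "lam a (ev y (?s i)) = (if i = i0 then lam a (ev y u) else \<zero>\<^bsub>K\<^esub>)" if i: "i \<in> LL j" for i
        proof -
          obtain b y' where by': "i = (b, y')" by (cases i)
          note l = LX[OF i[unfolded by']]
          have rb: "rho j b (ev y' u) \<in> carrier A" using module_hom_in[OF rho(1)[OF jm] ev_in[OF l(3) uC]] .
          have ib: "iprod A b (Suc j) m \<in> carrier A" using Xi_iprod_closed[OF l(1)] by simp
          have "ev y (?s i) = (if y = y' then rho j b (ev y' u) \<otimes> iprod A b (Suc j) m else \<zero>)"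
            unfolding by' ff_qq[OF j i[unfolded by'] uC] by (rule ev_pt_ind[OF yS A.m_closed[OF rb ib]])
          then show ?thesis
            using lam_rho[OF j(1) jm aX l(1) ev_in[OF yS uC]] lam_zero[OF aX] by (auto simp: by' i0_def)
        qed
        have "lam a (ev y (finsum C ?s ?F)) = finsum (ring_module K) (\<lambda>i. lam a (ev y (?s i))) ?F"
          using sC by (intro module_hom_pair.hom_finsum[OF CR h]) auto
        also have "\<dots> = finsum K (\<lambda>i. lam a (ev y (?s i))) ?F" by (simp add: finsum_def finprod_def ring_module_def)
        also have "\<dots> = finsum K (\<lambda>i. if i = i0 then lam a (ev y u) else \<zero>\<^bsub>K\<^esub>) ?F"
          using t lam_in[OF aX ev_in[OF yS uC]] by (intro finsum_cong') auto
        also have "\<dots> = lam a (ev y u)"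
        proof (cases "i0 \<in> ?F")
          case True
          then show ?thesis using finsum_singleton[of i0 ?F "\<lambda>_. lam a (ev y u)"] F lam_in[OF aX ev_in[OF yS uC]] by (simp add: eq_commute)
        next
          case False
          then have "finsum K (\<lambda>i. if i = i0 then lam a (ev y u) else \<zero>\<^bsub>K\<^esub>) ?F = finsum K (\<lambda>i. \<zero>\<^bsub>K\<^esub>) ?F"
            by (intro finsum_cong') auto
          moreover have "lam a (ev y u) = \<zero>\<^bsub>K\<^esub>"
          proof (cases "i0 \<in> LL j")
            case True
            then have "?s i0 = \<zero>\<^bsub>C\<^esub>" using False qC[of "merge j b0 a" y] by (auto simp: i0_def)
            then show ?thesis using t[OF True] module_hom_pair.hom_zero[OF CR h] by simp
          next
            case nL: False
            have g: "a \<in> Good j y" by (rule LL_complete[OF j a]) (use nL in \<open>simp add: i0_def\<close>)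
            then have "y \<in> Y j" by (simp add: Good_def)
            then show ?thesis using g u TI_iff[OF j(1) jm] by (auto simp: NG_def)
          qed
          ultimately show ?thesis by simp
        qed
        finally show ?thesis .
      qed
      moreover have "ev y (u \<ominus>\<^bsub>C\<^esub> finsum C ?s ?F) = ev y u \<ominus> ev y (finsum C ?s ?F)"
        by (rule module_hom_pair.hom_diff[OF CA ev(1)[OF yS] uC SC])
      moreover have "lam a (v \<ominus> v') = \<zero>\<^bsub>K\<^esub>" if "a \<in> Xi" "v \<in> carrier A" "v' \<in> carrier A" "lam a v' = lam a v" for a v v'
      proof -
        have rm: "left_module K (ring_module K)" by (rule ring_module_left_module[OF ring_axioms])
        have "lam a (v \<ominus> v') = lam a v \<ominus>\<^bsub>ring_module K\<^esub> lam a v"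
          using module_hom_pair.hom_diff[OF module_hom_pair.intro[OF L.V.left_module_axioms rm] lam_hom[OF that(1)] that(2,3)] that(4) by simp
        also have "\<dots> = \<zero>\<^bsub>ring_module K\<^esub>"
          unfolding a_minus_def by (rule abelian_group.r_neg[OF left_module.axioms(2)[OF rm]]) (simp add: lam_in[OF that(1,2)])
        finally show ?thesis by simp
      qed
      ultimately show ?thesis using ev_in[OF yS uC] ev_in[OF yS SC] by (auto simp: NG_def Good_def)
    qed
    then show ?thesis using TI_iff[of "Suc j"] j uC SC by auto
  qed
  have fa: "ff j (b, y) (u \<oplus>\<^bsub>C\<^esub> v) = ff j (b, y) u \<oplus>\<^bsub>C\<^esub> ff j (b, y) v" if "(b, y) \<in> LL j" "u \<in> carrier C" "v \<in> carrier C" for b y u v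
    by (rule module_hom_add[OF ff_hom[OF jm LX(3)[OF that(1)]] that(2,3)])
  show ?thesis unfolding heredity_step_def
  proof (intro conjI ip ballI)
    fix i assume i: "i \<in> LL j"
    obtain b y where by': "i = (b, y)" by (cases i)
    note i' = i[unfolded by']
    show "qq j i \<in> carrier C" "ch j \<otimes>\<^bsub>C\<^esub> qq j i = qq j i" unfolding by' using qC[OF i'] eq[OF i'] .
    show "ff j i u \<in> DD j" if "u \<in> TI j" for u unfolding by' using fD[OF i' TI_in[OF that]] .
    show "ff j i u \<in> TI (Suc j)" if "u \<in> TI (Suc j)" for u unfolding by' using ff_TI[OF j i' that] .
    show "ff j i (u \<oplus>\<^bsub>C\<^esub> v) = ff j i u \<oplus>\<^bsub>C\<^esub> ff j i v" if "u \<in> TI j" "v \<in> TI j" for u v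
      unfolding by' using fa[OF i' TI_in[OF that(1)] TI_in[OF that(2)]] .
    show "ff j i (d \<otimes>\<^bsub>C\<^esub> u) = d \<otimes>\<^bsub>C\<^esub> ff j i u" if "d \<in> DD j" "u \<in> TI j" for d u
      unfolding by' using ff_mult[OF j i' that(1) TI_in[OF that(2)]] .
  next
    fix u assume u: "u \<in> TI j"
    show "finite {i \<in> LL j. ff j i u \<noteq> \<zero>\<^bsub>C\<^esub>}" using fin[OF TI_in[OF u]] .
    show "u \<ominus>\<^bsub>C\<^esub> finsum C (\<lambda>i. ff j i u \<otimes>\<^bsub>C\<^esub> qq j i) {i \<in> LL j. ff j i u \<noteq> \<zero>\<^bsub>C\<^esub>} \<in> TI (Suc j)" by (rule sum[OF u])
  qed
qed

end

section \<open>Multiplication maps of ideals with a dual basis\<close>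

text \<open>The situation after the smaller ideal has been divided out, so that the expansion in the
  \<open>q i\<close> holds exactly.\<close>

locale dual_basis_algebra = field K + V: left_module K D + D: ring D
  for K :: "'k ring" and D :: "('k, 'r) module" (structure) +
  fixes e :: 'r and D1 :: "'r set" and L :: "'i set" and q :: "'i \<Rightarrow> 'r" and f :: "'i \<Rightarrow> 'r \<Rightarrow> 'r"
  assumes smult_left: "\<And>k x y. k \<in> carrier K \<Longrightarrow> x \<in> carrier D \<Longrightarrow> y \<in> carrier D \<Longrightarrow> (k \<odot> x) \<otimes> y = k \<odot> (x \<otimes> y)"
    and smult_right: "\<And>k x y. k \<in> carrier K \<Longrightarrow> x \<in> carrier D \<Longrightarrow> y \<in> carrier D \<Longrightarrow> x \<otimes> (k \<odot> y) = k \<odot> (x \<otimes> y)"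
    and e: "e \<in> carrier D" "e \<otimes> e = e"
    and D1: "D1 \<subseteq> carrier D" "e \<in> D1"
    and q: "\<And>i. i \<in> L \<Longrightarrow> q i \<in> carrier D" "\<And>i. i \<in> L \<Longrightarrow> e \<otimes> q i = q i"
    and f_in: "\<And>i u. i \<in> L \<Longrightarrow> u \<in> two_sided D e \<Longrightarrow> f i u \<in> D1"
    and f_add: "\<And>i u v. i \<in> L \<Longrightarrow> u \<in> two_sided D e \<Longrightarrow> v \<in> two_sided D e \<Longrightarrow> f i (u \<oplus> v) = f i u \<oplus> f i v"
    and f_mult: "\<And>i p u. i \<in> L \<Longrightarrow> p \<in> D1 \<Longrightarrow> u \<in> two_sided D e \<Longrightarrow> f i (p \<otimes> u) = p \<otimes> f i u"
    and f_finite: "\<And>u. u \<in> two_sided D e \<Longrightarrow> finite {i \<in> L. f i u \<noteq> \<zero>}"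
    and f_sum: "\<And>u. u \<in> two_sided D e \<Longrightarrow> finsum D (\<lambda>i. f i u \<otimes> q i) {i \<in> L. f i u \<noteq> \<zero>} = u"
begin

definition "De = {x \<otimes> e | x. x \<in> carrier D}"
definition "eD = {e \<otimes> x | x. x \<in> carrier D}"
definition "eDe = {e \<otimes> x \<otimes> e | x. x \<in> carrier D}"
definition "DeD = two_sided D e"
definition "M = D\<lparr>carrier := De\<rparr>"
definition "N = D\<lparr>carrier := eD\<rparr>"
definition "B = D\<lparr>carrier := DeD\<rparr>"

lemma De_iff: "x \<in> De \<longleftrightarrow> x \<in> carrier D \<and> x \<otimes> e = x"
  unfolding De_def using e by (auto simp: D.m_assoc) metis
lemma eD_iff: "x \<in> eD \<longleftrightarrow> x \<in> carrier D \<and> e \<otimes> x = x"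
  unfolding eD_def using e by (auto simp flip: D.m_assoc) metis
lemma eDe_I: "x \<in> carrier D \<Longrightarrow> e \<otimes> x \<otimes> e \<in> eDe" unfolding eDe_def by blast
lemma eDe_in: "x \<in> eDe \<Longrightarrow> x \<in> carrier D" unfolding eDe_def using e by auto
lemma De_mult: "x \<in> De \<Longrightarrow> r \<in> eDe \<Longrightarrow> x \<otimes> r \<in> De"
  unfolding De_iff eDe_def using e by (auto simp: D.m_assoc)
lemma eD_mult: "y \<in> eD \<Longrightarrow> r \<in> eDe \<Longrightarrow> r \<otimes> y \<in> eD"
  unfolding eD_iff eDe_def using e by (auto simp flip: D.m_assoc)

lemma DeD_ideal: "ideal DeD D" unfolding DeD_def by (rule D.two_sided_ideal[OF e(1)])
lemmas DeD_in = idealD(2)[OF DeD_ideal]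

lemma e_DeD: "e \<in> DeD" unfolding DeD_def using D.two_sided_mem[OF e(1) e(1) e(1)] e by simp
lemma De_DeD: "x \<in> De \<Longrightarrow> x \<in> DeD" unfolding De_def using idealD(6)[OF DeD_ideal _ e_DeD] by auto
lemma eD_DeD: "x \<in> eD \<Longrightarrow> x \<in> DeD" unfolding eD_def using idealD(7)[OF DeD_ideal _ e_DeD] by auto

lemma De_sub: "left_submodule K D De"
  by (rule left_submoduleI) (use e in \<open>auto simp: De_iff D.l_distr smult_left V.smult_closed\<close>)
lemma eD_sub: "left_submodule K D eD"
  by (rule left_submoduleI) (use e in \<open>auto simp: eD_iff D.r_distr smult_right V.smult_closed\<close>)
lemma DeD_sub: "left_submodule K D DeD"
proof (rule left_submoduleI)
  fix k c assume k: "k \<in> carrier K" and c: "c \<in> DeD"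
  have "k \<odot> c = (k \<odot> \<one>) \<otimes> c" using smult_left[OF k D.one_closed DeD_in[OF c]] DeD_in[OF c] by simp
  then show "k \<odot> c \<in> DeD" using idealD(6)[OF DeD_ideal V.smult_closed[OF k D.one_closed] c] by simp
qed (use idealD[OF DeD_ideal] in auto)

lemma M_simps: "carrier M = De" "zero M = \<zero>" "add M = add D" "smult M = smult D" by (simp_all add: M_def)
lemma N_simps: "carrier N = eD" "zero N = \<zero>" "add N = add D" "smult N = smult D" by (simp_all add: N_def)
lemma B_simps: "carrier B = DeD" "zero B = \<zero>" "add B = add D" "smult B = smult D" by (simp_all add: B_def)

sublocale M: left_module K M unfolding M_def by (rule V.submodule_left_module[OF De_sub])
sublocale N: left_module K N unfolding N_def by (rule V.submodule_left_module[OF eD_sub])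
sublocale B: left_module K B unfolding B_def by (rule V.submodule_left_module[OF DeD_sub])
sublocale TP: tensor_pair K M N by unfold_locales
sublocale TK: kspace K "tensor K M N" by unfold_locales

definition "rels = {pure_tensor K M N (x \<otimes> r) y \<ominus>\<^bsub>tensor K M N\<^esub> pure_tensor K M N x (r \<otimes> y) | x r y.
        x \<in> carrier M \<and> r \<in> eDe \<and> y \<in> carrier N}"
definition "BT = balanced_tensor K eDe M (\<otimes>) N (\<otimes>)"
definition "bp = balanced_pure K eDe M (\<otimes>) N (\<otimes>)"

lemma rels_in: "rels \<subseteq> carrier (tensor K M N)"
  unfolding rels_def using TP.pt_in De_mult eD_mult by (auto simp: M_simps N_simps intro!: TP.T.M.minus_closed)

sublocale BQ: quot_mod K "tensor K M N" "lspan K (tensor K M N) rels"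
  by unfold_locales (rule TK.lspan_submodule[OF rels_in])

lemma BT_eq: "BT = BQ.Q" unfolding BT_def balanced_tensor_def balanced_null_def rels_def ..
lemma bp_eq: "bp x y = BQ.cls (TP.pt x y)" unfolding bp_def balanced_pure_def balanced_null_def rels_def ..

sublocale BT: left_module K BT unfolding BT_eq by (rule BQ.quot_left_module)
sublocale NT: module_hom_pair K N BT by unfold_locales
sublocale MT: module_hom_pair K M BT by unfold_locales
sublocale TB: module_hom_pair K BT B by unfold_locales

lemma bp_left: "y \<in> eD \<Longrightarrow> (\<lambda>x. bp x y) \<in> module_hom K M BT"
  unfolding bp_eq BT_eq by (rule module_hom_comp[OF TP.pt_left_hom BQ.cls_hom]) (simp add: N_simps)
lemma bp_right: "x \<in> De \<Longrightarrow> (\<lambda>y. bp x y) \<in> module_hom K N BT"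
  unfolding bp_eq BT_eq by (rule module_hom_comp[OF TP.pt_right_hom BQ.cls_hom]) (simp add: M_simps)

lemma bp_in: "x \<in> De \<Longrightarrow> y \<in> eD \<Longrightarrow> bp x y \<in> carrier BT"
  using module_hom_in[OF bp_left] by (simp add: M_simps)

lemma bp_balanced:
  assumes "x \<in> De" "r \<in> eDe" "y \<in> eD"
  shows "bp (x \<otimes> r) y = bp x (r \<otimes> y)"
proof -
  have "TP.pt (x \<otimes> r) y \<ominus>\<^bsub>tensor K M N\<^esub> TP.pt x (r \<otimes> y) \<in> rels" unfolding rels_def using assms M_simps N_simps by auto
  then have "TP.pt (x \<otimes> r) y \<ominus>\<^bsub>tensor K M N\<^esub> TP.pt x (r \<otimes> y) \<in> lspan K (tensor K M N) rels"
    by (rule TK.lspan_incl[OF rels_in])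
  then show ?thesis unfolding bp_eq
    using BQ.cls_eq TP.pt_in assms De_mult eD_mult by (simp add: M_simps N_simps)
qed

lemmas finsum_N = V.finsum_submodule[OF eD_sub, folded N_def]
  and finsum_M = V.finsum_submodule[OF De_sub, folded M_def]
  and finsum_B = V.finsum_submodule[OF DeD_sub, folded B_def]

lemmas f_in' = f_in[folded DeD_def] and f_add' = f_add[folded DeD_def] and f_mult' = f_mult[folded DeD_def]
  and f_finite' = f_finite[folded DeD_def] and f_sum' = f_sum[folded DeD_def]

lemma f_D: "i \<in> L \<Longrightarrow> u \<in> DeD \<Longrightarrow> f i u \<in> carrier D" using f_in' D1 by blast

lemma f_e: "i \<in> L \<Longrightarrow> u \<in> DeD \<Longrightarrow> f i u \<otimes> e \<in> De"
  using f_D e unfolding De_def by blast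

lemma q_eD: "i \<in> L \<Longrightarrow> q i \<in> eD" using q by (simp add: eD_iff)

lemma f_zero: assumes i: "i \<in> L" shows "f i \<zero> = \<zero>"
proof -
  have z: "\<zero> \<in> DeD" by (rule idealD(3)[OF DeD_ideal])
  have "f i \<zero> \<oplus> f i \<zero> = f i \<zero>" using f_add'[OF i z z] by simp
  then show ?thesis using f_D[OF i z] by (metis V.M.add.r_cancel_one)
qed

section \<open>The inverse of the multiplication map\<close>

definition supp where "supp u = {i \<in> L. f i u \<noteq> \<zero>}"
definition H where "H u = finsum BT (\<lambda>i. bp (f i u \<otimes> e) (q i)) (supp u)"

lemma H_superset:
  assumes u: "u \<in> DeD" and F: "finite F" "supp u \<subseteq> F" "F \<subseteq> L"
  shows "H u = finsum BT (\<lambda>i. bp (f i u \<otimes> e) (q i)) F"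
  unfolding H_def
proof (rule BT.M.finsum_support[OF F(1) _ F(2)])
  fix i assume "i \<in> F"
  then show "bp (f i u \<otimes> e) (q i) \<in> carrier BT" using bp_in f_e[OF _ u] q_eD F by blast
next
  fix i assume i: "i \<in> F - supp u"
  then have "f i u = \<zero>" "i \<in> L" using F by (auto simp: supp_def)
  then show "bp (f i u \<otimes> e) (q i) = \<zero>\<^bsub>BT\<^esub>"
    using MT.hom_zero[OF bp_left[OF q_eD]] e by (simp add: M_simps)
qed

lemma supp: "u \<in> DeD \<Longrightarrow> finite (supp u)" "supp u \<subseteq> L"
  unfolding supp_def using f_finite' by auto

lemma H_in: "u \<in> DeD \<Longrightarrow> H u \<in> carrier BT"
  unfolding H_def using supp(2) bp_in f_e q_eD by (intro BT.M.finsum_closed) blast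

lemma H_add:
  assumes u: "u \<in> DeD" and v: "v \<in> DeD"
  shows "H (u \<oplus> v) = H u \<oplus>\<^bsub>BT\<^esub> H v"
proof -
  let ?F = "supp u \<union> supp v"
  have uv: "u \<oplus> v \<in> DeD" using idealD(4)[OF DeD_ideal u v] .
  have F: "finite ?F" "?F \<subseteq> L" using supp u v by auto
  have "supp (u \<oplus> v) \<subseteq> ?F" unfolding supp_def using f_add'[OF _ u v] by auto
  then have "H (u \<oplus> v) = finsum BT (\<lambda>i. bp (f i (u \<oplus> v) \<otimes> e) (q i)) ?F"
    by (rule H_superset[OF uv F(1) _ F(2)])
  also have "\<dots> = finsum BT (\<lambda>i. bp (f i u \<otimes> e) (q i) \<oplus>\<^bsub>BT\<^esub> bp (f i v \<otimes> e) (q i)) ?F"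
  proof (rule BT.M.finsum_cong', goal_cases)
    case 2
    show ?case using F bp_in f_e q_eD u v by (intro Pi_I BT.M.a_closed) blast+
  next
    case (3 i)
    then have i: "i \<in> L" using F by blast
    have "f i (u \<oplus> v) \<otimes> e = f i u \<otimes> e \<oplus> f i v \<otimes> e"
      using f_add'[OF i u v] f_D[OF i] u v e by (simp add: D.l_distr)
    then show ?case using module_hom_add[OF bp_left[OF q_eD[OF i]]] f_e[OF i] u v by (simp add: M_simps)
  qed simp
  also have "\<dots> = finsum BT (\<lambda>i. bp (f i u \<otimes> e) (q i)) ?F \<oplus>\<^bsub>BT\<^esub> finsum BT (\<lambda>i. bp (f i v \<otimes> e) (q i)) ?F"
    using F bp_in f_e q_eD u v by (intro BT.M.finsum_addf Pi_I) blast+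
  finally show ?thesis using H_superset[OF u F(1) _ F(2)] H_superset[OF v F(1) _ F(2)] by simp
qed

lemma H_zero: "H \<zero> = \<zero>\<^bsub>BT\<^esub>"
  using H_superset[OF idealD(3)[OF DeD_ideal], of "{}"] f_zero by (auto simp: supp_def)

lemma H_finsum:
  assumes "finite F"
  shows "(\<And>i. i \<in> F \<Longrightarrow> g i \<in> DeD) \<Longrightarrow> H (finsum D g F) = finsum BT (\<lambda>i. H (g i)) F"
  using assms
proof (induction F)
  case empty
  then show ?case by (simp add: H_zero)
next
  case (insert i F)
  have g: "g i \<in> DeD" "\<And>k. k \<in> F \<Longrightarrow> g k \<in> DeD" using insert.prems by auto
  have s: "finsum D g F \<in> DeD" by (rule V.submodule_finsum[OF DeD_sub g(2)])
  have gD: "g \<in> F \<rightarrow> carrier D" and hT: "(\<lambda>i. H (g i)) \<in> F \<rightarrow> carrier BT" using g DeD_in H_in by auto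
  have "H (finsum D g (insert i F)) = H (g i) \<oplus>\<^bsub>BT\<^esub> H (finsum D g F)"
    unfolding V.M.finsum_insert[OF insert.hyps gD DeD_in[OF g(1)]] by (rule H_add[OF g(1) s])
  also have "\<dots> = finsum BT (\<lambda>i. H (g i)) (insert i F)"
    using insert.IH[OF g(2)] BT.M.finsum_insert[OF insert.hyps hT H_in[OF g(1)]] by simp
  finally show ?case .
qed

text \<open>For a left factor in \<open>D1\<close> the linearity of the \<open>f i\<close> applies,
  and the coordinates \<open>f i v = e \<otimes> f i v\<close> can be carried across the tensor
  sign, where they reassemble \<open>v\<close>.\<close>

lemma H_mult:
  assumes p: "p \<in> D1" and v: "v \<in> eD"
  shows "H (p \<otimes> v) = bp (p \<otimes> e) v"
proof -
  have pD: "p \<in> carrier D" using p D1 by blast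
  have vV: "v \<in> DeD" by (rule eD_DeD[OF v])
  have vD: "v \<in> carrier D" "e \<otimes> v = v" using v by (auto simp: eD_iff)
  have pv: "p \<otimes> v \<in> DeD" using idealD(6)[OF DeD_ideal pD vV] .
  have pe: "p \<otimes> e \<in> De" using pD by (auto simp: De_def)
  let ?F = "supp v"
  have fv: "f i v \<in> carrier D" "e \<otimes> f i v = f i v" if i: "i \<in> L" for i
    using f_D[OF i vV] f_mult'[OF i D1(2) vV] vD by auto
  have t: "f i v \<otimes> q i \<in> eD" if i: "i \<in> L" for i
    using fv[OF i] q[OF i] e by (simp add: eD_iff flip: D.m_assoc)
  have "supp (p \<otimes> v) \<subseteq> ?F" unfolding supp_def using f_mult'[OF _ p vV] pD by auto
  then have "H (p \<otimes> v) = finsum BT (\<lambda>i. bp (f i (p \<otimes> v) \<otimes> e) (q i)) ?F"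
    using H_superset[OF pv supp(1)[OF vV] _ supp(2)] by blast
  also have "\<dots> = finsum BT (\<lambda>i. bp (p \<otimes> e) (f i v \<otimes> q i)) ?F"
  proof (rule BT.M.finsum_cong', goal_cases)
    case 2
    show ?case using supp(2) bp_in[OF pe t] by blast
  next
    case (3 i)
    then have i: "i \<in> L" using supp(2) by blast
    \<comment> \<open>Only elements of \<open>eDe\<close> may be carried across. The
      \<open>e\<close> added on the right is absorbed by \<open>q i\<close>, the one on the left by
      \<open>f i v\<close>.\<close>
    let ?r = "e \<otimes> f i v \<otimes> e"
    have r: "?r \<in> eDe" by (rule eDe_I[OF fv(1)[OF i]])
    have "f i (p \<otimes> v) \<otimes> e = p \<otimes> (e \<otimes> f i v) \<otimes> e" using f_mult'[OF i p vV] fv[OF i] by simp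
    also have "\<dots> = p \<otimes> ((e \<otimes> e) \<otimes> f i v) \<otimes> e" using e by simp
    also have "\<dots> = (p \<otimes> e) \<otimes> ?r" using e(1) pD fv(1)[OF i] by (simp add: D.m_assoc)
    finally have "bp (f i (p \<otimes> v) \<otimes> e) (q i) = bp (p \<otimes> e) (?r \<otimes> q i)"
      using bp_balanced[OF pe r q_eD[OF i]] by simp
    also have "?r \<otimes> q i = f i v \<otimes> q i" using fv[OF i] q[OF i] e by (simp add: D.m_assoc)
    finally show ?case .
  qed simp
  also have "\<dots> = bp (p \<otimes> e) (finsum N (\<lambda>i. f i v \<otimes> q i) ?F)"
    by (rule NT.hom_finsum[OF bp_right[OF pe], symmetric]) (use supp(2) t N_simps in blast)
  also have "finsum N (\<lambda>i. f i v \<otimes> q i) ?F = finsum D (\<lambda>i. f i v \<otimes> q i) ?F"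
    by (rule finsum_N) (use supp(2) t in blast)
  also have "\<dots> = v" using f_sum'[OF vV] by (simp add: supp_def)
  finally show ?thesis .
qed

text \<open>An element \<open>x\<close> of \<open>De\<close> need not lie in \<open>D1\<close>, so
  it is expanded as the sum of the \<open>f i x \<otimes> q i\<close>. Now \<open>f i x\<close> lies
  in \<open>D1\<close> and \<open>q i \<otimes> y\<close> in \<open>eD\<close>, so
  \<open>H_mult\<close> applies to each term; carrying \<open>e \<otimes> q i \<otimes> e\<close>
  back to the left reassembles \<open>x\<close>.\<close>

lemma H_pure:
  assumes x: "x \<in> De" and y: "y \<in> eD"
  shows "H (x \<otimes> y) = bp x y"
proof -
  have xV: "x \<in> DeD" by (rule De_DeD[OF x])
  have xD: "x \<in> carrier D" "x \<otimes> e = x" and yD: "y \<in> carrier D" "e \<otimes> y = y" using x y by (auto simp: De_iff eD_iff)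
  let ?F = "supp x" and ?g = "\<lambda>i. f i x \<otimes> q i"
  have F: "finite ?F" "?F \<subseteq> L" using supp xV by auto
  have xs: "finsum D ?g ?F = x" using f_sum'[OF xV] by (simp add: supp_def)
  have gD: "?g \<in> ?F \<rightarrow> carrier D" using F f_D[OF _ xV] q by auto
  have qy: "q i \<otimes> y \<in> eD" if "i \<in> L" for i using q[OF that] yD e by (simp add: eD_iff flip: D.m_assoc)
  have t: "?g i \<otimes> e \<in> De" if "i \<in> L" for i using f_D[OF that xV] q[OF that] e by (auto simp: De_def)
  have "x \<otimes> y = finsum D (\<lambda>i. ?g i \<otimes> y) ?F" using D.finsum_ldistr[OF F(1) yD(1) gD] xs by simp
  also have "\<dots> = finsum D (\<lambda>i. f i x \<otimes> (q i \<otimes> y)) ?F"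
    by (rule V.M.finsum_cong') (use F f_D[OF _ xV] q yD in \<open>auto simp: D.m_assoc subset_eq\<close>)
  finally have "H (x \<otimes> y) = finsum BT (\<lambda>i. H (f i x \<otimes> (q i \<otimes> y))) ?F"
    using H_finsum[OF F(1), of "\<lambda>i. f i x \<otimes> (q i \<otimes> y)"] idealD(6)[OF DeD_ideal f_D[OF _ xV] eD_DeD[OF qy]] F(2) by (simp add: subset_eq)
  also have "\<dots> = finsum BT (\<lambda>i. bp (?g i \<otimes> e) y) ?F"
  proof (rule BT.M.finsum_cong', goal_cases)
    case 2
    show ?case using F bp_in[OF t y] by blast
  next
    case (3 i)
    then have i: "i \<in> L" using F by blast
    let ?r = "e \<otimes> q i \<otimes> e"
    have r: "?r \<in> eDe" by (rule eDe_I[OF q(1)[OF i]])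
    have "?r \<otimes> y = q i \<otimes> y" using q[OF i] yD e by (simp add: D.m_assoc)
    then have "H (f i x \<otimes> (q i \<otimes> y)) = bp (f i x \<otimes> e) (?r \<otimes> y)"
      using H_mult[OF f_in'[OF i xV] qy[OF i]] by simp
    also have "\<dots> = bp (f i x \<otimes> e \<otimes> ?r) y" using bp_balanced[OF f_e[OF i xV] r y] by simp
    also have "f i x \<otimes> e \<otimes> ?r = f i x \<otimes> (e \<otimes> (e \<otimes> q i)) \<otimes> e"
      using f_D[OF i xV] e(1) q(1)[OF i] by (simp add: D.m_assoc)
    also have "\<dots> = ?g i \<otimes> e" using q[OF i] by simp
    finally show ?case .
  qed simp
  also have "\<dots> = bp (finsum M (\<lambda>i. ?g i \<otimes> e) ?F) y"
    by (rule MT.hom_finsum[OF bp_left[OF y], symmetric]) (use F t M_simps in blast)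
  also have "finsum M (\<lambda>i. ?g i \<otimes> e) ?F = finsum D (\<lambda>i. ?g i \<otimes> e) ?F"
    by (rule finsum_M) (use F t in blast)
  also have "\<dots> = x" using D.finsum_ldistr[OF F(1) e(1) gD] xs xD by simp
  finally show ?thesis .
qed

theorem mult_map_iso: "mult_map_iso K D e"
proof -
  have DeD_mult: "x \<otimes> y \<in> DeD" if "x \<in> De" "y \<in> eD" for x y
    using idealD(7)[OF DeD_ideal _ De_DeD[OF that(1)]] that(2) by (auto simp: eD_iff)
  have "\<exists>g\<in>module_hom K (tensor K M N) B. \<forall>x\<in>carrier M. \<forall>y\<in>carrier N. g (TP.pt x y) = x \<otimes> y"
    by (rule TP.tensor_lift[OF B.left_module_axioms])
       (rule module_homI; auto simp: M_simps N_simps B_simps DeD_mult De_iff eD_iff D.l_distr D.r_distr smult_left smult_right)+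
  then obtain g where g: "g \<in> module_hom K (tensor K M N) B" "\<And>x y. x \<in> De \<Longrightarrow> y \<in> eD \<Longrightarrow> g (TP.pt x y) = x \<otimes> y"
    by (auto simp: M_simps N_simps)
  interpret TM: module_hom_pair K "tensor K M N" B by unfold_locales
  have "left_submodule K (tensor K M N) {t \<in> carrier (tensor K M N). g t = \<zero>\<^bsub>B\<^esub>}"
    by (rule left_submoduleI)
       (auto simp: TM.hom_zero[OF g(1)] module_hom_add[OF g(1)] module_hom_smult[OF g(1)] TP.T.smult_closed)
  moreover have "rels \<subseteq> {t \<in> carrier (tensor K M N). g t = \<zero>\<^bsub>B\<^esub>}"
  proof
    fix t assume tr: "t \<in> rels"
    then obtain x r y where t: "t = TP.pt (x \<otimes> r) y \<ominus>\<^bsub>tensor K M N\<^esub> TP.pt x (r \<otimes> y)" and xry: "x \<in> De" "r \<in> eDe" "y \<in> eD"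
      unfolding rels_def by (auto simp: M_simps N_simps)
    have "TP.pt (x \<otimes> r) y \<in> carrier (tensor K M N)" "TP.pt x (r \<otimes> y) \<in> carrier (tensor K M N)"
      using TP.pt_in xry De_mult eD_mult by (simp_all add: M_simps N_simps)
    then have "g t = g (TP.pt (x \<otimes> r) y) \<ominus>\<^bsub>B\<^esub> g (TP.pt x (r \<otimes> y))"
      unfolding t by (rule TM.hom_diff[OF g(1)])
    also have "g (TP.pt (x \<otimes> r) y) = x \<otimes> r \<otimes> y" using g(2) De_mult xry by simp
    also have "g (TP.pt x (r \<otimes> y)) = x \<otimes> r \<otimes> y"
      using g(2)[OF xry(1) eD_mult[OF xry(3,2)]] xry eDe_in by (simp add: De_iff eD_iff D.m_assoc)
    also have "x \<otimes> r \<otimes> y \<ominus>\<^bsub>B\<^esub> x \<otimes> r \<otimes> y = \<zero>\<^bsub>B\<^esub>"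
      unfolding a_minus_def by (rule B.M.r_neg) (use DeD_mult[OF De_mult[OF xry(1,2)] xry(3)] B_simps in simp)
    finally show "t \<in> {t \<in> carrier (tensor K M N). g t = \<zero>\<^bsub>B\<^esub>}" using rels_in tr by blast
  qed
  ultimately have "lspan K (tensor K M N) rels \<subseteq> {t \<in> carrier (tensor K M N). g t = \<zero>\<^bsub>B\<^esub>}"
    using TK.lspan_minimal by blast
  then have g0: "g t = \<zero>\<^bsub>B\<^esub>" if "t \<in> lspan K (tensor K M N) rels" for t using that by blast
  obtain h where h: "h \<in> module_hom K BQ.Q B" "\<And>t. t \<in> carrier (tensor K M N) \<Longrightarrow> h (BQ.cls t) = g t"
    using BQ.quot_lift[OF B.left_module_axioms g(1) g0] by blast
  have hh: "h \<in> module_hom K BT B" using h(1) BT_eq by simp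
  have hb: "h (bp x y) = x \<otimes> y" if "x \<in> De" "y \<in> eD" for x y
    unfolding bp_eq using h(2)[OF TP.pt_in] g(2) that by (simp add: M_simps N_simps)
  have hH: "h (H u) = u" if u: "u \<in> DeD" for u
  proof -
    have "h (H u) = finsum B (\<lambda>i. h (bp (f i u \<otimes> e) (q i))) (supp u)"
      unfolding H_def by (rule TB.hom_finsum[OF hh]) (use supp(2) bp_in f_e[OF _ u] q_eD in blast)
    also have "\<dots> = finsum D (\<lambda>i. h (bp (f i u \<otimes> e) (q i))) (supp u)"
    proof (rule finsum_B)
      fix i assume "i \<in> supp u"
      then have i: "i \<in> L" using supp(2) by blast
      show "h (bp (f i u \<otimes> e) (q i)) \<in> DeD"
        unfolding hb[OF f_e[OF i u] q_eD[OF i]] by (rule DeD_mult[OF f_e[OF i u] q_eD[OF i]])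
    qed
    also have "\<dots> = finsum D (\<lambda>i. f i u \<otimes> q i) (supp u)"
    proof (rule V.M.finsum_cong', goal_cases)
      case (3 i)
      then have i: "i \<in> L" using supp(2) by blast
      show ?case using hb[OF f_e[OF i u] q_eD[OF i]] f_D[OF i u] q[OF i] e by (simp add: D.m_assoc)
    qed (use supp(2)[of u] f_D[OF _ u] q in \<open>auto simp: subset_eq\<close>)
    also have "\<dots> = u" using f_sum'[OF u] by (simp add: supp_def)
    finally show ?thesis .
  qed
  have Hh: "H (h t) = t" if t: "t \<in> carrier BT" for t
  proof -
    obtain s where s: "s \<in> carrier (tensor K M N)" "t = BQ.cls s" using t unfolding BT_eq BQ.quot_carrier by blast
    have "H (h (BQ.cls s)) = BQ.cls s" using s(1)
    proof (induction rule: TP.tensor_induct)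
      case (pure x y)
      then show ?case using hb[of x y] H_pure[of x y] by (simp add: M_simps N_simps flip: bp_eq)
    next
      case (add x y)
      have c: "BQ.cls x \<in> carrier BT" "BQ.cls y \<in> carrier BT" using BQ.cls_in add(1,2) BT_eq by auto
      have a: "BQ.cls (x \<oplus>\<^bsub>tensor K M N\<^esub> y) = BQ.cls x \<oplus>\<^bsub>BT\<^esub> BQ.cls y" using BQ.cls_add[OF add(1,2)] BT_eq by simp
      have "h (BQ.cls x) \<in> DeD" "h (BQ.cls y) \<in> DeD" using module_hom_in[OF hh] c B_simps by auto
      then show ?case unfolding a using module_hom_add[OF hh c] H_add add(3,4) by (simp add: B_simps)
    qed
    then show ?thesis using s by simp
  qed
  have "bij_betw h (carrier BT) DeD"
    by (rule bij_betw_byWitness[of _ H]) (use hH Hh H_in module_hom_in[OF hh] B_simps in auto)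
  then show ?thesis using hh hb
    unfolding mult_map_iso_def Let_def De_def[symmetric] eD_def[symmetric] eDe_def[symmetric] DeD_def[symmetric]
      M_def[symmetric] N_def[symmetric] B_def[symmetric] BT_def[symmetric] bp_def[symmetric] by blast
qed

end

text \<open>The functionals are additive and map \<open>U\<close> into \<open>U\<close>, so they
  descend to the quotient by \<open>U\<close>, where the congruence of the heredity step becomes an
  equation.\<close>

lemma mult_map_iso_quot:
  fixes K :: "'k ring" and C :: "('k, 'r) module"
  assumes C: "kalgebra K C" and U: "left_submodule K C U"
    and V: "V = two_sided C e" and ee: "e \<otimes>\<^bsub>C\<^esub> e = e"
    and hs: "heredity_step C U V e D L q f"
  shows "mult_map_iso K (quot_module C U) (U +>\<^bsub>C\<^esub> e)"
proof -

  have CK: "field K" "left_module K C" using C vectorspace_iff unfolding kalgebra_def by blast+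
  interpret field K by (rule CK(1))
  interpret CQ: quot_mod K C U by (intro quot_mod.intro quot_mod_axioms.intro CK(2) U)
  interpret ip: ideal_pair C U V e D using hs by (simp add: heredity_step_def)
  note hs' = hs[unfolded heredity_step_def]
  note UI = idealD[OF ip.U] and VI = idealD[OF ip.V]
  let ?Q = "quot_module C U" and ?c = "\<lambda>x. U +>\<^bsub>C\<^esub> x"
  note Q = quot_ring[OF ip.U]
  interpret h: ring_hom_ring C ?Q ?c by (rule Q(2))
  have eC: "e \<in> carrier C" using VI(2)[OF ip.eV] .
  have VQ: "two_sided ?Q (?c e) = ?c ` V"
    unfolding V by (rule two_sided_image[OF Q(2,3) eC, symmetric])
  have fD: "f i u \<in> D" if "i \<in> L" "u \<in> V" for i u using hs' that by blast
  have fC: "f i u \<in> carrier C" if "i \<in> L" "u \<in> V" for i u using fD[OF that] ip.D by blast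
  have fU: "f i u \<in> U" if "i \<in> L" "u \<in> U" for i u using hs' that by blast
  have fadd: "f i (u \<oplus>\<^bsub>C\<^esub> v) = f i u \<oplus>\<^bsub>C\<^esub> f i v" if "i \<in> L" "u \<in> V" "v \<in> V" for i u v using hs' that by blast
  have fmul: "f i (b \<otimes>\<^bsub>C\<^esub> u) = b \<otimes>\<^bsub>C\<^esub> f i u" if "i \<in> L" "b \<in> D" "u \<in> V" for i b u using hs' that by blast
  have q: "q i \<in> carrier C" "e \<otimes>\<^bsub>C\<^esub> q i = q i" if "i \<in> L" for i using hs' that by blast+
  define g where "g i X = ?c (f i (SOME u. u \<in> V \<and> ?c u = X))" for i X
  have g: "g i (?c u) = ?c (f i u)" if i: "i \<in> L" and u: "u \<in> V" for i u
  proof -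
    define v where "v = (SOME v. v \<in> V \<and> ?c v = ?c u)"
    have v: "v \<in> V" "?c v = ?c u" using someI[of "\<lambda>v. v \<in> V \<and> ?c v = ?c u" u] u by (auto simp: v_def)
    have vu: "v \<ominus>\<^bsub>C\<^esub> u \<in> U" using v u VI(2) CQ.cls_eq by blast
    have "v = (v \<ominus>\<^bsub>C\<^esub> u) \<oplus>\<^bsub>C\<^esub> u" using v u VI(2) by (simp add: a_minus_def CQ.M.a_assoc CQ.M.l_neg)
    then have "f i v = f i (v \<ominus>\<^bsub>C\<^esub> u) \<oplus>\<^bsub>C\<^esub> f i u" using fadd[OF i _ u, of "v \<ominus>\<^bsub>C\<^esub> u"] vu ip.UV by auto
    then have "?c (f i v) = ?c (f i (v \<ominus>\<^bsub>C\<^esub> u)) \<oplus>\<^bsub>?Q\<^esub> ?c (f i u)"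
      using CQ.cls_add fU[OF i vu] UI(2) fC[OF i u] by simp
    also have "?c (f i (v \<ominus>\<^bsub>C\<^esub> u)) = \<zero>\<^bsub>?Q\<^esub>" using CQ.cls_eq_zero fU[OF i vu] UI(2) by blast
    finally show ?thesis unfolding g_def v_def[symmetric] using CQ.cls_in[OF fC[OF i u]] by simp
  qed
  have sum: "finite {i \<in> L. g i X \<noteq> \<zero>\<^bsub>?Q\<^esub>} \<and> finsum ?Q (\<lambda>i. g i X \<otimes>\<^bsub>?Q\<^esub> ?c (q i)) {i \<in> L. g i X \<noteq> \<zero>\<^bsub>?Q\<^esub>} = X"
    if X: "X \<in> two_sided ?Q (?c e)" for X
  proof -
    obtain u where u: "u \<in> V" "X = ?c u" using X unfolding VQ by blast
    let ?F = "{i \<in> L. f i u \<noteq> \<zero>\<^bsub>C\<^esub>}" and ?F' = "{i \<in> L. g i X \<noteq> \<zero>\<^bsub>?Q\<^esub>}" and ?s = "\<lambda>i. f i u \<otimes>\<^bsub>C\<^esub> q i"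
    have F: "finite ?F" and us: "u \<ominus>\<^bsub>C\<^esub> finsum C ?s ?F \<in> U" using hs' u(1) by blast+
    have sC: "?s i \<in> carrier C" if "i \<in> ?F" for i using that fC[OF _ u(1)] q by simp
    have s: "finsum C ?s ?F \<in> carrier C" using sC by (intro CQ.M.finsum_closed) blast
    have t: "g i X \<otimes>\<^bsub>?Q\<^esub> ?c (q i) = ?c (?s i)" if "i \<in> L" for i
      using g[OF that u(1)] u(2) fC[OF that u(1)] q(1)[OF that] by simp
    \<comment> \<open>Passing to classes may kill coordinates, so the support can shrink; the terms
      lost are zero.\<close>
    have sub: "?F' \<subseteq> ?F" using g[OF _ u(1)] u(2) CQ.cls_zero by auto
    have "X = ?c (finsum C ?s ?F)" using CQ.cls_eq[OF VI(2)[OF u(1)] s] us u(2) by simp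
    also have "\<dots> = finsum ?Q (\<lambda>i. ?c (?s i)) ?F" by (rule CQ.cls_finsum[OF sC])
    also have "\<dots> = finsum ?Q (\<lambda>i. g i X \<otimes>\<^bsub>?Q\<^esub> ?c (q i)) ?F"
      by (rule CQ.Q.M.finsum_cong') (use t sC CQ.cls_in in auto)
    also have "\<dots> = finsum ?Q (\<lambda>i. g i X \<otimes>\<^bsub>?Q\<^esub> ?c (q i)) ?F'"
    proof (rule CQ.Q.M.finsum_support[OF F _ sub, symmetric])
      fix i assume "i \<in> ?F"
      then show "g i X \<otimes>\<^bsub>?Q\<^esub> ?c (q i) \<in> carrier ?Q" using t sC CQ.cls_in by auto
    next
      fix i assume "i \<in> ?F - ?F'"
      then show "g i X \<otimes>\<^bsub>?Q\<^esub> ?c (q i) = \<zero>\<^bsub>?Q\<^esub>" using CQ.cls_in q(1) by auto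
    qed
    finally show ?thesis using finite_subset[OF sub F] by simp
  qed
  have "dual_basis_algebra K ?Q (?c e) (?c ` D) L (\<lambda>i. ?c (q i)) g"
  proof (intro dual_basis_algebra.intro dual_basis_algebra_axioms.intro CK(1) CQ.quot_left_module Q(1), goal_cases)
    case (1 k x y)
    then show ?case by (auto simp: CQ.quot_carrier CQ.cls_smult CQ.smult_closed kalgebra.smult_mult_left[OF C] simp flip: h.hom_mult)
  next
    case (2 k x y)
    then show ?case by (auto simp: CQ.quot_carrier CQ.cls_smult CQ.smult_closed kalgebra.smult_mult_right[OF C] simp flip: h.hom_mult)
  next
    case 3 show ?case using CQ.cls_in[OF eC] .
  next
    case 4 show ?case using h.hom_mult[OF eC eC] ee by simp
  next
    case 5 show ?case using CQ.cls_in ip.D by blast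
  next
    case 6 show ?case using ip.eD by blast
  next
    case (7 i) then show ?case using CQ.cls_in q by blast
  next
    case (8 i) then show ?case using h.hom_mult[OF eC q(1)] q(2) by simp
  next
    case (9 i u) then show ?case unfolding VQ using g fD by auto
  next
    case (10 i u v)
    then obtain u' v' where uv: "u = ?c u'" "v = ?c v'" "u' \<in> V" "v' \<in> V" unfolding VQ by blast
    note i = 10(1)
    have "u \<oplus>\<^bsub>?Q\<^esub> v = ?c (u' \<oplus>\<^bsub>C\<^esub> v')" using uv VI(2) CQ.cls_add by simp
    then have "g i (u \<oplus>\<^bsub>?Q\<^esub> v) = ?c (f i u' \<oplus>\<^bsub>C\<^esub> f i v')" using g[OF i VI(4)[OF uv(3,4)]] fadd[OF i uv(3,4)] by simp
    also have "\<dots> = g i u \<oplus>\<^bsub>?Q\<^esub> g i v"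
      unfolding uv g[OF i uv(3)] g[OF i uv(4)] by (rule CQ.cls_add[OF fC[OF i uv(3)] fC[OF i uv(4)], symmetric])
    finally show ?case .
  next
    case (11 i p u)
    then obtain u' p' where uv: "u = ?c u'" "u' \<in> V" "p = ?c p'" "p' \<in> D" unfolding VQ by blast
    then have "p' \<in> carrier C" using ip.D by blast
    then show ?case using uv g[OF 11(1)] fmul[OF 11(1)] VI(2,6) h.hom_mult fC[OF 11(1)] by (simp flip: h.hom_mult)
  next
    case (12 u) then show ?case using sum by blast
  next
    case (13 u) then show ?case using sum by blast
  qed
  then show ?thesis by (rule dual_basis_algebra.mult_map_iso)
qed

section \<open>The theorem\<close>

context convex_setup begin

lemma ch_idem: "ch j \<otimes>\<^bsub>C\<^esub> ch j = ch j"
proof -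
  have "ind (S - Y j) \<otimes>\<^bsub>B\<^esub> ind (S - Y j) = ind (S - Y j)"
    by (simp add: fun_eq_iff indicator_map_def)
  then show ?thesis using pt_ch[OF A.one_closed ind_in[of "S - Y j"], of j] unfolding ch_def by simp
qed

lemma trunc_eq: "trunc K G S act A gr (Y j) = quot_module C (TI j)"
  and trunc_class_eq: "trunc_class K G S act A gr (Y j) c = TI j +>\<^bsub>C\<^esub> c"
  by (simp_all add: trunc_def trunc_class_def trunc_ideal_def TI_def ch_def chi_def smash_elem_def)

lemma chi_eq: "chi K S A (S - Y j) = ch j"
  by (simp add: ch_def chi_def smash_elem_def)

lemma mult_map_iso_trunc:
  assumes j: "1 \<le> j" "Suc j \<le> m"
  shows "mult_map_iso K (quot_module C (TI (Suc j))) (TI (Suc j) +>\<^bsub>C\<^esub> ch j)"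
  by (rule mult_map_iso_quot[OF C_kalgebra TI_sub TI_def ch_idem heredity_step_TI[OF j]])

text \<open>Admitting any \<open>k \<le> j\<close> covers both claims of (c):
  \<open>k = j - 1\<close> for the first and, with \<open>j = m\<close>, \<open>k = 1\<close> for
  the second.\<close>

lemma strong_idempotent_trunc:
  assumes k: "1 \<le> k" "k \<le> j" and j: "j \<le> m"
  shows "strong_idempotent TYPE('m) TYPE('n) TYPE('p) TYPE('q)
    (two_sided (quot_module C (TI j)) (TI j +>\<^bsub>C\<^esub> ch k)) (quot_module C (TI j))"
proof -
  let ?R = "quot_module C (TI j)" and ?h = "\<lambda>c. TI j +>\<^bsub>C\<^esub> c"
  note Q = quot_ring[OF TI_ideal[of j]]
  interpret Q: quot_mod K C "TI j" by (rule quot_TI)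
  interpret R: ring ?R by (rule Q(1))
  have img: "two_sided ?R (?h (ch k)) = ?h ` TI k"
    unfolding TI_def[of k] by (rule two_sided_image[OF Q(2,3) ch_in, symmetric])
  have sub: "TI j \<subseteq> TI k" by (rule TI_mono[OF k j])
  \<comment> \<open>An ideal containing \<open>TI j\<close> is the full preimage of its image in the
    quotient.\<close>
  have Tl: "TI k = {c \<in> carrier C. ?h c \<in> ?h ` TI k}"
  proof (intro equalityI subsetI CollectI conjI)
    fix c assume "c \<in> {c \<in> carrier C. ?h c \<in> ?h ` TI k}"
    then obtain u where c: "c \<in> carrier C" and u: "u \<in> TI k" "?h c = ?h u" by blast
    then have "c \<ominus>\<^bsub>C\<^esub> u \<in> TI k" using Q.cls_eq[OF c TI_in] sub by blast
    moreover have "(c \<ominus>\<^bsub>C\<^esub> u) \<oplus>\<^bsub>C\<^esub> u = c" using c TI_in[OF u(1)] by (simp add: a_minus_def CM.M.a_assoc CM.M.l_neg)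
    ultimately show "c \<in> TI k" using idealD(4)[OF TI_ideal _ u(1), of "c \<ominus>\<^bsub>C\<^esub> u"] by simp
  qed (use TI_in in auto)
  have st: "heredity_step C (TI (j - t)) (TI (j - Suc t)) (ch (j - Suc t)) (DD (j - Suc t)) (LL (j - Suc t)) (qq (j - Suc t)) (ff (j - Suc t))"
    if "t < j - k" for t
  proof -
    have "Suc (j - Suc t) = j - t" using that by simp
    then show ?thesis using heredity_step_TI[of "j - Suc t"] that k j by simp
  qed
  show ?thesis
  \<comment> \<open>The chain ascends from \<open>TI j\<close> to \<open>TI k\<close>, while the
    index of \<open>TI\<close> descends. Its length \<open>j - k\<close> is zero for
    \<open>k = j\<close>, which happens in the last claim when \<open>m = 1\<close>.\<close>
  proof (rule strong_idempotentI[where l = "j - k" and T = "\<lambda>t. TI (j - t)", OF Q(2,3) _ _ _ _ st])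
    show "ideal (two_sided ?R (?h (ch k))) ?R" by (rule R.two_sided_ideal[OF Q.cls_in[OF ch_in]])
    show "TI (j - 0) = {c \<in> carrier C. ?h c = \<zero>\<^bsub>?R\<^esub>}" using Q.cls_eq_zero TI_in by auto
    show "TI (j - (j - k)) = {c \<in> carrier C. ?h c \<in> two_sided ?R (?h (ch k))}"
      unfolding img using Tl k by simp
  qed (rule TI_ideal)
qed

lemma basis_trunc:
  assumes j: "1 \<le> j" "j \<le> m"
  shows "vectorspace.basis K (quot_module C (TI j))
    {TI j +>\<^bsub>C\<^esub> pt (iprod A a 1 m) (ind {y}) | a y.
       (\<forall>k\<in>{1..m}. a k \<in> J k) \<and> y \<in> Y j \<and> (\<forall>k\<in>{1..m}. act (gr_degree G gr (iprod A a k m)) y \<in> Y j)}"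
    (is "vectorspace.basis K _ ?B")
proof -
  have "?B = {TI j +>\<^bsub>C\<^esub> pt (w a) (ind {y}) | a y. a \<in> Good j y}" (is "_ = ?B'")
  proof (intro equalityI subsetI)
    fix X assume "X \<in> ?B"
    then obtain a y where X: "X = TI j +>\<^bsub>C\<^esub> pt (iprod A a 1 m) (ind {y})" and a: "\<forall>k\<in>{1..m}. a k \<in> J k" and y: "y \<in> Y j"
      and g: "\<forall>k\<in>{1..m}. act (gr_degree G gr (iprod A a k m)) y \<in> Y j" by blast
    \<comment> \<open>The statement leaves the values of \<open>a\<close> outside
      \<open>{1..m}\<close> arbitrary; restriction gives an index in \<open>Xi\<close> and changes
      no partial product.\<close>
    let ?a = "restrict a {1..m}"
    have i: "iprod A ?a k m = iprod A a k m" if "1 \<le> k" for k using that by (intro iprod_cong) auto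
    have "?a \<in> Good j y" unfolding Good_def pos_def dg_def Xi_def using a y g i by auto
    moreover have "X = TI j +>\<^bsub>C\<^esub> pt (w ?a) (ind {y})" unfolding X w_def i[OF order_refl] ..
    ultimately show "X \<in> ?B'" by blast
  next
    fix X assume "X \<in> ?B'"
    then obtain a y where X: "X = TI j +>\<^bsub>C\<^esub> pt (w a) (ind {y})" and a: "a \<in> Good j y" by blast
    then have "(\<forall>k\<in>{1..m}. a k \<in> J k) \<and> y \<in> Y j \<and> (\<forall>k\<in>{1..m}. act (gr_degree G gr (iprod A a k m)) y \<in> Y j)"
      unfolding Good_def pos_def dg_def using XiD by blast
    then show "X \<in> ?B" unfolding X w_def by blast
  qed
  then show ?thesis using basis_TI[OF j] by simp
qed

end

theorem theorem1p35:
  fixes K :: "'k ring"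
    and G :: "'g monoid" and le :: "'g rel"
    and S :: "'s set" and act :: "'g \<Rightarrow> 's \<Rightarrow> 's"
    and A :: "('k, 'a) module" and gr :: "'g \<Rightarrow> 'a set"
    and m :: nat and As :: "nat \<Rightarrow> 'a set" and J :: "nat \<Rightarrow> 'a set"
    and Z :: "nat \<Rightarrow> 's set" and Gs :: "nat \<Rightarrow> 'g set"
  defines "Y \<equiv> (\<lambda>j. \<Union>i\<in>{1..j}. Z i)"
  defines "C \<equiv> trunc K G S act A gr"
    and "cl \<equiv> trunc_class K G S act A gr"
    and "e \<equiv> (\<lambda>j. chi K S A (S - Y j))"
  assumes K: "field K"
    and G: "comm_monoid G" "ordered_monoid G le" "\<forall>g\<in>carrier G. (\<one>\<^bsub>G\<^esub>, g) \<in> le"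
    and act: "effective_action G S act"
    and A: "graded_algebra K G A gr"
    and m: "1 \<le> m"
    and As: "\<forall>i\<in>{1..m}. graded_subalgebra K G A gr (As i)"
    and A_tensor: "graded_tensor_decomposition K G A gr m As"
    and A_block: "\<forall>i j. 1 \<le> i \<and> i < j \<and> j \<le> m \<longrightarrow>
                    graded_subalgebra K G A gr (tensor_block K A As i j)"
    and J: "\<forall>i\<in>{1..m}. vectorspace.basis K (A\<lparr>carrier := As i\<rparr>) (J i) \<and>
              J i \<subseteq> (\<Union>g\<in>carrier G. gr g)"
    and Z: "\<forall>i\<in>{1..m}. Z i \<subseteq> S" "disjoint_family_on Z {1..m}"
    and Y: "finite (Y m)" "act_convex act (carrier G) S (Y m)"
    and Gs: "\<forall>i\<in>{1..m}. submonoid (Gs i) G"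
    and cond1: "\<forall>i\<in>{1..m}. \<forall>g\<in>carrier G - Gs i. As i \<inter> gr g = {\<zero>\<^bsub>A\<^esub>}"
    and cond2: "\<forall>i j. 1 \<le> i \<and> i \<le> j \<and> j \<le> m \<longrightarrow>
                  act_set act (Gs j) (Z i) \<inter> Y m \<subseteq> (\<Union>k\<in>{i..j}. Z k)"
    and cond3: "\<forall>i j. 1 \<le> i \<and> i < j \<and> j \<le> m \<longrightarrow> act_set act (Gs i) (Y j) \<inter> Y m = Y j"
  shows
    "(\<forall>j. 1 \<le> j \<and> j < m \<longrightarrow> mult_map_iso K (C (Y (j + 1))) (cl (Y (j + 1)) (e j)))
     \<and>
     (\<forall>j\<in>{1..m}. vectorspace.basis K (C (Y j))
        {cl (Y j) (smash_elem K S A (iprod A a 1 m) (indicator_map K S {y})) | a y.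
           (\<forall>k\<in>{1..m}. a k \<in> J k) \<and> y \<in> Y j \<and>
           (\<forall>k\<in>{1..m}. act (gr_degree G gr (iprod A a k m)) y \<in> Y j)})
     \<and>
     ((\<forall>g\<in>carrier G. vectorspace.fin_dim K (A\<lparr>carrier := gr g\<rparr>)) \<and>
      jacobson_radical (A\<lparr>carrier := gr \<one>\<^bsub>G\<^esub>\<rparr>) = {\<zero>\<^bsub>A\<^esub>} \<and>
      (\<forall>j\<in>{2..m}. \<exists>r. partial_order_on (Z j) r \<and>
         (\<forall>z\<in>Z j. \<forall>z'\<in>Z j.
            (\<forall>i\<in>{j..m}. act_le act (Gs i) z z' \<longrightarrow> (z, z') \<in> r) \<and>
            (\<forall>i\<in>{1..<j}. act_le act (Gs i) z z' \<longrightarrow> (z', z) \<in> r)))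
      \<longrightarrow>
      (\<forall>j\<in>{2..m}. strong_idempotent TYPE('m) TYPE('n) TYPE('p) TYPE('q)
         (two_sided (C (Y j)) (cl (Y j) (e (j - 1)))) (C (Y j))) \<and>
      strong_idempotent TYPE('m) TYPE('n) TYPE('p) TYPE('q)
         (two_sided (C (Y m)) (cl (Y m) (chi K S A (S - Z 1)))) (C (Y m)))"
proof -
  interpret convex_setup K G A gr m As J S act Z Gs Y
    unfolding convex_setup_def smash_setup_def monomials_def gralg_def
    using K G(1) A m As A_tensor A_block J act Z Y cond1 cond2 cond3
    by (auto simp only: gralg_axioms_def monomials_axioms_def smash_setup_axioms_def convex_setup_axioms_def Y_def)
  have trunc: "C (Y j) = quot_module (smash K G S act A gr) (TI j)"
    "cl (Y j) c = TI j +>\<^bsub>smash K G S act A gr\<^esub> c" "e j = ch j" for j c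
    unfolding C_def cl_def e_def by (rule trunc_eq trunc_class_eq chi_eq)+
  show ?thesis
  proof (intro conjI allI ballI impI, goal_cases)
    case (1 j)
    then show ?case using mult_map_iso_trunc[of j] unfolding trunc by simp
  next
    case (2 j)
    then show ?case using basis_trunc[of j] unfolding trunc smash_elem_def by simp
  next
    case (3 j)
    then show ?case unfolding trunc by (intro strong_idempotent_trunc) auto
  next
    case 4
    \<comment> \<open>The idempotent of the last claim is thus \<open>e 1\<close>, and the claim is
      the case \<open>k = 1\<close>, \<open>j = m\<close>.\<close>
    have "S - Z 1 = S - Y 1" by (simp add: Y_def)
    then have "chi K S A (S - Z 1) = ch 1" using chi_eq[of 1] by simp
    then show ?case unfolding trunc using strong_idempotent_trunc[of 1 m] m by simp
  qed
qed

end
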